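(* Let $q$ be an odd prime power with $q\equiv 1\pmod 3$, and let $d=2n$. For every $\varepsilon>0$ and every monic irreducible polynomial $P\in\mathbb{F}_q[T]$ of degree $n$, $$\widetilde{M}_{q,d}(P)=\overline{\omega(\chi_P)}+O\left(q^{(\varepsilon-\frac16)d}\right)$$ as $d\to\infty$, where $$\widetilde{M}_{q,d}(P):=\frac{1}{\#\mathcal{F}_3(d)}\sum_{\chi_c\in\mathcal{F}_3(d)}\omega(\chi_c)\,\overline{\chi_c}(P)\,\sqrt{|P|}.$$
   Context: $\mathcal{H}_d$ is the set of monic square-free polynomials of degree $d$ in $\mathbb{F}_q[T]$, and $|P|=q^{\deg P}$. Fix an identification of the cube roots of unity in $\mathbb{F}_q^*$ with those in $\mathbb{C}^*$. For a monic irreducible $Q$ and $Q\nmid f$, the cubic residue symbol $\left(\frac{f}{Q}\right)_3\in\mathbb{C}^*$ is the cube root of unity corresponding to $f^{(|Q|-1)/3}\bmod Q$; it is $0$ if $Q\mid f$, and it is extended multiplicatively to monic denominators $c$. Put $\chi_c(f)=\left(\frac{f}{c}\right)_3$ and $\mathcal{F}_3(d)=\{\chi_c: c\in\mathcal{H}_d\}$. $\omega(\chi_c)$ denotes the root number (sign of the functional equation) of the Dirichlet $L$-function of $\chi_c$. Explicitly, let $p$ be the characteristic of $\mathbb{F}_q$; for $a\in\mathbb{F}_q((1/T))$ let $e_q(a)=e^{2\pi i\,\mathrm{tr}_{\mathbb{F}_q/\mathbb{F}_p}(a_1)/p}$, where $a_1$ is the coefficient of $1/T$ in $a$, and let $G_q(1,c)=\sum_{u\bmod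 c}\chi_c(u)\,e_q(u/c)$. If $\chi_c$ is even (trivial on $\mathbb{F}_q^*$, i.e. $3\mid\deg c$), then $\omega(\chi_c)=q^{-\deg(c)/2}G_q(1,c)$. If $\chi_c$ is odd (i.e. $3\nmid\deg c$), then $\omega(\chi_c)=\frac{q^{-\deg(c)/2}}{\epsilon(\chi_c)}G_q(1,c)$ with $\epsilon(\chi_c)=q^{-1/2}\sum_{a\in\mathbb{F}_q^*}\chi_c(a)e^{2\pi i\,\mathrm{tr}_{\mathbb{F}_q/\mathbb{F}_p}(a)/p}$. The implied constant may depend on $q$ and $\varepsilon$ but not on $P$ or $d$. *)

theory Defs
  imports
    "HOL-Analysis.Analysis"
    "HOL-Computational_Algebra.Computational_Algebra"
begin

text \<open>
  The field with \<open>q\<close> elements is a type \<open>'a\<close> of class \<open>finite_field\<close>, so \<open>q = CARD('a)\<close>,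
  \<open>p = CHAR('a)\<close>, and \<open>\<F>\<^sub>q[T]\<close> is \<open>'a poly\<close>.
\<close>

section \<open>Additive characters\<close>

text \<open>
  The trace of \<open>\<F>\<^sub>q / \<F>\<^sub>p\<close> is the sum of the \<open>m\<close> Galois conjugates, where \<open>q = p ^ m\<close>.
  Its values lie in the prime field.
\<close>

definition field_trace :: "'a::finite_field \<Rightarrow> 'a" where
  "field_trace x = (\<Sum>i<multiplicity CHAR('a) CARD('a). x ^ (CHAR('a) ^ i))"

definition prime_field_rep :: "'a::finite_field \<Rightarrow> nat" where
  "prime_field_rep x = (THE m. m < CHAR('a) \<and> of_nat m = x)"

definition add_char :: "'a::finite_field \<Rightarrow> complex" where
  "add_char a = exp (2 * of_real pi * \<i> * of_nat (prime_field_rep (field_trace a)) / of_nat CHAR('a))"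

text \<open>
  The field \<open>\<F>\<^sub>q((1/T))\<close> is represented by formal Laurent series in the variable \<open>X = 1/T\<close>.
  Hence \<open>T\<close> is \<open>fls_X_inv\<close>, and the coefficient of \<open>1/T\<close> is the coefficient of \<open>X ^ 1\<close>.
\<close>

definition poly_at_infinity :: "'a::finite_field poly \<Rightarrow> 'a fls" where
  "poly_at_infinity f = poly (map_poly fls_const f) fls_X_inv"

definition e_q :: "'a::finite_field fls \<Rightarrow> complex" where
  "e_q a = add_char (fls_nth a 1)"

section \<open>Cubic residue symbols\<close>

definition cube_root_identification :: "('a::finite_field \<Rightarrow> complex) \<Rightarrow> bool" where
  "cube_root_identification \<iota> \<longleftrightarrow>
     bij_betw \<iota> {a. a ^ 3 = 1} {z. z ^ 3 = 1} \<and>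
     (\<forall>a b. a ^ 3 = 1 \<longrightarrow> b ^ 3 = 1 \<longrightarrow> \<iota> (a * b) = \<iota> a * \<iota> b)"

definition poly_abs :: "'a::finite_field poly \<Rightarrow> nat" where
  "poly_abs f = (if f = 0 then 0 else CARD('a) ^ degree f)"

definition monic_irreducible :: "'a::field poly \<Rightarrow> bool" where
  "monic_irreducible Q \<longleftrightarrow> lead_coeff Q = 1 \<and> irreducible Q"

text \<open>
  If \<open>Q\<close> does not divide \<open>f\<close> and \<open>q \<equiv> 1 (mod 3)\<close>, the residue of \<open>f ^ ((|Q| - 1) / 3)\<close> modulo \<open>Q\<close>
  is a constant polynomial whose value is a cube root of unity in \<open>\<F>\<^sub>q\<close>
  (see \<open>cubic_residue_constant\<close> below); the constant coefficient extracts this value.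
\<close>

definition cubic_symbol_irred :: "('a::finite_field \<Rightarrow> complex) \<Rightarrow> 'a poly \<Rightarrow> 'a poly \<Rightarrow> complex" where
  "cubic_symbol_irred \<iota> f Q =
     (if Q dvd f then 0 else \<iota> (coeff (f ^ ((poly_abs Q - 1) div 3) mod Q) 0))"

text \<open>
  Multiplicative extension to monic \<open>c\<close>: the exponent of \<open>Q\<close> is its multiplicity in \<open>c\<close>.
  (The library constant \<open>multiplicity\<close> needs a normalisation on \<open>'a poly\<close>, which is not available
  for an arbitrary finite field type.)
\<close>

definition chi :: "('a::finite_field \<Rightarrow> complex) \<Rightarrow> 'a poly \<Rightarrow> 'a poly \<Rightarrow> complex" where
  "chi \<iota> c f = (\<Prod>Q | monic_irreducible Q \<and> Q dvd c. cubic_symbol_irred \<iota> f Q ^ Max {k. Q ^ k dvd c})"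

definition monic_squarefree :: "'a::field poly \<Rightarrow> bool" where
  "monic_squarefree c \<longleftrightarrow> lead_coeff c = 1 \<and> squarefree c"

definition H_set :: "nat \<Rightarrow> 'a::finite_field poly set" where
  "H_set d = {c. monic_squarefree c \<and> degree c = d}"

definition F3 :: "('a::finite_field \<Rightarrow> complex) \<Rightarrow> nat \<Rightarrow> ('a poly \<Rightarrow> complex) set" where
  "F3 \<iota> d = chi \<iota> ` H_set d"

section \<open>Root numbers\<close>

text \<open>The sum over \<open>u mod c\<close> runs over the reduced representatives.\<close>

definition gauss_sum :: "('a::finite_field poly \<Rightarrow> complex) \<Rightarrow> 'a poly \<Rightarrow> complex" where
  "gauss_sum \<psi> c =
     (\<Sum>u \<in> {u. u mod c = u}. \<psi> u * e_q (poly_at_infinity u / poly_at_infinity c))"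

definition even_char :: "('a::finite_field poly \<Rightarrow> complex) \<Rightarrow> bool" where
  "even_char \<psi> \<longleftrightarrow> (\<forall>a. a \<noteq> 0 \<longrightarrow> \<psi> [:a:] = 1)"

definition eps :: "('a::finite_field poly \<Rightarrow> complex) \<Rightarrow> complex" where
  "eps \<psi> = of_real (real CARD('a) powr (- 1 / 2)) * (\<Sum>a \<in> {a. a \<noteq> 0}. \<psi> [:a:] * add_char a)"

text \<open>
  A root number is attached to a character. A character \<open>\<chi>\<^sub>c\<close> with \<open>c\<close> monic and square-free
  determines \<open>c\<close> (see \<open>chi_inj_on\<close> below).
\<close>

definition char_modulus :: "('a::finite_field \<Rightarrow> complex) \<Rightarrow> ('a poly \<Rightarrow> complex) \<Rightarrow> 'a poly" where
  "char_modulus \<iota> \<psi> = (THE c. monic_squarefree c \<and> chi \<iota> c = \<psi>)"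

definition root_number :: "('a::finite_field \<Rightarrow> complex) \<Rightarrow> ('a poly \<Rightarrow> complex) \<Rightarrow> complex" where
  "root_number \<iota> \<psi> = (let c = char_modulus \<iota> \<psi>;
     w = of_real (real CARD('a) powr (- real (degree c) / 2)) * gauss_sum \<psi> c
     in if even_char \<psi> then w else w / eps \<psi>)"

definition M_tilde :: "('a::finite_field \<Rightarrow> complex) \<Rightarrow> nat \<Rightarrow> 'a poly \<Rightarrow> complex" where
  "M_tilde \<iota> d P = 1 / of_nat (card (F3 \<iota> d)) *
     (\<Sum>\<psi> \<in> F3 \<iota> d. root_number \<iota> \<psi> * cnj (\<psi> P) * of_real (sqrt (real (poly_abs P))))"

section \<open>Well-definedness of the symbol and of the modulus\<close>

lemma polys_below:
  "finite {f :: 'a::finite_field poly. \<forall>i\<ge>n. coeff f i = 0} \<and>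
   card {f :: 'a poly. \<forall>i\<ge>n. coeff f i = 0} = CARD('a) ^ n"
proof (induction n)
  case 0
  have "{f :: 'a poly. \<forall>i\<ge>0. coeff f i = 0} = {0}"
    by (auto simp: poly_eq_iff)
  then show ?case by simp
next
  case (Suc n)
  let ?S = "\<lambda>n. {f :: 'a poly. \<forall>i\<ge>n. coeff f i = 0}"
  have eq: "?S (Suc n) = (\<lambda>(a, f). pCons a f) ` (UNIV \<times> ?S n)"
  proof (intro equalityI subsetI)
    fix f assume "f \<in> ?S (Suc n)"
    moreover obtain a g where f: "f = pCons a g" by (cases f)
    ultimately have "coeff g i = 0" if "i \<ge> n" for i
      using that by (auto dest!: spec[of _ "Suc i"])
    then show "f \<in> (\<lambda>(a, f). pCons a f) ` (UNIV \<times> ?S n)"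
      using f by auto
  qed (auto simp: coeff_pCons split: nat.split)
  have inj: "inj_on (\<lambda>(a, f). pCons a f) (UNIV \<times> ?S n)"
    by (auto simp: inj_on_def)
  show ?case
    unfolding eq using Suc by (simp add: card_image[OF inj] card_cartesian_product)
qed

lemma polys_below_degree:
  "n > 0 \<Longrightarrow> {f. \<forall>i\<ge>n. coeff f i = 0} = {f. degree f < n}"
  by (auto simp: coeff_eq_0 intro: degree_lessI)

lemma irreducible_degree_pos:
  "irreducible (Q :: 'a::field poly) \<Longrightarrow> degree Q > 0"
  by (metis gr0I irreducible_def is_unit_iff_degree)

lemma fermat_poly:
  fixes f Q :: "'a::finite_field poly"
  assumes Q: "irreducible Q" and f: "\<not> Q dvd f"
  shows "Q dvd f ^ (CARD('a) ^ degree Q - 1) - 1"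
proof -
  have pr: "prime_elem Q" using Q by (rule field_poly_irreducible_imp_prime)
  have dQ: "degree Q > 0" using Q by (rule irreducible_degree_pos)
  have Q0: "Q \<noteq> 0" using Q by auto
  define R where "R = {g :: 'a poly. degree g < degree Q} - {0}"
  have fin: "finite R" and card: "card R = CARD('a) ^ degree Q - 1"
    using polys_below[of "degree Q", where ?'a = 'a] dQ
    by (auto simp: R_def polys_below_degree[OF dQ])
  have ndvd: "\<not> Q dvd g" if "g \<in> R" for g
    using that dvd_imp_degree_le[of Q g] by (auto simp: R_def)
  let ?h = "\<lambda>g. (f * g) mod Q"
  have maps: "?h g \<in> R" if "g \<in> R" for g
  proof -
    have "\<not> Q dvd f * g" using ndvd[OF that] f pr by (simp add: prime_elem_dvd_mult_iff)
    then have "?h g \<noteq> 0" by (simp add: mod_eq_0_iff_dvd)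
    then show ?thesis using degree_mod_less'[OF Q0] by (auto simp: R_def)
  qed
  have inj: "inj_on ?h R"
  proof (rule inj_onI)
    fix g g' assume *: "g \<in> R" "g' \<in> R" "?h g = ?h g'"
    then have "Q dvd f * g - f * g'" by (simp add: mod_eq_dvd_iff)
    then have "Q dvd f * (g - g')" by (simp add: right_diff_distrib)
    then have "Q dvd g - g'" using f pr by (simp add: prime_elem_dvd_mult_iff)
    moreover have "degree (g - g') < degree Q"
      using * by (auto simp: R_def intro: degree_diff_less)
    ultimately show "g = g'" using dvd_imp_degree_le[of Q "g - g'"] by fastforce
  qed
  have im: "?h ` R = R"
    using endo_inj_surj[OF fin _ inj] maps by blast
  have prodR: "\<not> Q dvd (\<Prod>g\<in>A. g)" if "A \<subseteq> R" "finite A" for A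
    using that(2,1)
  proof (induction A)
    case empty
    then show ?case using pr by (auto simp: prime_elem_def)
  next
    case (insert x A)
    then show ?case using ndvd pr by (simp add: prime_elem_dvd_mult_iff)
  qed
  have "(\<Prod>g\<in>R. g) mod Q = (\<Prod>g\<in>R. ?h g) mod Q"
    using prod.reindex[OF inj, of id] im by simp
  also have "\<dots> = (\<Prod>g\<in>R. f * g) mod Q" by (rule mod_prod_eq)
  also have "(\<Prod>g\<in>R. f * g) = f ^ card R * (\<Prod>g\<in>R. g)"
    by (simp add: prod.distrib)
  finally have "Q dvd f ^ card R * (\<Prod>g\<in>R. g) - (\<Prod>g\<in>R. g)"
    by (metis mod_eq_dvd_iff)
  then have "Q dvd (f ^ card R - 1) * (\<Prod>g\<in>R. g)"
    by (simp add: left_diff_distrib)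
  then show ?thesis
    using prodR[OF subset_refl fin] pr card by (simp add: prime_elem_dvd_mult_iff)
qed

lemma ex_cube_root_unity:
  assumes "CARD('a::finite_field) mod 3 = 1"
  shows "\<exists>w::'a. w ^ 2 + w + 1 = 0"
proof -
  define k where "k = (CARD('a) - 1) div 3"
  have c2: "CARD('a) \<ge> 2"
    using card_mono[of UNIV "{0::'a, 1}"] by simp
  have k: "CARD('a) = 3 * k + 1" using assms c2 unfolding k_def by presburger
  then have k0: "k > 0" using c2 by simp
  let ?p = "monom 1 k - 1 :: 'a poly"
  have p: "poly ?p x = x ^ k - 1" for x by (simp add: poly_monom)
  have nz: "?p \<noteq> 0" using p[of 0] k0 by (auto simp: power_0_left)
  have "degree ?p \<le> k" by (intro degree_diff_le) (auto simp: degree_monom_le)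
  then have "card {x. poly ?p x = 0} \<le> k" using card_poly_roots_bound[OF nz] by linarith
  also have "k < card (UNIV - {0::'a})" using k k0 by simp
  finally have "\<not> UNIV - {0} \<subseteq> {x. poly ?p x = 0}"
    using card_mono[OF poly_roots_finite[OF nz], of "UNIV - {0}"] by linarith
  then obtain x where "x \<in> UNIV - {0}" "poly ?p x \<noteq> 0" by blast
  then have x: "x \<noteq> 0" "x ^ k \<noteq> 1" by (auto simp: poly_monom)
  have "x ^ (3 * k) * x = 1 * x"
    using finite_field_power_card_eq_same[of x] k by (simp add: mult.commute)
  then have "(x ^ k) ^ 3 = 1" using x(1) by (simp add: power_mult[symmetric] mult.commute)
  then have "(x ^ k - 1) * ((x ^ k) ^ 2 + x ^ k + 1) = 0"
    by (simp add: algebra_simps power2_eq_square power3_eq_cube)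
  then show ?thesis using x(2) by (metis mult_eq_0_iff right_minus_eq)
qed

lemma cubic_residue_constant:
  fixes f Q :: "'a::finite_field poly"
  assumes q: "CARD('a) mod 3 = 1" and Q: "irreducible Q" and f: "\<not> Q dvd f"
  shows "\<exists>a. a ^ 3 = 1 \<and> f ^ ((poly_abs Q - 1) div 3) mod Q = [:a:]"
proof -
  have pr: "prime_elem Q" using Q by (rule field_poly_irreducible_imp_prime)
  have dQ: "degree Q > 0" using Q by (rule irreducible_degree_pos)
  have Q0: "Q \<noteq> 0" using Q by auto
  define k where "k = (poly_abs Q - 1) div 3"
  have "poly_abs Q mod 3 = 1"
    using Q0 q power_mod[of "CARD('a)" 3 "degree Q"] by (simp add: poly_abs_def)
  then have "poly_abs Q - 1 = 3 * k" unfolding k_def by presburger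
  then have k: "f ^ (CARD('a) ^ degree Q - 1) = (f ^ k) ^ 3"
    using Q0 by (simp add: poly_abs_def power_mult[symmetric] mult.commute)
  obtain w :: 'a where w: "w ^ 2 + w + 1 = 0" using ex_cube_root_unity[OF q] by blast
  have w2: "w ^ 2 = - w - 1" using w by algebra
  have w3: "w ^ 3 = 1" using w by algebra
  let ?g = "f ^ k"
  have "?g ^ 3 - 1 = (?g - [:1:]) * (?g - [:w:]) * (?g - [:w ^ 2:])"
  proof -
    have e1: "[:w:] + [:w ^ 2:] = (-1 :: 'a poly)" using w2 by (simp add: one_pCons)
    have e2: "[:w:] * [:w ^ 2:] = (1 :: 'a poly)"
      using w3 by (simp add: one_pCons power2_eq_square power3_eq_cube mult.assoc)
    have "x ^ 3 - 1 = (x - 1) * (x - u) * (x - v)" if "u + v = -1" "u * v = 1" for x u v :: "'a poly"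
      using that by algebra
    from this[OF e1 e2, of ?g] show ?thesis by (simp only: one_pCons)
  qed
  then have "Q dvd (?g - [:1:]) * (?g - [:w:]) * (?g - [:w ^ 2:])"
    using fermat_poly[OF Q f] k by simp
  then have "Q dvd ?g - [:1:] \<or> Q dvd ?g - [:w:] \<or> Q dvd ?g - [:w ^ 2:]"
    using pr by (simp add: prime_elem_dvd_mult_iff)
  moreover have "(w ^ 2) ^ 3 = 1" using w3 by algebra
  ultimately obtain a where a: "a ^ 3 = 1" "Q dvd ?g - [:a:]" using w3 power_one[of 3] by blast
  then have "?g mod Q = [:a:] mod Q" by (simp add: mod_eq_dvd_iff)
  also have "\<dots> = [:a:]" using dQ by (simp add: mod_poly_less)
  finally show ?thesis using a(1) unfolding k_def by blast
qed

lemma cubic_symbol_irred_eq_0_iff: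
  assumes "CARD('a::finite_field) mod 3 = 1" "cube_root_identification \<iota>" "irreducible (Q :: 'a poly)"
  shows "cubic_symbol_irred \<iota> f Q = 0 \<longleftrightarrow> Q dvd f"
proof -
  have "\<iota> a \<noteq> 0" if "a ^ 3 = 1" for a
  proof -
    have "\<iota> a ^ 3 = 1"
      using that assms(2) unfolding cube_root_identification_def bij_betw_def by blast
    then show ?thesis by auto
  qed
  then show ?thesis
    using cubic_residue_constant[OF assms(1,3), of f]
    by (auto simp: cubic_symbol_irred_def)
qed

lemma chi_eq_0_iff:
  assumes "CARD('a::finite_field) mod 3 = 1" "cube_root_identification \<iota>" "c \<noteq> (0 :: 'a poly)"
  shows "chi \<iota> c f = 0 \<longleftrightarrow> (\<exists>Q. monic_irreducible Q \<and> Q dvd c \<and> Q dvd f)"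
proof -
  let ?A = "{Q. monic_irreducible Q \<and> Q dvd c}"
  have "?A \<subseteq> {f. \<forall>i\<ge>Suc (degree c). coeff f i = 0}"
    using dvd_imp_degree_le[OF _ assms(3)] by (auto intro!: coeff_eq_0 simp: less_Suc_eq_le Suc_le_eq intro: le_less_trans)
  then have fin: "finite ?A" using polys_below finite_subset by blast
  have pos: "Max {k. Q ^ k dvd c} > 0" if "Q \<in> ?A" for Q
  proof -
    have Q: "irreducible Q" "Q dvd c" using that by (auto simp: monic_irreducible_def)
    have dQ: "degree Q > 0" using Q by (simp add: irreducible_degree_pos)
    have "k \<le> degree c" if "Q ^ k dvd c" for k
    proof -
      have "k \<le> k * degree Q" using dQ by simp
      also have "\<dots> = degree (Q ^ k)" using Q by (subst degree_power_eq) auto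
      also have "\<dots> \<le> degree c" using that assms(3) by (rule dvd_imp_degree_le)
      finally show ?thesis .
    qed
    then have "finite {k. Q ^ k dvd c}" by (meson finite_nat_set_iff_bounded_le mem_Collect_eq)
    moreover have "1 \<in> {k. Q ^ k dvd c}" using Q by simp
    ultimately have "1 \<le> Max {k. Q ^ k dvd c}" by (rule Max_ge)
    then show ?thesis by simp
  qed
  show ?thesis
    unfolding chi_def using fin pos cubic_symbol_irred_eq_0_iff[OF assms(1,2)]
    by (auto simp: prod_zero_iff monic_irreducible_def)
qed

lemma ex_irreducible_factor:
  fixes c :: "'a::field poly"
  assumes "degree c > 0"
  shows "\<exists>Q. monic_irreducible Q \<and> Q dvd c"
proof -
  define P where "P = (\<lambda>g::'a poly. g dvd c \<and> degree g > 0)"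
  define g where "g = arg_min degree P"
  have "P c" using assms by (simp add: P_def)
  then have g: "P g" and least: "\<And>h. P h \<Longrightarrow> degree g \<le> degree h"
    unfolding g_def by (auto intro: arg_min_natI arg_min_nat_le)
  have g0: "g \<noteq> 0" using g by (auto simp: P_def)
  have irr: "irreducible g"
  proof (rule irreducibleI)
    show "\<not> g dvd 1" using g g0 by (simp add: P_def is_unit_iff_degree)
  next
    fix a b assume ab: "g = a * b"
    have nz: "a \<noteq> 0" "b \<noteq> 0" using ab g0 by auto
    have deg: "degree g = degree a + degree b" using ab nz by (simp add: degree_mult_eq)
    show "a dvd 1 \<or> b dvd 1"
    proof (rule ccontr)
      assume "\<not> (a dvd 1 \<or> b dvd 1)"
      then have "degree a > 0" "degree b > 0" using nz by (auto simp: is_unit_iff_degree)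
      moreover have "a dvd c" using ab g unfolding P_def by (metis dvd_mult_left)
      ultimately show False using least[of a] deg by (simp add: P_def)
    qed
  qed (fact g0)
  let ?Q = "smult (inverse (lead_coeff g)) g"
  have u: "lead_coeff g \<noteq> 0" using g0 by simp
  have "irreducible ?Q"
  proof (rule irreducibleI)
    show "?Q \<noteq> 0" "\<not> ?Q dvd 1" using g g0 u by (auto simp: P_def is_unit_iff_degree)
  next
    fix a b assume "?Q = a * b"
    then have "g = smult (lead_coeff g) a * b" using u by (simp flip: \<open>?Q = a * b\<close>)
    then have "smult (lead_coeff g) a dvd 1 \<or> b dvd 1" using irr by (rule irreducibleD[rotated])
    then show "a dvd 1 \<or> b dvd 1" using u by (simp add: smult_dvd_iff)
  qed
  moreover have "lead_coeff ?Q = 1" "?Q dvd c"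
    using u g by (auto simp: P_def smult_dvd_iff)
  ultimately show ?thesis unfolding monic_irreducible_def by blast
qed

lemma squarefree_dvdI:
  fixes c d :: "'a::field poly"
  assumes "squarefree c" "\<And>Q. monic_irreducible Q \<Longrightarrow> Q dvd c \<Longrightarrow> Q dvd d"
  shows "c dvd d"
  using assms
proof (induction "degree c" arbitrary: c rule: less_induct)
  case less
  have c0: "c \<noteq> 0" using less.prems(1) by auto
  show ?case
  proof (cases "degree c = 0")
    case True
    then show ?thesis using c0 by (metis is_unit_iff_degree unit_imp_dvd)
  next
    case False
    then obtain Q where Q: "monic_irreducible Q" "Q dvd c" using ex_irreducible_factor by blast
    then have pr: "prime_elem Q" and dQ: "degree Q > 0"
      by (auto simp: monic_irreducible_def irreducible_degree_pos intro: field_poly_irreducible_imp_prime)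
    obtain b where b: "c = Q * b" using Q by (elim dvdE)
    have nd: "\<not> Q dvd b"
    proof
      assume "Q dvd b"
      then have "Q ^ 2 dvd c" using b by (simp add: power2_eq_square mult_dvd_mono)
      then have "Q dvd 1" using less.prems(1) squarefreeD by blast
      then show False using pr by (simp add: prime_elem_def)
    qed
    have "b dvd d"
    proof (rule less.hyps)
      show "degree b < degree c" using b c0 dQ by (auto simp: degree_mult_eq)
      show "squarefree b" using less.prems(1) b by (auto simp: squarefree_def intro: dvd_mult)
    qed (use less.prems(2) b in auto)
    then obtain e where e: "d = b * e" by (elim dvdE)
    have "Q dvd b * e" using less.prems(2)[OF Q] e by simp
    then have "Q dvd e" using nd pr by (simp add: prime_elem_dvd_mult_iff)
    then show ?thesis using b e by (auto simp: mult.commute intro: mult_dvd_mono)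
  qed
qed

lemma chi_inj_on:
  assumes "CARD('a::finite_field) mod 3 = 1" "cube_root_identification \<iota>"
  shows "inj_on (chi \<iota>) {c :: 'a poly. monic_squarefree c}"
proof (rule inj_onI)
  have dvd: "c dvd d" if *: "monic_squarefree c" "monic_squarefree d" "chi \<iota> c = chi \<iota> d"
    for c d :: "'a poly"
  proof (rule squarefree_dvdI)
    show "squarefree c" using * by (simp add: monic_squarefree_def)
    have nz: "c \<noteq> 0" "d \<noteq> 0" using * by (auto simp: monic_squarefree_def)
    fix Q :: "'a poly" assume Q: "monic_irreducible Q" "Q dvd c"
    then have "chi \<iota> d Q = 0" using *(3) chi_eq_0_iff[OF assms nz(1), of Q] by auto
    then obtain R where R: "monic_irreducible R" "R dvd d" "R dvd Q"
      using chi_eq_0_iff[OF assms nz(2)] by blast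
    then have "Q dvd R"
      using Q(1) irreducibleD'[of Q R] by (auto simp: monic_irreducible_def irreducible_not_unit)
    then show "Q dvd d" using R(2) dvd_trans by blast
  qed
  fix c d :: "'a poly"
  assume "c \<in> {c. monic_squarefree c}" "d \<in> {c. monic_squarefree c}" "chi \<iota> c = chi \<iota> d"
  then have *: "c dvd d" "d dvd c" "lead_coeff c = 1" "lead_coeff d = 1"
    using dvd[of c d] dvd[of d c] by (auto simp: monic_squarefree_def)
  then obtain e where e: "d = c * e" by blast
  then have "degree e = 0"
    using * dvd_imp_degree_le[of d c] by (cases "c = 0 \<or> e = 0") (auto simp: degree_mult_eq)
  then obtain a where "e = [:a:]" by (rule degree_eq_zeroE)
  moreover from this have "a = 1" using e *(3,4) by (cases "a = 0") auto
  ultimately show "c = d" using e by simp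
qed

lemma char_modulus_chi:
  assumes "CARD('a::finite_field) mod 3 = 1" "cube_root_identification \<iota>"
    "monic_squarefree (c :: 'a poly)"
  shows "char_modulus \<iota> (chi \<iota> c) = c"
  unfolding char_modulus_def
  using chi_inj_on[OF assms(1,2)] assms(3) by (intro the_equality) (auto simp: inj_on_def)

end

theory Submission
  imports "HOL-Algebra.Algebraic_Closure_Type" "HOL-Number_Theory.Cong" Defs
begin

text \<open>
  Write \<open>M\<^sub>d\<close> for the monic polynomials of degree \<open>d\<close>, and \<open>G(f, c)\<close> for the Gauss sum of \<open>\<chi>\<^sub>c\<close> at the
  additive character \<open>d \<mapsto> e(f d / c)\<close>. The moment has a closed form, in lemma \<open>M_tilde_eq\<close>: for
  \<open>n \<ge> 2\<close> it is the conjugate of \<open>\<omega>(\<chi>\<^sub>P)\<close> times \<open>1 - q ^ n / (q ^ (2 n) - q ^ (2 n - 1))\<close>. The error is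
  therefore \<open>O(q ^ (- d / 2))\<close>, which is smaller than the theorem asks for. Everything is
  elementary: no \<open>L\<close>-function and no analytic continuation enters.

  Reduction to a character sum. By the Chinese remainder theorem and reciprocity, \<open>G(1, c)\<close> times the
  conjugate of \<open>\<chi>\<^sub>c(P)\<close> is \<open>G(1, c P)\<close> times a factor that depends on \<open>P\<close> only. Since \<open>G(1, F) = 0\<close>
  unless \<open>F\<close> is square-free, \<open>c\<close> may run over all of \<open>M\<^sub>2\<^sub>n\<close>. As \<open>deg (c P) = 3 n\<close> is divisible by \<open>3\<close>,
  the Gauss sum \<open>G(1, c P)\<close> is, up to a complete sum, \<open>- q\<close> times the sum of \<open>\<chi>\<^sub>c\<^sub>P(u)\<close> over the
  monic \<open>u\<close> of degree \<open>3 n - 1\<close>. So the theorem amounts to the evaluation \<open>q ^ (3 n - 2)\<close> of the double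
  sum of \<open>\<chi>\<^sub>c\<^sub>P(u)\<close> over \<open>c\<close> and \<open>u\<close>, lemma \<open>sum_chi_mult_prime\<close>. Poisson summation over \<open>c\<close> turns it
  into the moments \<open>C(v P\<^sup>2, 3 n - 1)\<close> with \<open>deg v \<le> n - 2\<close>, where \<open>C(f, a)\<close> is the sum of \<open>G(f, c)\<close> over
  \<open>c\<close> in \<open>M\<^sub>a\<close>.

  The functional equation. Approximate \<open>d / c\<close> by a reduced fraction \<open>q / p\<close> with \<open>deg p\<close> below a
  height \<open>h\<close>. This writes the row \<open>(c, d)\<close> uniquely as a combination \<open>(R, r)\<close> of the rows of a
  unimodular matrix with first row \<open>(p, q)\<close>, and Kubota's cocycle relation says that the symbol splits
  as \<open>\<chi>\<^sub>c(d) = \<chi>\<^sub>p(q) \<chi>\<^sub>R(r)\<close>. Summing over \<open>(R, r)\<close> expresses a long moment by short ones, lemma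
  \<open>gauss_moment_formula\<close>. Hence long moments are geometric: \<open>C(f, a) = q ^ (4 a / 3) \<beta>\<^sub>f(a)\<close>, where
  \<open>\<beta>\<^sub>f(a)\<close> depends on \<open>a\<close> modulo \<open>3\<close> only; moreover \<open>\<beta>\<^sub>f\<close> vanishes on one class modulo \<open>3\<close> and its
  values at the other two determine each other. Up to normalisation these numbers are the Fourier
  coefficients of the cubic theta function.

  Vanishing at squares of primes. The main step is \<open>\<beta>\<^sub>f(3 n - 1) = 0\<close> for \<open>f = j P\<^sup>2\<close>, \<open>j \<noteq> 0\<close> and
  \<open>deg j \<le> n - 2\<close>, lemma \<open>moment_coeff_vanishes\<close>. It comes from positivity. Let \<open>D(J)\<close> be the
  sum of \<open>\<chi>\<^sub>c(d)\<close> over all \<open>d\<close> modulo \<open>c\<close> and all \<open>c\<close> in \<open>M\<^sub>J\<close> that are divisible by \<open>P\<close>. It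
  satisfies a recursion and is known explicitly. On the other hand, cutting \<open>d / c\<close> in the middle and
  detecting \<open>P dvd c\<close> by additive characters modulo \<open>P\<close> makes \<open>D(J)\<close> a Hermitian form in the moments
  of \<open>j P\<^sup>2\<close> for \<open>deg j < n\<close>, lemma \<open>multiple_total_cut\<close>. For \<open>J = 6 n N\<close> the terms with \<open>j = 0\<close>
  account for \<open>D(J)\<close> except for \<open>O(q ^ (4 n N))\<close>, while the terms of each \<open>j \<noteq> 0\<close>, divided by
  \<open>q ^ (8 n N)\<close>, tend to a quantity that the duality of the \<open>\<beta>\<^sub>f\<close> shows to be a sum of nonnegative
  terms. So all these terms are zero, and one of them is zero only if \<open>\<beta>\<^sub>f(3 n - 1)\<close>
  is.

  After this, only the \<open>v\<close> of degree exactly \<open>n - 2\<close> contribute to the double sum, because there the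
  moment lies one step before the geometric range. Its value is a Gauss sum over \<open>\<F>\<^sub>q\<close>, and the sum
  over the leading coefficient of \<open>v\<close> gives \<open>q ^ (3 n - 2)\<close>.
\<close>

section \<open>The additive character of the base field\<close>

lemma of_nat_mult_closed:
  fixes H :: "'a::comm_semiring_1 set"
  assumes "0 \<in> H" "\<And>x y. x \<in> H \<Longrightarrow> y \<in> H \<Longrightarrow> x + y \<in> H" "x \<in> H"
  shows "of_nat k * x \<in> H"
  by (induction k) (auto simp: algebra_simps intro: assms)

text \<open>
  A subset of maximal size among the additively closed subsets of \<open>p\<close>-power size is everything:
  adjoining a further element \<open>x\<close> to such a set \<open>H\<close> multiplies its size by \<open>p\<close>.
\<close>

lemma card_finite_field_prime_power: "\<exists>m. CARD('a::finite_field) = CHAR('a) ^ m"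
proof -
  define p where "p = CHAR('a)"
  have p: "prime p" unfolding p_def by (rule CHAR_prime)
  have of_nat0: "(of_nat k :: 'a) = 0 \<longleftrightarrow> p dvd k" for k
    unfolding p_def by (rule of_nat_eq_0_iff_char_dvd)
  define S where "S = {H :: 'a set. 0 \<in> H \<and> (\<forall>x\<in>H. \<forall>y\<in>H. x + y \<in> H) \<and> (\<exists>m. card H = p ^ m)}"
  have "{0} \<in> S" by (auto simp: S_def intro: exI[of _ 0])
  then have ne: "S \<noteq> {}" by blast
  have "finite (card ` S)" by simp
  then obtain H where H: "H \<in> S" and mx: "\<And>H'. H' \<in> S \<Longrightarrow> card H' \<le> card H"
    using ne Max_ge[of "card ` S"] Max_in[of "card ` S"] by (metis (no_types, lifting) imageE imageI image_is_empty)
  have H0: "0 \<in> H" and Hadd: "\<And>x y. x \<in> H \<Longrightarrow> y \<in> H \<Longrightarrow> x + y \<in> H"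
    using H by (auto simp: S_def)
  obtain m where m: "card H = p ^ m" using H by (auto simp: S_def)
  have mult: "of_nat k * x \<in> H" if "x \<in> H" for k x using of_nat_mult_closed[OF H0 Hadd that] .
  have "H = UNIV"
  proof (rule ccontr)
    assume "H \<noteq> UNIV"
    then obtain x where x: "x \<notin> H" by blast
    define f where "f = (\<lambda>(h, i). h + of_nat i * x)"
    define H' where "H' = f ` (H \<times> {..<p})"
    have reduce: "h + of_nat i * x \<in> H'" if "h \<in> H" for h and i :: nat
    proof -
      have "(of_nat i :: 'a) = of_nat (i mod p)"
        unfolding p_def of_nat_eq_iff_cong_CHAR by (simp add: cong_def)
      then show ?thesis
        using that p prime_gt_0_nat[of p] by (auto simp: H'_def f_def intro!: image_eqI[of _ _ "(h, i mod p)"])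
    qed
    have inj: "inj_on f (H \<times> {..<p})"
    proof (rule inj_onI, clarify)
      have *: "i' \<le> i" if "f (h, i) = f (h', i')" "h \<in> H" "h' \<in> H" "i < p" "i' < p" for h h' i i'
      proof (rule ccontr)
        assume lt: "\<not> i' \<le> i"
        have "h = h' + of_nat (i' - i) * x"
          using that(1) lt by (simp add: f_def of_nat_diff algebra_simps)
        then have d: "of_nat (i' - i) * x = h + of_nat (p - 1) * h'"
          using p prime_ge_1_nat[OF p] of_nat0[of p] by (simp add: of_nat_diff algebra_simps)
        have "coprime (i' - i) p"
        proof -
          have "\<not> p dvd (i' - i)" using lt that(5) by (auto dest: dvd_imp_le)
          then show ?thesis using p by (metis prime_imp_coprime coprime_commute)
        qed
        then obtain k where k: "[(i' - i) * k = 1] (mod p)" using cong_solve_coprime_nat by auto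
        have "of_nat k * (of_nat (i' - i) * x) \<in> H"
          unfolding d using that by (intro mult Hadd) auto
        moreover have "of_nat k * (of_nat (i' - i) * x) = of_nat ((i' - i) * k) * x" by (simp add: mult_ac)
        moreover have "(of_nat ((i' - i) * k) :: 'a) = of_nat 1"
          using k unfolding of_nat_eq_iff_cong_CHAR p_def .
        ultimately show False using x by simp
      qed
      fix h i h' i' assume a: "h \<in> H" "i < p" "h' \<in> H" "i' < p" "f (h, i) = f (h', i')"
      have "i = i'" using *[of h i h' i'] *[of h' i' h i] a by simp
      then show "h = h' \<and> i = i'" using a(5) by (simp add: f_def)
    qed
    have "H' \<in> S"
      unfolding S_def
    proof (intro CollectI conjI ballI)
      show "0 \<in> H'" using reduce[OF H0, of 0] by simp
      show "\<exists>m. card H' = p ^ m"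
        unfolding H'_def card_image[OF inj] using m by (auto simp: card_cartesian_product intro!: exI[of _ "Suc m"])
      fix u v assume "u \<in> H'" "v \<in> H'"
      then obtain h i h' i' where "h \<in> H" "h' \<in> H" "u = h + of_nat i * x" "v = h' + of_nat i' * x"
        by (auto simp: H'_def f_def)
      then show "u + v \<in> H'" using reduce[of "h + h'" "i + i'"] Hadd by (simp add: algebra_simps)
    qed
    moreover have "card H < card H'"
      unfolding H'_def card_image[OF inj] using m p prime_gt_1_nat[of p]
      by (auto simp: card_cartesian_product)
    ultimately show False using mx by force
  qed
  then show ?thesis using m p_def by auto
qed

lemma CHAR_finite_field_prime: "prime CHAR('a::finite_field)"
  by (rule CHAR_prime)

lemma card_eq_CHAR_power: "CARD('a::finite_field) = CHAR('a) ^ multiplicity CHAR('a) CARD('a)"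
proof -
  obtain m where "CARD('a) = CHAR('a) ^ m" using card_finite_field_prime_power[where ?'a = 'a] by blast
  then show ?thesis using CHAR_finite_field_prime[where ?'a = 'a] by simp
qed

lemma field_trace_add: "field_trace (x + y :: 'a::finite_field) = field_trace x + field_trace y"
  unfolding field_trace_def
  using freshmans_dream'[OF CHAR_finite_field_prime[where ?'a = 'a] refl] by (simp add: sum.distrib)

text \<open>
  Frobenius permutes the conjugates cyclically, so the trace lies in the prime field.
\<close>

lemma field_trace_power_CHAR: "field_trace (x :: 'a::finite_field) ^ CHAR('a) = field_trace x"
proof -
  define p where "p = CHAR('a)"
  define m where "m = multiplicity p CARD('a)"
  have q: "CARD('a) = p ^ m" using card_eq_CHAR_power unfolding p_def m_def .
  have "field_trace x ^ p = (\<Sum>i<m. (x ^ (p ^ i)) ^ p)"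
    unfolding field_trace_def p_def[symmetric] m_def[symmetric]
    using freshmans_dream_sum[OF CHAR_finite_field_prime[where ?'a = 'a] refl] by (simp add: p_def)
  also have "\<dots> = (\<Sum>i<m. x ^ (p ^ Suc i))" by (simp add: power_mult[symmetric] mult.commute)
  also have "\<dots> = (\<Sum>i<m. x ^ (p ^ i)) + (x ^ (p ^ m) - x ^ (p ^ 0))"
    using sum_lessThan_telescope[of "\<lambda>i. x ^ (p ^ i)" m] by (simp add: sum_subtractf algebra_simps)
  also have "x ^ (p ^ m) = x" using finite_field_power_card_eq_same[of x] q by simp
  finally show ?thesis unfolding field_trace_def p_def[symmetric] m_def[symmetric] by simp
qed

text \<open>
  The images of \<open>0, \<dots>, p - 1\<close> are \<open>p\<close> roots of \<open>y ^ p - y\<close>, hence all of them.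
\<close>

lemma prime_field_repI:
  fixes x :: "'a::finite_field"
  assumes "x ^ CHAR('a) = x"
  shows "prime_field_rep x < CHAR('a)" "of_nat (prime_field_rep x) = x"
proof -
  define p where "p = CHAR('a)"
  have p: "prime p" unfolding p_def by (rule CHAR_finite_field_prime)
  have inj: "inj_on (of_nat :: nat \<Rightarrow> 'a) {..<p}"
    by (rule inj_onI) (simp add: of_nat_eq_iff_cong_CHAR p_def cong_less_modulus_unique_nat)
  let ?f = "monom 1 p - monom 1 1 :: 'a poly"
  have f: "poly ?f y = y ^ p - y" for y by (simp add: poly_monom)
  have cf: "coeff ?f p = 1" using prime_gt_1_nat[OF p] by auto
  then have nz: "?f \<noteq> 0" by (metis coeff_0 zero_neq_one)
  have "degree ?f \<le> p" using prime_gt_1_nat[OF p] by (intro degree_diff_le) (auto simp: degree_monom_eq)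
  then have "card {y. poly ?f y = 0} \<le> p" using card_poly_roots_bound[OF nz] by linarith
  moreover have "of_nat ` {..<p} \<subseteq> {y. poly ?f y = 0}"
  proof clarsimp
    fix k :: nat
    have "(of_nat k :: 'a) ^ p = of_nat k"
    proof (induction k)
      case (Suc k)
      then show ?case using freshmans_dream[OF CHAR_finite_field_prime[where ?'a = 'a] refl, of 1 "of_nat k"] by (simp add: p_def)
    qed (use prime_gt_0_nat[OF p] in simp)
    then show "poly (monom 1 p) (of_nat k :: 'a) = poly (monom 1 (Suc 0)) (of_nat k)" by (simp add: poly_monom)
  qed
  moreover have "card (of_nat ` {..<p} :: 'a set) = p" using card_image[OF inj] by simp
  ultimately have eq: "of_nat ` {..<p} = {y. poly ?f y = 0}"
    by (intro card_seteq poly_roots_finite nz) auto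
  have "x \<in> {y. poly ?f y = 0}" using assms f by (simp add: p_def)
  then have "x \<in> of_nat ` {..<p}" unfolding eq .
  then obtain m where m: "m < p" "of_nat m = x" by blast
  have "\<exists>!m. m < CHAR('a) \<and> of_nat m = x"
    using m inj unfolding p_def inj_on_def by blast
  from theI'[OF this] show "prime_field_rep x < CHAR('a)" "of_nat (prime_field_rep x) = x"
    by (auto simp: prime_field_rep_def)
qed

text \<open>
  The exponential has period \<open>p\<close>, so the choice of the representative of the trace is immaterial.
\<close>

lemma add_char_of_nat:
  fixes a :: "'a::finite_field"
  assumes "of_nat k = field_trace a"
  shows "add_char a = exp (2 * of_real pi * \<i> * of_nat k / of_nat CHAR('a))"
proof -
  define p where "p = CHAR('a)"
  have p: "p > 0" unfolding p_def by (simp add: finite_imp_CHAR_pos)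
  have r: "of_nat (prime_field_rep (field_trace a)) = field_trace a"
    using prime_field_repI field_trace_power_CHAR by blast
  have "[k = prime_field_rep (field_trace a)] (mod p)"
    unfolding p_def of_nat_eq_iff_cong_CHAR[symmetric] by (simp add: assms r)
  then obtain u v where "k + u * p = prime_field_rep (field_trace a) + v * p"
    unfolding cong_iff_lin_nat by metis
  then have eq: "of_nat k + of_nat u * of_nat p = (of_nat (prime_field_rep (field_trace a)) + of_nat v * of_nat p :: complex)"
    by (metis of_nat_add of_nat_mult)
  have per: "exp (2 * of_real pi * \<i> * (x + of_nat u * of_nat p) / of_nat p) = exp (2 * of_real pi * \<i> * x / of_nat p)" for x :: complex and u :: nat
  proof -
    have "2 * of_real pi * \<i> * (x + of_nat u * of_nat p) / of_nat p = 2 * of_real pi * \<i> * x / of_nat p + 2 * of_nat u * of_real pi * \<i>"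
      using p by (simp add: field_simps)
    then show ?thesis using exp_plus_2pin[of _ "int u"] by (simp add: mult_ac)
  qed
  show ?thesis
    unfolding add_char_def p_def[symmetric] using per[of "of_nat k" u] per[of "of_nat (prime_field_rep (field_trace a))" v] eq by simp
qed

lemma add_char_add: "add_char (a + b :: 'a::finite_field) = add_char a * add_char b"
proof -
  let ?r = "\<lambda>x::'a. prime_field_rep (field_trace x)"
  have r: "of_nat (?r x) = field_trace x" for x :: 'a
    using prime_field_repI field_trace_power_CHAR by blast
  have "add_char (a + b) = exp (2 * of_real pi * \<i> * of_nat (?r a + ?r b) / of_nat CHAR('a))"
    by (rule add_char_of_nat) (simp add: r field_trace_add)
  also have "\<dots> = add_char a * add_char b"
    by (simp add: add_char_def exp_add[symmetric] distrib_left add_divide_distrib)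
  finally show ?thesis .
qed

lemma add_char_0 [simp]: "add_char (0 :: 'a::finite_field) = 1"
  using add_char_of_nat[of 0 "0::'a"] by (simp add: field_trace_def power_0_left finite_imp_CHAR_pos)

lemma norm_add_char [simp]: "norm (add_char a) = 1"
proof -
  have "add_char a = exp (\<i> * of_real (2 * pi * prime_field_rep (field_trace a) / CHAR('a)))"
    by (simp add: add_char_def mult_ac)
  then show ?thesis by (simp only: norm_exp_i_times)
qed

lemma add_char_minus: "add_char (- a) = cnj (add_char a)"
proof -
  have "add_char (- a) * add_char a = 1" using add_char_add[of "- a" a] by simp
  moreover have "cnj (add_char a) * add_char a = 1"
    using complex_norm_square[of "add_char a"] by (simp add: mult.commute)
  moreover have "add_char a \<noteq> 0" using norm_add_char[of a] by fastforce
  ultimately show ?thesis by (metis mult_right_cancel)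
qed

text \<open>
  The trace is a polynomial function of degree \<open>p ^ (m - 1) < q\<close>, so it does not vanish identically.
\<close>

lemma ex_add_char_neq_1: "\<exists>a :: 'a::finite_field. add_char a \<noteq> 1"
proof -
  define p where "p = CHAR('a)"
  have p: "prime p" unfolding p_def by (rule CHAR_finite_field_prime)
  define m where "m = multiplicity p CARD('a)"
  have q: "CARD('a) = p ^ m" using card_eq_CHAR_power unfolding p_def m_def .
  have c2: "CARD('a) \<ge> 2"
    using card_mono[of UNIV "{0::'a, 1}"] by simp
  have m: "m > 0" using q c2 by (cases m) auto
  let ?f = "\<Sum>i<m. monom 1 (p ^ i) :: 'a poly"
  have f: "poly ?f x = field_trace x" for x
    unfolding field_trace_def p_def[symmetric] m_def[symmetric] by (simp add: poly_sum poly_monom)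
  have "coeff ?f (p ^ 0) = (\<Sum>i<m. if i = 0 then 1 else 0)"
    unfolding coeff_sum using prime_gt_1_nat[OF p] by (intro sum.cong) auto
  then have "coeff ?f 1 = 1" using m by simp
  then have nz: "?f \<noteq> 0" by (metis coeff_0 zero_neq_one)
  have "degree ?f \<le> p ^ (m - 1)"
  proof (intro degree_sum_le)
    fix i assume "i \<in> {..<m}"
    then have "p ^ i \<le> p ^ (m - 1)" using prime_gt_0_nat[OF p] by (intro power_increasing) auto
    then show "degree (monom 1 (p ^ i) :: 'a poly) \<le> p ^ (m - 1)"
      using degree_monom_le[of "1::'a" "p ^ i"] by linarith
  qed auto
  also have "\<dots> < p ^ m" using m prime_gt_1_nat[OF p] by simp
  finally have "card {x. poly ?f x = 0} < CARD('a)" using card_poly_roots_bound[OF nz] q by linarith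
  then have "{x. poly ?f x = 0} \<noteq> UNIV" by force
  then obtain a :: 'a where "poly ?f a \<noteq> 0" by blast
  then have a: "field_trace a \<noteq> 0" by (simp add: f)
  define k where "k = prime_field_rep (field_trace a)"
  have k: "k < p" "of_nat k = field_trace a"
    unfolding k_def p_def using prime_field_repI field_trace_power_CHAR by blast+
  then have "k > 0" using a by (cases k) auto
  have "add_char a = exp (2 * of_real pi * \<i> * of_nat k / of_nat p)"
    unfolding p_def by (rule add_char_of_nat) (use k in simp)
  also have "\<dots> \<noteq> 1"
  proof
    assume "exp (2 * of_real pi * \<i> * of_nat k / of_nat p) = (1 :: complex)"
    then obtain z :: int where "Im (2 * of_real pi * \<i> * of_nat k / of_nat p) = of_int (2 * z) * pi"
      unfolding exp_eq_1 by blast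
    then have "real k / real p * (2 * pi) = of_int z * (2 * pi)" by (simp add: mult_ac)
    then have "real k / real p = of_int z" unfolding mult_cancel_right using pi_neq_zero by simp
    moreover have "0 < real k / real p" "real k / real p < 1" using k \<open>k > 0\<close> by auto
    ultimately show False by simp
  qed
  finally show ?thesis by blast
qed

lemma sum_add_char_mult: "(\<Sum>a\<in>UNIV. add_char (x * a :: 'a::finite_field)) = (if x = 0 then of_nat CARD('a) else 0)"
proof (cases "x = 0")
  case False
  obtain b :: 'a where b: "add_char b \<noteq> 1" using ex_add_char_neq_1 by blast
  have "(\<Sum>a\<in>UNIV. add_char (x * a)) = (\<Sum>a\<in>UNIV. add_char (x * (a + b / x)))"
    by (rule sum.reindex_bij_witness[of _ "\<lambda>a. a + b / x" "\<lambda>a. a - b / x"]) auto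
  also have "\<dots> = (\<Sum>a\<in>UNIV. add_char (x * a)) * add_char b"
    using False by (simp add: distrib_left add_char_add sum_distrib_right)
  finally have "(\<Sum>a\<in>UNIV. add_char (x * a)) * (add_char b - 1) = 0" by (simp add: algebra_simps)
  then show ?thesis using b False by simp
qed simp

section \<open>Evaluation in the algebraic closure\<close>

definition ac_eval :: "'a::field poly \<Rightarrow> 'a alg_closure \<Rightarrow> 'a alg_closure" where
  "ac_eval f x = poly (map_poly to_ac f) x"

lemma ac_eval_pCons [simp]: "ac_eval (pCons a f) x = to_ac a + x * ac_eval f x"
  by (simp add: ac_eval_def map_poly_pCons)

lemma ac_eval_0 [simp]: "ac_eval 0 x = 0"
  by (simp add: ac_eval_def)

lemma ac_eval_1 [simp]: "ac_eval 1 x = 1"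
  by (simp add: one_pCons)

lemma ac_eval_add [simp]: "ac_eval (f + g) x = ac_eval f x + ac_eval g x"
  by (induction f g rule: poly_induct2) (simp_all add: algebra_simps)

lemma ac_eval_smult [simp]: "ac_eval (smult a f) x = to_ac a * ac_eval f x"
  by (induction f) (simp_all add: algebra_simps)

lemma ac_eval_mult [simp]: "ac_eval (f * g) x = ac_eval f x * ac_eval g x"
  by (induction f) (simp_all add: algebra_simps)

lemma ac_eval_diff [simp]: "ac_eval (f - g) x = ac_eval f x - ac_eval g x"
proof -
  have "ac_eval (f - g + g) x = ac_eval (f - g) x + ac_eval g x" by (rule ac_eval_add)
  then show ?thesis by simp
qed

lemma ac_eval_power [simp]: "ac_eval (f ^ n) x = ac_eval f x ^ n"
  by (induction n) simp_all

lemma ac_eval_frobenius: "ac_eval (f :: 'a::finite_field poly) x ^ CARD('a) = ac_eval f (x ^ CARD('a))"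
proof (induction f)
  case (pCons a f)
  obtain m where m: "CARD('a) = CHAR('a) ^ m" using card_finite_field_prime_power[where ?'a = 'a] by blast
  have fd: "(u + v) ^ CARD('a) = u ^ CARD('a) + v ^ CARD('a)" for u v :: "'a alg_closure"
    unfolding m by (rule freshmans_dream'[of _ m]) simp_all
  show ?case
    using pCons.IH by (simp add: fd power_mult_distrib finite_field_power_card_eq_same flip: to_ac_power)
qed (simp add: finite_UNIV_card_ge_0)

lemma ac_eval_frobenius_power:
  "ac_eval (f :: 'a::finite_field poly) (x ^ (CARD('a) ^ i)) = ac_eval f x ^ (CARD('a) ^ i)"
proof (induction i)
  case (Suc i)
  have "x ^ (CARD('a) ^ Suc i) = (x ^ (CARD('a) ^ i)) ^ CARD('a)"
    by (simp add: power_mult[symmetric] mult.commute)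
  then have "ac_eval f (x ^ (CARD('a) ^ Suc i)) = (ac_eval f x ^ (CARD('a) ^ i)) ^ CARD('a)"
    using Suc by (simp only: ac_eval_frobenius[symmetric])
  then show ?case by (simp add: power_mult[symmetric] mult.commute)
qed simp

lemma ex_ac_root:
  assumes "irreducible (Q :: 'a::finite_field poly)"
  shows "\<exists>x. ac_eval Q x = 0"
proof -
  have "degree (map_poly to_ac Q) = degree Q" by (rule degree_map_poly) simp
  then have "degree (map_poly to_ac Q) > 0" using irreducible_degree_pos[OF assms] by simp
  then show ?thesis unfolding ac_eval_def by (rule alg_closed_imp_poly_has_root)
qed

lemma ac_eval_eq_0_iff:
  fixes Q :: "'a::finite_field poly"
  assumes "irreducible Q" "ac_eval Q x = 0"
  shows "ac_eval f x = 0 \<longleftrightarrow> Q dvd f"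
proof
  assume 0: "ac_eval f x = 0"
  show "Q dvd f"
  proof (rule ccontr)
    assume nd: "\<not> Q dvd f"
    let ?N = "CARD('a) ^ degree Q - 1"
    from fermat_poly[OF assms(1) nd] obtain g where g: "f ^ ?N - 1 = Q * g" by (elim dvdE)
    have "ac_eval (f ^ ?N - 1) x = 0" unfolding g using assms(2) by simp
    moreover have "?N > 0"
    proof -
      have "CARD('a) \<ge> 2"
        using card_mono[of UNIV "{0::'a, 1}"] by simp
      then have "CARD('a) ^ degree Q > 1" using irreducible_degree_pos[OF assms(1)] by (intro one_less_power) auto
      then show ?thesis by simp
    qed
    ultimately show False using 0 by (simp add: power_0_left)
  qed
qed (use assms(2) in auto)

lemma ac_eval_inj_on:
  fixes Q :: "'a::finite_field poly"
  assumes "irreducible Q" "ac_eval Q x = 0"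
  shows "inj_on (\<lambda>f. ac_eval f x) {f. degree f < degree Q}"
proof (rule inj_onI)
  fix f g assume *: "f \<in> {f. degree f < degree Q}" "g \<in> {f. degree f < degree Q}" "ac_eval f x = ac_eval g x"
  then have "Q dvd f - g" using ac_eval_eq_0_iff[OF assms, of "f - g"] by simp
  moreover have "degree (f - g) < degree Q" using * by (auto intro: degree_diff_less)
  ultimately show "f = g" using dvd_imp_degree_le[of Q "f - g"] by fastforce
qed

text \<open>
  The \<open>deg Q\<close> Frobenius images of a root are distinct: otherwise a power \<open>q ^ s\<close> with \<open>s < deg Q\<close> of
  Frobenius would fix the field \<open>\<F>\<^sub>q(x)\<close>, which has \<open>q ^ deg Q\<close> elements.
\<close>

lemma ac_eval_irreducible_roots:
  fixes Q :: "'a::finite_field poly"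
  assumes Q: "irreducible Q" "lead_coeff Q = 1" and x: "ac_eval Q x = 0"
  shows "ac_eval Q y = (\<Prod>i<degree Q. y - x ^ (CARD('a) ^ i))"
proof -
  define q where "q = CARD('a)"
  define D where "D = degree Q"
  have D: "D > 0" unfolding D_def using Q by (simp add: irreducible_degree_pos)
  have q2: "q \<ge> 2" unfolding q_def using card_mono[of UNIV "{0::'a, 1}"] by simp
  have card: "card {f :: 'a poly. degree f < D} = q ^ D"
    using polys_below[of D, where ?'a = 'a] polys_below_degree[OF D, where ?'a = 'a] by (simp add: q_def)
  have frob: "x ^ (q ^ D) = x"
  proof (cases "Q dvd [:0, 1:]")
    case True
    then have "ac_eval [:0, 1:] x = 0" using ac_eval_eq_0_iff[OF Q(1) x] by blast
    then show ?thesis using q2 by simp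
  next
    case False
    from fermat_poly[OF Q(1) this] have "ac_eval ([:0, 1:] ^ (q ^ D - 1) - 1) x = 0"
      using ac_eval_eq_0_iff[OF Q(1) x] unfolding q_def D_def by blast
    then have "x ^ (q ^ D - 1) = 1" by simp
    then have "x ^ Suc (q ^ D - 1) = x" by simp
    then show ?thesis using q2 by simp
  qed
  have period: False if s: "0 < s" "s < D" "x ^ (q ^ s) = x" for s
  proof -
    let ?f = "monom 1 (q ^ s) - monom 1 1 :: 'a alg_closure poly"
    have qs: "q ^ s > 1" using q2 s by (intro one_less_power) auto
    have "coeff ?f (q ^ s) = 1" using qs by auto
    then have nz: "?f \<noteq> 0" by (metis coeff_0 zero_neq_one)
    have "degree ?f \<le> q ^ s" using qs by (intro degree_diff_le) (auto simp: degree_monom_eq)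
    then have le: "card {y. poly ?f y = 0} \<le> q ^ s" using card_poly_roots_bound[OF nz] by linarith
    have sub: "(\<lambda>f. ac_eval f x) ` {f. degree f < D} \<subseteq> {y. poly ?f y = 0}"
    proof clarify
      fix f :: "'a poly"
      have "ac_eval f x ^ (q ^ s) = ac_eval f x"
        using ac_eval_frobenius_power[of f x s] s(3) by (simp add: q_def)
      then show "poly ?f (ac_eval f x) = 0" by (simp add: poly_monom)
    qed
    have "q ^ D \<le> card {y. poly ?f y = 0}"
      using card_mono[OF poly_roots_finite[OF nz] sub] card_image[OF ac_eval_inj_on[OF Q(1) x]] card
      by (simp add: D_def)
    with le have "q ^ D \<le> q ^ s" by simp
    then show False using s(2) q2 by (simp add: power_le_imp_le_exp)
  qed
  have step: False if "i < j" "j < D" "x ^ (q ^ i) = x ^ (q ^ j)" for i j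
  proof -
    have e1: "(x ^ (q ^ i)) ^ (q ^ (D - j)) = x ^ (q ^ (D - (j - i)))"
      using that(1,2) by (simp add: power_mult[symmetric] power_add[symmetric] add.commute)
    have e2: "(x ^ (q ^ j)) ^ (q ^ (D - j)) = x ^ (q ^ D)"
      using that(2) by (simp add: power_mult[symmetric] power_add[symmetric])
    have "x ^ (q ^ (D - (j - i))) = x" using that(3) e1 e2 frob by simp
    moreover have "0 < D - (j - i)" "D - (j - i) < D" using that by linarith+
    ultimately show False using period by blast
  qed
  have inj: "inj_on (\<lambda>i. x ^ (q ^ i)) {..<D}"
    by (rule inj_onI) (metis step lessThan_iff linorder_neqE_nat)
  define A where "A = (\<lambda>i. x ^ (q ^ i)) ` {..<D}"
  have cardA: "card A = D" unfolding A_def using card_image[OF inj] by simp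
  let ?p = "map_poly to_ac Q" and ?r = "\<Prod>a\<in>A. [:- a, 1:]"
  have dp: "degree ?p = D" unfolding D_def by (rule degree_map_poly) simp
  have lp: "coeff ?p D = 1" using Q(2) by (simp add: coeff_map_poly D_def)
  have dr: "degree ?r = D" using cardA by (subst degree_prod_eq_sum_degree) auto
  have "lead_coeff ?r = 1" unfolding lead_coeff_prod by simp
  then have lr: "coeff ?r D = 1" unfolding dr .
  have "?p = ?r"
  proof (rule ccontr)
    assume "?p \<noteq> ?r"
    then have nz: "?p - ?r \<noteq> 0" by simp
    have "degree (?p - ?r) < D"
    proof (rule degree_lessI)
      show "?p - ?r \<noteq> 0 \<or> D > 0" using D by simp
      show "\<forall>k\<ge>D. coeff (?p - ?r) k = 0"
      proof (intro allI impI)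
        fix k assume "k \<ge> D"
        then show "coeff (?p - ?r) k = 0"
          using dp dr lp lr by (cases "k = D") (auto simp: coeff_eq_0)
      qed
    qed
    then have lt: "card {y. poly (?p - ?r) y = 0} < D" using card_poly_roots_bound[OF nz] by linarith
    have "A \<subseteq> {y. poly (?p - ?r) y = 0}"
    proof
      fix a assume a: "a \<in> A"
      then obtain i where "a = x ^ (q ^ i)" by (auto simp: A_def)
      then have "poly ?p a = 0"
        using ac_eval_frobenius_power[of Q x i] x q2 by (simp add: ac_eval_def q_def power_0_left)
      moreover have "poly ?r a = 0" using a by (auto simp: poly_prod A_def)
      ultimately show "a \<in> {y. poly (?p - ?r) y = 0}" by simp
    qed
    from card_mono[OF poly_roots_finite[OF nz] this] lt cardA show False by simp
  qed
  then have "ac_eval Q y = (\<Prod>a\<in>A. y - a)"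
    unfolding ac_eval_def by (simp add: poly_prod)
  also have "\<dots> = (\<Prod>i<D. y - x ^ (q ^ i))" unfolding A_def by (subst prod.reindex[OF inj]) simp
  finally show ?thesis unfolding D_def q_def .
qed

section \<open>The cubic residue symbol\<close>

lemma monic_irreducible_finite:
  assumes "c \<noteq> (0 :: 'a::finite_field poly)"
  shows "finite {Q. monic_irreducible Q \<and> Q dvd c}"
proof -
  have "{Q. monic_irreducible Q \<and> Q dvd c} \<subseteq> {f. \<forall>i\<ge>Suc (degree c). coeff f i = 0}"
    using dvd_imp_degree_le[OF _ assms]
    by (auto intro!: coeff_eq_0 simp: less_Suc_eq_le Suc_le_eq intro: le_less_trans)
  then show ?thesis using polys_below finite_subset by blast
qed

lemma monic_irreducible_dvd_eq:
  assumes "monic_irreducible (P :: 'a::field poly)" "monic_irreducible Q" "P dvd Q"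
  shows "P = Q"
proof -
  have "Q dvd P" using assms irreducibleD'[of Q P] by (auto simp: monic_irreducible_def irreducible_not_unit)
  then obtain e where e: "P = Q * e" by blast
  have PQ: "P \<noteq> 0" "Q \<noteq> 0" using assms by (auto simp: monic_irreducible_def)
  have "degree e = 0"
    using e PQ dvd_imp_degree_le[OF assms(3) PQ(2)] by (cases "e = 0") (auto simp: degree_mult_eq)
  then obtain a where a: "e = [:a:]" by (rule degree_eq_zeroE)
  then have "lead_coeff P = lead_coeff Q * a" using e by (cases "a = 0") auto
  then have "a = 1" using assms by (simp add: monic_irreducible_def)
  then show ?thesis using e a by simp
qed

lemma monic_irreducible_prime_elem: "monic_irreducible (Q :: 'a::field poly) \<Longrightarrow> prime_elem Q"
  by (auto simp: monic_irreducible_def intro: field_poly_irreducible_imp_prime)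

lemma monic_factor_induct [consumes 1, case_names one mult]:
  fixes c :: "'a::field poly"
  assumes "lead_coeff c = 1" "P 1"
    "\<And>Q c. monic_irreducible Q \<Longrightarrow> lead_coeff c = 1 \<Longrightarrow> P c \<Longrightarrow> P (Q * c)"
  shows "P c"
  using assms(1)
proof (induction "degree c" arbitrary: c rule: less_induct)
  case less
  show ?case
  proof (cases "degree c = 0")
    case True
    then obtain a where "c = [:a:]" by (rule degree_eq_zeroE)
    then have "c = 1" using less.prems by (simp add: one_pCons)
    then show ?thesis using assms(2) by simp
  next
    case False
    then obtain Q where Q: "monic_irreducible Q" "Q dvd c" using ex_irreducible_factor by blast
    then obtain b where b: "c = Q * b" by blast
    have "lead_coeff b = 1"
      using less.prems Q b by (simp add: lead_coeff_mult monic_irreducible_def)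
    moreover have "degree b < degree c"
    proof -
      have "c \<noteq> 0" using less.prems by auto
      moreover have "degree Q > 0" using Q by (simp add: monic_irreducible_def irreducible_degree_pos)
      ultimately show ?thesis using b by (auto simp: degree_mult_eq)
    qed
    ultimately show ?thesis using less.hyps[of b] assms(3)[of Q b] Q b by simp
  qed
qed

lemma power_dvd_bounded:
  fixes Q c :: "'a::field poly"
  assumes "irreducible Q" "c \<noteq> 0"
  shows "finite {k. Q ^ k dvd c}"
proof -
  have dQ: "degree Q > 0" using assms by (simp add: irreducible_degree_pos)
  have "k \<le> degree c" if "Q ^ k dvd c" for k
  proof -
    have "k \<le> k * degree Q" using dQ by simp
    also have "\<dots> = degree (Q ^ k)" using assms by (subst degree_power_eq) auto
    also have "\<dots> \<le> degree c" using that assms(2) by (rule dvd_imp_degree_le)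
    finally show ?thesis .
  qed
  then show ?thesis by (meson finite_nat_set_iff_bounded_le mem_Collect_eq)
qed

lemma Max_power_dvd_mult_self:
  fixes Q c :: "'a::field poly"
  assumes "irreducible Q" "c \<noteq> 0"
  shows "Max {k. Q ^ k dvd Q * c} = Suc (Max {k. Q ^ k dvd c})"
proof -
  have Q0: "Q \<noteq> 0" using assms by auto
  have eq: "{k. Q ^ k dvd Q * c} = insert 0 (Suc ` {k. Q ^ k dvd c})"
  proof (intro equalityI subsetI)
    fix k assume "k \<in> {k. Q ^ k dvd Q * c}"
    then show "k \<in> insert 0 (Suc ` {k. Q ^ k dvd c})" using Q0 by (cases k) auto
  qed (auto intro: mult_dvd_mono)
  have fin: "finite {k. Q ^ k dvd c}" by (rule power_dvd_bounded[OF assms])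
  have ne: "{k. Q ^ k dvd c} \<noteq> {}" by (auto intro: exI[of _ 0])
  have "Max (Suc ` {k. Q ^ k dvd c}) = Suc (Max {k. Q ^ k dvd c})"
    using fin ne by (simp add: mono_Max_commute[symmetric] mono_Suc)
  then show ?thesis unfolding eq using fin ne by (subst Max_insert) auto
qed

lemma power_dvd_mult_other:
  fixes Q R c :: "'a::field poly"
  assumes "monic_irreducible Q" "monic_irreducible R" "Q \<noteq> R"
  shows "Q ^ k dvd R * c \<longleftrightarrow> Q ^ k dvd c"
proof (induction k arbitrary: c)
  case (Suc k)
  have pr: "prime_elem Q" using assms(1) by (rule monic_irreducible_prime_elem)
  have Q0: "Q \<noteq> 0" using assms(1) by (auto simp: monic_irreducible_def)
  have "\<not> Q dvd R" using assms monic_irreducible_dvd_eq by blast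
  show ?case
  proof
    assume *: "Q ^ Suc k dvd R * c"
    then have "Q dvd R * c" by (metis dvd_mult_left power_Suc)
    then obtain d where d: "c = Q * d" using \<open>\<not> Q dvd R\<close> pr by (auto simp: prime_elem_dvd_mult_iff)
    then have "Q * Q ^ k dvd Q * (R * d)" using * by (simp add: mult_ac)
    then have "Q ^ k dvd R * d" using Q0 by (simp only: dvd_mult_cancel_left) simp
    then show "Q ^ Suc k dvd c" using Suc d by simp
  qed (rule dvd_mult)
qed simp

lemma chi_1 [simp]: "chi \<iota> (1 :: 'a::finite_field poly) f = 1"
proof -
  have "{Q :: 'a poly. monic_irreducible Q \<and> Q dvd 1} = {}"
    by (auto simp: monic_irreducible_def irreducible_not_unit)
  then show ?thesis by (simp only: chi_def prod.empty)
qed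

lemma chi_irreducible_mult:
  assumes Q: "monic_irreducible (Q :: 'a::finite_field poly)" and c: "c \<noteq> 0"
  shows "chi \<iota> (Q * c) f = cubic_symbol_irred \<iota> f Q * chi \<iota> c f"
proof -
  have irr: "irreducible Q" and Q0: "Q \<noteq> 0" using Q by (auto simp: monic_irreducible_def)
  let ?S = "\<lambda>c. {R. monic_irreducible R \<and> R dvd c}"
  let ?g = "\<lambda>c R. cubic_symbol_irred \<iota> f R ^ Max {k. R ^ k dvd c}"
  have fin: "finite (?S (Q * c))" using c Q0 by (intro monic_irreducible_finite) auto
  have QS: "Q \<in> ?S (Q * c)" using Q by auto
  have M0: "Max {k. R ^ k dvd c} = 0" if R: "irreducible R" "\<not> R dvd c" for R
  proof -
    have "{k. R ^ k dvd c} = {0}"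
    proof (intro equalityI subsetI)
      fix k assume "k \<in> {k. R ^ k dvd c}"
      then show "k \<in> {0}" using R(2) by (cases k) (auto dest: dvd_mult_left)
    qed auto
    then show ?thesis by simp
  qed
  have "chi \<iota> c f = (\<Prod>R\<in>?S (Q * c). ?g c R)"
    unfolding chi_def by (rule prod.mono_neutral_left[OF fin]) (auto simp: M0 monic_irreducible_def)
  also have "\<dots> = ?g c Q * (\<Prod>R\<in>?S (Q * c) - {Q}. ?g c R)" by (rule prod.remove[OF fin QS])
  finally have 1: "chi \<iota> c f = ?g c Q * (\<Prod>R\<in>?S (Q * c) - {Q}. ?g c R)" .
  have "chi \<iota> (Q * c) f = ?g (Q * c) Q * (\<Prod>R\<in>?S (Q * c) - {Q}. ?g (Q * c) R)"
    unfolding chi_def by (rule prod.remove[OF fin QS])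
  also have "(\<Prod>R\<in>?S (Q * c) - {Q}. ?g (Q * c) R) = (\<Prod>R\<in>?S (Q * c) - {Q}. ?g c R)"
    using Q by (intro prod.cong refl) (auto simp: power_dvd_mult_other)
  also have "?g (Q * c) Q = cubic_symbol_irred \<iota> f Q * ?g c Q"
    unfolding Max_power_dvd_mult_self[OF irr c] by simp
  finally show ?thesis unfolding 1 by (simp add: mult_ac)
qed

lemma chi_irreducible: "monic_irreducible Q \<Longrightarrow> chi \<iota> Q f = cubic_symbol_irred \<iota> f Q"
  using chi_irreducible_mult[of Q 1 \<iota> f] by simp

lemma chi_mult_modulus:
  fixes c d :: "'a::finite_field poly"
  assumes "lead_coeff c = 1" "lead_coeff d = 1"
  shows "chi \<iota> (c * d) f = chi \<iota> c f * chi \<iota> d f"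
  using assms(1)
proof (induction c rule: monic_factor_induct)
  case (mult Q c)
  have "c * d \<noteq> 0" "c \<noteq> 0" using mult assms(2) by auto
  then show ?case using mult by (simp add: chi_irreducible_mult mult.assoc)
qed simp

lemma cubic_symbol_cong:
  assumes "Q dvd f - g"
  shows "cubic_symbol_irred \<iota> f Q = cubic_symbol_irred \<iota> g (Q :: 'a::finite_field poly)"
proof -
  have "f mod Q = g mod Q" using assms by (simp add: mod_eq_dvd_iff)
  then have "f ^ k mod Q = g ^ k mod Q" "Q dvd f \<longleftrightarrow> Q dvd g" for k
    by (metis power_mod) (simp add: dvd_eq_mod_eq_0 \<open>f mod Q = g mod Q\<close>)
  then show ?thesis by (simp add: cubic_symbol_irred_def)
qed

lemma chi_cong:
  assumes "c dvd f - g"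
  shows "chi \<iota> c f = chi \<iota> (c :: 'a::finite_field poly) g"
  unfolding chi_def
proof (rule prod.cong)
  fix Q assume "Q \<in> {Q. monic_irreducible Q \<and> Q dvd c}"
  then have "Q dvd f - g" using assms dvd_trans by blast
  then show "cubic_symbol_irred \<iota> f Q ^ Max {k. Q ^ k dvd c} = cubic_symbol_irred \<iota> g Q ^ Max {k. Q ^ k dvd c}"
    by (simp only: cubic_symbol_cong)
qed simp

text \<open>
  Over the algebraic closure, the residue symbol is the cubic character of the norm of \<open>f\<close> from the
  residue field \<open>\<F>\<^sub>q[T] / Q\<close> down to \<open>\<F>\<^sub>q\<close>: the conjugates of a root \<open>x\<close> of \<open>Q\<close> are its images under
  Frobenius.
\<close>

lemma cubic_symbol_norm:
  fixes Q f :: "'a::finite_field poly"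
  assumes q: "CARD('a) mod 3 = 1" and Q: "irreducible Q" and f: "\<not> Q dvd f" and x: "ac_eval Q x = 0"
  obtains a where "a ^ 3 = 1" "cubic_symbol_irred \<iota> f Q = \<iota> a"
    "to_ac a = (\<Prod>i<degree Q. ac_eval f (x ^ (CARD('a) ^ i))) ^ ((CARD('a) - 1) div 3)"
proof -
  define k where "k = (CARD('a) - 1) div 3"
  define D where "D = degree Q"
  have c0: "CARD('a) > 0" by (simp add: finite_UNIV_card_ge_0)
  have k: "CARD('a) - 1 = k * 3" unfolding k_def using q by presburger
  have geo: "CARD('a) ^ D - 1 = (CARD('a) - 1) * (\<Sum>i<D. CARD('a) ^ i)"
  proof -
    obtain c where c: "CARD('a) = Suc c" using c0 gr0_implies_Suc by blast
    have "Suc c ^ D = Suc (c * (\<Sum>i<D. Suc c ^ i))" by (induction D) (auto simp: algebra_simps)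
    then show ?thesis unfolding c by simp
  qed
  have "poly_abs Q - 1 = CARD('a) ^ D - 1" using Q by (auto simp: poly_abs_def D_def)
  then have N: "(poly_abs Q - 1) div 3 = k * (\<Sum>i<D. CARD('a) ^ i)"
    unfolding geo k by simp
  obtain a where a: "a ^ 3 = 1" "f ^ ((poly_abs Q - 1) div 3) mod Q = [:a:]"
    using cubic_residue_constant[OF q Q f] by blast
  have "f ^ ((poly_abs Q - 1) div 3) = Q * (f ^ ((poly_abs Q - 1) div 3) div Q) + [:a:]"
    using a(2) by (metis mult_div_mod_eq)
  then have "ac_eval (f ^ ((poly_abs Q - 1) div 3)) x = ac_eval (Q * (f ^ ((poly_abs Q - 1) div 3) div Q) + [:a:]) x"
    by (rule arg_cong)
  then have "to_ac a = ac_eval f x ^ ((poly_abs Q - 1) div 3)" using x by simp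
  also have "\<dots> = (ac_eval f x ^ (\<Sum>i<D. CARD('a) ^ i)) ^ k" unfolding N by (simp add: power_mult[symmetric] mult.commute)
  also have "ac_eval f x ^ (\<Sum>i<D. CARD('a) ^ i) = (\<Prod>i<D. ac_eval f (x ^ (CARD('a) ^ i)))"
    by (simp add: power_sum ac_eval_frobenius_power)
  finally have "to_ac a = (\<Prod>i<degree Q. ac_eval f (x ^ (CARD('a) ^ i))) ^ ((CARD('a) - 1) div 3)"
    unfolding D_def k_def .
  moreover have "cubic_symbol_irred \<iota> f Q = \<iota> a" using f a(2) by (simp add: cubic_symbol_irred_def)
  ultimately show ?thesis using that a(1) by blast
qed

locale cubic_symbols =
  fixes \<iota> :: "'a::finite_field \<Rightarrow> complex"
  assumes q_odd: "odd CARD('a)"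
    and q_mod_3: "CARD('a) mod 3 = 1"
    and ident: "cube_root_identification \<iota>"
begin

abbreviation symbol :: "'a poly \<Rightarrow> 'a poly \<Rightarrow> complex" ("\<chi>") where "\<chi> \<equiv> chi \<iota>"

definition third :: nat where
  "third = (CARD('a) - 1) div 3"

definition chi0 :: "'a \<Rightarrow> complex" where
  "chi0 a = (if a = 0 then 0 else \<iota> (a ^ third))"

lemma iota_mult: "a ^ 3 = 1 \<Longrightarrow> b ^ 3 = 1 \<Longrightarrow> \<iota> (a * b) = \<iota> a * \<iota> b"
  using ident by (simp add: cube_root_identification_def)

lemma iota_cube: "a ^ 3 = 1 \<Longrightarrow> \<iota> a ^ 3 = 1"
  using ident unfolding cube_root_identification_def bij_betw_def by blast

lemma iota_1: "\<iota> 1 = 1"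
proof -
  have "\<iota> 1 * \<iota> 1 = \<iota> 1 * 1" using iota_mult[of 1 1] by simp
  moreover have "\<iota> 1 \<noteq> 0" using iota_cube[of 1] by auto
  ultimately show ?thesis by (simp only: mult_cancel_left) simp
qed

lemma iota_eq_1_iff: "a ^ 3 = 1 \<Longrightarrow> \<iota> a = 1 \<longleftrightarrow> a = 1"
  using ident iota_1 unfolding cube_root_identification_def bij_betw_def inj_on_def
  by (metis (mono_tags, lifting) mem_Collect_eq power_one)

lemma q_ge_2: "CARD('a) \<ge> 2"
  using card_mono[of UNIV "{0::'a, 1}"] by simp

lemma third: "CARD('a) = third * 3 + 1"
  unfolding third_def using q_mod_3 q_ge_2 by presburger

text \<open>
  This is the form in which \<open>q\<close> odd is used: \<open>(- 1) ^ ((q - 1) / 3) = 1\<close>.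
\<close>

lemma even_third: "even third"
  using q_odd third by simp

lemma third_pow_cube:
  assumes "a \<noteq> (0::'a)"
  shows "(a ^ third) ^ 3 = 1"
proof -
  have "a * a ^ (third * 3) = a * 1"
    using finite_field_power_card_eq_same[of a] unfolding third by simp
  then show ?thesis using assms by (simp add: power_mult)
qed

lemma chi0_0 [simp]: "chi0 0 = 0"
  by (simp add: chi0_def)

lemma chi0_1 [simp]: "chi0 1 = 1"
  by (simp add: chi0_def iota_1)

lemma chi0_mult: "chi0 (a * b) = chi0 a * chi0 b"
  by (simp add: chi0_def power_mult_distrib iota_mult third_pow_cube)

lemma chi0_cube: "a \<noteq> 0 \<Longrightarrow> chi0 a ^ 3 = 1"
  by (simp add: chi0_def iota_cube third_pow_cube)

lemma chi0_eq_0_iff [simp]: "chi0 a = 0 \<longleftrightarrow> a = 0"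
  using chi0_cube[of a] by (cases "a = 0") (auto simp: power_0_left)

lemma chi0_minus: "chi0 (- a) = chi0 a"
  using even_third by (simp add: chi0_def)

lemmas cubic_symbol_norm' = cubic_symbol_norm[OF q_mod_3, folded third_def]

lemma cubic_symbol_mult:
  assumes "irreducible Q"
  shows "cubic_symbol_irred \<iota> (f * g) Q = cubic_symbol_irred \<iota> f Q * cubic_symbol_irred \<iota> g Q"
proof -
  have pr: "prime_elem Q" using assms by (rule field_poly_irreducible_imp_prime)
  show ?thesis
  proof (cases "Q dvd f * g")
    case True
    then show ?thesis using pr by (auto simp: cubic_symbol_irred_def prime_elem_dvd_mult_iff)
  next
    case False
    then have nf: "\<not> Q dvd f" and ng: "\<not> Q dvd g" by auto
    obtain x where x: "ac_eval Q x = 0" using ex_ac_root[OF assms] by blast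
    obtain a where a: "a ^ 3 = 1" "cubic_symbol_irred \<iota> f Q = \<iota> a"
      "to_ac a = (\<Prod>i<degree Q. ac_eval f (x ^ (CARD('a) ^ i))) ^ third"
      using cubic_symbol_norm'[OF assms nf x] by blast
    obtain b where b: "b ^ 3 = 1" "cubic_symbol_irred \<iota> g Q = \<iota> b"
      "to_ac b = (\<Prod>i<degree Q. ac_eval g (x ^ (CARD('a) ^ i))) ^ third"
      using cubic_symbol_norm'[OF assms ng x] by blast
    obtain c where c: "c ^ 3 = 1" "cubic_symbol_irred \<iota> (f * g) Q = \<iota> c"
      "to_ac c = (\<Prod>i<degree Q. ac_eval (f * g) (x ^ (CARD('a) ^ i))) ^ third"
      using cubic_symbol_norm'[OF assms False x] by blast
    have "to_ac c = to_ac (a * b)"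
      using a(3) b(3) c(3) by (simp add: prod.distrib power_mult_distrib)
    then have "c = a * b" by (simp only: to_ac_eq_iff)
    then show ?thesis using a b c iota_mult by simp
  qed
qed

lemma chi_mult: "\<chi> c (f * g) = \<chi> c f * \<chi> c g"
  unfolding chi_def prod.distrib[symmetric]
  by (intro prod.cong refl) (auto simp: cubic_symbol_mult power_mult_distrib monic_irreducible_def)

lemma chi_eq_0: "c \<noteq> 0 \<Longrightarrow> \<chi> c f = 0 \<longleftrightarrow> (\<exists>Q. monic_irreducible Q \<and> Q dvd c \<and> Q dvd f)"
  by (rule chi_eq_0_iff[OF q_mod_3 ident])

lemma cubic_symbol_cube:
  assumes "irreducible Q" "\<not> Q dvd f"
  shows "cubic_symbol_irred \<iota> f Q ^ 3 = 1"
proof -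
  obtain x where x: "ac_eval Q x = 0" using ex_ac_root[OF assms(1)] by blast
  show ?thesis using cubic_symbol_norm'[OF assms x] iota_cube by metis
qed

lemma chi_cube:
  assumes "c \<noteq> 0" "\<chi> c f \<noteq> 0"
  shows "\<chi> c f ^ 3 = 1"
proof -
  have "\<not> Q dvd f" if "monic_irreducible Q" "Q dvd c" for Q using assms that chi_eq_0 by blast
  then have "\<chi> c f ^ 3 = (\<Prod>Q | monic_irreducible Q \<and> Q dvd c. (cubic_symbol_irred \<iota> f Q ^ 3) ^ Max {k. Q ^ k dvd c})"
    unfolding chi_def prod_power_distrib by (simp add: power_mult[symmetric] mult.commute)
  also have "\<dots> = (\<Prod>Q | monic_irreducible Q \<and> Q dvd c. 1)"
    using \<open>\<And>Q. monic_irreducible Q \<Longrightarrow> Q dvd c \<Longrightarrow> \<not> Q dvd f\<close>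
    by (intro prod.cong refl) (auto simp: cubic_symbol_cube monic_irreducible_def)
  finally show ?thesis by simp
qed

lemma chi_const:
  assumes "lead_coeff c = 1" "a \<noteq> 0"
  shows "\<chi> c [:a:] = chi0 a ^ degree c"
  using assms(1)
proof (induction c rule: monic_factor_induct)
  case (mult Q c)
  then have irr: "irreducible Q" and nz: "c \<noteq> 0" "Q \<noteq> 0" by (auto simp: monic_irreducible_def)
  have nd: "\<not> Q dvd [:a:]"
    using irr assms(2) dvd_imp_degree_le[of Q "[:a:]"] irreducible_degree_pos[of Q] by auto
  obtain x where x: "ac_eval Q x = 0" using ex_ac_root[OF irr] by blast
  obtain b where b: "b ^ 3 = 1" "cubic_symbol_irred \<iota> [:a:] Q = \<iota> b"
    "to_ac b = (\<Prod>i<degree Q. ac_eval [:a:] (x ^ (CARD('a) ^ i))) ^ third"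
    using cubic_symbol_norm'[OF irr nd x] by blast
  have "to_ac b = to_ac ((a ^ third) ^ degree Q)"
    unfolding b(3) by (simp add: power_mult[symmetric] mult.commute)
  then have b': "b = (a ^ third) ^ degree Q" by (simp only: to_ac_eq_iff)
  have pw: "\<iota> (u ^ k) = \<iota> u ^ k" if "u ^ 3 = 1" for u :: 'a and k
  proof (induction k)
    case (Suc k)
    have "(u ^ k) ^ 3 = 1" using that by (metis power_commutes power_mult mult.commute power_one)
    then show ?case using iota_mult[OF that] Suc by simp
  qed (simp add: iota_1)
  have "cubic_symbol_irred \<iota> [:a:] Q = chi0 a ^ degree Q"
    unfolding b(2) b' pw[OF third_pow_cube[OF assms(2)]] using assms(2) by (simp add: chi0_def)
  then show ?case using mult nz by (simp add: chi_irreducible_mult degree_mult_eq power_add)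
qed simp

text \<open>
  Both symbols are cubic characters of a resultant, a product of differences \<open>x - y\<close> of a root of
  \<open>Q\<close> and a root of \<open>P\<close>. Exchanging the roles changes signs only, and \<open>- 1\<close> is a cube.
\<close>

lemma cubic_reciprocity_irreducible:
  assumes P: "monic_irreducible P" and Q: "monic_irreducible Q" and ne: "P \<noteq> Q"
  shows "cubic_symbol_irred \<iota> P Q = cubic_symbol_irred \<iota> Q P"
proof -
  have irr: "irreducible P" "irreducible Q" and l: "lead_coeff P = 1" "lead_coeff Q = 1"
    using P Q by (auto simp: monic_irreducible_def)
  have nd: "\<not> Q dvd P" "\<not> P dvd Q" using monic_irreducible_dvd_eq P Q ne by blast+
  define k where "k = (CARD('a) - 1) div 3"
  obtain x where x: "ac_eval Q x = 0" using ex_ac_root[OF irr(2)] by blast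
  obtain y where y: "ac_eval P y = 0" using ex_ac_root[OF irr(1)] by blast
  let ?X = "\<lambda>i. x ^ (CARD('a) ^ i)" and ?Y = "\<lambda>j. y ^ (CARD('a) ^ j)"
  obtain a where a: "cubic_symbol_irred \<iota> P Q = \<iota> a"
    "to_ac a = (\<Prod>i<degree Q. ac_eval P (?X i)) ^ third"
    using cubic_symbol_norm'[OF irr(2) nd(1) x] by blast
  obtain b where b: "cubic_symbol_irred \<iota> Q P = \<iota> b"
    "to_ac b = (\<Prod>j<degree P. ac_eval Q (?Y j)) ^ third"
    using cubic_symbol_norm'[OF irr(1) nd(2) y] by blast
  have "(\<Prod>i<degree Q. ac_eval P (?X i)) ^ third = (\<Prod>i<degree Q. \<Prod>j<degree P. (?X i - ?Y j) ^ third)"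
    by (simp add: ac_eval_irreducible_roots[OF irr(1) l(1) y] prod_power_distrib)
  also have "\<dots> = (\<Prod>i<degree Q. \<Prod>j<degree P. (?Y j - ?X i) ^ third)"
    using even_third by (intro prod.cong refl) (metis minus_diff_eq power_minus_even)
  also have "\<dots> = (\<Prod>j<degree P. \<Prod>i<degree Q. (?Y j - ?X i) ^ third)" by (rule prod.swap)
  also have "\<dots> = (\<Prod>j<degree P. ac_eval Q (?Y j)) ^ third"
    by (simp add: ac_eval_irreducible_roots[OF irr(2) l(2) x] prod_power_distrib)
  finally have "to_ac a = to_ac b" using a(2) b(2) by simp
  then have "a = b" by (simp only: to_ac_eq_iff)
  then show ?thesis using a b by simp
qed

theorem cubic_reciprocity:
  assumes "lead_coeff c = 1" "lead_coeff d = 1"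
  shows "\<chi> c d = \<chi> d c"
  using assms(1)
proof (induction c rule: monic_factor_induct)
  case one
  have "d \<noteq> 0" using assms(2) by auto
  have "\<chi> d [:1:] = chi0 1 ^ degree d" by (rule chi_const[OF assms(2)]) simp
  then show ?case by (simp flip: one_pCons)
next
  case (mult Q c)
  have c0: "c \<noteq> 0" using mult by auto
  have "\<chi> Q d = \<chi> d Q"
    using assms(2)
  proof (induction d rule: monic_factor_induct)
    case one
    have "\<chi> Q [:1:] = chi0 1 ^ degree Q" using mult(1) by (intro chi_const) (auto simp: monic_irreducible_def)
    then show ?case by (simp flip: one_pCons)
  next
    case (mult R d)
    have "d \<noteq> 0" using mult by auto
    moreover have "\<chi> Q R = cubic_symbol_irred \<iota> Q R"
    proof (cases "Q = R")
      case False
      then show ?thesis using \<open>monic_irreducible Q\<close> mult(1)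
        by (simp add: chi_irreducible cubic_reciprocity_irreducible[of R Q])
    qed (use mult(1) in \<open>simp add: chi_irreducible\<close>)
    ultimately show ?case using mult by (simp add: chi_mult chi_irreducible_mult)
  qed
  then show ?case using mult c0 by (simp add: chi_irreducible_mult chi_mult chi_irreducible)
qed

text \<open>
  Otherwise all \<open>q ^ deg Q - 1\<close> units of the residue field would be roots of a polynomial of a third
  of that degree.
\<close>

lemma chi_nontrivial:
  assumes Q: "monic_irreducible Q"
  shows "\<exists>f. \<chi> Q f \<noteq> 0 \<and> \<chi> Q f \<noteq> 1"
proof (rule ccontr)
  assume "\<not> ?thesis"
  then have triv: "\<chi> Q f = 1" if "\<not> Q dvd f" for f
    using that \<open>\<not> (\<exists>f. \<chi> Q f \<noteq> 0 \<and> \<chi> Q f \<noteq> 1)\<close> Q chi_irreducible[OF Q, of \<iota> f]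
      cubic_symbol_irred_eq_0_iff[OF q_mod_3 ident, of Q f]
    unfolding monic_irreducible_def by metis
  have irr: "irreducible Q" using Q by (simp add: monic_irreducible_def)
  have D: "degree Q > 0" using irr by (rule irreducible_degree_pos)
  obtain x where x: "ac_eval Q x = 0" using ex_ac_root[OF irr] by blast
  define N where "N = CARD('a) ^ degree Q - 1"
  define k where "k = N div 3"
  have Nk: "(poly_abs Q - 1) div 3 = k" using irr by (auto simp: poly_abs_def k_def N_def)
  have "1 < CARD('a) ^ degree Q" using q_ge_2 D by (intro one_less_power) auto
  moreover have "CARD('a) ^ degree Q mod 3 = 1" using q_mod_3 power_mod[of "CARD('a)" 3 "degree Q"] by simp
  ultimately have N: "N = 3 * k" "k > 0" unfolding k_def N_def by presburger+
  let ?f = "monom 1 k - 1 :: 'a alg_closure poly"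
  have cf: "coeff ?f k = 1" using N by auto
  then have nz: "?f \<noteq> 0" by (metis coeff_0 zero_neq_one)
  have "degree ?f \<le> k" using N by (intro degree_diff_le) (auto simp: degree_monom_eq)
  then have le: "card {y. poly ?f y = 0} \<le> k" using card_poly_roots_bound[OF nz] by linarith
  let ?A = "{f :: 'a poly. degree f < degree Q} - {0}"
  have sub: "(\<lambda>f. ac_eval f x) ` ?A \<subseteq> {y. poly ?f y = 0}"
  proof clarify
    fix f :: "'a poly" assume f: "degree f < degree Q" "f \<noteq> 0"
    then have nd: "\<not> Q dvd f" using dvd_imp_degree_le[of Q f] by auto
    obtain a where a: "a ^ 3 = 1" "f ^ k mod Q = [:a:]"
      using cubic_residue_constant[OF q_mod_3 irr nd] unfolding Nk by blast
    have "\<iota> a = 1" using triv[OF nd] nd a(2) unfolding chi_irreducible[OF Q] cubic_symbol_irred_def Nk by simp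
    then have "f ^ k mod Q = 1" using a iota_eq_1_iff by (simp add: one_pCons)
    then have "f ^ k = Q * (f ^ k div Q) + 1" by (metis mult_div_mod_eq)
    then have "ac_eval (f ^ k) x = ac_eval (Q * (f ^ k div Q) + 1) x" by (rule arg_cong)
    then show "poly ?f (ac_eval f x) = 0" using x by (simp add: poly_monom)
  qed
  have inj: "inj_on (\<lambda>f. ac_eval f x) ?A"
    using ac_eval_inj_on[OF irr x] by (rule inj_on_subset) auto
  have "card ?A = N"
    using polys_below[of "degree Q", where ?'a = 'a] polys_below_degree[OF D, where ?'a = 'a] D
    by (simp add: N_def card_Diff_singleton)
  then have "N \<le> card {y. poly ?f y = 0}"
    using card_mono[OF poly_roots_finite[OF nz] sub] card_image[OF inj] by simp
  with le N show False by simp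
qed

lemma norm_eq_1_of_cube: "norm (z :: complex) = 1" if "z ^ 3 = 1"
proof -
  have "norm z ^ 3 = 1 ^ 3" using that by (metis norm_one norm_power power_one)
  then show ?thesis using power_eq_imp_eq_base[of "norm z" 3 1] by simp
qed

lemma cnj_eq_of_cube: "cnj z = z ^ 2" if "z ^ 3 = 1"
proof -
  have "z * cnj z = 1" using norm_eq_1_of_cube[OF that] by (simp add: complex_norm_square[symmetric])
  moreover have "z * z ^ 2 = 1" using that by (simp add: power2_eq_square power3_eq_cube mult.assoc)
  moreover have "z \<noteq> 0" using that by auto
  ultimately show ?thesis by (metis mult_left_cancel)
qed

lemma chi_mult_cnj: "c \<noteq> 0 \<Longrightarrow> \<chi> c f \<noteq> 0 \<Longrightarrow> \<chi> c f * cnj (\<chi> c f) = 1"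
  using norm_eq_1_of_cube[OF chi_cube] by (simp add: complex_norm_square[symmetric])

lemma cnj_chi: "c \<noteq> 0 \<Longrightarrow> cnj (\<chi> c f) = \<chi> c f ^ 2"
  using cnj_eq_of_cube[OF chi_cube[of c f]] by (cases "\<chi> c f = 0") auto

lemma cnj_chi0: "cnj (chi0 a) = chi0 a ^ 2"
  using cnj_eq_of_cube[OF chi0_cube[of a]] by (cases "a = 0") auto

lemma chi0_power_mod: "a \<noteq> 0 \<Longrightarrow> m mod 3 = n mod 3 \<Longrightarrow> chi0 a ^ m = chi0 a ^ n"
proof -
  assume a: "a \<noteq> 0" and mn: "m mod 3 = n mod 3"
  have "chi0 a ^ k = chi0 a ^ (k mod 3)" for k
  proof -
    have "chi0 a ^ k = chi0 a ^ (3 * (k div 3) + k mod 3)" by simp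
    also have "\<dots> = chi0 a ^ (k mod 3)" unfolding power_add power_mult using chi0_cube[OF a] by simp
    finally show ?thesis .
  qed
  then show ?thesis using mn by metis
qed

end

section \<open>Polynomials of bounded degree, monic polynomials, residues\<close>

definition below :: "nat \<Rightarrow> 'a::finite_field poly set" where
  "below n = {f. \<forall>i\<ge>n. coeff f i = 0}"

definition monics :: "nat \<Rightarrow> 'a::finite_field poly set" where
  "monics n = {f. degree f = n \<and> lead_coeff f = 1}"

lemma finite_below [simp, intro]: "finite (below n :: 'a::finite_field poly set)"
  and card_below: "card (below n :: 'a poly set) = CARD('a) ^ n"
  using polys_below[of n, where ?'a = 'a] by (simp_all add: below_def)

lemma below_iff: "f \<in> below n \<longleftrightarrow> f = 0 \<or> degree f < n"
  unfolding below_def by (auto simp: coeff_eq_0) (metis leading_coeff_0_iff linorder_not_le)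

lemma below_0 [simp]: "below 0 = {0}"
  by (auto simp: below_iff)

lemma zero_in_below [simp]: "0 \<in> below n"
  by (simp add: below_iff)

lemma below_add: "f \<in> below n \<Longrightarrow> g \<in> below n \<Longrightarrow> f + g \<in> below n"
  and below_diff: "f \<in> below n \<Longrightarrow> g \<in> below n \<Longrightarrow> f - g \<in> below n"
  and below_uminus: "f \<in> below n \<Longrightarrow> - f \<in> below n"
  and below_smult: "f \<in> below n \<Longrightarrow> smult a f \<in> below n"
  by (simp_all add: below_def)

lemma below_mono: "f \<in> below m \<Longrightarrow> m \<le> n \<Longrightarrow> f \<in> below n"
  by (simp add: below_def)

lemma below_mult: "f \<in> below m \<Longrightarrow> degree g \<le> k \<Longrightarrow> f * g \<in> below (m + k)"
  using degree_mult_le[of f g] by (auto simp: below_iff)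

lemma monics_iff: "f \<in> monics n \<longleftrightarrow> degree f = n \<and> lead_coeff f = 1"
  by (simp add: monics_def)

lemma monics_nonzero: "f \<in> monics n \<Longrightarrow> f \<noteq> 0"
  by (auto simp: monics_def)

lemma monics_0 [simp]: "monics 0 = {1}"
  by (auto simp: monics_def one_pCons elim!: degree_eq_zeroE)

lemma monicsD: "f \<in> monics n \<Longrightarrow> degree f = n" "f \<in> monics n \<Longrightarrow> coeff f n = 1"
  "f \<in> monics n \<Longrightarrow> lead_coeff f = 1"
  by (auto simp: monics_def)

lemma monics_mult:
  assumes "f \<in> monics m" "g \<in> monics n"
  shows "f * g \<in> monics (m + n)"
proof -
  have "lead_coeff (f * g) = 1" using assms by (simp only: lead_coeff_mult monicsD(3)) simp
  moreover have "degree (f * g) = m + n"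
    using assms monics_nonzero[OF assms(1)] monics_nonzero[OF assms(2)] by (simp add: degree_mult_eq monicsD)
  ultimately show ?thesis by (simp add: monics_iff)
qed

lemma monics_mult_cancel: "f \<in> monics m \<Longrightarrow> f * g \<in> monics (m + n) \<Longrightarrow> g \<in> monics n"
proof -
  assume a: "f \<in> monics m" "f * g \<in> monics (m + n)"
  have nz: "f \<noteq> 0" "g \<noteq> 0" using monics_nonzero a by fastforce+
  have "lead_coeff f * lead_coeff g = 1" using monicsD(3)[OF a(2)] unfolding lead_coeff_mult .
  then have "lead_coeff g = 1" using monicsD(3)[OF a(1)] by simp
  moreover have "degree g = n" using a nz monicsD(1)[OF a(2)] monicsD(1)[OF a(1)] by (simp add: degree_mult_eq)
  ultimately show "g \<in> monics n" by (simp add: monics_iff)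
qed

lemma monics_add_below:
  assumes "f \<in> monics n" "g \<in> below n"
  shows "f + g \<in> monics n"
proof (cases "g = 0")
  case False
  then have "degree g < degree f" using assms by (simp add: below_iff monics_iff)
  then have "degree (f + g) = n" "coeff g n = 0"
    using monicsD(1)[OF assms(1)] by (simp_all add: degree_add_eq_left coeff_eq_0)
  then show ?thesis using monicsD(2)[OF assms(1)] by (simp add: monics_iff)
qed (use assms in simp)

lemma monics_diff_below: "f \<in> monics n \<Longrightarrow> g \<in> monics n \<Longrightarrow> f - g \<in> below n"
  by (auto simp: below_def monics_def coeff_eq_0 le_less)

lemma monics_eq_image: "(f :: 'a::finite_field poly) \<in> monics n \<Longrightarrow> monics n = (\<lambda>g. f + g) ` below n"
proof (intro equalityI subsetI)
  fix h :: "'a poly" assume "f \<in> monics n" "h \<in> monics n"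
  then show "h \<in> (\<lambda>g. f + g) ` below n"
    using monics_diff_below[of h n f] by (intro image_eqI[of _ _ "h - f"]) auto
qed (auto intro: monics_add_below)

lemma monom_in_monics [simp]: "monom 1 n \<in> monics n"
  by (simp add: monics_def degree_monom_eq)

lemma finite_monics [simp, intro]: "finite (monics n)"
  unfolding monics_eq_image[OF monom_in_monics, of n] by simp

lemma card_monics: "card (monics n :: 'a::finite_field poly set) = CARD('a) ^ n"
proof -
  have "inj_on (\<lambda>g. monom 1 n + g) (below n :: 'a poly set)" by (simp add: inj_on_def)
  then show ?thesis
    using monics_eq_image[OF monom_in_monics, of n, where ?'a = 'a] by (simp add: card_image card_below)
qed

lemma sum_below_translate: "h \<in> below n \<Longrightarrow> (\<Sum>g\<in>below n. F (g + h)) = (\<Sum>g\<in>below n. F g)"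
  by (rule sum.reindex_bij_witness[of _ "\<lambda>g. g - h" "\<lambda>g. g + h"]) (auto intro: below_add below_diff)

lemma sum_monics_translate: "h \<in> below n \<Longrightarrow> (\<Sum>g\<in>monics n. F (g + h)) = (\<Sum>g\<in>monics n. F g)"
  by (rule sum.reindex_bij_witness[of _ "\<lambda>g. g - h" "\<lambda>g. g + h"])
     (auto intro: monics_add_below simp: below_uminus monics_add_below[of _ n "- h", simplified])

lemma sum_below_smult: "a \<noteq> 0 \<Longrightarrow> (\<Sum>g\<in>below n. F (smult a g)) = (\<Sum>g\<in>below n. F g)"
  by (rule sum.reindex_bij_witness[of _ "\<lambda>g. smult (inverse a) g" "\<lambda>g. smult a g"]) (auto intro: below_smult)

lemma below_Suc_decomp:
  "below n - {0 :: 'a::finite_field poly} = (\<Union>l<n. (\<lambda>(a, f). smult a f) ` ((UNIV - {0}) \<times> monics l))"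
proof (intro equalityI subsetI)
  fix g :: "'a poly" assume g: "g \<in> below n - {0}"
  then have "degree g < n" by (auto simp: below_iff)
  moreover have "g = smult (lead_coeff g) (smult (inverse (lead_coeff g)) g)" using g by simp
  moreover have "smult (inverse (lead_coeff g)) g \<in> monics (degree g)" using g by (simp add: monics_iff)
  ultimately show "g \<in> (\<Union>l<n. (\<lambda>(a, f). smult a f) ` ((UNIV - {0}) \<times> monics l))"
    using g by (intro UN_I[of "degree g"] image_eqI[of _ _ "(lead_coeff g, smult (inverse (lead_coeff g)) g)"]) auto
next
  fix g :: "'a poly" assume "g \<in> (\<Union>l<n. (\<lambda>(a, f). smult a f) ` ((UNIV - {0}) \<times> monics l))"
  then show "g \<in> below n - {0}" by (auto simp: below_iff monics_iff dest: monics_nonzero)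
qed

text \<open>A nonzero polynomial of degree below \<open>n\<close> is a unit times a monic polynomial.\<close>

lemma sum_below_leading:
  assumes "F 0 = 0"
  shows "(\<Sum>g\<in>below n. F g) = (\<Sum>l<n. \<Sum>f\<in>monics l. \<Sum>a\<in>UNIV - {0 :: 'a::finite_field}. F (smult a f))"
proof -
  have inj: "inj_on (\<lambda>(a, f). smult a f) ((UNIV - {0 :: 'a}) \<times> monics l)" for l
  proof (rule inj_onI)
    fix u v assume u: "u \<in> (UNIV - {0 :: 'a}) \<times> monics l" and v: "v \<in> (UNIV - {0 :: 'a}) \<times> monics l"
      and eq: "(\<lambda>(a, f). smult a f) u = (\<lambda>(a, f). smult a f) v"
    obtain a f b g where uv: "u = (a, f)" "v = (b, g)" by (metis surj_pair)
    then have *: "a \<noteq> 0" "f \<in> monics l" "b \<noteq> 0" "g \<in> monics l" "smult a f = smult b g"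
      using u v eq by simp_all
    have "a * coeff f l = b * coeff g l" using *(5) by (metis coeff_smult)
    then have "a = b" using monicsD(2)[OF *(2)] monicsD(2)[OF *(4)] by simp
    then have sm: "smult a f = smult a g" using *(5) by simp
    have "f = g" using sm *(1) by (simp add: poly_eq_iff)
    with \<open>a = b\<close> show "u = v" using uv by simp
  qed
  have "(\<Sum>g\<in>below n. F g) = (\<Sum>g\<in>below n - {0}. F g)"
    using assms by (intro sum.mono_neutral_right) auto
  also have "\<dots> = (\<Sum>l<n. \<Sum>g\<in>(\<lambda>(a, f). smult a f) ` ((UNIV - {0 :: 'a}) \<times> monics l). F g)"
    unfolding below_Suc_decomp
  proof (rule sum.UNION_disjoint)
    have "degree g = l" if "g \<in> (\<lambda>(a, f). smult a f) ` ((UNIV - {0 :: 'a}) \<times> monics l)" for g l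
      using that by (auto split: if_splits simp: monicsD)
    then show "\<forall>i\<in>{..<n}. \<forall>j\<in>{..<n}. i \<noteq> j \<longrightarrow> (\<lambda>(a, f). smult a f) ` ((UNIV - {0 :: 'a}) \<times> monics i) \<inter>
        (\<lambda>(a, f). smult a f) ` ((UNIV - {0}) \<times> monics j) = {}" by blast
  qed auto
  also have "\<dots> = (\<Sum>l<n. \<Sum>(a, f)\<in>(UNIV - {0 :: 'a}) \<times> monics l. F (smult a f))"
    by (intro sum.cong refl) (subst sum.reindex[OF inj], simp add: case_prod_unfold)
  also have "\<dots> = (\<Sum>l<n. \<Sum>f\<in>monics l. \<Sum>a\<in>UNIV - {0 :: 'a}. F (smult a f))"
    by (intro sum.cong refl) (simp add: sum.cartesian_product[symmetric] sum.swap[of _ _ "UNIV - {0}"])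
  finally show ?thesis .
qed

lemma mod_in_below: "c \<noteq> 0 \<Longrightarrow> f mod c \<in> below (degree c)"
  using degree_mod_less[of c f] by (auto simp: below_iff)

lemma mod_below: "f \<in> below (degree c) \<Longrightarrow> f mod c = f"
  by (auto simp: below_iff mod_poly_less)

lemma sum_monics_division:
  fixes c :: "'a::finite_field poly"
  assumes "c \<in> monics l" "l \<le> b"
  shows "(\<Sum>R\<in>monics b. F R) = (\<Sum>w\<in>monics (b - l). \<Sum>d\<in>below l. F (w * c + d))"
proof -
  have dc: "degree c = l" and c0: "c \<noteq> 0" using assms monics_nonzero[of c l] by (auto simp: monics_iff)
  have "(\<Sum>w\<in>monics (b - l). \<Sum>d\<in>below l. F (w * c + d)) = (\<Sum>(w, d)\<in>monics (b - l) \<times> below l. F (w * c + d))"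
    by (rule sum.cartesian_product)
  also have "\<dots> = (\<Sum>R\<in>monics b. F R)"
  proof (rule sum.reindex_bij_witness[of _ "\<lambda>R. (R div c, R mod c)" "\<lambda>(w, d). w * c + d"])
    fix R :: "'a poly" assume R: "R \<in> monics b"
    have "R - R mod c \<in> monics b"
      using monics_add_below[OF R, of "- (R mod c)"] below_uminus[OF below_mono[of "R mod c" l b]]
        mod_in_below[OF c0, of R] assms dc by simp
    moreover have "R - R mod c = c * (R div c)" by (simp add: minus_mod_eq_mult_div)
    ultimately have "R div c \<in> monics (b - l)" using monics_mult_cancel[of c l "R div c" "b - l"] assms by simp
    then show "(R div c, R mod c) \<in> monics (b - l) \<times> below l" using mod_in_below[OF c0, of R] dc by simp
  next
    fix wd assume "wd \<in> (monics (b - l) :: 'a poly set) \<times> (below l :: 'a poly set)"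
    then obtain w d where wd: "wd = (w, d)" "w \<in> monics (b - l)" "d \<in> below l" by blast
    have "w * c + d \<in> monics b"
      using monics_add_below[OF monics_mult[OF wd(2) assms(1)] below_mono[OF wd(3)]] assms(2) by simp
    moreover have "d div c = 0" "d mod c = d" using wd(3) dc mod_below[of d c] by (auto simp: below_iff div_poly_less)
    moreover from this have "(w * c + d) div c = w" "(w * c + d) mod c = d" using c0 by simp_all
    ultimately show "(\<lambda>R. (R div c, R mod c)) ((\<lambda>(w, d). w * c + d) wd) = wd"
      "(\<lambda>(w, d). w * c + d) wd \<in> monics b"
      using wd by simp_all
  qed auto
  finally show ?thesis by simp
qed

lemma sum_below_division:
  fixes c :: "'a::finite_field poly"
  assumes "c \<in> monics l" "l \<le> b"
  shows "(\<Sum>R\<in>below b. F R) = (\<Sum>w\<in>below (b - l). \<Sum>d\<in>below l. F (w * c + d))"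
proof -
  have dc: "degree c = l" and c0: "c \<noteq> 0" using assms monics_nonzero[of c l] by (auto simp: monics_iff)
  have "(\<Sum>w\<in>below (b - l). \<Sum>d\<in>below l. F (w * c + d)) = (\<Sum>(w, d)\<in>below (b - l) \<times> below l. F (w * c + d))"
    by (rule sum.cartesian_product)
  also have "\<dots> = (\<Sum>R\<in>below b. F R)"
  proof (rule sum.reindex_bij_witness[of _ "\<lambda>R. (R div c, R mod c)" "\<lambda>(w, d). w * c + d"])
    fix R :: "'a poly" assume R: "R \<in> below b"
    have "R div c \<in> below (b - l)"
    proof (cases "R div c = 0")
      case False
      have "c * (R div c) \<in> below b"
        using below_diff[OF R below_mono[of "R mod c" l b]] mod_in_below[OF c0, of R] assms dc
        by (simp add: minus_mod_eq_mult_div)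
      then have "l + degree (R div c) < b" using False c0 dc by (simp add: below_iff degree_mult_eq)
      then have "degree (R div c) < b - l" by linarith
      then show ?thesis by (simp add: below_iff)
    qed simp
    then show "(R div c, R mod c) \<in> below (b - l) \<times> below l" using mod_in_below[OF c0, of R] dc by simp
  next
    fix wd assume "wd \<in> (below (b - l) :: 'a poly set) \<times> (below l :: 'a poly set)"
    then obtain w d where wd: "wd = (w, d)" "w \<in> below (b - l)" "d \<in> below l" by blast
    have "w * c + d \<in> below b"
      using below_add[OF below_mult[OF wd(2), of c l] below_mono[OF wd(3)]] assms(2) dc by simp
    moreover have "d div c = 0" "d mod c = d" using wd(3) dc mod_below[of d c] by (auto simp: below_iff div_poly_less)
    moreover from this have "(w * c + d) div c = w" "(w * c + d) mod c = d" using c0 by simp_all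
    ultimately show "(\<lambda>R. (R div c, R mod c)) ((\<lambda>(w, d). w * c + d) wd) = wd"
      "(\<lambda>(w, d). w * c + d) wd \<in> below b"
      using wd by simp_all
  qed auto
  finally show ?thesis by simp
qed

lemma sum_monics_residues:
  fixes F :: "'a::finite_field poly \<Rightarrow> complex"
  assumes "c \<in> monics l" "l \<le> b" "\<And>w d. F (w * c + d) = F d"
  shows "(\<Sum>R\<in>monics b. F R) = of_nat (CARD('a) ^ (b - l)) * (\<Sum>d\<in>below l. F d)"
  unfolding sum_monics_division[OF assms(1,2)] assms(3) by (simp add: card_monics)

lemma sum_below_residues:
  fixes F :: "'a::finite_field poly \<Rightarrow> complex"
  assumes "c \<in> monics l" "l \<le> b" "\<And>w d. F (w * c + d) = F d"
  shows "(\<Sum>R\<in>below b. F R) = of_nat (CARD('a) ^ (b - l)) * (\<Sum>d\<in>below l. F d)"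
  unfolding sum_below_division[OF assms(1,2)] assms(3) by (simp add: card_below)

section \<open>Coprime polynomials and unimodular matrices\<close>

text \<open>
  Euclid's algorithm, stated with a linear combination that divides both polynomials instead of a
  normalised greatest common divisor.
\<close>

lemma poly_bezout: "\<exists>s t. (p * s + r * t) dvd p \<and> (p * s + r * t) dvd (r :: 'a::field poly)"
proof (induction "if r = 0 then 0 else Suc (degree r)" arbitrary: p r rule: less_induct)
  case less
  show ?case
  proof (cases "r = 0")
    case True
    then show ?thesis by (intro exI[of _ 1] exI[of _ 0]) simp
  next
    case False
    have "(if p mod r = 0 then 0 else Suc (degree (p mod r))) < (if r = 0 then 0 else Suc (degree r))"
      using False degree_mod_less[of r p] by auto
    from less.hyps[OF this] obtain s t where st: "(r * s + (p mod r) * t) dvd r" "(r * s + (p mod r) * t) dvd p mod r"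
      by blast
    let ?g = "r * s + (p mod r) * t"
    have "p mod r = p - r * (p div r)" by (simp add: minus_mult_div_eq_mod)
    then have eq: "?g = p * t + r * (s - (p div r) * t)" by (simp only:) (simp add: algebra_simps)
    have "?g dvd r * (p div r) + p mod r" by (intro dvd_add dvd_mult2 st)
    then have "?g dvd p" by simp
    with st(1) show ?thesis unfolding eq by blast
  qed
qed

lemma coprime_bezout:
  fixes p r :: "'a::field poly"
  assumes "coprime p r"
  obtains s t where "p * s + r * t = 1"
proof -
  obtain s t where st: "(p * s + r * t) dvd p" "(p * s + r * t) dvd r" using poly_bezout by blast
  then have "p * s + r * t dvd 1" using assms coprime_common_divisor by blast
  then obtain u where "1 = (p * s + r * t) * u" by blast
  then have "p * (s * u) + r * (t * u) = 1" by (simp add: algebra_simps)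
  then show thesis using that by blast
qed

lemma coprimeI_monic_irreducible:
  fixes p r :: "'a::field poly"
  assumes "p \<noteq> 0" "\<And>Q. monic_irreducible Q \<Longrightarrow> Q dvd p \<Longrightarrow> Q dvd r \<Longrightarrow> False"
  shows "coprime p r"
proof (rule coprimeI)
  fix d assume d: "d dvd p" "d dvd r"
  have d0: "d \<noteq> 0" using d assms(1) by auto
  show "is_unit d"
  proof (cases "degree d = 0")
    case False
    then obtain Q where "monic_irreducible Q" "Q dvd d" using ex_irreducible_factor by blast
    then show ?thesis using assms(2) d dvd_trans by blast
  qed (use d0 in \<open>simp add: is_unit_iff_degree\<close>)
qed

lemma coprime_monic_irreducible_iff:
  "monic_irreducible (P :: 'a::field poly) \<Longrightarrow> coprime P f \<longleftrightarrow> \<not> P dvd f"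
proof
  assume P: "monic_irreducible P" and "\<not> P dvd f"
  then show "coprime P f"
    using monic_irreducible_dvd_eq[of _ P] by (intro coprimeI_monic_irreducible) (auto simp: monic_irreducible_def)
next
  assume P: "monic_irreducible P" and c: "coprime P f"
  show "\<not> P dvd f"
  proof
    assume "P dvd f"
    then have "is_unit P" using c coprime_common_divisor[of P f P] by simp
    then show False using P by (simp add: monic_irreducible_def irreducible_not_unit)
  qed
qed

lemma ex_mod_inverse:
  fixes c f :: "'a::field poly"
  assumes "coprime c f"
  obtains g where "c dvd f * g - 1"
proof -
  obtain s t where "c * s + f * t = 1" using coprime_bezout[OF assms] by blast
  then have "f * t - 1 = c * (- s)" by (simp add: algebra_simps eq_diff_eq)
  then have "c dvd f * t - 1" by (metis dvd_triv_left)
  then show thesis using that by blast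
qed

lemma coprime_dvd_mult_poly:
  fixes c f g :: "'a::field poly"
  assumes "coprime c f" "c dvd f * g"
  shows "c dvd g"
proof -
  obtain s t where st: "c * s + f * t = 1" using coprime_bezout[OF assms(1)] by blast
  have "g = (c * s + f * t) * g" using st by simp
  also have "\<dots> = c * (s * g) + (f * g) * t" by (simp add: algebra_simps)
  finally show ?thesis using assms(2) by (metis dvd_add dvd_mult2 dvd_triv_left)
qed

text \<open>
  The second row of a matrix of determinant \<open>1\<close> with first row \<open>(p, q)\<close>; reducing it modulo the first
  row gives the bound on \<open>ps\<close>.
\<close>

lemma ex_complement:
  fixes p q :: "'a::finite_field poly"
  assumes "p \<in> monics k" "coprime p q"
  obtains ps qs where "ps \<in> below k" "p * qs - q * ps = 1"
proof -
  obtain s t where st: "p * s + q * t = 1" using coprime_bezout[OF assms(2)] by blast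
  have p0: "p \<noteq> 0" and dp: "degree p = k" using assms monics_nonzero[of p k] by (auto simp: monics_iff)
  let ?ps = "(- t) mod p"
  have "p * (s + q * ((t + ?ps) div p)) - q * ?ps = 1"
  proof -
    have "p dvd ?ps - (- t)" by (simp add: mod_eq_dvd_iff[symmetric])
    then have "p * ((t + ?ps) div p) = t + ?ps" by (simp add: add.commute)
    moreover have "p * (s + q * ((t + ?ps) div p)) - q * ?ps = p * s + q * (p * ((t + ?ps) div p)) - q * ?ps"
      by (simp only: algebra_simps)
    ultimately have "p * (s + q * ((t + ?ps) div p)) - q * ?ps = p * s + q * (t + ?ps) - q * ?ps" by (simp only:)
    also have "\<dots> = p * s + q * t" by (simp add: algebra_simps)
    finally show ?thesis using st by simp
  qed
  then show thesis using that mod_in_below[OF p0, of "- t"] dp by blast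
qed

section \<open>The additive character of a fraction\<close>

text \<open>
  For monic \<open>c\<close> the coefficient of \<open>1/T\<close> in \<open>f / c\<close> is the coefficient of \<open>T ^ (deg c - 1)\<close> in
  \<open>f mod c\<close>. This form keeps all manipulations of fractions inside the polynomial ring.
\<close>

definition echar :: "'a::finite_field poly \<Rightarrow> 'a poly \<Rightarrow> complex" where
  "echar f c = add_char (coeff (f mod c) (degree c - 1))"

lemma norm_echar [simp]: "norm (echar f c) = 1"
  by (simp add: echar_def)

lemma echar_0 [simp]: "echar 0 c = 1"
  by (simp add: echar_def)

lemma echar_add: "echar (f + g) c = echar f c * echar g c"
  by (simp add: echar_def poly_mod_add_left add_char_add)

lemma echar_minus: "echar (- f) c = cnj (echar f c)"
  by (simp add: echar_def poly_mod_minus_left add_char_minus)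

lemma echar_diff: "echar (f - g) c = echar f c * cnj (echar g c)"
  using echar_add[of f "- g" c] by (simp add: echar_minus)

lemma echar_cong: "c dvd f - g \<Longrightarrow> echar f c = echar g c"
  by (simp add: echar_def mod_eq_dvd_iff[symmetric])

lemma echar_small:
  assumes "f \<in> below (degree c - 1)"
  shows "echar f c = 1"
proof -
  have "f mod c = f" using assms by (intro mod_below below_mono[OF assms]) simp
  then show ?thesis using assms by (simp add: echar_def below_def)
qed

lemma echar_below: "f \<in> below (degree c) \<Longrightarrow> echar f c = add_char (coeff f (degree c - 1))"
  by (simp add: echar_def mod_below)

lemma coeff_mult_monic:
  assumes "r \<in> below n" "g \<in> monics m"
  shows "coeff (r * g) (n + m - 1) = coeff r (n - 1)"
proof (cases "n = 0 \<or> r = 0")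
  case True
  then show ?thesis using assms by auto
next
  case False
  then have dr: "degree r \<le> n - 1" and n: "n \<ge> 1" using assms by (auto simp: below_iff)
  have dg: "degree g = m" "coeff g m = 1" using assms by (auto simp: monics_iff)
  show ?thesis
  proof (cases "degree r = n - 1")
    case True
    then have "n + m - 1 = degree r + degree g" using n dg by simp
    then have "coeff (r * g) (n + m - 1) = lead_coeff r * lead_coeff g" by (simp only: coeff_mult_degree_sum)
    then show ?thesis using True dg by simp
  next
    case False
    then have "degree r < n - 1" using dr by simp
    moreover from this have "degree (r * g) < n + m - 1" using degree_mult_le[of r g] dg by linarith
    ultimately show ?thesis by (simp add: coeff_eq_0)
  qed
qed

lemma echar_cancel:
  assumes "c \<noteq> 0" "lead_coeff g = 1"
  shows "echar (f * g) (c * g) = echar f c"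
proof -
  have g: "g \<in> monics (degree g)" "g \<noteq> 0" using assms by (auto simp: monics_iff)
  have 1: "(f * g) mod (c * g) = (f mod c) * g" by (metis mod_mult_mult2)
  have 2: "degree (c * g) - 1 = degree c + degree g - 1" using assms g by (simp add: degree_mult_eq)
  show ?thesis
    unfolding echar_def 1 2 coeff_mult_monic[OF mod_in_below[OF assms(1)] g(1), of f] ..
qed

lemma echar_common_denominator:
  assumes "lead_coeff b = 1" "lead_coeff c = 1"
  shows "echar f b * echar g c = echar (f * c + g * b) (b * c)"
proof -
  have nz: "b \<noteq> 0" "c \<noteq> 0" using assms by auto
  have "echar (f * c) (b * c) = echar f b" by (rule echar_cancel[OF nz(1) assms(2)])
  moreover have "echar (g * b) (b * c) = echar g c"
    using echar_cancel[OF nz(2) assms(1), of g] by (simp add: mult.commute)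
  ultimately show ?thesis by (simp add: echar_add)
qed

text \<open>
  Orthogonality for a range of multipliers that is too short to detect \<open>z = 0\<close>: it detects that the
  top \<open>N\<close> coefficients of \<open>z\<close> vanish.
\<close>

lemma sum_echar:
  fixes z c :: "'a::finite_field poly"
  assumes c: "lead_coeff c = 1" and z: "z \<in> below (degree c)" and N: "N \<le> degree c"
  shows "(\<Sum>v\<in>below N. echar (v * z) c) = (if z \<in> below (degree c - N) then of_nat (CARD('a) ^ N) else 0)"
proof (cases "z \<in> below (degree c - N)")
  case True
  have "echar (v * z) c = 1" if v: "v \<in> below N" for v
  proof (cases "z = 0 \<or> v = 0")
    case False
    then have "degree (v * z) < degree c - 1"
      using v True degree_mult_le[of v z] by (auto simp: below_iff)
    then show ?thesis by (intro echar_small) (simp add: below_iff)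
  qed auto
  then show ?thesis using True by (simp add: card_below)
next
  case False
  then have z0: "z \<noteq> 0" and dz: "degree c - N \<le> degree z" "degree z < degree c" using z by (auto simp: below_iff)
  define k where "k = degree c - 1 - degree z"
  have k: "k < N" "k + degree z = degree c - 1" using dz N unfolding k_def by linarith+
  have val: "echar (monom a k * z) c = add_char (lead_coeff z * a)" for a
  proof -
    have "monom a k * z \<in> below (degree c)"
      using k dz degree_mult_le[of "monom a k" z] degree_monom_le[of a k] by (auto simp: below_iff)
    moreover have "coeff (monom a k * z) (degree c - 1) = a * lead_coeff z"
      unfolding k(2)[symmetric] by (simp add: coeff_monom_mult)
    ultimately show ?thesis by (simp add: echar_below mult.commute)
  qed
  have "(\<Sum>v\<in>below N. echar (v * z) c) = (\<Sum>v\<in>below N. echar (v * z) c) * add_char (lead_coeff z * a)" for a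
  proof -
    have "(\<Sum>v\<in>below N. echar (v * z) c) = (\<Sum>v\<in>below N. echar ((v + monom a k) * z) c)"
      using k by (intro sum_below_translate[symmetric]) (auto simp: below_iff intro: le_less_trans[OF degree_monom_le])
    also have "\<dots> = (\<Sum>v\<in>below N. echar (v * z) c) * add_char (lead_coeff z * a)"
      by (simp only: distrib_right echar_add val sum_distrib_right)
    finally show ?thesis .
  qed
  then have "(\<Sum>a\<in>(UNIV::'a set). \<Sum>v\<in>below N. echar (v * z) c) = (\<Sum>v\<in>below N. echar (v * z) c) * (\<Sum>a\<in>UNIV. add_char (lead_coeff z * a))"
    unfolding sum_distrib_left by (intro sum.cong refl) blast
  also have "\<dots> = 0" using z0 by (simp add: sum_add_char_mult)
  finally show ?thesis using False by simp
qed

section \<open>Kubota's cocycle and the splitting of coprime pairs\<close>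

context cubic_symbols
begin

lemma chi_recip: "c \<in> monics a \<Longrightarrow> d \<in> monics b \<Longrightarrow> \<chi> c d = \<chi> d c"
  by (rule cubic_reciprocity) (auto simp: monicsD)

lemma chi_eq_0_iff_coprime:
  assumes "c \<noteq> 0"
  shows "\<chi> c f = 0 \<longleftrightarrow> \<not> coprime c f"
proof
  assume "\<chi> c f = 0"
  then obtain Q where Q: "monic_irreducible Q" "Q dvd c" "Q dvd f" using chi_eq_0[OF assms] by blast
  then have "\<not> is_unit Q" by (simp add: monic_irreducible_def irreducible_not_unit)
  then show "\<not> coprime c f" using Q coprime_common_divisor by blast
next
  assume "\<not> coprime c f"
  then show "\<chi> c f = 0" using coprimeI_monic_irreducible[OF assms, of f] chi_eq_0[OF assms] by blast
qed

lemma chi_zero: "degree c > 0 \<Longrightarrow> \<chi> c 0 = 0"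
  using ex_irreducible_factor[of c] chi_eq_0[of c 0] by (cases "c = 0") auto

lemma chi_smult:
  assumes "c \<in> monics k" "a \<noteq> 0"
  shows "\<chi> c (smult a f) = chi0 a ^ k * \<chi> c f"
proof -
  have "smult a f = [:a:] * f" by simp
  then show ?thesis using chi_const[OF monicsD(3)[OF assms(1)] assms(2)] monicsD(1)[OF assms(1)]
    by (simp only: chi_mult)
qed

lemma chi_minus: "c \<in> monics k \<Longrightarrow> \<chi> c (- f) = \<chi> c f"
  using chi_smult[of c k "- 1" f] chi0_minus[of 1] by simp

lemma chi_translate [simp]: "\<chi> c (w * c + d) = \<chi> c d"
  by (rule chi_cong) simp

lemma chi_translate' [simp]: "\<chi> c (c * w + d) = \<chi> c d"
  by (rule chi_cong) simp

text \<open>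
  The symbol of a product of two unimodular matrices is the product of the symbols, as long as the
  relevant leading terms do not cancel: this is Kubota's cocycle relation, whose factor at infinity is
  trivial here because \<open>p\<close> and \<open>R\<close> are monic. The induction follows the continued fraction of \<open>q / p\<close>:
  the complement of the pair, made monic, is its preceding convergent. Reciprocity alone would give the
  relation if \<open>p\<close> and \<open>r\<close> were coprime, which they need not be.
\<close>

lemma chi_cocycle:
  assumes "p \<in> monics k" "ps \<in> below k" "p * qs - q * ps = 1" "R \<in> monics b" "r \<in> below (Suc b)"
  shows "\<chi> (R * p + r * ps) (R * q + r * qs) = \<chi> p q * \<chi> R r"
  using assms
proof (induction k arbitrary: p ps q qs R r b rule: less_induct)
  case (less k)
  show ?case
  proof (cases "k = 0")
    case True
    then have "p = 1" "ps = 0" using less.prems by simp_all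
    then show ?thesis using less.prems by simp
  next
    case False
    have ps0: "ps \<noteq> 0"
    proof
      assume "ps = 0"
      then have "p * qs = 1" using less.prems(3) by simp
      then have "is_unit p" by (metis dvd_triv_left)
      then show False using False monicsD(1)[OF less.prems(1)] monics_nonzero[OF less.prems(1)]
        by (simp add: is_unit_iff_degree)
    qed
    define l where "l = lead_coeff ps"
    define k0 where "k0 = degree ps"
    have l: "l \<noteq> 0" and k0: "k0 < k" using ps0 less.prems(2) by (auto simp: l_def k0_def below_iff)
    define p0 where "p0 = smult (inverse l) ps"
    define q0 where "q0 = smult (inverse l) qs"
    have ps: "ps = smult l p0" and qs: "qs = smult l q0" using l by (simp_all add: p0_def q0_def)
    have p0: "p0 \<in> monics k0" using l ps0 by (simp add: p0_def monics_iff k0_def l_def)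
    have det: "p0 * q - q0 * p = [:- inverse l:]"
    proof -
      have "smult l (p0 * q - q0 * p) = - 1"
        using less.prems(3) unfolding ps qs by (simp add: algebra_simps smult_diff_right)
      then have "smult (inverse l) (smult l (p0 * q - q0 * p)) = smult (inverse l) (- 1)" by simp
      then show ?thesis using l by (simp add: one_pCons)
    qed
    have "coprime p0 q0"
    proof (rule coprimeI)
      fix d assume "d dvd p0" "d dvd q0"
      then have "d dvd p * qs - q * ps" unfolding ps qs by (intro dvd_diff dvd_mult dvd_smult)
      then show "is_unit d" using less.prems(3) by simp
    qed
    then obtain p0s q0s where c0: "p0s \<in> below k0" "p0 * q0s - q0 * p0s = 1"
      using ex_complement[OF p0] by blast
    define R0 where "R0 = p * q0s - q * p0s"
    define r0 where "r0 = [:- inverse l:]"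
    have e1: "R0 * p0 + r0 * p0s = p"
    proof -
      have "R0 * p0 + r0 * p0s = p * (p0 * q0s - q0 * p0s)"
        unfolding R0_def r0_def det[symmetric] by (simp add: algebra_simps)
      then show ?thesis using c0 by simp
    qed
    have e2: "R0 * q0 + r0 * q0s = q"
    proof -
      have "R0 * q0 + r0 * q0s = q * (p0 * q0s - q0 * p0s)"
        unfolding R0_def r0_def det[symmetric] by (simp add: algebra_simps)
      then show ?thesis using c0 by simp
    qed
    have R0: "R0 \<in> monics (k - k0)"
    proof -
      have "r0 * p0s \<in> below k0" unfolding r0_def using c0(1) by (simp add: below_smult below_uminus)
      then have "p - r0 * p0s \<in> monics k"
        using monics_add_below[OF less.prems(1) below_uminus[OF below_mono[of "r0 * p0s" k0 k]]] k0 by simp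
      moreover have "p0 * R0 = p - r0 * p0s" using e1 by (simp add: algebra_simps eq_diff_eq)
      ultimately show ?thesis using monics_mult_cancel[OF p0, of R0 "k - k0"] k0 by simp
    qed
    have IH1: "\<chi> p q = \<chi> p0 q0 * \<chi> R0 r0"
      using less.IH[OF k0 p0 c0 R0, of r0] unfolding e1 e2 by (simp add: r0_def below_iff)
    have r0: "\<chi> R0 r0 = chi0 (inverse l) ^ (k - k0)"
      unfolding r0_def using chi_const[OF monicsD(3)[OF R0], of "- inverse l"] monicsD(1)[OF R0] l
      by (simp add: chi0_minus)
    define c where "c = R * p + r * ps"
    define d where "d = R * q + r * qs"
    define R1 where "R1 = R * R0 + smult l r"
    define r1 where "r1 = smult (- inverse l) R"
    have f1: "R1 * p0 + r1 * p0s = c"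
    proof -
      have "R1 * p0 + r1 * p0s = R * (R0 * p0 + r0 * p0s) + smult l r * p0"
        unfolding R1_def r1_def r0_def by (simp add: algebra_simps)
      then show ?thesis unfolding e1 c_def ps by (simp add: mult.commute)
    qed
    have f2: "R1 * q0 + r1 * q0s = d"
    proof -
      have "R1 * q0 + r1 * q0s = R * (R0 * q0 + r0 * q0s) + smult l r * q0"
        unfolding R1_def r1_def r0_def by (simp add: algebra_simps)
      then show ?thesis unfolding e2 d_def qs by (simp add: mult.commute)
    qed
    have R1: "R1 \<in> monics (b + (k - k0))"
      unfolding R1_def using k0 less.prems(5)
      by (intro monics_add_below monics_mult less.prems(4) R0 below_smult) (auto intro: below_mono)
    have r1: "r1 \<in> below (Suc (b + (k - k0)))"
      unfolding r1_def using monicsD(1)[OF less.prems(4)] by (intro below_smult) (simp add: below_iff)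
    have "\<chi> c d = \<chi> p0 q0 * \<chi> R1 r1"
      using less.IH[OF k0 p0 c0 R1 r1] unfolding f1 f2 .
    also have "\<chi> R1 r1 = chi0 (inverse l) ^ (b + (k - k0)) * \<chi> R R1"
      unfolding r1_def using chi_smult[OF R1, of "- inverse l" R] l chi_recip[OF R1 less.prems(4)]
      by (simp add: chi0_minus)
    also have "\<chi> R R1 = chi0 l ^ b * \<chi> R r"
      unfolding R1_def by (simp add: chi_smult[OF less.prems(4) l])
    finally have "\<chi> c d = \<chi> p0 q0 * chi0 (inverse l) ^ (k - k0) * (chi0 (inverse l) * chi0 l) ^ b * \<chi> R r"
      by (simp add: power_add power_mult_distrib mult_ac)
    also have "chi0 (inverse l) * chi0 l = 1" using l by (simp add: chi0_mult[symmetric])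
    finally show ?thesis unfolding c_def d_def IH1 r0 by simp
  qed
qed

text \<open>A choice of the second row of a unimodular matrix with given first row.\<close>

definition complement :: "'a poly \<Rightarrow> 'a poly \<Rightarrow> 'a poly \<times> 'a poly" where
  "complement p q = (SOME m. fst m \<in> below (degree p) \<and> p * snd m - q * fst m = 1)"

lemma complement:
  assumes "p \<in> monics k" "coprime p q"
  shows "fst (complement p q) \<in> below k" "p * snd (complement p q) - q * fst (complement p q) = 1"
proof -
  obtain ps qs where "ps \<in> below k" "p * qs - q * ps = 1" using ex_complement[OF assms] by blast
  then have "\<exists>m. fst m \<in> below (degree p) \<and> p * snd m - q * fst m = 1"
    using monicsD(1)[OF assms(1)] by (intro exI[of _ "(ps, qs)"]) simp
  from someI_ex[OF this] show "fst (complement p q) \<in> below k" "p * snd (complement p q) - q * fst (complement p q) = 1"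
    using monicsD(1)[OF assms(1)] by (auto simp: complement_def)
qed

text \<open>Dirichlet's approximation theorem for \<open>d / c\<close>, by the pigeonhole principle.\<close>

lemma dirichlet_approximation:
  fixes c d :: "'a poly"
  assumes c: "c \<in> monics J" and h: "1 \<le> h" "h \<le> J"
  shows "\<exists>p q. p \<noteq> 0 \<and> degree p < h \<and> p * d - q * c \<in> below (J - h + 1)"
proof -
  have c0: "c \<noteq> 0" and dc: "degree c = J" using c monics_nonzero by (auto simp: monicsD)
  \<comment> \<open>Map \<open>p\<close> to the \<open>h - 1\<close> coefficients of \<open>p d mod c\<close> that have to vanish.\<close>
  define f where "f = (\<lambda>p :: 'a poly. Poly (map (\<lambda>i. coeff ((p * d) mod c) (J - h + 1 + i)) [0..<h - 1]))"
  have cf: "coeff (f p) i = (if i < h - 1 then coeff ((p * d) mod c) (J - h + 1 + i) else 0)" for p i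
    by (simp add: f_def coeff_Poly_eq nth_default_def)
  have "f ` below h \<subseteq> below (h - 1)" by (auto simp: below_def cf)
  then have "card (f ` below h) \<le> CARD('a) ^ (h - 1)"
    using card_mono[OF finite_below, of "f ` below h" "h - 1"] by (simp add: card_below)
  also have "\<dots> < CARD('a) ^ h" using q_ge_2 h by (intro power_strict_increasing) auto
  finally have "\<not> inj_on f (below h)" using card_image[of f "below h"] card_below[of h, where ?'a = 'a] by linarith
  then obtain u v where uv: "u \<in> below h" "v \<in> below h" "f u = f v" "u \<noteq> v" by (auto simp: inj_on_def)
  define p where "p = u - v"
  have "p \<in> below h" "p \<noteq> 0" using uv by (auto simp: p_def below_diff)
  moreover have "(p * d) mod c \<in> below (J - h + 1)"
  proof -
    have m: "(p * d) mod c = (u * d) mod c - (v * d) mod c" by (simp add: p_def left_diff_distrib poly_mod_diff_left)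
    have "coeff ((p * d) mod c) i = 0" if i: "i \<ge> J - h + 1" for i
    proof (cases "i \<ge> J")
      case True
      then show ?thesis using mod_in_below[OF c0, of "p * d"] dc by (simp add: below_def)
    next
      case False
      define t where "t = i - (J - h + 1)"
      have t: "t < h - 1" "J - h + 1 + t = i" using i False h by (auto simp: t_def)
      have "coeff (f u) t = coeff (f v) t" using uv(3) by simp
      then show ?thesis unfolding m cf using t by simp
    qed
    then show ?thesis by (simp add: below_def)
  qed
  moreover have "(p * d) mod c = p * d - (p * d div c) * c" by (simp add: minus_div_mult_eq_mod)
  ultimately show ?thesis using h by (intro exI[of _ p] exI[of _ "p * d div c"]) (auto simp: below_iff)
qed

text \<open>
  Every fraction \<open>d / c\<close> in lowest terms has exactly one reduced approximation \<open>q / p\<close> with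
  \<open>deg p < h\<close> and an error \<open>r / (p c)\<close> with \<open>deg r \<le> J - h\<close>. Completing \<open>(p, q)\<close> to a unimodular
  matrix, the pair \<open>(c, d)\<close> becomes the combination of the rows with coefficients \<open>(R, r)\<close>.
\<close>

lemma bij_betw_cut:
  assumes h: "1 \<le> h" "h \<le> J"
  defines "\<Phi> \<equiv> (\<lambda>((p, q), (R, r)). (R * p + r * fst (complement p q), R * q + r * snd (complement p q)))"
  shows "bij_betw \<Phi>
    (SIGMA (p, q) : (\<Union>k<h. SIGMA p : monics k. {q \<in> below k. coprime p q}).
       SIGMA R : monics (J - degree p). {r \<in> below (J - h + 1). coprime R r})
    (SIGMA c : monics J. {d \<in> below J. coprime c d})"
    (is "bij_betw _ ?T ?S")
proof -
  have D: "\<exists>k ps qs. k < h \<and> p \<in> monics k \<and> q \<in> below k \<and> coprime p q \<and> R \<in> monics (J - k) \<and> r \<in> below (J - h + 1) \<and>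
      coprime R r \<and> ps = fst (complement p q) \<and> qs = snd (complement p q) \<and> ps \<in> below k \<and> p * qs - q * ps = 1"
    if "((p, q), (R, r)) \<in> ?T" for p q R r
    using that complement[of p _ q] by (fastforce simp: monicsD)
  have inverse: "p * (R * q + r * qs) - q * (R * p + r * ps) = r" "(R * p + r * ps) * qs - (R * q + r * qs) * ps = R"
    if det: "p * qs - q * ps = 1" for p q ps qs R r :: "'a poly"
  proof -
    have "p * (R * q + r * qs) - q * (R * p + r * ps) = r * (p * qs - q * ps)" by (simp add: algebra_simps)
    then show "p * (R * q + r * qs) - q * (R * p + r * ps) = r" using det by simp
    have "(R * p + r * ps) * qs - (R * q + r * qs) * ps = R * (p * qs - q * ps)" by (simp add: algebra_simps)
    then show "(R * p + r * ps) * qs - (R * q + r * qs) * ps = R" using det by simp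
  qed
  have maps: "\<Phi> x \<in> ?S" if x: "x \<in> ?T" for x
  proof -
    obtain p q R r where xe: "x = ((p, q), (R, r))" by (metis surj_pair)
    obtain k ps qs where k: "k < h" "p \<in> monics k" "q \<in> below k" "coprime p q" "R \<in> monics (J - k)" "r \<in> below (J - h + 1)"
      "coprime R r" and ps: "ps = fst (complement p q)" "qs = snd (complement p q)" "ps \<in> below k" "p * qs - q * ps = 1"
      using D[of p q R r] x xe by blast
    define c where "c = R * p + r * ps"
    define d where "d = R * q + r * qs"
    have dr: "degree r \<le> J - h" using k(6) h by (auto simp: below_iff)
    have "r * ps \<in> below J"
    proof (rule below_mono)
      show "r * ps \<in> below (k + (J - h))" using below_mult[OF ps(3) dr] by (simp add: mult.commute)
    qed (use k h in linarith)
    then have c: "c \<in> monics J"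
      unfolding c_def using monics_mult[OF k(5) k(2)] k(1) h by (intro monics_add_below) simp_all
    have r: "p * d - q * c = r" unfolding c_def d_def using inverse(1)[OF ps(4)] .
    have R: "c * qs - d * ps = R" unfolding c_def d_def using inverse(2)[OF ps(4)] .
    have "d \<in> below J"
    proof -
      have "p * d = r + q * c" using r by (simp add: algebra_simps)
      moreover have "q * c \<in> below (k + J)" using below_mult[OF k(3), of c J] monicsD(1)[OF c] by simp
      moreover have "r \<in> below (k + J)" using k(6) h by (intro below_mono[OF k(6)]) linarith
      ultimately have "p * d \<in> below (k + J)" by (simp add: below_add)
      then show ?thesis using monicsD(1)[OF k(2)] monics_nonzero[OF k(2)]
        by (cases "d = 0") (auto simp: below_iff degree_mult_eq)
    qed
    moreover have "coprime c d"
    proof (rule coprimeI)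
      fix g assume "g dvd c" "g dvd d"
      then have "g dvd R" "g dvd r" unfolding r[symmetric] R[symmetric] by (auto intro: dvd_diff dvd_mult dvd_mult2)
      then show "is_unit g" using k(7) coprime_common_divisor by blast
    qed
    ultimately show ?thesis using c unfolding xe \<Phi>_def c_def d_def ps(1,2) by simp
  qed
  moreover have "inj_on \<Phi> ?T"
  proof (rule inj_onI)
    fix x y assume x: "x \<in> ?T" and y: "y \<in> ?T" and eq: "\<Phi> x = \<Phi> y"
    obtain p q R r where xe: "x = ((p, q), (R, r))" by (metis surj_pair)
    obtain p' q' R' r' where ye: "y = ((p', q'), (R', r'))" by (metis surj_pair)
    obtain k ps qs where k: "k < h" "p \<in> monics k" "q \<in> below k" "coprime p q" "R \<in> monics (J - k)" "r \<in> below (J - h + 1)"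
      and ps: "ps = fst (complement p q)" "qs = snd (complement p q)" "p * qs - q * ps = 1"
      using D[of p q R r] x xe by blast
    obtain k' ps' qs' where k': "k' < h" "p' \<in> monics k'" "q' \<in> below k'" "coprime p' q'" "R' \<in> monics (J - k')" "r' \<in> below (J - h + 1)"
      and ps': "ps' = fst (complement p' q')" "qs' = snd (complement p' q')" "p' * qs' - q' * ps' = 1"
      using D[of p' q' R' r'] y ye by blast
    obtain c d where cd: "\<Phi> x = (c, d)" by (metis surj_pair)
    have c: "c = R * p + r * ps" "d = R * q + r * qs" using cd unfolding xe \<Phi>_def ps(1,2) by simp_all
    have "\<Phi> y = (c, d)" using cd eq by simp
    then have c': "c = R' * p' + r' * ps'" "d = R' * q' + r' * qs'" unfolding ye \<Phi>_def ps'(1,2) by simp_all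
    have r: "p * d - q * c = r" unfolding c using inverse(1)[OF ps(3)] .
    have r': "p' * d - q' * c = r'" unfolding c' using inverse(1)[OF ps'(3)] .
    have cm: "c \<in> monics J" using maps[OF x] cd by simp
    have "c * (p * q' - p' * q) = p' * r - p * r'" unfolding r[symmetric] r'[symmetric] by (simp add: algebra_simps)
    moreover have "p' * r - p * r' \<in> below J"
    proof (rule below_mono)
      show "p' * r - p * r' \<in> below (J - h + 1 + (h - 1))"
        using below_mult[OF k(6), of p' "h - 1"] below_mult[OF k'(6), of p "h - 1"] k(1) k'(1)
          monicsD(1)[OF k(2)] monicsD(1)[OF k'(2)] by (intro below_diff) (simp_all add: mult.commute)
    qed (use h in linarith)
    ultimately have "c * (p * q' - p' * q) \<in> below J" by simp
    then have "p * q' - p' * q = 0"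
      using cm monicsD(1)[OF cm] monics_nonzero[OF cm] by (cases "p * q' - p' * q = 0") (auto simp: below_iff degree_mult_eq)
    then have pq: "p * q' = p' * q" by simp
    have "p dvd p'"
      using coprime_dvd_mult_poly[OF k(4), of p'] pq by (metis dvd_triv_left mult.commute)
    moreover have "p' dvd p"
      using coprime_dvd_mult_poly[OF k'(4), of p] pq by (metis dvd_triv_left mult.commute)
    ultimately have dd: "degree p = degree p'"
      using monics_nonzero[OF k(2)] monics_nonzero[OF k'(2)] by (simp add: dvd_imp_degree_le le_antisym)
    then have "k = k'" using monicsD(1)[OF k(2)] monicsD(1)[OF k'(2)] by simp
    obtain e where e: "p' = p * e" using \<open>p dvd p'\<close> by blast
    then have "e \<in> monics 0" using monics_mult_cancel[OF k(2), of e 0] k'(2) \<open>k = k'\<close> by simp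
    then have "p = p'" using e by simp
    then have "q = q'" using pq monics_nonzero[OF k(2)] by simp
    have "r = r'" using r r' \<open>p = p'\<close> \<open>q = q'\<close> by simp
    moreover have "ps = ps'" using ps ps' \<open>p = p'\<close> \<open>q = q'\<close> by simp
    ultimately have "R * p = R' * p" using c(1) c'(1) \<open>p = p'\<close> by (metis add_right_cancel)
    then have "R = R'" using monics_nonzero[OF k(2)] by simp
    then show "x = y" using xe ye \<open>p = p'\<close> \<open>q = q'\<close> \<open>r = r'\<close> by simp
  qed
  moreover have "?S \<subseteq> \<Phi> ` ?T"
  proof
    fix x assume "x \<in> ?S"
    then obtain c d where x: "x = (c, d)" and c: "c \<in> monics J" and d: "d \<in> below J" and cop: "coprime c d" by auto
    \<comment> \<open>An approximation with \<open>deg p\<close> minimal is reduced.\<close>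
    define P where "P = (\<lambda>p :: 'a poly. p \<noteq> 0 \<and> degree p < h \<and> (\<exists>q. p * d - q * c \<in> below (J - h + 1)))"
    have "\<exists>p. P p" using dirichlet_approximation[OF c h, of d] unfolding P_def by blast
    then obtain p' where p': "P p'" and least: "\<And>p''. P p'' \<Longrightarrow> degree p' \<le> degree p''"
      using arg_min_natI[of P _ degree] arg_min_nat_le[of P _ degree] by metis
    obtain q' where q': "p' * d - q' * c \<in> below (J - h + 1)" using p' by (auto simp: P_def)
    define k where "k = degree p'"
    define p where "p = smult (inverse (lead_coeff p')) p'"
    define q where "q = smult (inverse (lead_coeff p')) q'"
    have p0': "p' \<noteq> 0" using p' by (simp add: P_def)
    have p: "p \<in> monics k" using p0' by (simp add: p_def monics_iff k_def)
    have k: "k < h" using p' by (simp add: P_def k_def)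
    define r where "r = p * d - q * c"
    have "r = smult (inverse (lead_coeff p')) (p' * d - q' * c)"
      by (simp add: r_def p_def q_def smult_diff_right)
    then have r: "r \<in> below (J - h + 1)" using q' by (simp add: below_smult)
    have q: "q \<in> below k"
    proof (cases "k = 0")
      case True
      then have "p = 1" using p by simp
      then have "q * c = d - r" by (simp add: r_def)
      then have "q * c \<in> below J" using below_diff[OF d below_mono[OF r, of J]] h by simp
      then have "q = 0" using monicsD(1)[OF c] monics_nonzero[OF c] by (cases "q = 0") (auto simp: below_iff degree_mult_eq)
      then show ?thesis by simp
    next
      case False
      have "q * c = p * d - r" by (simp add: r_def)
      moreover have "d * p \<in> below (J + k)" using below_mult[OF d, of p k] monicsD(1)[OF p] by simp
      ultimately have "q * c \<in> below (J + k)"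
        using below_diff[of "d * p" "J + k" r] below_mono[OF r, of "J + k"] h by (simp add: mult.commute)
      then show ?thesis using monicsD(1)[OF c] monics_nonzero[OF c] by (cases "q = 0") (auto simp: below_iff degree_mult_eq)
    qed
    have pq: "coprime p q"
    proof (rule coprimeI_monic_irreducible)
      show "p \<noteq> 0" using p by (rule monics_nonzero)
      fix Q assume Q: "monic_irreducible Q" "Q dvd p" "Q dvd q"
      then obtain u v where uv: "p = Q * u" "q = Q * v" by blast
      have dQ: "degree Q > 0" and Q0: "Q \<noteq> 0" using Q(1) by (auto simp: monic_irreducible_def irreducible_degree_pos)
      have u0: "u \<noteq> 0" using uv monics_nonzero[OF p] by auto
      have "r = Q * (u * d - v * c)" unfolding r_def uv by (simp add: algebra_simps)
      then have "u * d - v * c \<in> below (J - h + 1)" using r Q0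
        by (cases "u * d - v * c = 0") (auto simp: below_iff degree_mult_eq)
      moreover have du: "degree u < k" using uv(1) monicsD(1)[OF p] Q0 u0 dQ by (simp add: degree_mult_eq)
      ultimately have "P u" using u0 k unfolding P_def by auto
      then show False using least[of u] du by (simp add: k_def)
    qed
    define ps where "ps = fst (complement p q)"
    define qs where "qs = snd (complement p q)"
    have det: "p * qs - q * ps = 1" "ps \<in> below k" unfolding ps_def qs_def using complement[OF p pq] by simp_all
    define R where "R = c * qs - d * ps"
    have e1: "R * p + r * ps = c"
    proof -
      have "R * p + r * ps = c * (p * qs - q * ps)" unfolding R_def r_def by (simp add: algebra_simps)
      then show ?thesis using det by simp
    qed
    have e2: "R * q + r * qs = d"
    proof -
      have "R * q + r * qs = d * (p * qs - q * ps)" unfolding R_def r_def by (simp add: algebra_simps)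
      then show ?thesis using det by simp
    qed
    have "R \<in> monics (J - k)"
    proof -
      have "degree r \<le> J - h" using r h by (auto simp: below_iff)
      then have "ps * r \<in> below (k + (J - h))" using below_mult[OF det(2)] by simp
      then have "r * ps \<in> below J" using k h by (intro below_mono[of _ "k + (J - h)" J]) (simp_all add: mult.commute)
      then have "c - r * ps \<in> monics J" using monics_add_below[OF c below_uminus] by simp
      moreover have "p * R = c - r * ps" using e1 by (simp add: algebra_simps eq_diff_eq)
      ultimately show ?thesis using monics_mult_cancel[OF p, of R "J - k"] k h by simp
    qed
    moreover have "coprime R r"
    proof (rule coprimeI)
      fix g assume "g dvd R" "g dvd r"
      then have "g dvd c" "g dvd d" unfolding e1[symmetric] e2[symmetric] by (auto intro: dvd_add dvd_mult2)
      then show "is_unit g" using cop coprime_common_divisor by blast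
    qed
    ultimately have mem: "((p, q), (R, r)) \<in> ?T" using p q pq k r monicsD(1)[OF p] by auto
    have "x = \<Phi> ((p, q), (R, r))"
      unfolding \<Phi>_def x using e1 e2 by (simp add: ps_def[symmetric] qs_def[symmetric])
    then show "x \<in> \<Phi> ` ?T" using mem by (rule image_eqI)
  qed
  ultimately show ?thesis unfolding bij_betw_def by blast
qed

text \<open>
  The bijection and the cocycle relation combined. Pairs that are not coprime have symbol \<open>0\<close>, so
  coprimality disappears from the ranges of summation.
\<close>

lemma chi_sum_cut:
  assumes h: "1 \<le> h" "h \<le> J"
  shows "(\<Sum>c\<in>monics J. \<Sum>d\<in>below J. \<chi> c d * E c d) =
    (\<Sum>k<h. \<Sum>p\<in>monics k. \<Sum>q\<in>below k. \<chi> p q *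
       (\<Sum>R\<in>monics (J - k). \<Sum>r\<in>below (J - h + 1). \<chi> R r *
          E (R * p + r * fst (complement p q)) (R * q + r * snd (complement p q))))"
proof -
  let ?S = "SIGMA c : (monics J :: 'a poly set). {d \<in> below J. coprime c d}"
  let ?L = "\<Union>k<h. SIGMA p : (monics k :: 'a poly set). {q \<in> below k. coprime p q}"
  let ?B = "\<lambda>p :: 'a poly. SIGMA R : (monics (J - degree p) :: 'a poly set). {r \<in> below (J - h + 1). coprime R r}"
  let ?\<Phi> = "\<lambda>((p, q), (R, r)). (R * p + r * fst (complement p q), R * q + r * snd (complement p q))"
  let ?E = "\<lambda>p q R r. E (R * p + r * fst (complement p q)) (R * q + r * snd (complement p q))"
  have restrict: "(\<Sum>c\<in>monics a. \<Sum>d\<in>below b. \<chi> c d * F c d) = (\<Sum>(c, d)\<in>(SIGMA c : monics a. {d \<in> below b. coprime c d}). \<chi> c d * F c d)"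
    for F :: "'a poly \<Rightarrow> 'a poly \<Rightarrow> complex" and a b
  proof -
    have "(\<Sum>d\<in>below b. \<chi> c d * F c d) = (\<Sum>d | d \<in> below b \<and> coprime c d. \<chi> c d * F c d)" if "c \<in> monics a" for c
      by (rule sum.mono_neutral_right) (auto simp: chi_eq_0_iff_coprime[OF monics_nonzero[OF that]])
    then show ?thesis by (simp add: sum.Sigma)
  qed
  have "(\<Sum>c\<in>monics J. \<Sum>d\<in>below J. \<chi> c d * E c d) = (\<Sum>(c, d)\<in>?S. \<chi> c d * E c d)" by (rule restrict)
  also have "\<dots> = (\<Sum>x\<in>(SIGMA (p, q) : ?L. ?B p). case ?\<Phi> x of (c, d) \<Rightarrow> \<chi> c d * E c d)"
    by (rule sum.reindex_bij_betw[OF bij_betw_cut[OF h], symmetric])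
  also have "\<dots> = (\<Sum>x\<in>(SIGMA (p, q) : ?L. ?B p). case x of ((p, q), (R, r)) \<Rightarrow> \<chi> p q * (\<chi> R r * ?E p q R r))"
  proof (rule sum.cong[OF refl])
    fix x assume x: "x \<in> (SIGMA (p, q) : ?L. ?B p)"
    obtain p q R r where xe: "x = ((p, q), (R, r))" by (metis surj_pair)
    obtain k where k: "k < h" "p \<in> monics k" "coprime p q" "R \<in> monics (J - k)" "r \<in> below (J - h + 1)"
      using x unfolding xe by (auto simp: monicsD)
    have "r \<in> below (Suc (J - k))" using k h by (intro below_mono[OF k(5)]) linarith
    from chi_cocycle[OF k(2) complement(1)[OF k(2,3)] complement(2)[OF k(2,3)] k(4) this]
    show "(case ?\<Phi> x of (c, d) \<Rightarrow> \<chi> c d * E c d) = (case x of ((p, q), (R, r)) \<Rightarrow> \<chi> p q * (\<chi> R r * ?E p q R r))"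
      unfolding xe by (simp add: mult.assoc)
  qed
  also have "\<dots> = (\<Sum>(p, q)\<in>?L. \<Sum>(R, r)\<in>?B p. \<chi> p q * (\<chi> R r * ?E p q R r))"
  proof -
    have "(\<Sum>y\<in>?L. \<Sum>z\<in>?B (fst y). case (y, z) of ((p, q), (R, r)) \<Rightarrow> \<chi> p q * (\<chi> R r * ?E p q R r)) =
      (\<Sum>(y, z)\<in>(SIGMA y : ?L. ?B (fst y)). case (y, z) of ((p, q), (R, r)) \<Rightarrow> \<chi> p q * (\<chi> R r * ?E p q R r))"
      by (rule sum.Sigma) auto
    moreover have "(SIGMA (p, q) : ?L. ?B p) = (SIGMA y : ?L. ?B (fst y))" by (simp add: case_prod_unfold)
    ultimately show ?thesis by (simp add: case_prod_unfold)
  qed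
  also have "\<dots> = (\<Sum>(p, q)\<in>?L. \<chi> p q * (\<Sum>R\<in>monics (J - degree p). \<Sum>r\<in>below (J - h + 1). \<chi> R r * ?E p q R r))"
    by (intro sum.cong refl) (auto simp: restrict sum_distrib_left case_prod_unfold)
  also have "\<dots> = (\<Sum>k<h. \<Sum>(p, q)\<in>(SIGMA p : monics k. {q \<in> below k. coprime p q}).
      \<chi> p q * (\<Sum>R\<in>monics (J - degree p). \<Sum>r\<in>below (J - h + 1). \<chi> R r * ?E p q R r))"
  proof (rule sum.UNION_disjoint)
    show "\<forall>k\<in>{..<h}. finite (SIGMA p : (monics k :: 'a poly set). {q \<in> below k. coprime p q})" by auto
    show "\<forall>i\<in>{..<h}. \<forall>j\<in>{..<h}. i \<noteq> j \<longrightarrow>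
        (SIGMA p : (monics i :: 'a poly set). {q \<in> below i. coprime p q}) \<inter> (SIGMA p : monics j. {q \<in> below j. coprime p q}) = {}"
      by (auto simp: monics_def)
  qed simp
  also have "\<dots> = (\<Sum>k<h. \<Sum>p\<in>monics k. \<Sum>q\<in>below k. \<chi> p q *
       (\<Sum>R\<in>monics (J - degree p). \<Sum>r\<in>below (J - h + 1). \<chi> R r * ?E p q R r))"
    by (intro sum.cong refl restrict[symmetric])
  also have "\<dots> = (\<Sum>k<h. \<Sum>p\<in>monics k. \<Sum>q\<in>below k. \<chi> p q *
       (\<Sum>R\<in>monics (J - k). \<Sum>r\<in>below (J - h + 1). \<chi> R r * ?E p q R r))"
    by (intro sum.cong refl) (simp add: monicsD)
  finally show ?thesis .
qed

section \<open>Gauss sums\<close>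

definition qc :: complex where "qc = of_nat CARD('a)"

lemma of_nat_card [simp]: "of_nat CARD('a) = qc"
  by (simp add: qc_def)

lemma qc_nonzero [simp]: "qc \<noteq> 0"
  using q_ge_2 unfolding qc_def of_nat_eq_0_iff by linarith

lemma qc_neq_1 [simp]: "qc \<noteq> 1"
proof
  assume "qc = 1"
  then have "(of_nat CARD('a) :: complex) = of_nat 1" unfolding qc_def by simp
  then have "CARD('a) = 1" by (simp only: of_nat_eq_iff)
  then show False using q_ge_2 by simp
qed

lemma of_nat_card_units: "of_nat (card (UNIV - {0::'a})) = qc - 1"
  using q_ge_2 by (simp add: card_Diff_singleton of_nat_diff)

definition field_gauss :: "nat \<Rightarrow> 'a \<Rightarrow> complex" where
  "field_gauss b l = (\<Sum>a\<in>UNIV - {0}. chi0 a ^ b * add_char (l * a))"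

lemma monic_irreducible_X: "monic_irreducible ([:0, 1:] :: 'b::field poly)"
proof -
  have "irreducible [:0, 1 :: 'b:]"
  proof (rule irreducibleI)
    show "\<not> is_unit [:0, 1 :: 'b:]" by (simp add: is_unit_iff_degree)
    fix a b :: "'b poly" assume ab: "[:0, 1:] = a * b"
    then have "a \<noteq> 0" "b \<noteq> 0" by auto
    moreover from this have "degree a + degree b = 1" using ab by (metis degree_mult_eq degree_pCons_eq_if degree_1 one_pCons pCons_eq_0_iff zero_neq_one One_nat_def)
    ultimately show "is_unit a \<or> is_unit b" by (auto simp: is_unit_iff_degree)
  qed simp
  then show ?thesis by (simp add: monic_irreducible_def)
qed

text \<open>
  Modulo \<open>T\<close> every residue is a constant, so nontriviality of \<open>\<chi>\<close> modulo \<open>T\<close> is nontriviality of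
  \<open>chi0\<close>.
\<close>

lemma chi0_nontrivial: "\<exists>a. a \<noteq> 0 \<and> chi0 a \<noteq> 1"
proof -
  obtain f where f: "\<chi> [:0, 1:] f \<noteq> 0" "\<chi> [:0, 1:] f \<noteq> 1" using chi_nontrivial[OF monic_irreducible_X] by blast
  have deg1: "[:0, 1 :: 'a:] \<in> monics 1" by (simp add: monics_iff)
  obtain a g where fa: "f = pCons a g" by (cases f)
  have "f = [:0, 1:] * g + [:a:]" by (simp add: fa)
  then have "\<chi> [:0, 1:] f = \<chi> [:0, 1:] [:a:]" by (simp only: chi_translate')
  moreover have "a \<noteq> 0" using calculation f(1) chi_zero[of "[:0, 1 :: 'a:]"] by auto
  moreover from this have "\<chi> [:0, 1:] [:a:] = chi0 a" using chi_const[OF monicsD(3)[OF deg1]] by simp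
  ultimately show ?thesis using f(2) by auto
qed

lemma chi0_power_eq_1: "3 dvd b \<Longrightarrow> a \<noteq> 0 \<Longrightarrow> chi0 a ^ b = 1"
  using chi0_power_mod[of a b 0] by (simp add: mod_eq_0_iff_dvd)

lemma chi0_power_nontrivial: "\<not> 3 dvd b \<Longrightarrow> \<exists>a. a \<noteq> 0 \<and> chi0 a ^ b \<noteq> 1"
proof -
  assume b: "\<not> 3 dvd b"
  obtain a where a: "a \<noteq> 0" "chi0 a \<noteq> 1" using chi0_nontrivial by blast
  have "chi0 a ^ b \<noteq> 1"
  proof
    assume 1: "chi0 a ^ b = 1"
    have "b mod 3 = 1 \<or> b mod 3 = 2" using b by presburger
    then have "b mod 3 = 1 \<or> (2 * b) mod 3 = 1" by presburger
    then have "chi0 a ^ b = chi0 a ^ 1 \<or> chi0 a ^ (2 * b) = chi0 a ^ 1"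
      using chi0_power_mod[OF a(1), of b 1] chi0_power_mod[OF a(1), of "2 * b" 1] by auto
    moreover have "chi0 a ^ (2 * b) = 1" using 1 by (simp add: power_mult mult.commute)
    ultimately show False using 1 a(2) by auto
  qed
  then show ?thesis using a by blast
qed

lemma field_gauss_cong: "b mod 3 = b' mod 3 \<Longrightarrow> field_gauss b l = field_gauss b' l"
  unfolding field_gauss_def using chi0_power_mod by (intro sum.cong refl) (metis DiffE insertI1)

lemma field_gauss_0: "field_gauss b 0 = (if 3 dvd b then qc - 1 else 0)"
proof (cases "3 dvd b")
  case True
  then have "field_gauss b 0 = (\<Sum>a\<in>UNIV - {0::'a}. 1)"
    unfolding field_gauss_def by (intro sum.cong) (auto simp: chi0_power_eq_1)
  then show ?thesis using True by (simp add: of_nat_card_units)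
next
  case False
  then obtain c where c: "c \<noteq> 0" "chi0 c ^ b \<noteq> 1" using chi0_power_nontrivial by blast
  have "field_gauss b 0 = (\<Sum>a\<in>UNIV - {0::'a}. chi0 (c * a) ^ b)"
    unfolding field_gauss_def
    by (rule sum.reindex_bij_witness[of _ "\<lambda>a. c * a" "\<lambda>a. a / c"]) (use c in auto)
  also have "\<dots> = chi0 c ^ b * field_gauss b 0"
    unfolding field_gauss_def by (simp add: chi0_mult power_mult_distrib sum_distrib_left)
  finally have "field_gauss b 0 * (1 - chi0 c ^ b) = 0" by (simp add: algebra_simps)
  then show ?thesis using False c(2) by simp
qed

lemma field_gauss_trivial:
  assumes "3 dvd b" "l \<noteq> 0"
  shows "field_gauss b l = - 1"
proof -
  have "field_gauss b l = (\<Sum>a\<in>UNIV - {0}. add_char (l * a))"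
    unfolding field_gauss_def using assms by (intro sum.cong) (auto simp: chi0_power_eq_1)
  moreover have "(\<Sum>a\<in>UNIV. add_char (l * a)) = add_char (l * 0) + (\<Sum>a\<in>UNIV - {0}. add_char (l * a))"
    by (rule sum.remove) auto
  ultimately have "0 = 1 + field_gauss b l" using sum_add_char_mult[of l] assms(2) by simp
  then show ?thesis by (simp add: eq_neg_iff_add_eq_0 add.commute)
qed

lemma field_gauss_scale:
  assumes "l \<noteq> 0"
  shows "field_gauss b l = chi0 (inverse l) ^ b * field_gauss b 1"
proof -
  have "field_gauss b l = (\<Sum>a\<in>UNIV - {0}. chi0 (inverse l * a) ^ b * add_char a)"
    unfolding field_gauss_def
    by (rule sum.reindex_bij_witness[of _ "\<lambda>a. inverse l * a" "\<lambda>a. l * a"]) (use assms in \<open>auto simp: field_simps\<close>)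
  also have "\<dots> = chi0 (inverse l) ^ b * field_gauss b 1"
    unfolding field_gauss_def by (simp add: chi0_mult power_mult_distrib sum_distrib_left mult.assoc)
  finally show ?thesis .
qed

lemma cnj_field_gauss: "cnj (field_gauss b l) = field_gauss (2 * b) l"
proof -
  have "cnj (field_gauss b l) = (\<Sum>a\<in>UNIV - {0}. chi0 a ^ (2 * b) * add_char (l * - a))"
    unfolding field_gauss_def cnj_sum
    by (intro sum.cong refl) (simp add: cnj_chi0 add_char_minus power_mult)
  also have "\<dots> = (\<Sum>a\<in>UNIV - {0}. chi0 (- a) ^ (2 * b) * add_char (l * a))"
    by (rule sum.reindex_bij_witness[of _ uminus uminus]) (auto simp: chi0_minus)
  finally show ?thesis unfolding field_gauss_def by (simp add: chi0_minus)
qed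

text \<open>The classical evaluation \<open>|g|\<^sup>2 = q\<close>, by averaging \<open>|g(b, l)|\<^sup>2\<close> over \<open>l\<close>.\<close>

lemma field_gauss_mult_cnj:
  assumes "\<not> 3 dvd b" "l \<noteq> 0"
  shows "field_gauss b l * cnj (field_gauss b l) = qc"
proof -
  let ?U = "UNIV - {0::'a}"
  have const: "field_gauss b y * cnj (field_gauss b y) = field_gauss b l * cnj (field_gauss b l)" if "y \<noteq> 0" for y
  proof -
    have u: "chi0 x ^ b * cnj (chi0 x ^ b) = 1" if "x \<noteq> 0" for x
      using norm_eq_1_of_cube[OF chi0_cube[OF that]]
      by (simp add: power_mult_distrib[symmetric] complex_norm_square[symmetric])
    have e: "field_gauss b z * cnj (field_gauss b z) = field_gauss b 1 * cnj (field_gauss b 1)" if "z \<noteq> 0" for z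
    proof -
      have "field_gauss b z * cnj (field_gauss b z)
          = (chi0 (inverse z) ^ b * cnj (chi0 (inverse z) ^ b)) * (field_gauss b 1 * cnj (field_gauss b 1))"
        unfolding field_gauss_scale[OF that] complex_cnj_mult by (simp only: mult_ac)
      then show ?thesis using u[of "inverse z"] that by simp
    qed
    show ?thesis using e[OF that] e[OF assms(2)] by (simp only:)
  qed
  have "(\<Sum>y\<in>UNIV. field_gauss b y * cnj (field_gauss b y))
      = (\<Sum>y\<in>UNIV. \<Sum>a\<in>?U. \<Sum>c\<in>?U. chi0 a ^ b * cnj (chi0 c ^ b) * add_char ((a - c) * y))"
    unfolding field_gauss_def cnj_sum sum_product
    by (intro sum.cong refl) (simp add: add_char_add[symmetric] add_char_minus[symmetric] algebra_simps)
  also have "\<dots> = (\<Sum>a\<in>?U. \<Sum>c\<in>?U. chi0 a ^ b * cnj (chi0 c ^ b) * (\<Sum>y\<in>UNIV. add_char ((a - c) * y)))"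
  proof -
    have "(\<Sum>y\<in>UNIV. \<Sum>a\<in>?U. \<Sum>c\<in>?U. chi0 a ^ b * cnj (chi0 c ^ b) * add_char ((a - c) * y))
        = (\<Sum>a\<in>?U. \<Sum>y\<in>UNIV. \<Sum>c\<in>?U. chi0 a ^ b * cnj (chi0 c ^ b) * add_char ((a - c) * y))"
      by (rule sum.swap)
    also have "\<dots> = (\<Sum>a\<in>?U. \<Sum>c\<in>?U. \<Sum>y\<in>UNIV. chi0 a ^ b * cnj (chi0 c ^ b) * add_char ((a - c) * y))"
      by (intro sum.cong refl sum.swap)
    finally show ?thesis unfolding sum_distrib_left .
  qed
  also have "\<dots> = (\<Sum>a\<in>?U. \<Sum>c\<in>?U. if a = c then qc else 0)"
  proof (intro sum.cong refl)
    fix a c assume "a \<in> ?U" "c \<in> ?U"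
    then have "chi0 a ^ b * cnj (chi0 a ^ b) = 1"
      using norm_eq_1_of_cube[OF chi0_cube[of a]]
      by (simp add: power_mult_distrib[symmetric] complex_norm_square[symmetric])
    then show "chi0 a ^ b * cnj (chi0 c ^ b) * (\<Sum>y\<in>UNIV. add_char ((a - c) * y)) = (if a = c then qc else 0)"
      unfolding sum_add_char_mult by auto
  qed
  also have "\<dots> = (qc - 1) * qc"
    by (simp add: of_nat_card_units)
  finally have 1: "(\<Sum>y\<in>UNIV. field_gauss b y * cnj (field_gauss b y)) = (qc - 1) * qc" .
  have "(\<Sum>y\<in>UNIV. field_gauss b y * cnj (field_gauss b y)) = field_gauss b 0 * cnj (field_gauss b 0) + (\<Sum>y\<in>?U. field_gauss b y * cnj (field_gauss b y))"
    by (rule sum.remove) auto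
  also have "\<dots> = (\<Sum>y\<in>?U. field_gauss b y * cnj (field_gauss b y))"
    using assms(1) by (simp add: field_gauss_0)
  also have "\<dots> = (\<Sum>y\<in>?U. field_gauss b l * cnj (field_gauss b l))"
    by (intro sum.cong refl const) simp
  also have "\<dots> = (qc - 1) * (field_gauss b l * cnj (field_gauss b l))"
    by (simp add: of_nat_card_units)
  finally have "(qc - 1) * (field_gauss b l * cnj (field_gauss b l)) = (qc - 1) * qc" using 1 by simp
  then show ?thesis by simp
qed

section \<open>Complete character sums on average over the modulus\<close>

text \<open>
  By reciprocity a sum over long moduli \<open>R\<close> is a sum over residues modulo the fixed argument \<open>r\<close>.
\<close>

lemma sum_chi_monics:
  assumes "r \<in> monics l" "l \<le> b" "a \<noteq> 0"
  shows "(\<Sum>R\<in>monics b. \<chi> R (smult a r)) = chi0 a ^ b * qc ^ (b - l) * (\<Sum>d\<in>below l. \<chi> r d)"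
proof -
  have "(\<Sum>R\<in>monics b. \<chi> R (smult a r)) = (\<Sum>R\<in>monics b. chi0 a ^ b * \<chi> r R)"
    using assms chi_recip[of _ b r l] by (intro sum.cong refl) (simp add: chi_smult)
  also have "\<dots> = chi0 a ^ b * (of_nat (CARD('a) ^ (b - l)) * (\<Sum>d\<in>below l. \<chi> r d))"
    unfolding sum_distrib_left[symmetric] by (subst sum_monics_residues[OF assms(1,2)]) simp_all
  finally show ?thesis by simp
qed

definition total :: "nat \<Rightarrow> complex" where
  "total l = (\<Sum>r\<in>monics l. \<Sum>d\<in>below l. \<chi> r d)"

lemma total_0: "total 0 = 1"
  by (simp add: total_def)

lemma sum_swap_inner:
  "(\<Sum>R\<in>A. \<Sum>m\<in>B. \<Sum>f\<in>C m. \<Sum>a\<in>D. F R m f a) = (\<Sum>m\<in>B. \<Sum>f\<in>C m. \<Sum>a\<in>D. \<Sum>R\<in>A. F R m f a)"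
proof -
  have "(\<Sum>R\<in>A. \<Sum>m\<in>B. \<Sum>f\<in>C m. \<Sum>a\<in>D. F R m f a) = (\<Sum>m\<in>B. \<Sum>R\<in>A. \<Sum>f\<in>C m. \<Sum>a\<in>D. F R m f a)"
    by (rule sum.swap)
  also have "\<dots> = (\<Sum>m\<in>B. \<Sum>f\<in>C m. \<Sum>R\<in>A. \<Sum>a\<in>D. F R m f a)"
    by (intro sum.cong refl sum.swap)
  also have "\<dots> = (\<Sum>m\<in>B. \<Sum>f\<in>C m. \<Sum>a\<in>D. \<Sum>R\<in>A. F R m f a)"
    by (intro sum.cong refl sum.swap)
  finally show ?thesis .
qed

lemma sum_below_chi_leading:
  assumes "l > 0 \<or> G 0 = 0"
  shows "(\<Sum>R\<in>monics l. \<Sum>d\<in>below n. \<chi> R d * G d)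
    = (\<Sum>m<n. \<Sum>f\<in>monics m. \<Sum>a\<in>UNIV - {0}. \<Sum>R\<in>monics l. \<chi> R (smult a f) * G (smult a f))"
proof -
  have "(\<Sum>R\<in>monics l. \<Sum>d\<in>below n. \<chi> R d * G d)
      = (\<Sum>R\<in>monics l. \<Sum>m<n. \<Sum>f\<in>monics m. \<Sum>a\<in>UNIV - {0}. \<chi> R (smult a f) * G (smult a f))"
    using assms chi_zero by (intro sum.cong refl sum_below_leading) (auto simp: monicsD)
  also have "\<dots> = (\<Sum>m<n. \<Sum>f\<in>monics m. \<Sum>a\<in>UNIV - {0}. \<Sum>R\<in>monics l. \<chi> R (smult a f) * G (smult a f))"
    by (rule sum_swap_inner)
  finally show ?thesis .
qed

text \<open>
  Reciprocity turns the sum over \<open>d\<close> modulo \<open>r\<close> into a sum over \<open>r\<close> modulo the shorter \<open>d\<close>.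
  This determines \<open>total\<close> recursively, without knowing which \<open>\<chi>\<^sub>r\<close> are principal.
\<close>

lemma total_rec:
  assumes "l > 0"
  shows "total l = (if 3 dvd l then qc - 1 else 0) * (\<Sum>m<l. qc ^ (l - m) * total m)"
proof -
  have "total l = (\<Sum>m<l. \<Sum>f\<in>monics m. \<Sum>a\<in>UNIV - {0}. \<Sum>R\<in>monics l. \<chi> R (smult a f))"
    unfolding total_def using sum_below_chi_leading[of l "\<lambda>_. 1" l] assms by simp
  also have "\<dots> = (\<Sum>m<l. \<Sum>f\<in>monics m. \<Sum>a\<in>UNIV - {0}. chi0 a ^ l * qc ^ (l - m) * (\<Sum>d\<in>below m. \<chi> f d))"
    by (intro sum.cong refl sum_chi_monics) auto
  also have "\<dots> = (\<Sum>m<l. \<Sum>f\<in>monics m. field_gauss l 0 * qc ^ (l - m) * (\<Sum>d\<in>below m. \<chi> f d))"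
    by (simp add: field_gauss_def sum_distrib_right)
  also have "\<dots> = field_gauss l 0 * (\<Sum>m<l. qc ^ (l - m) * total m)"
    unfolding total_def by (simp add: sum_distrib_left mult.assoc)
  finally show ?thesis by (simp only: field_gauss_0)
qed

text \<open>
  The recursion says that each \<open>m\<close> divisible by \<open>3\<close> multiplies the partial sum by \<open>q\<close>.
\<close>

lemma sum_total: "(\<Sum>m<Suc L. total m / qc ^ m) = qc ^ (L div 3)"
proof (induction L)
  case 0
  then show ?case by (simp add: total_0)
next
  case (Suc L)
  have "(\<Sum>m<Suc L. qc ^ (Suc L - m) * total m) = qc ^ Suc L * (\<Sum>m<Suc L. total m / qc ^ m)"
    unfolding sum_distrib_left
  proof (intro sum.cong refl)
    fix m assume "m \<in> {..<Suc L}"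
    then have "qc ^ Suc L = qc ^ (Suc L - m) * qc ^ m" by (simp flip: power_add)
    then show "qc ^ (Suc L - m) * total m = qc ^ Suc L * (total m / qc ^ m)" by simp
  qed
  then have "total (Suc L) = (if 3 dvd Suc L then qc - 1 else 0) * (qc ^ Suc L * qc ^ (L div 3))"
    using total_rec[of "Suc L"] Suc by simp
  then have "(\<Sum>m<Suc (Suc L). total m / qc ^ m) = qc ^ (L div 3) + (if 3 dvd Suc L then qc - 1 else 0) * qc ^ (L div 3)"
    using Suc by simp
  also have "\<dots> = qc ^ (Suc L div 3)"
  proof (cases "3 dvd Suc L")
    case True
    then have "Suc L div 3 = Suc (L div 3)" by presburger
    then show ?thesis using True by (simp add: algebra_simps)
  next
    case False
    then have "Suc L div 3 = L div 3" by presburger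
    then show ?thesis using False by simp
  qed
  finally show ?case .
qed

lemma total_eq:
  assumes "l > 0"
  shows "total l = (if 3 dvd l then (qc - 1) * qc ^ (l + (l - 1) div 3) else 0)"
proof -
  obtain L where l: "l = Suc L" using assms gr0_implies_Suc by blast
  have "(\<Sum>m<Suc (Suc L). total m / qc ^ m) = (\<Sum>m<Suc L. total m / qc ^ m) + total l / qc ^ l"
    unfolding l by (rule sum.lessThan_Suc)
  then have "total l / qc ^ l = qc ^ (Suc L div 3) - qc ^ (L div 3)"
    unfolding sum_total by (simp add: algebra_simps)
  also have "\<dots> = (if 3 dvd l then (qc - 1) * qc ^ (L div 3) else 0)"
  proof (cases "3 dvd l")
    case True
    then have "Suc L div 3 = Suc (L div 3)" unfolding l by presburger
    then show ?thesis using True by (simp add: algebra_simps)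
  next
    case False
    then have "Suc L div 3 = L div 3" unfolding l by presburger
    then show ?thesis using False by simp
  qed
  finally have "total l = (if 3 dvd l then (qc - 1) * qc ^ (L div 3) else 0) * qc ^ l"
    by (simp add: field_simps)
  then show ?thesis unfolding l by (simp add: power_add mult_ac)
qed

section \<open>Moments of shifted Gauss sums\<close>

definition gauss :: "'a poly \<Rightarrow> 'a poly \<Rightarrow> complex" where
  "gauss f c = (\<Sum>d\<in>below (degree c). \<chi> c d * echar (f * d) c)"

definition gauss_moment :: "'a poly \<Rightarrow> nat \<Rightarrow> complex" where
  "gauss_moment f a = (\<Sum>c\<in>monics a. gauss f c)"

lemma gauss_moment_0: "gauss_moment f 0 = 1"
  by (simp add: gauss_moment_def gauss_def)

text \<open>
  The contribution of one approximation \<open>q / p\<close> to the moment. If the error \<open>r / (p c)\<close> is so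
  large that \<open>f r / (p c)\<close> has a nontrivial integral part, then the shift \<open>R \<mapsto> R + r z\<close> with
  \<open>deg z = 2 a - 2 l - m - 1\<close> changes \<open>f r / (p c)\<close> by \<open>- f r\<^sup>2 z / c\<^sup>2\<close>, up to smaller terms, hence
  only in the coefficient of \<open>1/T\<close>, and the sum over \<open>z\<close> vanishes.
\<close>

lemma sum_approximation_error:
  assumes f: "f \<noteq> 0" "degree f = m" and p: "p \<in> monics k" "ps \<in> below k"
    and k: "k \<le> a" and r0: "r0 \<in> monics l" and u: "u \<noteq> 0" and l: "2 * l + m + 1 \<le> 2 * a" "l < a - k"
  shows "(\<Sum>R\<in>monics (a - k). \<chi> R (smult u r0) * echar (f * smult u r0) (p * (R * p + smult u r0 * ps))) =
    (if l + m + 1 < a + k then \<Sum>R\<in>monics (a - k). \<chi> R (smult u r0)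
     else if l + m + 1 = a + k then add_char (lead_coeff f * u) * (\<Sum>R\<in>monics (a - k). \<chi> R (smult u r0))
     else 0)"
proof -
  define r where "r = smult u r0"
  define b where "b = a - k"
  have r: "r \<noteq> 0" "degree r = l" "lead_coeff r = u"
    using u monics_nonzero[OF r0] monicsD[OF r0] by (simp_all add: r_def)
  have ab: "a = b + k" using k by (simp add: b_def)
  have c: "R * p + r * ps \<in> monics a" if "R \<in> monics b" for R :: "'a poly"
  proof -
    have "ps * r \<in> below (k + l)" using below_mult[OF p(2), of r l] r by simp
    then show ?thesis unfolding ab using monics_mult[OF that p(1)] l(2)
      by (intro monics_add_below) (auto simp: mult.commute b_def intro: below_mono)
  qed
  have pc: "p * (R * p + r * ps) \<in> monics (k + a)" if "R \<in> monics b" for R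
    using monics_mult[OF p(1) c[OF that]] .
  have fr: "f * r \<noteq> 0" "degree (f * r) = m + l" "lead_coeff (f * r) = lead_coeff f * u"
    using f r lead_coeff_mult[of f r] by (simp_all add: degree_mult_eq)
  consider "l + m + 1 < a + k" | "l + m + 1 = a + k" | "l + m + 1 > a + k" by linarith
  then have "(\<Sum>R\<in>monics b. \<chi> R r * echar (f * r) (p * (R * p + r * ps))) =
    (if l + m + 1 < a + k then \<Sum>R\<in>monics b. \<chi> R r
     else if l + m + 1 = a + k then add_char (lead_coeff f * u) * (\<Sum>R\<in>monics b. \<chi> R r) else 0)"
  proof cases
    case 1
    have "echar (f * r) (p * (R * p + r * ps)) = 1" if "R \<in> monics b" for R
      using monicsD(1)[OF pc[OF that]] fr 1 by (intro echar_small) (simp add: below_iff)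
    then show ?thesis using 1 by simp
  next
    case 2
    have "echar (f * r) (p * (R * p + r * ps)) = add_char (lead_coeff f * u)" if "R \<in> monics b" for R
    proof -
      have "f * r \<in> below (degree (p * (R * p + r * ps)))" "degree (p * (R * p + r * ps)) - 1 = degree (f * r)"
        using monicsD(1)[OF pc[OF that]] fr 2 by (auto simp: below_iff)
      then show ?thesis using fr(3) by (simp add: echar_below)
    qed
    then show ?thesis using 2 by (simp add: sum_distrib_left mult.commute)
  next
    case 3
    \<comment> \<open>The shift \<open>z = w T ^ t\<close> changes \<open>f r / (p c)\<close> exactly at the coefficient of \<open>1/T\<close>.\<close>
    define t where "t = 2 * a - 2 * l - m - 1"
    have t: "t + l < b" "m + 2 * l + t = 2 * a - 1" using 3 l ab unfolding t_def by linarith+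
    define S where "S = (\<Sum>R\<in>monics b. \<chi> R r * echar (f * r) (p * (R * p + r * ps)))"
    have S: "S = S * add_char (- lead_coeff f * u ^ 2 * w)" for w
    proof -
      define z where "z = monom w t"
      have rz: "r * z \<in> below b"
        using t r degree_mult_le[of r z] degree_monom_le[of w t] by (auto simp: below_iff z_def)
      have "S = (\<Sum>R\<in>monics b. \<chi> (R + r * z) r * echar (f * r) (p * ((R + r * z) * p + r * ps)))"
        unfolding S_def by (rule sum_monics_translate[OF rz, symmetric])
      also have "\<dots> = (\<Sum>R\<in>monics b. \<chi> R r * (echar (f * r) (p * (R * p + r * ps)) * add_char (- lead_coeff f * u ^ 2 * w)))"
      proof (intro sum.cong refl arg_cong2[of _ _ _ _ "(*)"])
        fix R :: "'a poly" assume R: "R \<in> monics b"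
        have R': "R + r * z \<in> monics b" using R rz by (rule monics_add_below)
        have "\<chi> (R + r * z) r = chi0 u ^ b * \<chi> r0 (R + r * z)"
          unfolding r_def chi_smult[OF R'[unfolded r_def] u] chi_recip[OF R'[unfolded r_def] r0] by simp
        also have "\<chi> r0 (R + r * z) = \<chi> r0 R" by (rule chi_cong) (simp add: r_def dvd_smult)
        also have "chi0 u ^ b * \<chi> r0 R = \<chi> R r"
          unfolding r_def chi_smult[OF R u] chi_recip[OF R r0] by simp
        finally show "\<chi> (R + r * z) r = \<chi> R r" .
        define c1 where "c1 = R * p + r * ps"
        define c2 where "c2 = (R + r * z) * p + r * ps"
        have c1: "c1 \<in> monics a" and c2: "c2 \<in> monics a" using c[OF R] c[OF R'] by (simp_all add: c1_def c2_def)
        have nz: "p * c1 \<noteq> 0" "p * c2 \<noteq> 0" "c1 * c2 \<noteq> 0" "p \<noteq> 0"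
          using monics_nonzero c1 c2 p(1) by auto
        have diff: "f * r * c1 - f * r * c2 = - (f * r ^ 2 * z) * p"
          by (simp add: c1_def c2_def algebra_simps power2_eq_square)
        have "echar (f * r) (p * c2) = echar (f * r * c1) (p * c2 * c1)"
          using echar_cancel[OF nz(2) monicsD(3)[OF c1]] by simp
        also have "\<dots> = echar (f * r * c2 + - (f * r ^ 2 * z) * p) (c1 * c2 * p)"
          unfolding diff[symmetric] by (simp add: mult_ac)
        also have "\<dots> = echar (f * r * c2) (p * c1 * c2) * echar (- (f * r ^ 2 * z) * p) (c1 * c2 * p)"
          unfolding echar_add by (simp add: mult_ac)
        also have "echar (f * r * c2) (p * c1 * c2) = echar (f * r) (p * c1)"
          using echar_cancel[OF nz(1) monicsD(3)[OF c2]] by simp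
        also have "echar (- (f * r ^ 2 * z) * p) (c1 * c2 * p) = echar (- (f * r ^ 2 * z)) (c1 * c2)"
          by (rule echar_cancel[OF nz(3) monicsD(3)[OF p(1)]])
        also have "\<dots> = add_char (- lead_coeff f * u ^ 2 * w)"
        proof -
          have dc: "degree (c1 * c2) = 2 * a" using monics_mult[OF c1 c2] by (simp add: monicsD)
          have fr2: "f * r ^ 2 \<noteq> 0" "degree (f * r ^ 2) = m + 2 * l" "lead_coeff (f * r ^ 2) = lead_coeff f * u ^ 2"
            using f r lead_coeff_mult[of f "r ^ 2"] lead_coeff_power[of r 2]
            by (simp_all add: degree_mult_eq degree_power_eq)
          have "degree (f * r ^ 2 * z) \<le> m + 2 * l + t"
            using degree_mult_le[of "f * r ^ 2" z] degree_monom_le[of w t] fr2(2) unfolding z_def by linarith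
          then have "- (f * r ^ 2 * z) \<in> below (degree (c1 * c2))"
            unfolding dc using t(2) l by (auto simp: below_iff)
          moreover have "coeff (- (f * r ^ 2 * z)) (degree (c1 * c2) - 1) = - (lead_coeff f * u ^ 2 * w)"
          proof -
            have "coeff (z * (f * r ^ 2)) (t + degree (f * r ^ 2)) = w * lead_coeff (f * r ^ 2)"
              unfolding z_def coeff_monom_mult by simp
            moreover have "t + degree (f * r ^ 2) = 2 * a - 1" using fr2(2) t(2) by simp
            ultimately show ?thesis unfolding dc fr2(3) by (simp add: mult_ac)
          qed
          ultimately show ?thesis by (simp add: echar_below)
        qed
        finally show "echar (f * r) (p * ((R + r * z) * p + r * ps)) = echar (f * r) (p * (R * p + r * ps)) * add_char (- lead_coeff f * u ^ 2 * w)"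
          unfolding c1_def c2_def .
      qed
      also have "\<dots> = S * add_char (- lead_coeff f * u ^ 2 * w)"
        unfolding S_def by (simp add: sum_distrib_right mult.assoc)
      finally show ?thesis .
    qed
    have "(\<Sum>w\<in>(UNIV::'a set). S) = S * (\<Sum>w\<in>UNIV. add_char (- lead_coeff f * u ^ 2 * w))"
      unfolding sum_distrib_left using S by (intro sum.cong refl) blast
    also have "\<dots> = 0" unfolding sum_add_char_mult using f(1) u by simp
    finally have "S = 0" by simp
    then show ?thesis using 3 unfolding S_def by simp
  qed
  then show ?thesis unfolding r_def b_def .
qed

text \<open>
  The functional equation in finite form: a long moment (\<open>a > deg f\<close>) is a combination of the short
  ones (\<open>k \<le> deg f / 2\<close>). The coefficient of the \<open>k\<close>-th one collects the sums over \<open>(R, r)\<close> that remain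
  when \<open>d / c\<close> is cut at a height just above \<open>deg f / 2\<close>. Errors \<open>r\<close> of degree below
  \<open>a + k - m - 1\<close> are invisible to the additive character, those of this degree contribute a Gauss sum
  over the field, and larger ones cancel.
\<close>

theorem gauss_moment_formula:
  assumes f: "f \<noteq> 0" "degree f = m" and a: "m < a"
  shows "gauss_moment f a = (\<Sum>k\<le>m div 2. gauss_moment f k *
    (field_gauss (a - k) 0 * (\<Sum>l<a + k - m - 1. qc ^ (a - k - l) * total l)
     + field_gauss (a - k) (lead_coeff f) * qc ^ (m + 1 - 2 * k) * total (a + k - m - 1)))"
proof -
  define h where "h = m div 2 + 1"
  have h: "1 \<le> h" "h \<le> a" using a unfolding h_def by linarith+
  have h': "m + 1 \<le> 2 * h" "2 * h \<le> m + 2" unfolding h_def by presburger+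
  define E where "E = (\<lambda>c d. echar (f * d) c)"
  define inner where "inner = (\<lambda>k p q. \<Sum>R\<in>monics (a - k). \<Sum>r\<in>below (a - h + 1). \<chi> R r *
          echar (f * r) (p * (R * p + r * fst (complement p q))))"
  define coef where "coef = (\<lambda>k. field_gauss (a - k) 0 * (\<Sum>l<a + k - m - 1. qc ^ (a - k - l) * total l)
     + field_gauss (a - k) (lead_coeff f) * qc ^ (m + 1 - 2 * k) * total (a + k - m - 1))"
  have inner: "inner k p q = coef k" if k: "k < h" and p: "p \<in> monics k" and cop: "coprime p q" for k p q
  proof -
    define ps where "ps = fst (complement p q)"
    have ps: "ps \<in> below k" unfolding ps_def by (rule complement(1)[OF p cop])
    define l0 where "l0 = a + k - m - 1"
    have l0: "l0 < a - h + 1" "a - k - l0 = m + 1 - 2 * k" "l0 + m + 1 = a + k" using k h h' a unfolding l0_def by linarith+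
    have ka: "k \<le> a" "a - k > 0" using k h by linarith+
    define Y where "Y = (\<lambda>l. \<Sum>r0\<in>monics l. \<Sum>u\<in>UNIV - {0}. \<Sum>R\<in>monics (a - k).
        \<chi> R (smult u r0) * echar (f * smult u r0) (p * (R * p + smult u r0 * ps)))"
    have "inner k p q = (\<Sum>R\<in>monics (a - k). \<Sum>l<a - h + 1. \<Sum>r0\<in>monics l. \<Sum>u\<in>UNIV - {0}.
        \<chi> R (smult u r0) * echar (f * smult u r0) (p * (R * p + smult u r0 * ps)))"
      unfolding inner_def ps_def[symmetric] using ka chi_zero
      by (intro sum.cong refl sum_below_leading) (auto simp: monicsD)
    also have "\<dots> = (\<Sum>l<a - h + 1. Y l)"
      unfolding Y_def by (rule sum_swap_inner)
    also have "\<dots> = (\<Sum>l<a - h + 1. if l < l0 then field_gauss (a - k) 0 * (qc ^ (a - k - l) * total l)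
        else if l = l0 then field_gauss (a - k) (lead_coeff f) * qc ^ (a - k - l) * total l else 0)"
    proof (intro sum.cong refl)
      fix l assume "l \<in> {..<a - h + 1}"
      then have l: "2 * l + m + 1 \<le> 2 * a" "l < a - k" using h h' k by simp_all
      have "Y l = (\<Sum>r0\<in>monics l. \<Sum>u\<in>UNIV - {0}. (if l < l0 then 1 else if l = l0 then add_char (lead_coeff f * u) else 0)
          * (\<Sum>R\<in>monics (a - k). \<chi> R (smult u r0)))"
        unfolding Y_def using l0(3)
        by (intro sum.cong refl, subst sum_approximation_error[OF f p ps ka(1) _ _ l]) auto
      also have "\<dots> = (\<Sum>r0\<in>monics l. \<Sum>u\<in>UNIV - {0}. (if l < l0 then 1 else if l = l0 then add_char (lead_coeff f * u) else 0)
          * (chi0 u ^ (a - k) * qc ^ (a - k - l) * (\<Sum>d\<in>below l. \<chi> r0 d)))"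
        using l by (intro sum.cong refl arg_cong2[of _ _ _ _ "(*)"] sum_chi_monics) auto
      also have "\<dots> = (\<Sum>u\<in>UNIV - {0}. (if l < l0 then 1 else if l = l0 then add_char (lead_coeff f * u) else 0)
          * chi0 u ^ (a - k)) * qc ^ (a - k - l) * total l"
        unfolding total_def sum_distrib_left sum_distrib_right
        by (subst sum.swap) (intro sum.cong refl, simp add: mult_ac)
      also have "\<dots> = (if l < l0 then field_gauss (a - k) 0 * (qc ^ (a - k - l) * total l)
        else if l = l0 then field_gauss (a - k) (lead_coeff f) * qc ^ (a - k - l) * total l else 0)"
        by (simp add: field_gauss_def mult.commute mult.assoc mult.left_commute)
      finally show "Y l = \<dots>" .
    qed
    also have "\<dots> = (\<Sum>l<Suc l0. if l < l0 then field_gauss (a - k) 0 * (qc ^ (a - k - l) * total l)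
        else if l = l0 then field_gauss (a - k) (lead_coeff f) * qc ^ (a - k - l) * total l else 0)"
      using l0(1) by (intro sum.mono_neutral_right) auto
    also have "\<dots> = coef k"
      unfolding coef_def l0_def[symmetric] l0(2)[symmetric] by (simp add: sum_distrib_left)
    finally show ?thesis .
  qed
  have "gauss_moment f a = (\<Sum>c\<in>monics a. \<Sum>d\<in>below a. \<chi> c d * E c d)"
    unfolding gauss_moment_def gauss_def E_def by (intro sum.cong refl) (simp_all add: monicsD)
  also have "\<dots> = (\<Sum>k<h. \<Sum>p\<in>monics k. \<Sum>q\<in>below k. \<chi> p q *
       (\<Sum>R\<in>monics (a - k). \<Sum>r\<in>below (a - h + 1). \<chi> R r *
          E (R * p + r * fst (complement p q)) (R * q + r * snd (complement p q))))"
    by (rule chi_sum_cut[OF h(1,2)])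
  also have "\<dots> = (\<Sum>k<h. \<Sum>p\<in>monics k. \<Sum>q\<in>below k. \<chi> p q * (echar (f * q) p * coef k))"
  proof (intro sum.cong refl)
    fix k and p q :: "'a poly" assume k: "k \<in> {..<h}" and p: "p \<in> monics k" and q: "q \<in> below k"
    show "\<chi> p q * (\<Sum>R\<in>monics (a - k). \<Sum>r\<in>below (a - h + 1). \<chi> R r *
          E (R * p + r * fst (complement p q)) (R * q + r * snd (complement p q))) = \<chi> p q * (echar (f * q) p * coef k)"
    proof (cases "coprime p q")
      case False
      then show ?thesis using chi_eq_0_iff_coprime[OF monics_nonzero[OF p]] by simp
    next
      case True
      define ps where "ps = fst (complement p q)"
      define qs where "qs = snd (complement p q)"
      have ps: "ps \<in> below k" "p * qs - q * ps = 1"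
        unfolding ps_def qs_def using complement[OF p True] by simp_all
      have E: "E (R * p + r * ps) (R * q + r * qs) = echar (f * q) p * echar (f * r) (p * (R * p + r * ps))"
        if R: "R \<in> monics (a - k)" and r: "r \<in> below (a - h + 1)" for R r
      proof -
        define c where "c = R * p + r * ps"
        define d where "d = R * q + r * qs"
        have "ps * r \<in> below (k + (a - h))" using below_mult[OF ps(1), of r "a - h"] r by (auto simp: below_iff)
        then have "r * ps \<in> below (a - k + k)"
          using k h by (intro below_mono[of _ "k + (a - h)" "a - k + k"]) (simp_all add: mult.commute)
        then have "c \<in> monics (a - k + k)"
          unfolding c_def by (intro monics_add_below monics_mult R p)
        then have c: "c \<noteq> 0" "lead_coeff c = 1" using monics_nonzero by (auto simp: monicsD)
        have det: "f * d * p = f * q * c + f * r"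
        proof -
          have "f * d * p - f * q * c = f * r * (p * qs - q * ps)" by (simp add: c_def d_def algebra_simps)
          then have "f * d * p - f * q * c = f * r" using ps(2) by simp
          then show ?thesis by (simp add: diff_eq_eq add.commute)
        qed
        have "echar (f * d) c = echar (f * d * p) (c * p)"
          by (rule echar_cancel[OF c(1) monicsD(3)[OF p], symmetric])
        also have "\<dots> = echar (f * q * c) (p * c) * echar (f * r) (p * c)"
          unfolding det echar_add by (simp add: mult.commute)
        also have "echar (f * q * c) (p * c) = echar (f * q) p" by (rule echar_cancel[OF monics_nonzero[OF p] c(2)])
        finally show ?thesis by (simp add: E_def c_def d_def)
      qed
      have "(\<Sum>R\<in>monics (a - k). \<Sum>r\<in>below (a - h + 1). \<chi> R r * E (R * p + r * ps) (R * q + r * qs))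
          = echar (f * q) p * inner k p q"
        unfolding inner_def ps_def[symmetric] sum_distrib_left by (intro sum.cong refl) (simp add: E mult_ac)
      then show ?thesis unfolding ps_def qs_def using inner[of k p q] k p True by simp
    qed
  qed
  also have "\<dots> = (\<Sum>k<h. gauss_moment f k * coef k)"
    unfolding gauss_moment_def gauss_def sum_distrib_right
    by (intro sum.cong refl) (simp_all add: monicsD mult.assoc)
  finally show ?thesis unfolding coef_def h_def by (simp add: lessThan_Suc_atMost)
qed

section \<open>Long moments are geometric\<close>

text \<open>The real cube root of \<open>q\<close>: moments grow by the factor \<open>q ^ (4/3)\<close> per degree.\<close>

definition cr :: complex where "cr = of_real (root 3 (real CARD('a)))"

lemma cr_cube: "cr ^ 3 = qc"
proof -
  have "root 3 (real CARD('a)) ^ 3 = real CARD('a)" by simp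
  then have "cr ^ 3 = of_real (real CARD('a))" unfolding cr_def of_real_power[symmetric] by (simp only:)
  then show ?thesis by simp
qed

lemma cr_nonzero [simp]: "cr \<noteq> 0"
  using cr_cube qc_nonzero by (metis power_zero_numeral)

lemma cr_power: "cr ^ (3 * k) = qc ^ k"
  by (simp add: power_mult cr_cube)

text \<open>
  The weight \<open>q ^ (- 2 k / 3)\<close> is the one with which the \<open>k\<close>-th short moment enters the limit.
\<close>

definition short_moment :: "'a poly \<Rightarrow> nat \<Rightarrow> complex" where
  "short_moment f i = (\<Sum>k\<le>degree f div 2. if k mod 3 = i mod 3 then gauss_moment f k / cr ^ (2 * k) else 0)"

text \<open>
  The constant of the geometric growth of \<open>gauss_moment f\<close> along a class modulo \<open>3\<close>, as it results from
  \<open>gauss_moment_formula\<close>: the class of \<open>a\<close> enters directly, and its dual \<open>deg f + 1 - a\<close>, written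
  \<open>2 a + deg f + 1\<close> to avoid subtraction, through a Gauss sum over the field. The case \<open>s = 0\<close> is the
  class that is its own dual.
\<close>

definition moment_coeff :: "'a poly \<Rightarrow> nat \<Rightarrow> complex" where
  "moment_coeff f a = (let s = (2 * a + 2 * degree f + 2) mod 3 in
     if s = 0 then 0 else (qc - 1) / cr ^ (degree f + 1) *
       (short_moment f a / cr ^ s + field_gauss s (lead_coeff f) / qc * short_moment f (2 * a + degree f + 1)))"

lemma moment_coeff_cong: "a mod 3 = b mod 3 \<Longrightarrow> moment_coeff f a = moment_coeff f b"
proof -
  assume ab: "a mod 3 = b mod 3"
  have "(2 * a + 2 * degree f + 2) mod 3 = (2 * b + 2 * degree f + 2) mod 3"
    "(2 * a + degree f + 1) mod 3 = (2 * b + degree f + 1) mod 3" using ab by (metis mod_add_left_eq mod_mult_right_eq)+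
  note eq = this
  have "short_moment f a = short_moment f b"
    "short_moment f (2 * a + degree f + 1) = short_moment f (2 * b + degree f + 1)"
    unfolding short_moment_def eq(2) ab by (rule refl)+
  then show ?thesis unfolding moment_coeff_def eq(1) by (simp only:)
qed

text \<open>
  The coefficient of \<open>gauss_moment f k\<close> in \<open>gauss_moment f a\<close>. It is nonzero in at most two
  classes of \<open>k\<close> modulo \<open>3\<close>, namely \<open>a\<close> and \<open>m + 1 - a\<close>; if these coincide, the two
  contributions cancel.
\<close>

lemma moment_weight:
  assumes l: "0 < a + k - m - 1" and k: "2 * k \<le> m" and am: "m < a" and L: "L \<noteq> 0"
  defines "s \<equiv> (2 * a + 2 * m + 2) mod 3"
  shows "field_gauss (a - k) 0 * (\<Sum>l<a + k - m - 1. qc ^ (a - k - l) * total l)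
     + field_gauss (a - k) L * qc ^ (m + 1 - 2 * k) * total (a + k - m - 1)
    = (if s = 0 then 0 else cr ^ (4 * a) * ((qc - 1) / cr ^ (m + 1)) *
        (((if k mod 3 = a mod 3 then 1 else 0) / cr ^ s
          + (if k mod 3 = (2 * a + m + 1) mod 3 then 1 else 0) * (field_gauss s L / qc)) / cr ^ (2 * k)))"
    (is "?lhs = ?rhs")
proof -
  define l0 where "l0 = a + k - m - 1"
  define e where "e = (l0 - 1) div 3"
  have l0: "l0 > 0" "l0 + m + 1 = a + k" "m + 1 - 2 * k + l0 = a - k" using l k am by (auto simp: l0_def)
  have ka: "k \<le> a" using k am by linarith
  have "(\<Sum>l<l0. qc ^ (a - k - l) * total l) = qc ^ (a - k) * (\<Sum>l<l0. total l / qc ^ l)"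
    unfolding sum_distrib_left
  proof (intro sum.cong refl)
    fix l assume "l \<in> {..<l0}"
    then have "l \<le> a - k" using l0 k am by simp
    then have "qc ^ (a - k) = qc ^ (a - k - l) * qc ^ l"
      by (subst power_add[symmetric], subst le_add_diff_inverse2) simp_all
    then show "qc ^ (a - k - l) * total l = qc ^ (a - k) * (total l / qc ^ l)" by simp
  qed
  also have "(\<Sum>l<l0. total l / qc ^ l) = qc ^ e"
    using sum_total[of "l0 - 1"] l0(1) by (simp add: e_def)
  finally have 1: "(\<Sum>l<l0. qc ^ (a - k - l) * total l) = qc ^ (a - k) * qc ^ e" .
  have 2: "qc ^ (m + 1 - 2 * k) * total l0 = qc ^ (a - k) * qc ^ e * (if 3 dvd l0 then qc - 1 else 0)"
  proof -
    have "qc ^ (m + 1 - 2 * k) * qc ^ l0 = qc ^ (a - k)" using l0(3) by (simp flip: power_add)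
    then show ?thesis unfolding total_eq[OF l0(1)] e_def[symmetric] by (simp add: power_add mult_ac)
  qed
  have lhs: "?lhs = qc ^ (a - k) * qc ^ e * (field_gauss (a - k) 0 + (if 3 dvd l0 then qc - 1 else 0) * field_gauss (a - k) L)"
  proof -
    have "?lhs = field_gauss (a - k) 0 * (qc ^ (a - k) * qc ^ e) + field_gauss (a - k) L * (qc ^ (m + 1 - 2 * k) * total l0)"
      unfolding l0_def[symmetric] 1 by (simp only: mult.assoc)
    then show ?thesis unfolding 2 by (simp add: algebra_simps)
  qed
  define x where "x = a - k"
  have xa: "a = x + k" using ka by (simp add: x_def)
  have s_x: "s = (x + l0) mod 3"
  proof -
    have "2 * a + 2 * m + 2 + 3 * l0 = x + l0 + 3 * (x + 2 * k)" using l0(2) xa by presburger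
    then have "(2 * a + 2 * m + 2 + 3 * l0) mod 3 = (x + l0 + 3 * (x + 2 * k)) mod 3" by (simp only:)
    then show ?thesis unfolding s_def mod_mult_self2 .
  qed
  have cls1: "3 dvd (a - k) \<longleftrightarrow> k mod 3 = a mod 3"
    using mod_eq_dvd_iff_nat[OF ka, of 3] by metis
  have cls2: "3 dvd l0 \<longleftrightarrow> k mod 3 = (2 * a + m + 1) mod 3"
  proof -
    define u where "u = 2 * a + m + 1"
    have "u + l0 = k + 3 * a" using l0(2) by (simp add: u_def)
    then have "(u + l0) mod 3 = (k + 3 * a) mod 3" by (simp only:)
    then have "k mod 3 = (u + l0) mod 3" by simp
    then show ?thesis using mod_eq_dvd_iff_nat[of u "u + l0" 3] unfolding u_def[symmetric] by auto
  qed
  \<comment> \<open>Rewriting powers of \<open>q\<close> as powers of its cube root exposes the growth \<open>q ^ (4 a / 3)\<close>.\<close>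
  have pw: "qc ^ (a - k) * qc ^ e = cr ^ (4 * a) / cr ^ (m + 1) / cr ^ (2 * k) / cr ^ t" if "l0 = 3 * e + t" for t
  proof -
    have "3 * (a - k) + 3 * e + (m + 1) + 2 * k + t = 4 * a" using that l0(2) ka by linarith
    then have "cr ^ (3 * (a - k)) * cr ^ (3 * e) * cr ^ (m + 1) * cr ^ (2 * k) * cr ^ t = cr ^ (4 * a)"
      unfolding power_add[symmetric] by (simp only:)
    then show ?thesis unfolding cr_power by (simp add: field_simps)
  qed
  show ?thesis
  proof (cases "s = 0")
    case True
    have "3 dvd (a - k) \<longleftrightarrow> 3 dvd l0" using True unfolding s_x x_def[symmetric] by presburger
    then have "field_gauss (a - k) 0 + (if 3 dvd l0 then qc - 1 else 0) * field_gauss (a - k) L = 0"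
      using L by (simp add: field_gauss_0 field_gauss_trivial)
    then show ?thesis using True lhs by simp
  next
    case False
    consider "3 dvd (a - k)" | "3 dvd l0" | "\<not> 3 dvd (a - k)" "\<not> 3 dvd l0" by blast
    then show ?thesis
    proof cases
      case 1
      have l3: "\<not> 3 dvd l0" using 1 False unfolding s_x x_def[symmetric] by presburger
      then have c: "k mod 3 = a mod 3" "k mod 3 \<noteq> (2 * a + m + 1) mod 3"
        using 1 cls1 cls2 by blast+
      have "s = l0 mod 3" using 1 unfolding s_x x_def[symmetric] by presburger
      then have "l0 = 3 * e + s" using l3 unfolding e_def by presburger
      from pw[OF this] show ?thesis using False c l3 1 unfolding lhs by (simp add: field_gauss_0 field_simps)
    next
      case 2
      have x3: "\<not> 3 dvd (a - k)" using 2 False unfolding s_x x_def[symmetric] by presburger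
      then have c: "k mod 3 = (2 * a + m + 1) mod 3" "k mod 3 \<noteq> a mod 3"
        using 2 cls1 cls2 by blast+
      have "l0 = 3 * e + 3" using 2 l0(1) unfolding e_def by presburger
      note pw3 = pw[OF this]
      have "(a - k) mod 3 = s mod 3" using 2 by (auto elim!: dvdE simp: s_x x_def[symmetric])
      then have fg: "field_gauss (a - k) L = field_gauss s L" by (rule field_gauss_cong)
      show ?thesis using False c x3 2 unfolding lhs unfolding fg pw3 cr_cube by (simp add: field_gauss_0 field_simps)
    next
      case 3
      then show ?thesis using False cls1 cls2 unfolding lhs by (simp add: field_gauss_0)
    qed
  qed
qed

lemma sum_moment_weights:
  "(\<Sum>k\<le>degree f div 2. gauss_moment f k * (if (2 * a + 2 * degree f + 2) mod 3 = 0 then 0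
      else cr ^ (4 * a) * ((qc - 1) / cr ^ (degree f + 1)) *
        (((if k mod 3 = a mod 3 then 1 else 0) / cr ^ ((2 * a + 2 * degree f + 2) mod 3)
          + (if k mod 3 = (2 * a + degree f + 1) mod 3 then 1 else 0) * (field_gauss ((2 * a + 2 * degree f + 2) mod 3) (lead_coeff f) / qc)) / cr ^ (2 * k))))
   = cr ^ (4 * a) * moment_coeff f a"
proof -
  define s where "s = (2 * a + 2 * degree f + 2) mod 3"
  define K where "K = (qc - 1) / cr ^ (degree f + 1)"
  have "(\<Sum>k\<le>degree f div 2. gauss_moment f k * (cr ^ (4 * a) * K *
        (((if k mod 3 = a mod 3 then 1 else 0) / cr ^ s
          + (if k mod 3 = (2 * a + degree f + 1) mod 3 then 1 else 0) * (field_gauss s (lead_coeff f) / qc)) / cr ^ (2 * k))))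
     = (\<Sum>k\<le>degree f div 2. cr ^ (4 * a) * K * ((if k mod 3 = a mod 3 then gauss_moment f k / cr ^ (2 * k) else 0) / cr ^ s
          + field_gauss s (lead_coeff f) / qc * (if k mod 3 = (2 * a + degree f + 1) mod 3 then gauss_moment f k / cr ^ (2 * k) else 0)))"
    by (intro sum.cong refl) (simp add: divide_inverse algebra_simps split: if_split)
  also have "\<dots> = cr ^ (4 * a) * K * (short_moment f a / cr ^ s + field_gauss s (lead_coeff f) / qc * short_moment f (2 * a + degree f + 1))"
    unfolding short_moment_def by (simp only: sum_distrib_left[symmetric] sum.distrib sum_divide_distrib[symmetric])
  finally show ?thesis unfolding moment_coeff_def Let_def s_def[symmetric] K_def[symmetric] by (simp add: mult.assoc)
qed

theorem gauss_moment_geometric: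
  assumes "f \<noteq> 0" "degree f + 2 \<le> a"
  shows "gauss_moment f a = cr ^ (4 * a) * moment_coeff f a"
proof -
  have a: "degree f < a" using assms by simp
  show ?thesis
    unfolding sum_moment_weights[symmetric] gauss_moment_formula[OF assms(1) refl a]
    using assms by (intro sum.cong refl arg_cong2[of _ _ _ _ "(*)"] moment_weight) auto
qed

text \<open>
  For \<open>a = deg f + 1\<close> the term \<open>k = 0\<close> contains \<open>total 0 = 1\<close>, which does not follow the pattern of
  \<open>total_eq\<close>; the correction is a Gauss sum over the field.
\<close>

lemma gauss_moment_first:
  assumes f: "f \<noteq> 0" "a = degree f + 1" and a: "\<not> 3 dvd a"
  shows "gauss_moment f a = cr ^ (4 * a) * moment_coeff f a + field_gauss a (lead_coeff f) * qc ^ (a - 1)"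
proof -
  let ?m = "degree f" and ?L = "lead_coeff f"
  define s where "s = (2 * a + 2 * ?m + 2) mod 3"
  define A where "A = (\<lambda>k. field_gauss (a - k) 0 * (\<Sum>l<a + k - ?m - 1. qc ^ (a - k - l) * total l)
     + field_gauss (a - k) ?L * qc ^ (?m + 1 - 2 * k) * total (a + k - ?m - 1))"
  define B where "B = (\<lambda>k. if s = 0 then 0 else cr ^ (4 * a) * ((qc - 1) / cr ^ (?m + 1)) *
        (((if k mod 3 = a mod 3 then 1 else 0) / cr ^ s
          + (if k mod 3 = (2 * a + ?m + 1) mod 3 then 1 else 0) * (field_gauss s ?L / qc)) / cr ^ (2 * k)))"
  have AB: "A k = B k" if "k \<in> {..?m div 2} - {0}" for k
    unfolding A_def B_def s_def using that f by (intro moment_weight) auto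
  have A0: "A 0 = field_gauss a ?L * qc ^ a" unfolding A_def using f by (simp add: total_0)
  have B0: "B 0 = (qc - 1) * field_gauss a ?L * qc ^ a / qc"
  proof -
    have s: "s mod 3 = a mod 3" "s \<noteq> 0" "a mod 3 \<noteq> 0" "(2 * a + ?m + 1) mod 3 = 0"
    proof -
      have "s mod 3 = a mod 3 \<and> s \<noteq> 0 \<and> a mod 3 \<noteq> 0 \<and> (2 * a + m + 1) mod 3 = 0"
        if "a = m + 1" "s = (2 * a + 2 * m + 2) mod 3" for m s
      proof -
        have "2 * a + 2 * m + 2 = a + 3 * a" "2 * a + m + 1 = 3 * a" using that(1) by simp_all
        then have "s = a mod 3" "(2 * a + m + 1) mod 3 = 0" using that(2) by (simp_all only: mod_mult_self2 mod_mult_self1_is_0)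
        then show ?thesis using a by (simp add: mod_eq_0_iff_dvd)
      qed
      from this[OF f(2) s_def] show "s mod 3 = a mod 3" "s \<noteq> 0" "a mod 3 \<noteq> 0" "(2 * a + ?m + 1) mod 3 = 0"
        by blast+
    qed
    have "4 * a = (?m + 1) + 3 * a" using f by simp
    then have "cr ^ (4 * a) = cr ^ (?m + 1) * cr ^ (3 * a)" by (simp only: power_add)
    then have "cr ^ (4 * a) = cr ^ (?m + 1) * qc ^ a" unfolding cr_power .
    then show ?thesis unfolding B_def using s field_gauss_cong[OF s(1), of ?L] by simp
  qed
  have "gauss_moment f a = (\<Sum>k\<le>?m div 2. gauss_moment f k * A k)"
    unfolding A_def using f by (intro gauss_moment_formula) auto
  also have "\<dots> = A 0 + (\<Sum>k\<in>{..?m div 2} - {0}. gauss_moment f k * A k)"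
    by (subst sum.remove[of _ 0]) (auto simp: gauss_moment_0)
  also have "(\<Sum>k\<in>{..?m div 2} - {0}. gauss_moment f k * A k) = (\<Sum>k\<in>{..?m div 2} - {0}. gauss_moment f k * B k)"
    using AB by (intro sum.cong) auto
  also have "\<dots> = (\<Sum>k\<le>?m div 2. gauss_moment f k * B k) - B 0"
    by (subst sum.remove[of "{..?m div 2}" 0]) (auto simp: gauss_moment_0)
  also have "(\<Sum>k\<le>?m div 2. gauss_moment f k * B k) = cr ^ (4 * a) * moment_coeff f a"
    unfolding B_def s_def by (rule sum_moment_weights)
  finally have "gauss_moment f a = cr ^ (4 * a) * moment_coeff f a + (A 0 - B 0)" by simp
  also have "A 0 - B 0 = field_gauss a ?L * qc ^ (a - 1)"
  proof -
    have "qc ^ a = qc * qc ^ (a - 1)" using f by simp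
    then show ?thesis unfolding A0 B0 by (simp add: field_simps)
  qed
  finally show ?thesis .
qed

lemma moment_coeff_self_dual: "(2 * a + 2 * degree f + 2) mod 3 = 0 \<Longrightarrow> moment_coeff f a = 0"
  by (simp add: moment_coeff_def)

lemma field_gauss_1_2: "L \<noteq> 0 \<Longrightarrow> field_gauss 1 L * field_gauss 2 L = qc"
  using field_gauss_mult_cnj[of 1 L] cnj_field_gauss[of 1 L] by simp

lemma mod_3_dual:
  assumes "(2 * a + 2 * d + 2) mod 3 = (1::nat)" "(a + b) mod 3 = (d + 1) mod 3"
  shows "(2 * b + 2 * d + 2) mod 3 = 2 \<and> (2 * a + d + 1) mod 3 = b mod 3 \<and> (2 * b + d + 1) mod 3 = a mod 3"
proof -
  define i j e where "i = a mod 3" "j = b mod 3" "e = d mod 3"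
  have red: "(2 * x + 2 * y + 2) mod 3 = (2 * (x mod 3) + 2 * (y mod 3) + 2) mod 3"
    "(2 * x + y + 1) mod 3 = (2 * (x mod 3) + y mod 3 + 1) mod 3" "(x + y) mod 3 = (x mod 3 + y mod 3) mod 3"
    "(x + 1) mod 3 = (x mod 3 + 1) mod 3" for x y :: nat
    by (rule mod_add_cong mod_mult_cong refl mod_mod_trivial[symmetric])+
  have "i < 3" "j < 3" "e < 3" by (simp_all add: i_j_e_def)
  then have "i \<in> {0, 1, 2}" "j \<in> {0, 1, 2}" "e \<in> {0, 1, 2}" by auto
  then show ?thesis
    using assms unfolding red(1)[of a d] red(1)[of b d] red(2)[of a d] red(2)[of b d] red(3)[of a b] red(4)[of d]
      i_j_e_def[symmetric] by auto
qed

text \<open>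
  Exchanging the class of \<open>a\<close> with its dual \<open>deg f + 1 - a\<close> exchanges the two short moments in
  \<open>moment_coeff\<close>, and the two Gauss sums over the field multiply to \<open>q\<close>.
\<close>

lemma moment_coeff_dual:
  assumes f: "f \<noteq> 0" and a: "(2 * a + 2 * degree f + 2) mod 3 = 1" and b: "(a + b) mod 3 = (degree f + 1) mod 3"
  shows "moment_coeff f b = field_gauss 2 (lead_coeff f) / cr ^ 2 * moment_coeff f a"
proof -
  let ?L = "lead_coeff f"
  have L: "?L \<noteq> 0" using f by simp
  have m: "(2 * b + 2 * degree f + 2) mod 3 = 2" "(2 * a + degree f + 1) mod 3 = b mod 3" "(2 * b + degree f + 1) mod 3 = a mod 3"
    using mod_3_dual[OF a b] by blast+
  define u where "u = short_moment f a"
  define v where "v = short_moment f b"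
  have uv: "short_moment f (2 * a + degree f + 1) = v" "short_moment f (2 * b + degree f + 1) = u"
    unfolding u_def v_def short_moment_def using m by simp_all
  define K where "K = (qc - 1) / cr ^ (degree f + 1)"
  have A: "moment_coeff f a = K * (u / cr + field_gauss 1 ?L / qc * v)"
    unfolding moment_coeff_def a Let_def uv(1) u_def[symmetric] K_def[symmetric] by simp
  have B: "moment_coeff f b = K * (v / cr ^ 2 + field_gauss 2 ?L / qc * u)"
    unfolding moment_coeff_def m(1) Let_def uv(2) v_def[symmetric] K_def[symmetric] by simp
  have q3: "qc = cr * cr ^ 2" using cr_cube by (simp add: power3_eq_cube power2_eq_square mult.assoc)
  have "field_gauss 2 ?L / cr ^ 2 * moment_coeff f a
      = K * (field_gauss 2 ?L * u / (cr * cr ^ 2) + (field_gauss 1 ?L * field_gauss 2 ?L) / qc * v / cr ^ 2)"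
    unfolding A by (simp add: field_simps)
  also have "\<dots> = moment_coeff f b"
    unfolding B field_gauss_1_2[OF L] q3[symmetric] by (simp add: field_simps)
  finally show ?thesis by simp
qed

section \<open>Denominators divisible by a fixed prime\<close>

lemma mult_mod_bij:
  fixes c g :: "'a poly"
  assumes "c \<noteq> 0" "coprime c g"
  shows "bij_betw (\<lambda>d. (g * d) mod c) (below (degree c)) (below (degree c))"
proof -
  have inj: "inj_on (\<lambda>d. (g * d) mod c) (below (degree c))"
  proof (rule inj_onI)
    fix d d' assume *: "d \<in> below (degree c)" "d' \<in> below (degree c)" "(g * d) mod c = (g * d') mod c"
    then have "c dvd g * (d - d')" by (simp add: mod_eq_dvd_iff right_diff_distrib)
    then have "c dvd d - d'" by (rule coprime_dvd_mult_poly[OF assms(2)])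
    then have "d mod c = d' mod c" by (simp add: mod_eq_dvd_iff)
    then show "d = d'" using * by (simp add: mod_below)
  qed
  have "(\<lambda>d. (g * d) mod c) ` below (degree c) \<subseteq> below (degree c)"
    using mod_in_below[OF assms(1)] by auto
  then have "(\<lambda>d. (g * d) mod c) ` below (degree c) = below (degree c)"
    by (rule endo_inj_surj[OF finite_below _ inj])
  then show ?thesis using inj by (simp add: bij_betw_def)
qed

lemma sum_residues_mult:
  fixes c g :: "'a poly"
  assumes "c \<noteq> 0" "coprime c g" "\<And>d e. c dvd d - e \<Longrightarrow> F d = F e"
  shows "(\<Sum>d\<in>below (degree c). F (g * d)) = (\<Sum>d\<in>below (degree c). F d)"
proof -
  have "(\<Sum>d\<in>below (degree c). F (g * d)) = (\<Sum>d\<in>below (degree c). F ((g * d) mod c))"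
    by (intro sum.cong refl assms(3)) (simp add: dvd_minus_mod)
  also have "\<dots> = (\<Sum>d\<in>below (degree c). F d)" by (rule sum.reindex_bij_betw[OF mult_mod_bij[OF assms(1,2)]])
  finally show ?thesis .
qed

lemma gauss_summand_cong:
  "c dvd d - e \<Longrightarrow> \<chi> c d * echar (f * d) c = \<chi> c e * echar (f * e) c"
proof -
  assume *: "c dvd d - e"
  then have "c dvd f * d - f * e" by (simp flip: right_diff_distrib)
  then show ?thesis using chi_cong[OF *] echar_cong by metis
qed

lemma gauss_mult_coprime:
  assumes c: "c \<noteq> 0" and cop: "coprime c g"
  shows "gauss (f * g) c * \<chi> c g = gauss f c"
proof -
  have "gauss (f * g) c * \<chi> c g = (\<Sum>d\<in>below (degree c). \<chi> c (g * d) * echar (f * (g * d)) c)"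
    unfolding gauss_def sum_distrib_right by (intro sum.cong refl) (simp add: chi_mult mult_ac)
  also have "\<dots> = gauss f c"
    unfolding gauss_def by (rule sum_residues_mult[OF c cop gauss_summand_cong])
  finally show ?thesis .
qed

text \<open>
  \<open>\<chi>\<^sub>c(g) ^ (- 2) = \<chi>\<^sub>c(g)\<close>, as the symbol is cubic.
\<close>

lemma gauss_mult_square:
  assumes c: "c \<noteq> 0" and cop: "coprime c g"
  shows "gauss (f * g ^ 2) c = \<chi> c g * gauss f c"
proof -
  have "gauss (f * g ^ 2) c * \<chi> c g * \<chi> c g = gauss f c"
    using gauss_mult_coprime[OF c cop, of f] gauss_mult_coprime[OF c cop, of "f * g"]
    by (simp add: power2_eq_square mult.assoc)
  then have "gauss (f * g ^ 2) c * \<chi> c g ^ 3 = \<chi> c g * gauss f c"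
    by (simp add: power3_eq_cube mult_ac)
  then show ?thesis using chi_cube[OF c] chi_eq_0_iff_coprime[OF c] cop by simp
qed

lemma gauss_minus:
  assumes "c \<in> monics k"
  shows "gauss (- f) c = gauss f c"
proof -
  have "coprime c (- 1)" by (rule coprimeI) simp
  then show ?thesis
  using assms gauss_mult_coprime[of c "- 1" f] monics_nonzero[of c k] chi_minus[of c k 1] chi_const[of c 1]
    by (simp add: monicsD one_pCons[symmetric])
qed

text \<open>
  If \<open>P\<close> divides the modulus exactly once or twice, the additive character \<open>e(f P\<^sup>2 d / (P ^ e c))\<close> depends
  on \<open>d\<close> modulo \<open>c\<close> only. So the Gauss sum is invariant under multiplication of \<open>d\<close> by a unit that is
  \<open>1\<close> modulo \<open>c\<close>, whereas \<open>\<chi>\<close> changes by a nontrivial factor.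
\<close>

lemma gauss_exact_power_eq_0:
  assumes P: "monic_irreducible P" and c: "lead_coeff c = 1" "\<not> P dvd c" and e: "e = 1 \<or> e = 2"
  shows "gauss (f * P ^ 2) (P ^ e * c) = 0"
proof -
  obtain x where x: "\<chi> P x \<noteq> 0" "\<chi> P x \<noteq> 1" using chi_nontrivial[OF P] by blast
  have lP: "lead_coeff P = 1" and P0: "P \<noteq> 0" using P by (auto simp: monic_irreducible_def)
  have c0: "c \<noteq> 0" using c by auto
  obtain t where t: "P dvd c * t - 1"
    using ex_mod_inverse[of P c] c(2) coprime_monic_irreducible_iff[OF P] by blast
  \<comment> \<open>By the Chinese remainder theorem, \<open>g\<close> is \<open>1\<close> modulo \<open>c\<close> and \<open>x\<close> modulo \<open>P\<close>.\<close>
  define g where "g = 1 + c * (t * (x - 1))"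
  have "P dvd (c * t - 1) * (x - 1)" using t by simp
  moreover have "(c * t - 1) * (x - 1) = g - x" by (simp add: g_def algebra_simps)
  ultimately have gP: "\<chi> P g = \<chi> P x" using chi_cong[of P g x \<iota>] by simp
  have gc: "\<chi> c g = 1"
  proof -
    have "\<chi> c g = \<chi> c [:1:]" by (rule chi_cong) (simp add: g_def one_pCons[symmetric])
    then show ?thesis using chi_const[OF c(1), of 1] by simp
  qed
  have lPe: "lead_coeff (P ^ e) = 1" using lP by (simp add: lead_coeff_power)
  have pe: "\<chi> (P ^ e) g = \<chi> P g ^ e"
    using e lP by (auto simp: chi_mult_modulus power2_eq_square)
  define b where "b = P ^ e * c"
  have b0: "b \<noteq> 0" using P0 c0 by (simp add: b_def)
  have bg: "\<chi> b g = \<chi> P x ^ e" unfolding b_def chi_mult_modulus[OF lPe c(1)] pe gP gc by simp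
  have ne1: "\<chi> P x ^ e \<noteq> 1"
  proof
    assume 1: "\<chi> P x ^ e = 1"
    then have "e = 2" using e x by auto
    then have "\<chi> P x ^ 3 = \<chi> P x" using 1 by (simp add: power3_eq_cube power2_eq_square)
    then show False using chi_cube[OF P0 x(1)] x(2) by simp
  qed
  have cop: "coprime b g" using chi_eq_0_iff_coprime[OF b0, of g] bg x(1) by simp
  have split: "P ^ 2 = P ^ (2 - e) * P ^ e" using e by (auto simp: power2_eq_square)
  have E: "echar (f * P ^ 2 * d) b = echar (f * P ^ (2 - e) * d) c" for d
  proof -
    have 1: "f * P ^ 2 * d = f * P ^ (2 - e) * d * P ^ e" unfolding split by (simp add: mult_ac)
    show ?thesis unfolding b_def 1 mult.commute[of "P ^ e" c] by (rule echar_cancel[OF c0 lPe])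
  qed
  have Eg: "echar (f * P ^ 2 * (g * d)) b = echar (f * P ^ 2 * d) b" for d
    unfolding E by (rule echar_cong) (simp add: g_def algebra_simps)
  have "gauss (f * P ^ 2) b = (\<Sum>d\<in>below (degree b). \<chi> b (g * d) * echar (f * P ^ 2 * (g * d)) b)"
    unfolding gauss_def by (rule sum_residues_mult[OF b0 cop gauss_summand_cong, symmetric])
  also have "\<dots> = \<chi> P x ^ e * gauss (f * P ^ 2) b"
    unfolding gauss_def Eg chi_mult bg by (simp add: sum_distrib_left mult.assoc)
  finally have "gauss (f * P ^ 2) b * (1 - \<chi> P x ^ e) = 0" by (simp add: algebra_simps)
  then show ?thesis using ne1 unfolding b_def by simp
qed

lemma chi_cube_modulus:
  assumes P: "monic_irreducible P" and c: "lead_coeff c = 1"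
  shows "\<chi> (P ^ 3 * c) d = (if P dvd d then 0 else \<chi> c d)"
proof -
  have lP: "lead_coeff P = 1" and P0: "P \<noteq> 0" using P by (auto simp: monic_irreducible_def)
  have c0: "c \<noteq> 0" using c by auto
  have "\<chi> (P ^ 3 * c) d = \<chi> P d ^ 3 * \<chi> c d"
    using P0 c0 by (simp add: power3_eq_cube mult.assoc chi_irreducible_mult[OF P] chi_irreducible[OF P])
  moreover have "\<chi> P d = 0 \<longleftrightarrow> P dvd d"
    using chi_eq_0_iff_coprime[OF P0] coprime_monic_irreducible_iff[OF P] by blast
  ultimately show ?thesis using chi_cube[OF P0] by auto
qed

lemma below_multiples:
  fixes P :: "'a poly"
  assumes "P \<in> monics n"
  shows "{d \<in> below (n + b). P dvd d} = (\<lambda>d. P * d) ` below b"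
proof (intro equalityI subsetI)
  fix d assume d: "d \<in> {d \<in> below (n + b). P dvd d}"
  then obtain e where e: "d = P * e" by blast
  have "e \<in> below b"
    using d e monics_nonzero[OF assms] monicsD(1)[OF assms] by (cases "e = 0") (auto simp: below_iff degree_mult_eq)
  then show "d \<in> (\<lambda>d. P * d) ` below b" using e by blast
next
  fix d assume "d \<in> (\<lambda>d. P * d) ` below b"
  then show "d \<in> {d \<in> below (n + b). P dvd d}"
    using below_mult[of _ b P n] monicsD(1)[OF assms] by (auto simp: mult.commute add.commute)
qed

lemma sum_below_multiples:
  fixes P :: "'a poly" and F :: "'a poly \<Rightarrow> complex"
  assumes "P \<in> monics n"
  shows "(\<Sum>d\<in>below (n + b). if P dvd d then 0 else F d) = (\<Sum>d\<in>below (n + b). F d) - (\<Sum>d\<in>below b. F (P * d))"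
proof -
  have "(\<Sum>d\<in>below (n + b). F d) = (\<Sum>d\<in>below (n + b). if P dvd d then 0 else F d) + (\<Sum>d\<in>below (n + b). if P dvd d then F d else 0)"
    unfolding sum.distrib[symmetric] by (intro sum.cong) auto
  moreover have "(\<Sum>d\<in>below (n + b). if P dvd d then F d else 0) = (\<Sum>d | d \<in> below (n + b) \<and> P dvd d. F d)"
    by (simp add: sum.inter_filter)
  moreover have "\<dots> = (\<Sum>d\<in>below b. F (P * d))"
    unfolding below_multiples[OF assms]
    by (subst sum.reindex) (use monics_nonzero[OF assms] in \<open>auto simp: inj_on_def\<close>)
  ultimately show ?thesis by simp
qed

text \<open>
  The symbol modulo \<open>P ^ 3 c\<close> is that modulo \<open>c\<close>, restricted to \<open>d\<close> prime to \<open>P\<close>. Without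
  the restriction the sum vanishes, because the additive character is nontrivial on the multiples of
  \<open>c\<close>; so the sum is minus the contribution of the multiples of \<open>P\<close>.
\<close>

lemma gauss_cube_modulus:
  assumes P: "monic_irreducible P" "P \<in> monics n" and c: "c \<in> monics k" and f: "\<not> P dvd f"
  shows "gauss (f * P ^ 2) (P ^ 3 * c) = - (qc ^ (2 * n) * \<chi> c P * gauss f c)"
proof -
  have c0: "c \<noteq> 0" and lc: "lead_coeff c = 1" using c monics_nonzero by (auto simp: monicsD)
  have P0: "P \<noteq> 0" and lP: "lead_coeff P = 1" using P monics_nonzero by (auto simp: monicsD)
  have Pc: "P * c \<in> monics (n + k)" using monics_mult[OF P(2) c] .
  have P2: "P ^ 2 \<in> monics (2 * n)" using monics_mult[OF P(2) P(2)] by (simp add: power2_eq_square mult_2)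
  have P3c: "P ^ 3 * c \<in> monics (2 * n + (n + k))"
    using monics_mult[OF P2 Pc] by (simp add: power3_eq_cube power2_eq_square mult.assoc)
  have E: "echar (f * P ^ 2 * d) (P ^ 3 * c) = echar (f * d) (P * c)" for d
  proof -
    have 1: "f * P ^ 2 * d = f * d * P ^ 2" and 2: "P ^ 3 * c = P * c * P ^ 2"
      by (simp_all add: power3_eq_cube power2_eq_square mult_ac)
    show ?thesis unfolding 1 2 by (rule echar_cancel[OF monics_nonzero[OF Pc] monicsD(3)[OF P2]])
  qed
  define F where "F = (\<lambda>d. if P dvd d then 0 else \<chi> c d * echar (f * d) (P * c))"
  have per: "F (w * (P * c) + d) = F d" for w d
  proof -
    have "\<chi> c (w * (P * c) + d) = \<chi> c d" by (rule chi_cong) simp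
    moreover have "echar (f * (w * (P * c) + d)) (P * c) = echar (f * d) (P * c)"
      by (rule echar_cong) (simp add: algebra_simps)
    moreover have "P dvd w * (P * c) + d \<longleftrightarrow> P dvd d" by (simp add: dvd_add_right_iff)
    ultimately show ?thesis by (simp add: F_def)
  qed
  have "gauss (f * P ^ 2) (P ^ 3 * c) = (\<Sum>d\<in>below (2 * n + (n + k)). F d)"
    unfolding gauss_def monicsD(1)[OF P3c] E chi_cube_modulus[OF P(1) lc] F_def by (intro sum.cong) auto
  also have "\<dots> = of_nat (CARD('a) ^ (2 * n)) * (\<Sum>d\<in>below (n + k). F d)"
    using sum_below_residues[OF Pc, of "2 * n + (n + k)" F] per by simp
  also have "(\<Sum>d\<in>below (n + k). F d) = (\<Sum>d\<in>below (n + k). \<chi> c d * echar (f * d) (P * c))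
      - (\<Sum>d\<in>below k. \<chi> c (P * d) * echar (f * (P * d)) (P * c))"
    unfolding F_def by (rule sum_below_multiples[OF P(2)])
  also have "(\<Sum>d\<in>below (n + k). \<chi> c d * echar (f * d) (P * c)) = 0"
  proof -
    have z: "(\<Sum>w\<in>below n. echar (w * f) P) = 0"
    proof -
      have "(\<Sum>w\<in>below n. echar (w * f) P) = (\<Sum>w\<in>below n. echar (w * (f mod P)) P)"
        by (intro sum.cong refl echar_cong) (simp add: right_diff_distrib[symmetric] dvd_minus_mod)
      also have "\<dots> = 0"
      proof -
        have "f mod P \<in> below (degree P)" "f mod P \<noteq> 0"
          using mod_in_below[OF P0] f by (auto simp: mod_eq_0_iff_dvd)
        then show ?thesis using sum_echar[OF lP, of "f mod P" n] monicsD(1)[OF P(2)] by simp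
      qed
      finally show ?thesis .
    qed
    have "(\<Sum>d\<in>below (n + k). \<chi> c d * echar (f * d) (P * c))
        = (\<Sum>w\<in>below n. \<Sum>d\<in>below k. \<chi> c (w * c + d) * echar (f * (w * c + d)) (P * c))"
      unfolding sum_below_division[OF c le_add2, of _ n] add_diff_cancel_right' by (rule refl)
    also have "\<dots> = (\<Sum>w\<in>below n. \<Sum>d\<in>below k. echar (w * f) P * (\<chi> c d * echar (f * d) (P * c)))"
    proof (intro sum.cong refl)
      fix w d :: "'a poly"
      have "f * (w * c + d) = w * f * c + f * d" by (simp add: algebra_simps)
      then show "\<chi> c (w * c + d) * echar (f * (w * c + d)) (P * c) = echar (w * f) P * (\<chi> c d * echar (f * d) (P * c))"
        using echar_cancel[OF P0 lc, of "w * f"] by (simp add: echar_add)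
    qed
    also have "\<dots> = 0" unfolding sum_distrib_left[symmetric] sum_distrib_right[symmetric] z by simp
    finally show ?thesis .
  qed
  also have "(\<Sum>d\<in>below k. \<chi> c (P * d) * echar (f * (P * d)) (P * c)) = \<chi> c P * gauss f c"
    unfolding gauss_def sum_distrib_left monicsD(1)[OF c]
  proof (intro sum.cong refl)
    fix d
    have 1: "f * (P * d) = f * d * P" and 2: "P * c = c * P" by (simp_all add: mult_ac)
    show "\<chi> c (P * d) * echar (f * (P * d)) (P * c) = \<chi> c P * (\<chi> c d * echar (f * d) c)"
      unfolding 1 2 echar_cancel[OF c0 lP] by (simp only: chi_mult mult.assoc)
  qed
  finally show ?thesis by simp
qed

lemma gauss_0_cube_modulus:
  assumes P: "monic_irreducible P" "P \<in> monics n" and c: "c \<in> monics k"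
  shows "gauss 0 (P ^ 3 * c) = (if P dvd c then qc ^ (3 * n) else qc ^ (3 * n) - qc ^ (2 * n)) * gauss 0 c"
proof -
  have c0: "c \<noteq> 0" and lc: "lead_coeff c = 1" using c monics_nonzero by (auto simp: monicsD)
  have P0: "P \<noteq> 0" using P monics_nonzero by auto
  have P2: "P ^ 2 \<in> monics (2 * n)" using monics_mult[OF P(2) P(2)] by (simp add: power2_eq_square mult_2)
  have P3c: "P ^ 3 * c \<in> monics (n + (2 * n + k))"
    using monics_mult[OF P(2) monics_mult[OF P2 c]] by (simp add: power3_eq_cube power2_eq_square mult.assoc)
  have S: "(\<Sum>d\<in>below (b + k). \<chi> c d) = qc ^ b * gauss 0 c" for b
    using sum_below_residues[OF c, of "b + k" "\<chi> c"] by (simp add: gauss_def monicsD(1)[OF c])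
  have "gauss 0 (P ^ 3 * c) = (\<Sum>d\<in>below (n + (2 * n + k)). if P dvd d then 0 else \<chi> c d)"
    unfolding gauss_def monicsD(1)[OF P3c] chi_cube_modulus[OF P(1) lc] by (intro sum.cong) auto
  also have "\<dots> = (\<Sum>d\<in>below (n + (2 * n + k)). \<chi> c d) - (\<Sum>d\<in>below (2 * n + k). \<chi> c (P * d))"
    by (rule sum_below_multiples[OF P(2)])
  also have "\<dots> = qc ^ (3 * n) * gauss 0 c - qc ^ (2 * n) * (\<chi> c P * gauss 0 c)"
  proof -
    have "(\<Sum>d\<in>below (2 * n + k). \<chi> c (P * d)) = \<chi> c P * (\<Sum>d\<in>below (2 * n + k). \<chi> c d)"
      unfolding sum_distrib_left by (simp only: chi_mult)
    moreover have "n + (2 * n + k) = 3 * n + k" by simp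
    ultimately show ?thesis using S[of "3 * n"] S[of "2 * n"] by (simp only: mult_ac)
  qed
  also have "\<chi> c P * gauss 0 c = (if P dvd c then 0 else gauss 0 c)"
  proof (cases "P dvd c")
    case True
    then have "\<chi> c P = 0" using chi_eq_0[OF c0, of P] P(1) by auto
    then show ?thesis using True by simp
  next
    case False
    then have "coprime c P" using coprime_monic_irreducible_iff[OF P(1), of c] by (simp add: coprime_commute)
    then show ?thesis using gauss_mult_coprime[OF c0, of P 0] False by (simp add: mult.commute)
  qed
  finally show ?thesis by (cases "P dvd c") (simp_all add: algebra_simps)
qed

text \<open>
  Moduli that \<open>P\<close> divides exactly once or twice contribute nothing.
\<close>

lemma sum_multiples_gauss:
  assumes P: "monic_irreducible P" "P \<in> monics n"
  shows "(\<Sum>c\<in>monics a. if P dvd c then gauss (f * P ^ 2) c else 0)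
    = (if 3 * n \<le> a then \<Sum>c\<in>monics (a - 3 * n). gauss (f * P ^ 2) (P ^ 3 * c) else 0)"
proof -
  have P0: "P \<noteq> 0" and lP: "lead_coeff P = 1" using P monics_nonzero by (auto simp: monicsD)
  have P3: "P ^ 3 \<in> monics (3 * n)"
  proof -
    have "n + (n + n) = 3 * n" by simp
    then show ?thesis using monics_mult[OF P(2) monics_mult[OF P(2) P(2)]] by (simp only: power3_eq_cube mult.assoc)
  qed
  have van: "gauss (f * P ^ 2) c = 0" if c: "c \<in> monics a" "P dvd c" "\<not> P ^ 3 dvd c" for c
  proof -
    obtain b where b: "c = P * b" using c by blast
    have lb: "lead_coeff b = 1" using monicsD(3)[OF c(1)] lP unfolding b lead_coeff_mult by simp
    show ?thesis
    proof (cases "P dvd b")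
      case False
      then show ?thesis using gauss_exact_power_eq_0[OF P(1) lb False, of 1 f] by (simp add: b)
    next
      case True
      then obtain d where d: "b = P * d" by blast
      have ld: "lead_coeff d = 1" using lb lP unfolding d lead_coeff_mult by simp
      have "\<not> P dvd d" using c(3) unfolding b d by (auto simp: power3_eq_cube mult.assoc mult_dvd_mono)
      then show ?thesis using gauss_exact_power_eq_0[OF P(1) ld, of 2 f] by (simp add: b d power2_eq_square mult.assoc)
    qed
  qed
  have "(\<Sum>c\<in>monics a. if P dvd c then gauss (f * P ^ 2) c else 0) = (\<Sum>c | c \<in> monics a \<and> P ^ 3 dvd c. gauss (f * P ^ 2) c)"
  proof -
    have "(\<Sum>c\<in>monics a. if P dvd c then gauss (f * P ^ 2) c else 0) = (\<Sum>c\<in>monics a. if P ^ 3 dvd c then gauss (f * P ^ 2) c else 0)"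
    proof (intro sum.cong refl)
      fix c assume c: "c \<in> (monics a :: 'a poly set)"
      have "P dvd P ^ 3" by (simp add: dvd_power)
      then show "(if P dvd c then gauss (f * P ^ 2) c else 0) = (if P ^ 3 dvd c then gauss (f * P ^ 2) c else 0)"
        using van[OF c] dvd_trans by auto
    qed
    then show ?thesis by (simp add: sum.inter_filter)
  qed
  also have "{c. c \<in> monics a \<and> P ^ 3 dvd c} = (if 3 * n \<le> a then (\<lambda>c. P ^ 3 * c) ` monics (a - 3 * n) else {})"
  proof (cases "3 * n \<le> a")
    case True
    have "c \<in> (\<lambda>c. P ^ 3 * c) ` monics (a - 3 * n)" if "c \<in> monics a" "P ^ 3 dvd c" for c
      using that monics_mult_cancel[OF P3, of _ "a - 3 * n"] True by auto
    moreover have "P ^ 3 * c \<in> monics a" if "c \<in> monics (a - 3 * n)" for c using monics_mult[OF P3 that] True by simp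
    ultimately show ?thesis using True by auto
  next
    case False
    have "False" if "c \<in> monics a" "P ^ 3 dvd c" for c
      using that dvd_imp_degree_le[OF that(2) monics_nonzero[OF that(1)]] monicsD(1)[OF P3] monicsD(1)[OF that(1)] False by simp
    then show ?thesis using False by auto
  qed
  also have "(\<Sum>c\<in>(if 3 * n \<le> a then (\<lambda>c. P ^ 3 * c) ` monics (a - 3 * n) else {}). gauss (f * P ^ 2) c)
      = (if 3 * n \<le> a then \<Sum>c\<in>monics (a - 3 * n). gauss (f * P ^ 2) (P ^ 3 * c) else 0)"
    using P0 by (auto simp: sum.reindex inj_on_def)
  finally show ?thesis .
qed

definition coprime_moment :: "'a poly \<Rightarrow> 'a poly \<Rightarrow> nat \<Rightarrow> complex" where
  "coprime_moment P f k = (\<Sum>p\<in>monics k. if P dvd p then 0 else \<chi> p P * gauss f p)"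

definition multiple_total :: "'a poly \<Rightarrow> nat \<Rightarrow> complex" where
  "multiple_total P k = (\<Sum>p\<in>monics k. if P dvd p then gauss 0 p else 0)"

lemma total_gauss: "total k = (\<Sum>p\<in>monics k. gauss 0 p)"
  unfolding total_def gauss_def by (intro sum.cong) (simp_all add: monicsD)

text \<open>
  The moduli prime to \<open>P\<close> give \<open>coprime_moment\<close>; those divisible by \<open>P\<close> are multiples of \<open>P ^ 3\<close>, and
  what remains of them is again a sum over moduli prime to \<open>P\<close>. The factor \<open>\<chi>\<^sub>p(P)\<close> in
  \<open>coprime_moment\<close> is what multiplication of \<open>f\<close> by \<open>P\<^sup>2\<close> contributes.
\<close>

lemma gauss_moment_mult_square:
  assumes P: "monic_irreducible P" "P \<in> monics n" and f: "\<not> P dvd f"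
  shows "gauss_moment (f * P ^ 2) a = coprime_moment P f a - (if 3 * n \<le> a then qc ^ (2 * n) * coprime_moment P f (a - 3 * n) else 0)"
proof -
  have van: "\<chi> c P = 0" if "c \<in> monics k" "P dvd c" for c k
    using chi_eq_0[OF monics_nonzero[OF that(1)], of P] that(2) P(1) by auto
  have "gauss_moment (f * P ^ 2) a = (\<Sum>c\<in>monics a. if P dvd c then 0 else gauss (f * P ^ 2) c)
      + (\<Sum>c\<in>monics a. if P dvd c then gauss (f * P ^ 2) c else 0)"
    unfolding gauss_moment_def sum.distrib[symmetric] by (intro sum.cong) auto
  also have "(\<Sum>c\<in>monics a. if P dvd c then 0 else gauss (f * P ^ 2) c) = coprime_moment P f a"
    unfolding coprime_moment_def
  proof (intro sum.cong refl)
    fix c :: "'a poly" assume c: "c \<in> monics a"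
    show "(if P dvd c then 0 else gauss (f * P ^ 2) c) = (if P dvd c then 0 else \<chi> c P * gauss f c)"
      using gauss_mult_square[OF monics_nonzero[OF c], of P f] coprime_monic_irreducible_iff[OF P(1), of c]
      by (auto simp: coprime_commute)
  qed
  also have "(\<Sum>c\<in>monics a. if P dvd c then gauss (f * P ^ 2) c else 0)
      = (if 3 * n \<le> a then \<Sum>c\<in>monics (a - 3 * n). - (qc ^ (2 * n) * \<chi> c P * gauss f c) else 0)"
    unfolding sum_multiples_gauss[OF P] by (intro if_cong refl sum.cong gauss_cube_modulus[OF P _ f])
  also have "\<dots> = - (if 3 * n \<le> a then qc ^ (2 * n) * coprime_moment P f (a - 3 * n) else 0)"
  proof -
    have "(\<Sum>c\<in>monics (a - 3 * n). - (qc ^ (2 * n) * \<chi> c P * gauss f c)) = - (qc ^ (2 * n) * coprime_moment P f (a - 3 * n))"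
      unfolding coprime_moment_def sum_distrib_left sum_negf[symmetric]
      by (intro sum.cong refl) (auto simp: van)
    then show ?thesis by simp
  qed
  finally show ?thesis by simp
qed

lemma multiple_total_rec:
  assumes P: "monic_irreducible P" "P \<in> monics n"
  shows "multiple_total P a = (if 3 * n \<le> a then (qc ^ (3 * n) - qc ^ (2 * n)) * total (a - 3 * n) + qc ^ (2 * n) * multiple_total P (a - 3 * n) else 0)"
proof -
  have "multiple_total P a = (\<Sum>c\<in>monics a. if P dvd c then gauss (0 * P ^ 2) c else 0)"
    by (simp only: multiple_total_def mult_zero_left)
  also have "\<dots> = (if 3 * n \<le> a then \<Sum>c\<in>monics (a - 3 * n). gauss (0 * P ^ 2) (P ^ 3 * c) else 0)"
    by (rule sum_multiples_gauss[OF P])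
  also have "\<dots> = (if 3 * n \<le> a then \<Sum>c\<in>monics (a - 3 * n).
      (qc ^ (3 * n) - qc ^ (2 * n)) * gauss 0 c + qc ^ (2 * n) * (if P dvd c then gauss 0 c else 0) else 0)"
  proof -
    have "gauss (0 * P ^ 2) (P ^ 3 * c) = (qc ^ (3 * n) - qc ^ (2 * n)) * gauss 0 c + qc ^ (2 * n) * (if P dvd c then gauss 0 c else 0)"
      if "c \<in> monics k" for c k
      unfolding mult_zero_left gauss_0_cube_modulus[OF P that] by (cases "P dvd c") (simp_all add: algebra_simps)
    then show ?thesis by (intro if_cong refl sum.cong)
  qed
  finally show ?thesis
    by (simp only: total_gauss multiple_total_def sum.distrib sum_distrib_left[symmetric])
qed

lemma coprime_moment_0:
  assumes P: "monic_irreducible P"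
  shows "coprime_moment P 0 k = total k - multiple_total P k"
proof -
  have "coprime_moment P 0 k = (\<Sum>p\<in>monics k. gauss 0 p - (if P dvd p then gauss 0 p else 0))"
    unfolding coprime_moment_def
  proof (intro sum.cong refl)
    fix p :: "'a poly" assume p: "p \<in> monics k"
    show "(if P dvd p then 0 else \<chi> p P * gauss 0 p) = gauss 0 p - (if P dvd p then gauss 0 p else 0)"
      using gauss_mult_coprime[OF monics_nonzero[OF p], of P 0] coprime_monic_irreducible_iff[OF P, of p]
      by (auto simp: coprime_commute mult.commute)
  qed
  then show ?thesis by (simp add: total_gauss multiple_total_def sum_subtractf)
qed

section \<open>Splitting the sum over multiples of a prime\<close>

definition inv_mod :: "'a poly \<Rightarrow> 'a poly \<Rightarrow> 'a poly" where
  "inv_mod P f = (SOME g. P dvd f * g - 1)"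

lemma inv_mod:
  assumes "monic_irreducible P" "\<not> P dvd f"
  shows "P dvd f * inv_mod P f - 1"
proof -
  obtain g where "P dvd f * g - 1"
    using ex_mod_inverse[of P f] assms coprime_monic_irreducible_iff by blast
  then show ?thesis unfolding inv_mod_def by (rule someI)
qed

lemma sum_echar_dvd:
  fixes P :: "'a poly"
  assumes P: "P \<in> monics n"
  shows "(\<Sum>j\<in>below n. echar (j * x) P) = (if P dvd x then qc ^ n else 0)"
proof -
  have P0: "P \<noteq> 0" and d: "degree P = n" using P monics_nonzero by (auto simp: monicsD)
  have "(\<Sum>j\<in>below n. echar (j * x) P) = (\<Sum>j\<in>below n. echar (j * (x mod P)) P)"
    by (intro sum.cong refl echar_cong) (simp add: right_diff_distrib[symmetric] dvd_minus_mod)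
  also have "\<dots> = (if x mod P \<in> below (n - n) then of_nat (CARD('a) ^ n) else 0)"
    using sum_echar[OF monicsD(3)[OF P], of "x mod P" n] mod_in_below[OF P0, of x] by (simp add: d)
  finally show ?thesis by (simp add: mod_eq_0_iff_dvd)
qed

text \<open>
  Reciprocity of additive characters, \<open>e(j s p' / P) e(j s P' / p) = e(j s / (p P))\<close>, where
  \<open>p p' + P P' = 1\<close>; the right-hand side is \<open>1\<close> because \<open>deg j < deg P\<close> and \<open>deg s < deg p\<close>.
\<close>

lemma sum_chi_echar_inv:
  assumes P: "monic_irreducible P" "P \<in> monics n" and p: "p \<in> monics k" "\<not> P dvd p" and j: "j \<in> below n"
  shows "(\<Sum>s\<in>below k. \<chi> p s * echar (j * s * inv_mod P p) P) = \<chi> p P * gauss j p"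
proof -
  have P0: "P \<noteq> 0" and p0: "p \<noteq> 0" and lP: "lead_coeff P = 1" and lp: "lead_coeff p = 1"
    using P p monics_nonzero by (auto simp: monicsD)
  have cop: "coprime p P" using coprime_monic_irreducible_iff[OF P(1), of p] p(2) by (simp add: coprime_commute)
  then obtain u v where uv: "p * u + P * v = 1" using coprime_bezout by blast
  have inv: "echar (j * s * inv_mod P p) P = echar (j * s * u) P" for s
  proof (rule echar_cong)
    have "P dvd p * inv_mod P p - 1" by (rule inv_mod[OF P(1) p(2)])
    moreover have "P dvd p * u - 1"
    proof -
      have "p * u - 1 = P * (- v)" using uv by (simp add: algebra_simps eq_diff_eq)
      then show ?thesis by simp
    qed
    ultimately have "P dvd (p * inv_mod P p - 1) - (p * u - 1)" by (rule dvd_diff)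
    then have "P dvd p * (inv_mod P p - u)" by (simp add: algebra_simps)
    then have "P dvd inv_mod P p - u"
      by (rule coprime_dvd_mult_poly[OF coprime_commute[THEN iffD1, OF cop]])
    then have "P dvd j * s * (inv_mod P p - u)" by (rule dvd_mult)
    then show "P dvd j * s * inv_mod P p - j * s * u" by (simp add: algebra_simps)
  qed
  have rec: "echar (j * s * u) P = echar (- j * (v * s)) p" if s: "s \<in> below k" for s
  proof -
    have "echar (j * s * u) P * echar (j * s * v) p = echar (j * s * u * p + j * s * v * P) (P * p)"
      by (rule echar_common_denominator[OF lP lp])
    also have "j * s * u * p + j * s * v * P = j * s * (p * u + P * v)" by (simp add: algebra_simps)
    also have "\<dots> = j * s" using uv by simp
    also have "echar (j * s) (P * p) = 1"
    proof (cases "j = 0 \<or> s = 0")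
      case False
      then have "degree (j * s) < n + k - 1"
        using j s degree_mult_le[of j s] by (auto simp: below_iff)
      then show ?thesis using monicsD(1)[OF monics_mult[OF P(2) p(1)]] by (intro echar_small) (simp add: below_iff)
    qed auto
    finally have 1: "echar (j * s * u) P * echar (j * s * v) p = 1" .
    have c1: "echar (j * s * v) p * cnj (echar (j * s * v) p) = 1"
      unfolding complex_norm_square[symmetric] by simp
    have "echar (j * s * u) P = echar (j * s * u) P * (echar (j * s * v) p * cnj (echar (j * s * v) p))"
      unfolding c1 by simp
    then have "echar (j * s * u) P = echar (j * s * u) P * echar (j * s * v) p * cnj (echar (j * s * v) p)"
      by (simp only: mult.assoc)
    then have "echar (j * s * u) P = cnj (echar (j * s * v) p)" unfolding 1 by simp
    then show ?thesis using echar_minus[of "j * s * v" p] by (simp add: mult_ac)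
  qed
  define F where "F = (\<lambda>s. \<chi> p s * echar (- j * (v * s)) p)"
  have F: "F s = F s'" if "p dvd s - s'" for s s'
  proof -
    have "p dvd - j * v * (s - s')" using that by (rule dvd_mult)
    then have "p dvd - j * (v * s) - - j * (v * s')" by (simp add: algebra_simps)
    then show ?thesis unfolding F_def using echar_cong chi_cong[OF that] by metis
  qed
  have "(\<Sum>s\<in>below k. \<chi> p s * echar (j * s * inv_mod P p) P) = (\<Sum>s\<in>below (degree p). F s)"
    unfolding F_def monicsD(1)[OF p(1)] by (intro sum.cong refl) (simp add: inv rec)
  also have "\<dots> = (\<Sum>s\<in>below (degree p). F (P * s))" by (rule sum_residues_mult[OF p0 cop F, symmetric])
  also have "\<dots> = (\<Sum>s\<in>below (degree p). \<chi> p P * (\<chi> p s * echar (- j * s) p))"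
  proof (intro sum.cong refl)
    fix s
    have "echar (- j * (v * (P * s))) p = echar (- j * s) p"
    proof (rule echar_cong)
      have "- j * (v * (P * s)) - - j * s = j * s * (1 - P * v)" by (simp add: algebra_simps)
      also have "1 - P * v = p * u" using uv by (simp add: algebra_simps eq_diff_eq)
      finally show "p dvd - j * (v * (P * s)) - - j * s" by simp
    qed
    then show "F (P * s) = \<chi> p P * (\<chi> p s * echar (- j * s) p)" by (simp add: F_def chi_mult mult.assoc)
  qed
  also have "\<dots> = \<chi> p P * gauss (- j) p" unfolding gauss_def by (simp add: sum_distrib_left)
  finally show ?thesis by (simp only: gauss_minus[OF p(1)])
qed

text \<open>
  Replacing \<open>q\<close> by the first entry of the complementary row conjugates the symbol, since
  \<open>q s \<equiv> - 1\<close> modulo \<open>p\<close>.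
\<close>

lemma sum_chi_complement:
  assumes p: "p \<in> monics k"
  shows "(\<Sum>q\<in>below k. \<chi> p q * B (fst (complement p q))) = (\<Sum>s\<in>below k. cnj (\<chi> p s) * B s)"
proof -
  let ?S = "{q \<in> below k. coprime p q}"
  let ?f = "\<lambda>q. fst (complement p q)"
  have p0: "p \<noteq> 0" using p by (rule monics_nonzero)
  have C: "?f q \<in> below k" "p dvd q * ?f q + 1" if "coprime p q" for q
  proof -
    show "?f q \<in> below k" by (rule complement(1)[OF p that])
    have "p * snd (complement p q) - q * ?f q = 1" by (rule complement(2)[OF p that])
    then have "q * ?f q + 1 = p * snd (complement p q)" by (simp add: algebra_simps)
    then show "p dvd q * ?f q + 1" by simp
  qed
  have cop: "coprime p (?f q)" if "coprime p q" for q
  proof (rule coprimeI)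
    fix d assume d: "d dvd p" "d dvd ?f q"
    then have "d dvd q * ?f q + 1" using C(2)[OF that] dvd_trans by blast
    moreover have "d dvd q * ?f q" using d(2) by (rule dvd_mult)
    ultimately show "is_unit d" using dvd_add_right_iff by blast
  qed
  have inj: "inj_on ?f ?S"
  proof (rule inj_onI)
    fix q q' assume q: "q \<in> ?S" "q' \<in> ?S" "?f q = ?f q'"
    have "p dvd (q * ?f q + 1) - (q' * ?f q' + 1)" using C(2)[of q] C(2)[of q'] q by (intro dvd_diff) auto
    then have "p dvd ?f q * (q - q')" unfolding q(3) by (simp add: algebra_simps)
    then have "p dvd q - q'" using coprime_dvd_mult_poly[OF cop] q(1) by blast
    then have "q mod p = q' mod p" by (simp only: mod_eq_dvd_iff)
    moreover have "q mod p = q" "q' mod p = q'" using q(1,2) monicsD(1)[OF p] by (auto intro!: mod_below)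
    ultimately show "q = q'" by simp
  qed
  have sub: "?f ` ?S \<subseteq> ?S" using C(1) cop by auto
  have "finite ?S" by simp
  then have bij: "bij_betw ?f ?S ?S" using endo_inj_surj[OF _ sub inj] inj by (simp add: bij_betw_def)
  have conj: "\<chi> p q = cnj (\<chi> p (?f q))" if "coprime p q" for q
  proof -
    have "\<chi> p q * \<chi> p (?f q) = \<chi> p (- 1)"
      unfolding chi_mult[symmetric] by (rule chi_cong) (use C(2)[OF that] in simp)
    also have "\<dots> = 1" using chi_minus[OF p, of 1] chi_const[OF monicsD(3)[OF p], of 1] by (simp add: one_pCons[symmetric])
    finally have 1: "\<chi> p q * \<chi> p (?f q) = 1" .
    then have nz: "\<chi> p (?f q) \<noteq> 0" by auto
    then have "cnj (\<chi> p (?f q)) * \<chi> p (?f q) = 1" using chi_mult_cnj[OF p0 nz] by (simp add: mult.commute)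
    then show ?thesis using 1 nz by (metis mult_right_cancel)
  qed
  have van: "\<chi> p q = 0" if "\<not> coprime p q" for q using that chi_eq_0_iff_coprime[OF p0] by blast
  have "(\<Sum>q\<in>below k. \<chi> p q * B (?f q)) = (\<Sum>q\<in>?S. \<chi> p q * B (?f q))"
    by (rule sum.mono_neutral_right) (auto simp: van)
  also have "\<dots> = (\<Sum>q\<in>?S. cnj (\<chi> p (?f q)) * B (?f q))"
    using conj by (intro sum.cong refl) auto
  also have "\<dots> = (\<Sum>s\<in>?S. cnj (\<chi> p s) * B s)" by (rule sum.reindex_bij_betw[OF bij])
  also have "\<dots> = (\<Sum>s\<in>below k. cnj (\<chi> p s) * B s)"
    by (rule sum.mono_neutral_left) (auto simp: van)
  finally show ?thesis .
qed

text \<open>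
  The sum over the polynomials \<open>u w\<close> of exact degree \<open>t\<close>, weighted by a power of the character of the
  leading coefficient \<open>u\<close>. It weighs the middle quotients when a fraction is cut.
\<close>

definition partial_gauss :: "'a poly \<Rightarrow> nat \<Rightarrow> nat \<Rightarrow> 'a poly \<Rightarrow> complex" where
  "partial_gauss P t e j = (\<Sum>w\<in>monics t. \<Sum>u\<in>UNIV - {0}. chi0 u ^ e * echar (j * smult u w) P)"

lemma prime_dvd_mult: "monic_irreducible P \<Longrightarrow> P dvd f * g \<longleftrightarrow> P dvd f \<or> P dvd (g :: 'a poly)"
  using monic_irreducible_prime_elem by (rule prime_elem_dvd_mult_iff)

text \<open>
  If \<open>P\<close> divides neither \<open>p\<close> nor \<open>r\<close>, then \<open>P dvd c\<close> for \<open>c = (u w r + r') p + r s\<close> is a congruence for \<open>u w\<close>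
  modulo \<open>P\<close>, which additive characters detect. If \<open>P\<close> divides both, the condition always holds; if it
  divides exactly one of them, the condition never holds.
\<close>

lemma sum_middle_quotient:
  assumes P: "monic_irreducible P" "P \<in> monics n" and ps: "coprime p s" and rr: "coprime r r'"
  shows "(\<Sum>w\<in>monics t. \<Sum>u\<in>UNIV - {0}. chi0 u ^ e * (if P dvd (smult u w * r + r') * p + r * s then 1 else 0))
    = (if P dvd p \<and> P dvd r then qc ^ t * field_gauss e 0 else 0)
      + (if P dvd p \<or> P dvd r then 0 else (\<Sum>j\<in>below n. partial_gauss P t e j *
          (echar (j * s * inv_mod P p) P * echar (j * r' * inv_mod P r) P)) / qc ^ n)"
proof -
  have nu: "\<not> is_unit P" using P(1) by (simp add: monic_irreducible_def irreducible_not_unit)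
  have nps: "\<not> (P dvd p \<and> P dvd s)" "\<not> (P dvd r \<and> P dvd r')"
    using nu ps rr coprime_common_divisor by blast+
  have both: "(P dvd (w * r + r') * p + r * s) \<longleftrightarrow> P dvd p \<and> P dvd r" if "P dvd p \<or> P dvd r" for w
  proof (cases "P dvd p")
    case True
    then have "P dvd (w * r + r') * p" by simp
    then have "(P dvd (w * r + r') * p + r * s) \<longleftrightarrow> P dvd r * s" by (rule dvd_add_right_iff)
    then show ?thesis using True nps prime_dvd_mult[OF P(1)] by blast
  next
    case False
    then have r: "P dvd r" using that by blast
    then have "(P dvd (w * r + r') * p + r * s) \<longleftrightarrow> P dvd (w * r + r') * p" by (simp add: dvd_add_left_iff)
    also have "\<dots> \<longleftrightarrow> P dvd w * r + r'" using False prime_dvd_mult[OF P(1)] by blast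
    also have "\<dots> \<longleftrightarrow> P dvd r'" using r by (simp add: dvd_add_right_iff)
    finally show ?thesis using nps r False by blast
  qed
  show ?thesis
  proof (cases "P dvd p \<or> P dvd r")
    case True
    have "(\<Sum>w\<in>monics t. \<Sum>u\<in>UNIV - {0}. chi0 u ^ e * (if P dvd (smult u w * r + r') * p + r * s then 1 else 0))
        = (\<Sum>w\<in>(monics t :: 'a poly set). (if P dvd p \<and> P dvd r then field_gauss e 0 else 0))"
      unfolding both[OF True] field_gauss_def by (intro sum.cong refl) simp
    then show ?thesis using True by (simp add: card_monics)
  next
    case False
    have pi: "P dvd p * inv_mod P p - 1" and ri: "P dvd r * inv_mod P r - 1" using inv_mod[OF P(1)] False by blast+
    have cond: "(P dvd (w * r + r') * p + r * s) \<longleftrightarrow> P dvd w + s * inv_mod P p + r' * inv_mod P r" for w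
    proof -
      have "P dvd p * r * (w + s * inv_mod P p + r' * inv_mod P r) - ((w * r + r') * p + r * s)"
      proof -
        have "p * r * (w + s * inv_mod P p + r' * inv_mod P r) - ((w * r + r') * p + r * s)
            = r * s * (p * inv_mod P p - 1) + p * r' * (r * inv_mod P r - 1)" by (simp add: algebra_simps)
        then show ?thesis using pi ri by (simp add: dvd_add)
      qed
      then have "(P dvd (w * r + r') * p + r * s) \<longleftrightarrow> P dvd p * r * (w + s * inv_mod P p + r' * inv_mod P r)"
        by (metis dvd_diffD dvd_diffD1 dvd_diff_commute dvd_minus_iff diff_add_cancel dvd_add)
      then show ?thesis using False prime_dvd_mult[OF P(1)] by blast
    qed
    have ind: "(if P dvd w + s * inv_mod P p + r' * inv_mod P r then 1 else 0)
        = (\<Sum>j\<in>below n. echar (j * w) P * (echar (j * s * inv_mod P p) P * echar (j * r' * inv_mod P r) P)) / qc ^ n" for w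
    proof -
      have "(\<Sum>j\<in>below n. echar (j * w) P * (echar (j * s * inv_mod P p) P * echar (j * r' * inv_mod P r) P))
          = (\<Sum>j\<in>below n. echar (j * (w + s * inv_mod P p + r' * inv_mod P r)) P)"
        by (intro sum.cong refl) (simp add: echar_add[symmetric] algebra_simps)
      then show ?thesis by (simp add: sum_echar_dvd[OF P(2)])
    qed
    have "(\<Sum>w\<in>monics t. \<Sum>u\<in>UNIV - {0}. chi0 u ^ e * (if P dvd (smult u w * r + r') * p + r * s then 1 else 0))
      = (\<Sum>w\<in>monics t. \<Sum>u\<in>UNIV - {0}. \<Sum>j\<in>below n. chi0 u ^ e * echar (j * smult u w) P *
          ((echar (j * s * inv_mod P p) P * echar (j * r' * inv_mod P r) P) / qc ^ n))"
      unfolding cond ind by (intro sum.cong refl) (simp add: sum_distrib_left sum_divide_distrib mult.assoc)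
    also have "\<dots> = (\<Sum>w\<in>monics t. \<Sum>j\<in>below n. \<Sum>u\<in>UNIV - {0}. chi0 u ^ e * echar (j * smult u w) P *
          ((echar (j * s * inv_mod P p) P * echar (j * r' * inv_mod P r) P) / qc ^ n))"
      by (intro sum.cong refl sum.swap)
    also have "\<dots> = (\<Sum>j\<in>below n. \<Sum>w\<in>monics t. \<Sum>u\<in>UNIV - {0}. chi0 u ^ e * echar (j * smult u w) P *
          ((echar (j * s * inv_mod P p) P * echar (j * r' * inv_mod P r) P) / qc ^ n))"
      by (rule sum.swap)
    also have "\<dots> = (\<Sum>j\<in>below n. partial_gauss P t e j *
          (echar (j * s * inv_mod P p) P * echar (j * r' * inv_mod P r) P)) / qc ^ n"
      unfolding partial_gauss_def sum_distrib_right sum_divide_distrib by simp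
    finally show ?thesis using False by auto
  qed
qed

text \<open>
  Division with remainder of \<open>R\<close> by \<open>r\<close>: the symbol of \<open>(R, r)\<close> becomes that of \<open>(r, r')\<close>, and
  only the leading coefficient \<open>u\<close> of the quotient \<open>u w\<close> remains.
\<close>

lemma sum_divide_pair:
  assumes J: "3 dvd J" and k: "k < h" "h \<le> J"
  shows "(\<Sum>R\<in>monics (J - k). \<Sum>r\<in>below (J - h + 1). \<chi> R r * (if P dvd R * p + r * s then 1 else 0)) =
    (\<Sum>l<J - h + 1. \<Sum>r\<in>monics l. \<Sum>r'\<in>below l. \<chi> r r' *
      (\<Sum>w\<in>monics (J - k - l). \<Sum>u\<in>UNIV - {0}. chi0 u ^ (k + 2 * l) * (if P dvd (smult u w * r + r') * p + r * s then 1 else 0)))"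
proof -
  define b where "b = J - k"
  let ?E = "\<lambda>R r. if P dvd R * p + r * s then 1 else 0 :: complex"
  have b: "b > 0" using k by (simp add: b_def)
  have "(\<Sum>R\<in>monics b. \<Sum>r\<in>below (J - h + 1). \<chi> R r * ?E R r)
      = (\<Sum>R\<in>monics b. \<Sum>l<J - h + 1. \<Sum>r\<in>monics l. \<Sum>y\<in>UNIV - {0}. \<chi> R (smult y r) * ?E R (smult y r))"
    using b chi_zero by (intro sum.cong refl sum_below_leading) (auto simp: monicsD)
  also have "\<dots> = (\<Sum>l<J - h + 1. \<Sum>r\<in>monics l. \<Sum>y\<in>UNIV - {0}. \<Sum>R\<in>monics b. \<chi> R (smult y r) * ?E R (smult y r))"
    by (rule sum_swap_inner)
  also have "\<dots> = (\<Sum>l<J - h + 1. \<Sum>r\<in>monics l. \<Sum>r'\<in>below l. \<chi> r r' *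
      (\<Sum>w\<in>monics (b - l). \<Sum>u\<in>UNIV - {0}. chi0 u ^ (k + 2 * l) * (if P dvd (smult u w * r + r') * p + r * s then 1 else 0)))"
  proof (intro sum.cong refl)
    fix l r assume l: "l \<in> {..<J - h + 1}" and r: "r \<in> (monics l :: 'a poly set)"
    have lb: "l \<le> b" using l k by (simp add: b_def)
    have step: "(\<Sum>R\<in>monics b. \<chi> R (smult y r) * ?E R (smult y r))
        = (\<Sum>w\<in>monics (b - l). \<Sum>r'\<in>below l. chi0 (inverse y) ^ (k + 2 * l) * \<chi> r r' *
            (if P dvd (smult (inverse y) w * r + r') * p + r * s then 1 else 0))" if y: "y \<noteq> 0" for y
    proof -
      have "(\<Sum>R\<in>monics b. \<chi> R (smult y r) * ?E R (smult y r)) = (\<Sum>R\<in>monics b. chi0 y ^ b * \<chi> r R * ?E R (smult y r))"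
        using chi_recip[OF _ r] by (intro sum.cong refl) (simp add: chi_smult[OF _ y])
      also have "\<dots> = (\<Sum>w\<in>monics (b - l). \<Sum>d\<in>below l. chi0 y ^ b * \<chi> r (w * r + d) * ?E (w * r + d) (smult y r))"
        by (rule sum_monics_division[OF r lb])
      also have "\<dots> = (\<Sum>w\<in>monics (b - l). \<Sum>d\<in>below l. chi0 y ^ b * \<chi> r d * ?E (w * r + d) (smult y r))"
        by (intro sum.cong refl) (simp only: chi_translate)
      also have "\<dots> = (\<Sum>w\<in>monics (b - l). \<Sum>d\<in>below l. chi0 y ^ b * \<chi> r (smult y d) * ?E (w * r + smult y d) (smult y r))"
        by (rule sum.cong[OF refl], rule sum_below_smult[OF y, symmetric])
      also have "\<dots> = (\<Sum>w\<in>monics (b - l). \<Sum>r'\<in>below l. chi0 (inverse y) ^ (k + 2 * l) * \<chi> r r' *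
            (if P dvd (smult (inverse y) w * r + r') * p + r * s then 1 else 0))"
      proof (intro sum.cong refl)
        fix w r' :: "'a poly"
        have e: "chi0 y ^ b * chi0 y ^ l = chi0 (inverse y) ^ (k + 2 * l)"
        proof -
          have "b + l + (k + 2 * l) = J + 3 * l" using lb k by (simp add: b_def)
          then have "chi0 y ^ (b + l) * chi0 y ^ (k + 2 * l) = 1"
            using J y by (subst power_add[symmetric], intro chi0_power_eq_1) auto
          moreover have "chi0 (inverse y) ^ (k + 2 * l) * chi0 y ^ (k + 2 * l) = 1"
            unfolding power_mult_distrib[symmetric] chi0_mult[symmetric] using y by simp
          moreover have "chi0 y ^ (k + 2 * l) \<noteq> 0" using y by simp
          ultimately have "chi0 y ^ (b + l) = chi0 (inverse y) ^ (k + 2 * l)" by (metis mult_right_cancel)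
          then show ?thesis by (simp add: power_add)
        qed
        have s: "chi0 y ^ b * \<chi> r (smult y r') = chi0 (inverse y) ^ (k + 2 * l) * \<chi> r r'"
          unfolding chi_smult[OF r y] e[symmetric] by (simp only: mult_ac)
        have "(w * r + smult y r') * p + smult y r * s = smult y ((smult (inverse y) w * r + r') * p + r * s)"
          using y by (simp add: smult_add_right algebra_simps)
        then have "?E (w * r + smult y r') (smult y r) = (if P dvd (smult (inverse y) w * r + r') * p + r * s then 1 else 0)"
          using y by (simp add: dvd_smult_iff)
        with s show "chi0 y ^ b * \<chi> r (smult y r') * ?E (w * r + smult y r') (smult y r)
            = chi0 (inverse y) ^ (k + 2 * l) * \<chi> r r' * (if P dvd (smult (inverse y) w * r + r') * p + r * s then 1 else 0)"
          by (simp only:)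
      qed
      finally show ?thesis .
    qed
    have "(\<Sum>y\<in>UNIV - {0}. \<Sum>R\<in>monics b. \<chi> R (smult y r) * ?E R (smult y r))
        = (\<Sum>y\<in>UNIV - {0}. \<Sum>w\<in>monics (b - l). \<Sum>r'\<in>below l. chi0 (inverse y) ^ (k + 2 * l) * \<chi> r r' *
            (if P dvd (smult (inverse y) w * r + r') * p + r * s then 1 else 0))"
      by (rule sum.cong[OF refl], rule step) simp
    also have "\<dots> = (\<Sum>u\<in>UNIV - {0}. \<Sum>w\<in>monics (b - l). \<Sum>r'\<in>below l. chi0 u ^ (k + 2 * l) * \<chi> r r' *
            (if P dvd (smult u w * r + r') * p + r * s then 1 else 0))"
      by (rule sum.reindex_bij_witness[of _ inverse inverse]) auto
    also have "\<dots> = (\<Sum>r'\<in>below l. \<Sum>w\<in>monics (b - l). \<Sum>u\<in>UNIV - {0}. chi0 u ^ (k + 2 * l) * \<chi> r r' *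
            (if P dvd (smult u w * r + r') * p + r * s then 1 else 0))"
    proof -
      have "(\<Sum>u\<in>UNIV - {0}. \<Sum>w\<in>monics (b - l). \<Sum>r'\<in>below l. F u w r') = (\<Sum>r'\<in>below l. \<Sum>w\<in>monics (b - l). \<Sum>u\<in>UNIV - {0}. F u w r')"
        for F :: "'a \<Rightarrow> 'a poly \<Rightarrow> 'a poly \<Rightarrow> complex"
      proof -
        have "(\<Sum>u\<in>UNIV - {0}. \<Sum>w\<in>monics (b - l). \<Sum>r'\<in>below l. F u w r') = (\<Sum>u\<in>UNIV - {0}. \<Sum>r'\<in>below l. \<Sum>w\<in>monics (b - l). F u w r')"
          by (intro sum.cong refl sum.swap)
        also have "\<dots> = (\<Sum>r'\<in>below l. \<Sum>u\<in>UNIV - {0}. \<Sum>w\<in>monics (b - l). F u w r')" by (rule sum.swap)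
        also have "\<dots> = (\<Sum>r'\<in>below l. \<Sum>w\<in>monics (b - l). \<Sum>u\<in>UNIV - {0}. F u w r')"
          by (intro sum.cong refl sum.swap)
        finally show ?thesis .
      qed
      then show ?thesis .
    qed
    also have "\<dots> = (\<Sum>r'\<in>below l. \<chi> r r' *
      (\<Sum>w\<in>monics (b - l). \<Sum>u\<in>UNIV - {0}. chi0 u ^ (k + 2 * l) * (if P dvd (smult u w * r + r') * p + r * s then 1 else 0)))"
      unfolding sum_distrib_left by (intro sum.cong refl) (simp only: mult_ac)
    finally show "(\<Sum>y\<in>UNIV - {0}. \<Sum>R\<in>monics b. \<chi> R (smult y r) * ?E R (smult y r)) = \<dots>" .
  qed
  finally show ?thesis unfolding b_def .
qed

text \<open>
  The sum over the multiples of \<open>P\<close> as a Hermitian form in the moments, obtained by cutting every fraction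
  \<open>d / c\<close> at the height \<open>h\<close> into two fractions with denominators of degree \<open>k\<close> and \<open>l\<close> and a middle
  quotient of degree \<open>J - k - l\<close>. The form is Hermitian, not merely bilinear, because passing from \<open>q\<close> to
  the complementary row conjugates the symbol of the first fraction.
\<close>

theorem multiple_total_cut:
  assumes P: "monic_irreducible P" "P \<in> monics n" and J: "3 dvd J" and h: "1 \<le> h" "h \<le> J"
  shows "multiple_total P J = (\<Sum>k<h. \<Sum>l<J - h + 1.
      qc ^ (J - k - l) * field_gauss (k + 2 * l) 0 * (cnj (multiple_total P k) * multiple_total P l)
      + (\<Sum>j\<in>below n. partial_gauss P (J - k - l) (k + 2 * l) j * (cnj (coprime_moment P j k) * coprime_moment P j l)) / qc ^ n)"
proof -
  let ?V = "\<lambda>k. monics k \<times> (below k :: 'a poly set)"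
  define a where "a = (\<lambda>(p, s). if P dvd p then \<chi> p s else 0)"
  define b where "b = (\<lambda>j (p, s). if P dvd p then 0 else \<chi> p s * echar (j * s * inv_mod P p) P)"
  define N where "N = (\<lambda>k l p s r r'. \<Sum>w\<in>monics (J - k - l). \<Sum>u\<in>UNIV - {0}. chi0 u ^ (k + 2 * l) *
      (if P dvd (smult u w * r + r') * p + r * s then 1 else 0 :: complex))"
  have sum_a: "(\<Sum>x\<in>?V k. a x) = multiple_total P k" for k
  proof -
    have "(\<Sum>x\<in>?V k. a x) = (\<Sum>p\<in>monics k. \<Sum>s\<in>below k. if P dvd p then \<chi> p s else 0)"
      unfolding a_def by (simp add: sum.cartesian_product)
    also have "\<dots> = multiple_total P k"
      unfolding multiple_total_def gauss_def by (intro sum.cong refl) (simp add: monicsD)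
    finally show ?thesis .
  qed
  have sum_b: "(\<Sum>x\<in>?V k. b j x) = coprime_moment P j k" if "j \<in> below n" for j k
  proof -
    have "(\<Sum>x\<in>?V k. b j x) = (\<Sum>p\<in>monics k. \<Sum>s\<in>below k. if P dvd p then 0 else \<chi> p s * echar (j * s * inv_mod P p) P)"
      unfolding b_def by (simp add: sum.cartesian_product)
    also have "\<dots> = coprime_moment P j k"
      unfolding coprime_moment_def using sum_chi_echar_inv[OF P _ _ that] by (intro sum.cong refl) simp
    finally show ?thesis .
  qed
  have cm_minus: "coprime_moment P (- j) k = coprime_moment P j k" for j k
    unfolding coprime_moment_def by (intro sum.cong refl) (simp add: gauss_minus)
  have point: "cnj (\<chi> p s) * (\<chi> r r' * N k l p s r r')
      = qc ^ (J - k - l) * field_gauss (k + 2 * l) 0 * (cnj (a (p, s)) * a (r, r'))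
        + (\<Sum>j\<in>below n. partial_gauss P (J - k - l) (k + 2 * l) j * (cnj (b (- j) (p, s)) * b j (r, r'))) / qc ^ n"
    if p: "p \<in> monics k" and r: "r \<in> monics l" for p s r r' k l
  proof (cases "coprime p s \<and> coprime r r'")
    case False
    then have "\<chi> p s = 0 \<or> \<chi> r r' = 0"
      using chi_eq_0_iff_coprime[OF monics_nonzero[OF p]] chi_eq_0_iff_coprime[OF monics_nonzero[OF r]] by blast
    moreover have "cnj (a (p, s)) * a (r, r') = 0" and z: "cnj (b (- j) (p, s)) * b j (r, r') = 0" for j
      using calculation by (auto simp: a_def b_def)
    ultimately show ?thesis unfolding z by auto
  next
    case True
    have cb: "cnj (b (- j) (p, s)) * b j (r, r') = (if P dvd p \<or> P dvd r then 0 else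
        cnj (\<chi> p s) * \<chi> r r' * (echar (j * s * inv_mod P p) P * echar (j * r' * inv_mod P r) P))" for j
      using echar_minus[of "j * s * inv_mod P p" P] by (simp add: b_def mult_ac)
    have N: "N k l p s r r' = (if P dvd p \<and> P dvd r then qc ^ (J - k - l) * field_gauss (k + 2 * l) 0 else 0)
      + (if P dvd p \<or> P dvd r then 0 else (\<Sum>j\<in>below n. partial_gauss P (J - k - l) (k + 2 * l) j *
          (echar (j * s * inv_mod P p) P * echar (j * r' * inv_mod P r) P)) / qc ^ n)"
      unfolding N_def using True by (intro sum_middle_quotient[OF P]) auto
    have d: "(\<Sum>j\<in>below n. F j * (if C then 0 else K * G j)) / Q = (if C then 0 else K * ((\<Sum>j\<in>below n. F j * G j) / Q))"
      for F G :: "'a poly \<Rightarrow> complex" and C K Q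
      by (simp add: sum_distrib_left mult_ac)
    show ?thesis unfolding N cb d by (simp add: a_def algebra_simps)
  qed
  have "multiple_total P J = (\<Sum>c\<in>monics J. \<Sum>d\<in>below J. \<chi> c d * (if P dvd c then 1 else 0))"
    unfolding multiple_total_def gauss_def by (intro sum.cong refl) (simp add: monicsD)
  also have "\<dots> = (\<Sum>k<h. \<Sum>p\<in>monics k. \<Sum>q\<in>below k. \<chi> p q *
       (\<Sum>R\<in>monics (J - k). \<Sum>r\<in>below (J - h + 1). \<chi> R r *
          (if P dvd R * p + r * fst (complement p q) then 1 else 0)))"
    by (rule chi_sum_cut[OF h])
  also have "\<dots> = (\<Sum>k<h. \<Sum>p\<in>monics k. \<Sum>s\<in>below k. cnj (\<chi> p s) *
       (\<Sum>R\<in>monics (J - k). \<Sum>r\<in>below (J - h + 1). \<chi> R r * (if P dvd R * p + r * s then 1 else 0)))"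
    by (intro sum.cong refl sum_chi_complement)
  also have "\<dots> = (\<Sum>k<h. \<Sum>p\<in>monics k. \<Sum>s\<in>below k. cnj (\<chi> p s) *
       (\<Sum>l<J - h + 1. \<Sum>r\<in>monics l. \<Sum>r'\<in>below l. \<chi> r r' * N k l p s r r'))"
    unfolding N_def using h by (intro sum.cong refl arg_cong2[of _ _ _ _ "(*)"] sum_divide_pair[OF J]) auto
  also have "\<dots> = (\<Sum>k<h. \<Sum>(p, s)\<in>?V k. \<Sum>l<J - h + 1. \<Sum>(r, r')\<in>?V l. cnj (\<chi> p s) * (\<chi> r r' * N k l p s r r'))"
    unfolding sum.cartesian_product[symmetric] sum_distrib_left ..
  also have "\<dots> = (\<Sum>k<h. \<Sum>l<J - h + 1. \<Sum>(p, s)\<in>?V k. \<Sum>(r, r')\<in>?V l. cnj (\<chi> p s) * (\<chi> r r' * N k l p s r r'))"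
    unfolding case_prod_unfold by (rule sum.cong[OF refl], rule sum.swap)
  also have "\<dots> = (\<Sum>k<h. \<Sum>l<J - h + 1. \<Sum>x\<in>?V k. \<Sum>y\<in>?V l.
      qc ^ (J - k - l) * field_gauss (k + 2 * l) 0 * (cnj (a x) * a y)
        + (\<Sum>j\<in>below n. partial_gauss P (J - k - l) (k + 2 * l) j * (cnj (b (- j) x) * b j y)) / qc ^ n)"
    by (intro sum.cong refl) (auto simp: case_prod_unfold point intro!: sum.cong)
  also have "\<dots> = (\<Sum>k<h. \<Sum>l<J - h + 1.
      qc ^ (J - k - l) * field_gauss (k + 2 * l) 0 * (cnj (multiple_total P k) * multiple_total P l)
      + (\<Sum>j\<in>below n. partial_gauss P (J - k - l) (k + 2 * l) j * (cnj (coprime_moment P j k) * coprime_moment P j l)) / qc ^ n)"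
  proof (intro sum.cong refl)
    fix k l
    let ?G = "partial_gauss P (J - k - l) (k + 2 * l)"
    have prod: "(\<Sum>x\<in>?V k. \<Sum>y\<in>?V l. cnj (f x) * g y) = cnj (\<Sum>x\<in>?V k. f x) * (\<Sum>y\<in>?V l. g y)"
      for f g :: "'a poly \<times> 'a poly \<Rightarrow> complex" by (simp add: sum_product)
    have "(\<Sum>x\<in>?V k. \<Sum>y\<in>?V l. (\<Sum>j\<in>below n. ?G j * (cnj (b (- j) x) * b j y)) / qc ^ n)
        = (\<Sum>x\<in>?V k. \<Sum>j\<in>below n. \<Sum>y\<in>?V l. ?G j * (cnj (b (- j) x) * b j y) / qc ^ n)"
      unfolding sum_divide_distrib by (intro sum.cong refl sum.swap)
    also have "\<dots> = (\<Sum>j\<in>below n. \<Sum>x\<in>?V k. \<Sum>y\<in>?V l. ?G j * (cnj (b (- j) x) * b j y) / qc ^ n)"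
      by (rule sum.swap)
    also have "\<dots> = (\<Sum>j\<in>below n. ?G j * (\<Sum>x\<in>?V k. \<Sum>y\<in>?V l. cnj (b (- j) x) * b j y)) / qc ^ n"
      by (simp add: sum_distrib_left sum_divide_distrib)
    also have "\<dots> = (\<Sum>j\<in>below n. ?G j * (cnj (coprime_moment P j k) * coprime_moment P j l)) / qc ^ n"
      by (intro arg_cong2[of _ _ _ _ "(/)"] sum.cong refl) (simp add: prod sum_b below_uminus cm_minus)
    finally have 2: "(\<Sum>x\<in>?V k. \<Sum>y\<in>?V l. (\<Sum>j\<in>below n. ?G j * (cnj (b (- j) x) * b j y)) / qc ^ n) = \<dots>" .
    have "(\<Sum>x\<in>?V k. \<Sum>y\<in>?V l. qc ^ (J - k - l) * field_gauss (k + 2 * l) 0 * (cnj (a x) * a y))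
        = qc ^ (J - k - l) * field_gauss (k + 2 * l) 0 * (cnj (multiple_total P k) * multiple_total P l)"
      by (simp only: sum_distrib_left[symmetric]) (simp only: sum_distrib_left[symmetric] sum_distrib_right[symmetric] cnj_sum[symmetric] sum_a)
    with 2 show "(\<Sum>x\<in>?V k. \<Sum>y\<in>?V l. qc ^ (J - k - l) * field_gauss (k + 2 * l) 0 * (cnj (a x) * a y)
        + (\<Sum>j\<in>below n. ?G j * (cnj (b (- j) x) * b j y)) / qc ^ n)
      = qc ^ (J - k - l) * field_gauss (k + 2 * l) 0 * (cnj (multiple_total P k) * multiple_total P l)
        + (\<Sum>j\<in>below n. ?G j * (cnj (coprime_moment P j k) * coprime_moment P j l)) / qc ^ n"
      unfolding sum.distrib by (simp only:)
  qed
  finally show ?thesis .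
qed

section \<open>Vanishing of the moments of \<open>j P\<^sup>2\<close>\<close>

text \<open>
  The product \<open>j w\<close> has degree below \<open>n\<close>, and only the product of the leading coefficients reaches the
  coefficient that the additive character reads.
\<close>

lemma echar_top_coeff:
  fixes j w P :: "'a poly"
  assumes P: "P \<in> monics n" and j: "j \<noteq> 0" "degree j + m + 1 = n" and w: "w \<in> below (Suc m)"
  shows "echar (j * w) P = add_char (lead_coeff j * coeff w m)"
proof -
  define g where "g = smult (inverse (lead_coeff j)) j"
  have g: "g \<in> monics (degree j)" and jg: "j = smult (lead_coeff j) g"
    using j by (auto simp: g_def monics_iff)
  have "j * w \<in> below (degree P)"
    using below_mult[OF w, of j "degree j"] j(2) monicsD(1)[OF P] by (simp add: mult.commute algebra_simps)
  then have e: "echar (j * w) P = add_char (coeff (j * w) (n - 1))"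
    using monicsD(1)[OF P] by (simp add: echar_below)
  have "j * w = smult (lead_coeff j) (w * g)"
    by (subst jg) (simp add: mult.commute)
  then have "coeff (j * w) (n - 1) = coeff (smult (lead_coeff j) (w * g)) (n - 1)" by simp
  also have "coeff (smult (lead_coeff j) (w * g)) (n - 1) = lead_coeff j * coeff (w * g) (Suc m + degree j - 1)"
    using j(2) by (simp add: algebra_simps)
  also have "coeff (w * g) (Suc m + degree j - 1) = coeff w m"
    using coeff_mult_monic[OF w g] by simp
  finally show ?thesis using e by simp
qed

lemma partial_gauss_0: "partial_gauss P t e 0 = qc ^ t * field_gauss e 0"
  unfolding partial_gauss_def field_gauss_def by (simp add: card_monics)

lemma partial_gauss_short:
  fixes j P :: "'a poly"
  assumes P: "P \<in> monics n" and j: "j \<noteq> 0" "degree j + m + 1 = n" and t: "t \<le> m"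
  shows "partial_gauss P t e j = qc ^ t * field_gauss e (if t = m then lead_coeff j else 0)"
proof -
  have "echar (j * smult u w) P = add_char ((if t = m then lead_coeff j else 0) * u)" if w: "w \<in> monics t" for w u
  proof -
    have "smult u w \<in> below (Suc m)" using t monicsD(1)[OF w] by (auto simp: below_iff)
    moreover have "coeff w m = (if t = m then 1 else 0)"
      using t monicsD[OF w] by (auto intro: coeff_eq_0)
    ultimately show ?thesis using echar_top_coeff[OF P j, of "smult u w"] by (simp del: mult_smult_right)
  qed
  then have "partial_gauss P t e j = (\<Sum>w\<in>(monics t :: 'a poly set). field_gauss e (if t = m then lead_coeff j else 0))"
    unfolding partial_gauss_def field_gauss_def by (intro sum.cong refl) simp
  then show ?thesis by (simp add: card_monics)
qed

text \<open>
  Changing the coefficient of \<open>T ^ m\<close> in \<open>w\<close> moves the additive character through all its values.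
\<close>

lemma partial_gauss_long:
  fixes j P :: "'a poly"
  assumes P: "P \<in> monics n" and j: "j \<noteq> 0" "degree j + m + 1 = n" and t: "m < t"
  shows "partial_gauss P t e j = 0"
proof -
  have "(\<Sum>w\<in>monics t. echar (j * smult u w) P) = 0" if u: "u \<noteq> 0" for u
  proof -
    let ?S = "\<Sum>w\<in>monics t. echar (j * smult u w) P"
    obtain a :: 'a where a: "add_char a \<noteq> 1" using ex_add_char_neq_1 by blast
    define z where "z = monom (a / (lead_coeff j * u)) m"
    have z: "z \<in> below t" using t by (auto simp: z_def below_def)
    have "smult u z \<in> below (Suc m)" by (auto simp: z_def below_def)
    then have ez: "echar (j * smult u z) P = add_char a"
      using echar_top_coeff[OF P j, of "smult u z"] j u by (simp add: z_def)
    have "?S = (\<Sum>w\<in>monics t. echar (j * smult u (w + z)) P)"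
      by (rule sum_monics_translate[OF z, symmetric])
    also have "\<dots> = (\<Sum>w\<in>monics t. echar (j * smult u w) P * add_char a)"
      by (intro sum.cong refl) (simp only: smult_add_right distrib_left echar_add ez)
    also have "\<dots> = ?S * add_char a" by (rule sum_distrib_right[symmetric])
    finally have "?S * (add_char a - 1) = 0" by (simp add: algebra_simps)
    then show ?thesis using a by simp
  qed
  then have "(\<Sum>u\<in>UNIV - {0}. chi0 u ^ e * (\<Sum>w\<in>monics t. echar (j * smult u w) P)) = 0" by simp
  moreover have "partial_gauss P t e j = (\<Sum>u\<in>UNIV - {0}. chi0 u ^ e * (\<Sum>w\<in>monics t. echar (j * smult u w) P))"
    unfolding partial_gauss_def by (subst sum.swap) (simp only: sum_distrib_left)
  ultimately show ?thesis by simp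
qed

lemma total_eq_0: "\<not> 3 dvd k \<Longrightarrow> total k = 0"
  using total_eq[of k] by (cases "k = 0") auto

lemma multiple_total_eq_0:
  assumes P: "monic_irreducible P" "P \<in> monics n" and n: "n > 0" and k: "\<not> 3 dvd k"
  shows "multiple_total P k = 0"
  using k
proof (induction k rule: less_induct)
  case (less k)
  show ?case
  proof (cases "3 * n \<le> k")
    case True
    have nd: "\<not> 3 dvd k - 3 * n"
      using less.prems dvd_diffD[OF _ dvd_triv_left True] by blast
    have "multiple_total P (k - 3 * n) = 0" by (rule less.IH[OF _ nd]) (use n True in linarith)
    then show ?thesis unfolding multiple_total_rec[OF P, of k] total_eq_0[OF nd] by simp
  qed (unfold multiple_total_rec[OF P, of k], simp)
qed

lemma cnj_qc [simp]: "cnj qc = qc"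
  unfolding qc_def by (rule complex_cnj_of_nat)

lemma cnj_total [simp]: "cnj (total k) = total k"
  using total_eq[of k] by (cases "k = 0") (auto simp: total_0)

lemma cnj_multiple_total:
  assumes P: "monic_irreducible P" "P \<in> monics n" and n: "n > 0"
  shows "cnj (multiple_total P k) = multiple_total P k"
proof (induction k rule: less_induct)
  case (less k)
  then show ?case
    using multiple_total_rec[OF P, of k] n by (cases "3 * n \<le> k") auto
qed

definition scaled_sum :: "(nat \<Rightarrow> complex) \<Rightarrow> nat \<Rightarrow> complex" where
  "scaled_sum x h = (\<Sum>k<h. x k / qc ^ k)"

lemma scaled_sum_total: "scaled_sum total (Suc k) = qc ^ (k div 3)"
  unfolding scaled_sum_def by (rule sum_total)

text \<open>
  The recursion of \<open>multiple_total\<close>, summed. The closed forms below follow from it by induction on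
  \<open>N\<close>.
\<close>

lemma scaled_sum_multiple_total:
  assumes P: "monic_irreducible P" "P \<in> monics n"
  shows "scaled_sum (multiple_total P) (3 * n + h) =
    (1 - 1 / qc ^ n) * scaled_sum total h + scaled_sum (multiple_total P) h / qc ^ n"
proof (induction h)
  case 0
  have "multiple_total P k = 0" if "k < 3 * n" for k
    using multiple_total_rec[OF P, of k] that by simp
  then show ?case by (simp add: scaled_sum_def)
next
  case (Suc h)
  have "multiple_total P (3 * n + h) / qc ^ (3 * n + h)
      = (1 - 1 / qc ^ n) * (total h / qc ^ h) + multiple_total P h / qc ^ h / qc ^ n"
  proof -
    have e: "multiple_total P (3 * n + h) = (qc ^ (3 * n) - qc ^ (2 * n)) * total h + qc ^ (2 * n) * multiple_total P h"
      using multiple_total_rec[OF P, of "3 * n + h"] by simp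
    have q: "qc ^ (3 * n) = qc ^ n * qc ^ n * qc ^ n" "qc ^ (2 * n) = qc ^ n * qc ^ n"
      by (simp_all add: power_mult power2_eq_square power3_eq_cube mult.commute[of _ n])
    have "((z * z * z - z * z) * a + z * z * b) / (z * z * z * w) = (1 - 1 / z) * (a / w) + b / w / z"
      if "z \<noteq> 0" "w \<noteq> 0" for z w a b :: complex using that by (simp add: field_simps)
    then show ?thesis unfolding e power_add q by simp
  qed
  then show ?case using Suc by (simp add: scaled_sum_def algebra_simps add_divide_distrib)
qed

lemma qc_power_plus_1_nonzero: "qc ^ n + 1 \<noteq> 0"
proof
  assume "qc ^ n + 1 = 0"
  then have "of_nat (CARD('a) ^ n + 1) = (0 :: complex)"
    unfolding of_nat_add of_nat_power of_nat_card of_nat_1 .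
  then show False unfolding of_nat_eq_0_iff by simp
qed

lemma scaled_sum_multiple_total_succ:
  assumes P: "monic_irreducible P" "P \<in> monics n"
  shows "scaled_sum (multiple_total P) (3 * n * N + 1) = (qc ^ (n * N) - 1 / qc ^ (n * N)) / (qc ^ n + 1)"
proof (induction N)
  case 0
  show ?case using multiple_total_rec[OF P, of 0] total_0 P
    by (cases "n = 0") (auto simp: scaled_sum_def multiple_total_def monic_irreducible_def)
next
  case (Suc N)
  have "scaled_sum (multiple_total P) (3 * n * Suc N + 1) = scaled_sum (multiple_total P) (3 * n + (3 * n * N + 1))"
    by (simp add: algebra_simps)
  also have "\<dots> = (1 - 1 / qc ^ n) * qc ^ (n * N) + (qc ^ (n * N) - 1 / qc ^ (n * N)) / (qc ^ n + 1) / qc ^ n"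
    unfolding scaled_sum_multiple_total[OF P] Suc.IH using scaled_sum_total[of "3 * n * N"] by (simp add: mult.assoc)
  also have "\<dots> = (qc ^ n * qc ^ (n * N) - 1 / (qc ^ n * qc ^ (n * N))) / (qc ^ n + 1)"
  proof -
    have "(1 - 1 / z) * w + (w - 1 / w) / (z + 1) / z = (z * w - 1 / (z * w)) / (z + 1)"
      if "z \<noteq> 0" "w \<noteq> 0" "z + 1 \<noteq> 0" for z w :: complex using that by (simp add: divide_simps) (simp add: algebra_simps)
    then show ?thesis using qc_power_plus_1_nonzero by simp
  qed
  finally show ?case by (simp add: power_add)
qed

lemma scaled_sum_multiple_total_dvd:
  assumes P: "monic_irreducible P" "P \<in> monics n" and n: "n > 0" and N: "N > 0"
  shows "scaled_sum (multiple_total P) (3 * n * N) = (qc ^ (n * N) - qc ^ (2 * n) / qc ^ (n * N)) / (qc * (qc ^ n + 1))"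
  using N
proof (induction N rule: nat_induct_non_zero)
  case 1
  show ?case using scaled_sum_multiple_total[OF P, of 0] by (simp add: scaled_sum_def mult_2 power_add)
next
  case (Suc N)
  have "scaled_sum total (3 * n * N) = qc ^ (n * N) / qc"
  proof -
    have "3 * n * N = Suc (3 * n * N - 1)" "(3 * n * N - 1) div 3 = n * N - 1" using n Suc by (auto simp: mult.assoc)
    then have "scaled_sum total (3 * n * N) = qc ^ (n * N - 1)" using scaled_sum_total by metis
    also have "\<dots> = qc ^ (n * N) / qc" using n Suc by (subst power_diff) auto
    finally show ?thesis .
  qed
  moreover have "scaled_sum (multiple_total P) (3 * n * Suc N) = scaled_sum (multiple_total P) (3 * n + 3 * n * N)"
    by (simp add: algebra_simps)
  ultimately have "scaled_sum (multiple_total P) (3 * n * Suc N)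
      = (1 - 1 / qc ^ n) * (qc ^ (n * N) / qc) + (qc ^ (n * N) - qc ^ (2 * n) / qc ^ (n * N)) / (qc * (qc ^ n + 1)) / qc ^ n"
    using scaled_sum_multiple_total[OF P] Suc.IH by simp
  also have "\<dots> = (qc ^ n * qc ^ (n * N) - (qc ^ n) ^ 2 / (qc ^ n * qc ^ (n * N))) / (qc * (qc ^ n + 1))"
  proof -
    have "(1 - 1 / z) * (w / q) + (w - z ^ 2 / w) / (q * (z + 1)) / z = (z * w - z ^ 2 / (z * w)) / (q * (z + 1))"
      if "z \<noteq> 0" "w \<noteq> 0" "z + 1 \<noteq> 0" "q \<noteq> 0" for z w q :: complex
      using that by (simp add: divide_simps) (simp add: algebra_simps)
    from this[of "qc ^ n" "qc ^ (n * N)" qc] show ?thesis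
      unfolding power_mult[symmetric] mult.commute[of n 2] using qc_power_plus_1_nonzero by simp
  qed
  finally show ?case by (simp add: power_add power_mult[symmetric] mult.commute[of n])
qed

text \<open>
  The weight \<open>q ^ (J - k - l)\<close> factors, and on functions supported on the multiples of \<open>3\<close> the factor
  \<open>field_gauss\<close> is constant; so the double sum is a product of two simple sums.
\<close>

lemma cut_form_rank_one:
  assumes xy: "\<And>k. \<not> 3 dvd k \<Longrightarrow> x k = 0" "\<And>k. \<not> 3 dvd k \<Longrightarrow> y k = 0" and h: "h + h' \<le> J + 1"
  shows "(\<Sum>k<h. \<Sum>l<h'. qc ^ (J - k - l) * field_gauss (k + 2 * l) 0 * (x k * y l))
    = (qc - 1) * qc ^ J * scaled_sum x h * scaled_sum y h'"
proof -
  have "qc ^ (J - k - l) * field_gauss (k + 2 * l) 0 * (x k * y l) = (qc - 1) * qc ^ J * (x k / qc ^ k * (y l / qc ^ l))"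
    if "k < h" "l < h'" for k l
  proof (cases "3 dvd k \<and> 3 dvd l")
    case True
    then have "field_gauss (k + 2 * l) 0 = qc - 1" by (simp add: field_gauss_0)
    moreover have "qc ^ J = qc ^ (J - k - l) * qc ^ k * qc ^ l"
      unfolding power_add[symmetric] using that h by (intro arg_cong[of _ _ "\<lambda>i. qc ^ i"]) simp
    ultimately show ?thesis by simp
  qed (use xy in auto)
  then have "(\<Sum>k<h. \<Sum>l<h'. qc ^ (J - k - l) * field_gauss (k + 2 * l) 0 * (x k * y l))
      = (\<Sum>k<h. \<Sum>l<h'. (qc - 1) * qc ^ J * (x k / qc ^ k * (y l / qc ^ l)))"
    by (intro sum.cong refl) auto
  also have "\<dots> = (qc - 1) * qc ^ J * ((\<Sum>k<h. x k / qc ^ k) * (\<Sum>l<h'. y l / qc ^ l))"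
    unfolding sum_product by (simp only: sum_distrib_left)
  finally show ?thesis unfolding scaled_sum_def mult.assoc .
qed

text \<open>
  The part of the form in \<open>multiple_total_cut\<close> that belongs to the frequency \<open>j\<close>.
\<close>

definition remainder_form :: "'a poly \<Rightarrow> nat \<Rightarrow> 'a poly \<Rightarrow> nat \<Rightarrow> complex" where
  "remainder_form P h j J = (\<Sum>k<h. \<Sum>l<J - h + 1.
     partial_gauss P (J - k - l) (k + 2 * l) j * (cnj (coprime_moment P j k) * coprime_moment P j l))"

text \<open>
  Both sides of \<open>multiple_total_cut\<close> are known except for the terms with \<open>j \<noteq> 0\<close>, so their sum is the
  difference. The terms of order \<open>q ^ (8 n N)\<close> and \<open>q ^ (6 n N)\<close> cancel in it, and what is left is
  smaller by the factor \<open>q ^ (4 n N)\<close> than the size of the single forms.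
\<close>

lemma sum_remainder_form:
  assumes P: "monic_irreducible P" "P \<in> monics n" and n: "n > 0" and N: "N > 0"
  shows "(\<Sum>j\<in>below n - {0}. remainder_form P (3 * n * N) j (6 * n * N)) = qc ^ n * (qc ^ n / qc - 1) * qc ^ (4 * n * N)"
proof -
  define h where "h = 3 * n * N"
  define J where "J = 6 * n * N"
  define z where "z = qc ^ n"
  define w where "w = qc ^ (n * N)"
  define S where "S = (\<Sum>j\<in>below n - {0}. remainder_form P h j J)"
  let ?D = "multiple_total P"
  have hJ: "3 dvd J" "1 \<le> h" "h \<le> J" "J - h + 1 = h + 1" using n N by (auto simp: h_def J_def)
  have nz: "z \<noteq> 0" "w \<noteq> 0" "z + 1 \<noteq> 0" using qc_power_plus_1_nonzero by (auto simp: z_def w_def)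
  have w2: "qc ^ (n * (2 * N)) = w ^ 2" by (simp add: w_def power_mult[symmetric] mult_ac)
  have z2: "qc ^ (2 * n) = z ^ 2" by (simp add: z_def power_mult[symmetric] mult_ac)
  have sD: "scaled_sum ?D h = (w - z ^ 2 / w) / (qc * (z + 1))" "scaled_sum ?D (h + 1) = (w - 1 / w) / (z + 1)"
    using scaled_sum_multiple_total_dvd[OF P n N] scaled_sum_multiple_total_succ[OF P, of N]
    by (simp_all add: z2 h_def z_def[symmetric] w_def[symmetric])
  have sJ: "scaled_sum ?D J = (w ^ 2 - z ^ 2 / w ^ 2) / (qc * (z + 1))" "scaled_sum ?D (J + 1) = (w ^ 2 - 1 / w ^ 2) / (z + 1)"
  proof -
    have J2: "J = 3 * n * (2 * N)" by (simp add: J_def)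
    have "w ^ 2 = qc ^ (n * (2 * N))" using w2 ..
    then show "scaled_sum ?D J = (w ^ 2 - z ^ 2 / w ^ 2) / (qc * (z + 1))" "scaled_sum ?D (J + 1) = (w ^ 2 - 1 / w ^ 2) / (z + 1)"
      unfolding J2 using scaled_sum_multiple_total_dvd[OF P n, of "2 * N"] scaled_sum_multiple_total_succ[OF P, of "2 * N"] N
      unfolding z2 z_def by simp_all
  qed
  have sT: "scaled_sum total h = w / qc" "scaled_sum total (h + 1) = w"
  proof -
    have "h = Suc (h - 1)" "(h - 1) div 3 = n * N - 1" using n N by (auto simp: h_def mult.assoc)
    then have "scaled_sum total h = qc ^ (n * N - 1)" using scaled_sum_total by metis
    also have "\<dots> = w / qc" using n N unfolding w_def by (subst power_diff) auto
    finally show "scaled_sum total h = w / qc" .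
    show "scaled_sum total (h + 1) = w" using scaled_sum_total[of h] by (simp add: h_def w_def mult.assoc)
  qed
  define Y where "Y = (\<lambda>k. total k - ?D k)"
  have sY: "scaled_sum Y i = scaled_sum total i - scaled_sum ?D i" for i
    by (simp add: scaled_sum_def Y_def diff_divide_distrib sum_subtractf)
  have "?D J = qc ^ J * (scaled_sum ?D (J + 1) - scaled_sum ?D J)" by (simp add: scaled_sum_def)
  moreover have "?D J = (qc - 1) * qc ^ J * scaled_sum ?D h * scaled_sum ?D (h + 1)
      + ((qc - 1) * qc ^ J * scaled_sum Y h * scaled_sum Y (h + 1) + S) / z"
  proof -
    let ?G = "\<lambda>k l j. partial_gauss P (J - k - l) (k + 2 * l) j * (cnj (coprime_moment P j k) * coprime_moment P j l)"
    have "?D J = (\<Sum>k<h. \<Sum>l<h + 1. qc ^ (J - k - l) * field_gauss (k + 2 * l) 0 * (?D k * ?D l))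
        + (\<Sum>k<h. \<Sum>l<h + 1. \<Sum>j\<in>below n. ?G k l j) / z"
      unfolding multiple_total_cut[OF P hJ(1,2,3)] hJ(4) cnj_multiple_total[OF P n] sum.distrib sum_divide_distrib z_def ..
    also have "(\<Sum>k<h. \<Sum>l<h + 1. \<Sum>j\<in>below n. ?G k l j) = (\<Sum>j\<in>below n. \<Sum>k<h. \<Sum>l<h + 1. ?G k l j)"
    proof -
      have "(\<Sum>k<h. \<Sum>l<h + 1. \<Sum>j\<in>below n. ?G k l j) = (\<Sum>k<h. \<Sum>j\<in>below n. \<Sum>l<h + 1. ?G k l j)"
        by (rule sum.cong[OF refl], rule sum.swap)
      also have "\<dots> = (\<Sum>j\<in>below n. \<Sum>k<h. \<Sum>l<h + 1. ?G k l j)" by (rule sum.swap)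
      finally show ?thesis .
    qed
    also have "\<dots> = (\<Sum>k<h. \<Sum>l<h + 1. ?G k l 0) + S"
      unfolding S_def remainder_form_def hJ(4) by (rule sum.remove) auto
    also have "(\<Sum>k<h. \<Sum>l<h + 1. ?G k l 0) = (\<Sum>k<h. \<Sum>l<h + 1. qc ^ (J - k - l) * field_gauss (k + 2 * l) 0 * (Y k * Y l))"
      unfolding partial_gauss_0 coprime_moment_0[OF P(1)] Y_def complex_cnj_diff cnj_total cnj_multiple_total[OF P n] ..
    also have "\<dots> = (qc - 1) * qc ^ J * scaled_sum Y h * scaled_sum Y (h + 1)"
      using hJ by (intro cut_form_rank_one) (auto simp: Y_def total_eq_0 multiple_total_eq_0[OF P n])
    also have "(\<Sum>k<h. \<Sum>l<h + 1. qc ^ (J - k - l) * field_gauss (k + 2 * l) 0 * (?D k * ?D l))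
        = (qc - 1) * qc ^ J * scaled_sum ?D h * scaled_sum ?D (h + 1)"
      using hJ by (intro cut_form_rank_one) (auto simp: multiple_total_eq_0[OF P n])
    finally show ?thesis .
  qed
  ultimately have key: "qc ^ J * ((w ^ 2 - 1 / w ^ 2) / (z + 1) - (w ^ 2 - z ^ 2 / w ^ 2) / (qc * (z + 1)))
      = (qc - 1) * qc ^ J * ((w - z ^ 2 / w) / (qc * (z + 1))) * ((w - 1 / w) / (z + 1))
      + ((qc - 1) * qc ^ J * (w / qc - (w - z ^ 2 / w) / (qc * (z + 1))) * (w - (w - 1 / w) / (z + 1)) + S) / z"
    unfolding sY sT sD sJ by simp
  \<comment> \<open>Inverses as variables, so that the remaining identity is one of polynomials.\<close>
  define y i r where "y = 1 / (z + 1)" "i = 1 / qc" "r = 1 / w"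
  have yir: "y * (z + 1) = 1" "i * qc = 1" "r * w = 1" using nz by (simp_all add: y_i_r_def)
  have 3: "(w - z ^ 2 / w) / (qc * (z + 1)) = i * y * (w - z ^ 2 * r)" "(w - 1 / w) / (z + 1) = y * (w - r)"
    by (simp_all add: y_i_r_def)
  have 0: "w / qc = w * i" by (simp add: y_i_r_def)
  have 1: "w * i - i * y * (w - z ^ 2 * r) = i * y * z * (w + z * r)"
  proof -
    have "w * i - i * y * (w - z ^ 2 * r) = i * w * (1 - y * (z + 1)) + i * y * z * (w + z * r)"
      by (simp add: algebra_simps power2_eq_square)
    then show ?thesis using yir(1) by simp
  qed
  have 2: "w - y * (w - r) = y * (z * w + r)"
  proof -
    have "w - y * (w - r) = w * (1 - y * (z + 1)) + y * (z * w + r)" by (simp add: algebra_simps)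
    then show ?thesis using yir(1) by simp
  qed
  have 4: "(w ^ 2 - 1 / w ^ 2) / (z + 1) - (w ^ 2 - z ^ 2 / w ^ 2) / (qc * (z + 1)) = y * (w ^ 2 - r ^ 2) - i * y * (w ^ 2 - z ^ 2 * r ^ 2)"
    by (simp add: y_i_r_def power_divide)
  have "qc ^ J * (y * (w ^ 2 - r ^ 2) - i * y * (w ^ 2 - z ^ 2 * r ^ 2))
      = (qc - 1) * qc ^ J * (i * y * (w - z ^ 2 * r)) * (y * (w - r))
      + ((qc - 1) * qc ^ J * (i * y * z * (w + z * r)) * (y * (z * w + r)) + S) / z"
    using key unfolding 4 unfolding 3 0 1 2 .
  also have "\<dots> = (qc - 1) * i * y * qc ^ J * (y * (w - z ^ 2 * r) * (w - r) + y * (w + z * r) * (z * w + r)) + S / z"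
  proof -
    have "A * b * (i * y * e) * (y * f) + (A * b * (i * y * z * c) * (y * d) + S) / z
        = A * i * y * b * (y * e * f + y * c * d) + S / z" for A b c d e f :: complex
      using nz by (simp add: add_divide_distrib distrib_left mult_ac)
    then show ?thesis .
  qed
  also have "y * (w - z ^ 2 * r) * (w - r) + y * (w + z * r) * (z * w + r) = w ^ 2 + z * r ^ 2"
  proof -
    have "y * (w - z ^ 2 * r) * (w - r) + y * (w + z * r) * (z * w + r) = (y * (z + 1)) * (w ^ 2 + z * r ^ 2)"
      by (simp add: algebra_simps power2_eq_square)
    then show ?thesis using yir(1) by simp
  qed
  also have "(qc - 1) * i = 1 - i" using yir(2) by (simp add: algebra_simps)
  finally have "S / z = qc ^ J * ((y * (w ^ 2 - r ^ 2) - i * y * (w ^ 2 - z ^ 2 * r ^ 2)) - (1 - i) * y * (w ^ 2 + z * r ^ 2))"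
    by (simp add: algebra_simps)
  also have "(y * (w ^ 2 - r ^ 2) - i * y * (w ^ 2 - z ^ 2 * r ^ 2)) - (1 - i) * y * (w ^ 2 + z * r ^ 2) = (y * (z + 1)) * (r ^ 2 * (i * z - 1))"
    by (simp add: algebra_simps power2_eq_square)
  finally have "z * (S / z) = z * (z * i - 1) * (qc ^ J * r ^ 2)" unfolding yir(1) by (simp only: mult_ac mult_1_left)
  then have "S = z * (z * i - 1) * (qc ^ J * r ^ 2)" using nz by simp
  also have "qc ^ J * r ^ 2 = qc ^ (4 * n * N)"
  proof -
    have "qc ^ J = qc ^ (4 * n * N) * w ^ 2"
      unfolding w_def power_mult[symmetric] power_add[symmetric] J_def by (intro arg_cong[of _ _ "\<lambda>i. qc ^ i"]) simp
    then show ?thesis using nz by (simp add: y_i_r_def power_divide)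
  qed
  finally show ?thesis by (simp add: S_def h_def J_def z_def y_i_r_def)
qed

lemma qc_of_real: "qc = of_real (real CARD('a))"
  unfolding qc_def by (rule of_real_of_nat_eq[symmetric])

lemma norm_qc [simp]: "norm qc = real CARD('a)"
  unfolding qc_def by (rule norm_of_nat)

lemma cnj_cr [simp]: "cnj cr = cr"
  unfolding cr_def by (rule complex_cnj_complex_of_real)

lemma partial_gauss_cong: "e mod 3 = e' mod 3 \<Longrightarrow> partial_gauss P t e j = partial_gauss P t e' j"
  unfolding partial_gauss_def by (intro sum.cong refl arg_cong2[of _ _ _ _ "(*)"] chi0_power_mod) auto

lemma recurrence_limit:
  fixes y :: "nat \<Rightarrow> complex"
  assumes y: "\<And>N. y (Suc N) = b + r * y N" and r: "norm r < 1"
  shows "y \<longlonglongrightarrow> b / (1 - r)"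
proof -
  have r1: "1 - r \<noteq> 0" using r by auto
  have e: "y N = b / (1 - r) + r ^ N * (y 0 - b / (1 - r))" for N
  proof (induction N)
    case (Suc N)
    have "b + r * (b / (1 - r) + s) = b / (1 - r) + r * s" for s
      using r1 by (simp add: field_simps)
    then show ?case using Suc y by simp
  qed simp
  have "(\<lambda>N. b / (1 - r) + r ^ N * (y 0 - b / (1 - r))) \<longlonglongrightarrow> b / (1 - r) + 0 * (y 0 - b / (1 - r))"
    by (intro tendsto_intros LIMSEQ_power_zero r)
  then show ?thesis unfolding e[symmetric] by simp
qed

lemma norm_inverse_qc: "k > 0 \<Longrightarrow> norm (1 / qc ^ k) < 1"
  using q_ge_2 one_less_power[of "real CARD('a)" k] by (simp add: norm_divide norm_power)

text \<open>
  A step of \<open>3 n\<close> in the degree contracts the normalised moment by \<open>q ^ (- 2 n)\<close> and adds the constant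
  \<open>moment_coeff (j P\<^sup>2) (2 c)\<close>, by \<open>gauss_moment_mult_square\<close> and \<open>gauss_moment_geometric\<close>. The degree
  \<open>3 n N - c\<close> is congruent to \<open>2 c\<close> modulo \<open>3\<close>.
\<close>

lemma coprime_moment_limit:
  fixes j P :: "'a poly"
  assumes P: "monic_irreducible P" "P \<in> monics n" and n: "n > 0" and j: "j \<noteq> 0" "degree j < n" and c: "c \<le> n"
  shows "(\<lambda>N. coprime_moment P j (3 * n * Suc N - c) / cr ^ (4 * (3 * n * Suc N - c)))
    \<longlonglongrightarrow> moment_coeff (j * P ^ 2) (2 * c) / (1 - 1 / qc ^ (2 * n))"
proof (rule recurrence_limit)
  show "norm (1 / qc ^ (2 * n)) < 1" using n by (intro norm_inverse_qc) simp
next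
  fix N
  define a where "a = 3 * n * Suc (Suc N) - c"
  have a3: "3 * n \<le> a" "a - 3 * n = 3 * n * Suc N - c" using c n by (auto simp: a_def algebra_simps)
  have P0: "P \<noteq> 0" using monics_nonzero[OF P(2)] .
  have nd: "\<not> P dvd j" using j dvd_imp_degree_le[of P j] monicsD(1)[OF P(2)] by auto
  have deg: "degree (j * P ^ 2) = degree j + 2 * n"
    using j P0 monicsD(1)[OF P(2)] by (simp add: degree_mult_eq degree_power_eq)
  have "degree (j * P ^ 2) + 2 \<le> a" unfolding deg a_def using c n j by (simp add: algebra_simps)
  then have geo: "gauss_moment (j * P ^ 2) a = cr ^ (4 * a) * moment_coeff (j * P ^ 2) a"
    using j P0 by (intro gauss_moment_geometric) auto
  have mc: "moment_coeff (j * P ^ 2) a = moment_coeff (j * P ^ 2) (2 * c)"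
  proof (rule moment_coeff_cong)
    have "c \<le> 3 * n * Suc (Suc N)" using c by simp
    then have "a + c = 3 * (n * Suc (Suc N))" unfolding a_def by (metis le_add_diff_inverse2 mult.assoc)
    then have "a + 3 * c = 2 * c + 3 * (n * Suc (Suc N))" by linarith
    then show "a mod 3 = (2 * c) mod 3" by (metis mod_mult_self2)
  qed
  have sq: "gauss_moment (j * P ^ 2) a = coprime_moment P j a - qc ^ (2 * n) * coprime_moment P j (a - 3 * n)"
    using gauss_moment_mult_square[OF P nd, of a] a3 by simp
  have w: "cr ^ (4 * a) = cr ^ (4 * (a - 3 * n)) * (qc ^ (2 * n) * qc ^ (2 * n))"
  proof -
    have "4 * a = 4 * (a - 3 * n) + 3 * (2 * n + 2 * n)" using a3(1) by simp
    then show ?thesis by (metis power_add cr_power)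
  qed
  have frac: "y / (w * (z * z)) = m + 1 / z * (y' / w)"
    if "y - z * y' = w * (z * z) * m" "w \<noteq> 0" "z \<noteq> 0" for y y' z w m :: complex
  proof -
    have "y = z * y' + w * (z * z) * m" using that(1) by (simp add: algebra_simps)
    then show ?thesis using that(2,3) by (simp add: add_divide_distrib)
  qed
  have "coprime_moment P j a / cr ^ (4 * a) = moment_coeff (j * P ^ 2) (2 * c)
      + 1 / qc ^ (2 * n) * (coprime_moment P j (a - 3 * n) / cr ^ (4 * (a - 3 * n)))"
    unfolding w by (rule frac) (use geo in \<open>simp_all only: mc sq w power_not_zero cr_nonzero qc_nonzero not_False_eq_True\<close>)
  then show "coprime_moment P j (3 * n * Suc (Suc N) - c) / cr ^ (4 * (3 * n * Suc (Suc N) - c)) =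
      moment_coeff (j * P ^ 2) (2 * c) + 1 / qc ^ (2 * n) * (coprime_moment P j (3 * n * Suc N - c) / cr ^ (4 * (3 * n * Suc N - c)))"
    unfolding a3(2) unfolding a_def .
qed

text \<open>
  Long middle quotients have \<open>partial_gauss\<close> zero, so both denominators have degree close to \<open>h\<close>. With
  \<open>k = h - a\<close> and \<open>l = h - b\<close> the form becomes a finite sum of fixed size.
\<close>

lemma remainder_form_short:
  fixes j P :: "'a poly"
  assumes P: "P \<in> monics n" and j: "j \<noteq> 0" "degree j < n" and h: "n \<le> h" "3 dvd h"
  shows "remainder_form P h j (2 * h) = (\<Sum>a\<in>{1..n}. \<Sum>b\<in>{0..n}. partial_gauss P (a + b) (2 * a + b) j *
     (cnj (coprime_moment P j (h - a)) * coprime_moment P j (h - b)))"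
proof -
  define m where "m = n - 1 - degree j"
  have m: "degree j + m + 1 = n" using j by (simp add: m_def)
  let ?F = "\<lambda>a b. partial_gauss P (a + b) (2 * a + b) j * (cnj (coprime_moment P j (h - a)) * coprime_moment P j (h - b))"
  have zero: "?F a b = 0" if "n < a \<or> n < b" for a b
    using partial_gauss_long[OF P j(1) m, of "a + b"] that m by auto
  have "remainder_form P h j (2 * h) = (\<Sum>k<h. \<Sum>l<h + 1. partial_gauss P (2 * h - k - l) (k + 2 * l) j *
      (cnj (coprime_moment P j k) * coprime_moment P j l))"
    unfolding remainder_form_def by simp
  also have "\<dots> = (\<Sum>a\<in>{1..h}. \<Sum>b\<in>{0..h}. ?F a b)"
  proof (rule sum.reindex_bij_witness[of _ "\<lambda>a. h - a" "\<lambda>k. h - k"]; (simp; fail)?)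
    fix k assume k: "k \<in> {..<h}"
    show "(\<Sum>b\<in>{0..h}. ?F (h - k) b) = (\<Sum>l<h + 1. partial_gauss P (2 * h - k - l) (k + 2 * l) j *
      (cnj (coprime_moment P j k) * coprime_moment P j l))"
    proof (rule sum.reindex_bij_witness[of _ "\<lambda>l. h - l" "\<lambda>b. h - b"]; (simp; fail)?)
      fix b assume b: "b \<in> {0..h}"
      have "partial_gauss P (2 * h - k - (h - b)) (k + 2 * (h - b)) j = partial_gauss P (h - k + b) (2 * (h - k) + b) j"
      proof -
        have "2 * h - k - (h - b) = h - k + b" using k b by simp
        moreover have "(k + 2 * (h - b)) mod 3 = (2 * (h - k) + b) mod 3"
        proof -
          have "k + 2 * (h - b) + 3 * b = 2 * (h - k) + b + 3 * k" using k b by simp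
          then show ?thesis by (metis mod_mult_self2)
        qed
        ultimately show ?thesis by (metis partial_gauss_cong)
      qed
      then show "partial_gauss P (2 * h - k - (h - b)) (k + 2 * (h - b)) j * (cnj (coprime_moment P j k) * coprime_moment P j (h - b)) = ?F (h - k) b"
        using k by simp
    qed
  qed
  also have "\<dots> = (\<Sum>a\<in>{1..n}. \<Sum>b\<in>{0..h}. ?F a b)"
  proof (intro sum.mono_neutral_right ballI)
    show "{1..n} \<subseteq> {1..h}" using h by simp
    show "(\<Sum>b\<in>{0..h}. ?F a b) = 0" if "a \<in> {1..h} - {1..n}" for a
      by (intro sum.neutral ballI zero) (use that in auto)
  qed simp
  also have "\<dots> = (\<Sum>a\<in>{1..n}. \<Sum>b\<in>{0..n}. ?F a b)"
  proof (rule sum.cong[OF refl], intro sum.mono_neutral_right ballI)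
    show "{0..n} \<subseteq> {0..h}" using h by simp
    show "?F a b = 0" if "b \<in> {0..h} - {0..n}" for a b
      by (rule zero) (use that in auto)
  qed simp
  finally show ?thesis .
qed

text \<open>
  The degree \<open>d\<close> will be that of \<open>j P\<^sup>2\<close>. On the diagonal \<open>a + b = m\<close> the classes of \<open>2 a\<close> and \<open>2 b\<close> are then
  dual to each other.
\<close>

lemma dual_index:
  assumes "d + 1 + (a + b) = 3 * (n::nat)"
  shows "(2 * (2 * a) + 2 * d + 2) mod 3 = (2 * a + b) mod 3" "(2 * a + 2 * b) mod 3 = (d + 1) mod 3"
    "(2 * (2 * b) + 2 * d + 2) mod 3 = (a + 2 * b) mod 3"
proof -
  have "2 * (2 * a) + 2 * d + 2 + 3 * b = 2 * a + b + 3 * (2 * n)" using assms by simp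
  then show "(2 * (2 * a) + 2 * d + 2) mod 3 = (2 * a + b) mod 3" by (metis mod_mult_self2)
  have "2 * (2 * b) + 2 * d + 2 + 3 * a = a + 2 * b + 3 * (2 * n)" using assms by simp
  then show "(2 * (2 * b) + 2 * d + 2) mod 3 = (a + 2 * b) mod 3" by (metis mod_mult_self2)
  have "2 * a + 2 * b + 3 * (d + 1) = d + 1 + 3 * (2 * n)" using assms by simp
  then show "(2 * a + 2 * b) mod 3 = (d + 1) mod 3" by (metis mod_mult_self2)
qed

text \<open>
  Each term of the limiting form is nonnegative: for \<open>a + b < m\<close> the constant \<open>field_gauss\<close> vanishes
  unless the two coefficients agree, and for \<open>a + b = m\<close> the Gauss sum over the field cancels against
  the one in the duality of the coefficients, which leaves a positive multiple of \<open>|x a|\<^sup>2\<close> or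
  \<open>|x b|\<^sup>2\<close>.
\<close>

lemma cut_term_nonneg:
  fixes j P :: "'a poly"
  assumes P: "P \<in> monics n" and j: "j \<noteq> 0" "degree j + m + 1 = n"
  defines "x \<equiv> \<lambda>c. moment_coeff (j * P ^ 2) (2 * c)"
  obtains r :: real where "r \<ge> 0"
    "partial_gauss P (a + b) (2 * a + b) j / cr ^ (4 * (a + b)) * (cnj (x a) * x b) = of_real r"
    "a + b = m \<Longrightarrow> r = 0 \<Longrightarrow> x a = 0"
proof -
  define f where "f = j * P ^ 2"
  define q where "q = real CARD('a)"
  define s where "s = root 3 q"
  define t where "t = a + b"
  have q: "q > 1" using q_ge_2 by (simp add: q_def)
  have s: "s > 0" "cr = of_real s" "qc = of_real q" using q by (simp_all only: s_def q_def real_root_gt_zero cr_def[symmetric] qc_of_real[symmetric])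
  have scale: "qc ^ t / cr ^ (4 * t) = of_real (q ^ t / s ^ (4 * t))" unfolding s(2,3) by simp
  have pos: "q ^ t / s ^ (4 * t) > 0" using q s by simp
  have P0: "P \<noteq> 0" using monics_nonzero[OF P] .
  have f: "f \<noteq> 0" "degree f = degree j + 2 * n" "lead_coeff f = lead_coeff j"
  proof -
    show "f \<noteq> 0" "degree f = degree j + 2 * n"
      using j P0 monicsD(1)[OF P] by (simp_all add: f_def degree_mult_eq degree_power_eq)
    show "lead_coeff f = lead_coeff j"
      unfolding f_def lead_coeff_mult lead_coeff_power monicsD(3)[OF P] by simp
  qed
  have sq: "cnj z * z = of_real ((norm z)\<^sup>2)" for z :: complex
    unfolding complex_norm_square by (rule mult.commute)
  consider "m < t" | "t < m" "\<not> 3 dvd 2 * a + b" | "t < m" "3 dvd 2 * a + b" | "t = m" by linarith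
  then show thesis
  proof cases
    case 1
    then show thesis using partial_gauss_long[OF P j] by (intro that[of 0]) (auto simp: t_def)
  next
    case 2
    then have "partial_gauss P t (2 * a + b) j = 0" using partial_gauss_short[OF P j, of t "2 * a + b"] by (simp add: field_gauss_0)
    then show thesis using 2 by (intro that[of 0]) (auto simp: t_def)
  next
    case 3
    have "x b = x a" unfolding x_def
    proof (rule moment_coeff_cong)
      obtain i where "2 * a + b = 3 * i" using 3(2) by blast
      then have "2 * b + 3 * (2 * a) = 2 * a + 3 * (2 * i)" by simp
      then show "2 * b mod 3 = 2 * a mod 3" by (metis mod_mult_self2)
    qed
    moreover have "partial_gauss P t (2 * a + b) j = qc ^ t * (qc - 1)"
      using partial_gauss_short[OF P j, of t "2 * a + b"] 3 by (simp add: field_gauss_0)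
    ultimately have "partial_gauss P t (2 * a + b) j / cr ^ (4 * t) * (cnj (x a) * x b) = qc ^ t / cr ^ (4 * t) * (qc - 1) * of_real ((norm (x a))\<^sup>2)"
      by (simp add: sq)
    also have "\<dots> = of_real (q ^ t / s ^ (4 * t) * (q - 1) * (norm (x a))\<^sup>2)" unfolding scale unfolding s(3) by simp
    finally have val: "partial_gauss P t (2 * a + b) j / cr ^ (4 * t) * (cnj (x a) * x b) = of_real (q ^ t / s ^ (4 * t) * (q - 1) * (norm (x a))\<^sup>2)" .
    show thesis
    proof (rule that[of "q ^ t / s ^ (4 * t) * (q - 1) * (norm (x a))\<^sup>2"])
      show "0 \<le> q ^ t / s ^ (4 * t) * (q - 1) * (norm (x a))\<^sup>2"
        using pos q by (intro mult_nonneg_nonneg) simp_all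
      show "x a = 0" if "a + b = m" using that 3 by (simp add: t_def)
    qed (use val in \<open>simp only: t_def\<close>)
  next
    case 4
    define L where "L = lead_coeff j"
    have L: "L \<noteq> 0" using j by (simp add: L_def)
    have di: "degree f + 1 + (a + b) = 3 * n" using j f(2) 4 by (simp add: t_def)
    note di = dual_index[OF di]
    have PG: "partial_gauss P t (2 * a + b) j = qc ^ t * field_gauss (2 * a + b) L"
      using partial_gauss_short[OF P j, of t "2 * a + b"] 4 by (simp add: L_def)
    have g12: "field_gauss 1 L * field_gauss 2 L / cr ^ 2 = of_real s"
    proof -
      have "qc / cr ^ 2 = cr" using cr_cube by (simp add: field_simps power3_eq_cube power2_eq_square)
      then show ?thesis using field_gauss_1_2[OF L] s(2) by simp
    qed
    note witness = that
    have result: thesis if c: "field_gauss (2 * a + b) L * (cnj (x a) * x b) = of_real s * of_real ((norm (x c))\<^sup>2)" "x c = 0 \<Longrightarrow> x a = 0" for c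
    proof (rule witness[of "q ^ t / s ^ (4 * t) * s * (norm (x c))\<^sup>2"])
      show "0 \<le> q ^ t / s ^ (4 * t) * s * (norm (x c))\<^sup>2"
        using s(1) pos by (intro mult_nonneg_nonneg) simp_all
      have "partial_gauss P t (2 * a + b) j / cr ^ (4 * t) * (cnj (x a) * x b) = qc ^ t / cr ^ (4 * t) * (field_gauss (2 * a + b) L * (cnj (x a) * x b))"
        unfolding PG by simp
      then show "partial_gauss P (a + b) (2 * a + b) j / cr ^ (4 * (a + b)) * (cnj (x a) * x b) = of_real (q ^ t / s ^ (4 * t) * s * (norm (x c))\<^sup>2)"
        unfolding c scale t_def[symmetric] by simp
      show "x a = 0" if "q ^ t / s ^ (4 * t) * s * (norm (x c))\<^sup>2 = 0"
        using that c(2) less_imp_neq[OF pos] s(1) by (metis mult_eq_0_iff norm_eq_zero power_eq_0_iff less_irrefl)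
    qed
    consider "(2 * a + b) mod 3 = 0" | "(2 * a + b) mod 3 = 1" | "(2 * a + b) mod 3 = 2" by linarith
    then show thesis
    proof cases
      case 1
      have "x a = 0" unfolding x_def f_def[symmetric] by (rule moment_coeff_self_dual) (use di 1 in simp)
      then show thesis by (intro result[of a]) auto
    next
      case 2
      have "x b = field_gauss 2 L / cr ^ 2 * x a"
        unfolding x_def f_def[symmetric] L_def f(3)[symmetric]
        by (rule moment_coeff_dual[OF f(1)]) (use di 2 in simp_all)
      moreover have "field_gauss (2 * a + b) L = field_gauss 1 L" using 2 by (intro field_gauss_cong) simp
      ultimately have "field_gauss (2 * a + b) L * (cnj (x a) * x b) = field_gauss 1 L * field_gauss 2 L / cr ^ 2 * (cnj (x a) * x a)"
        by simp
      then show thesis unfolding g12 sq by (rule result) simp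
    next
      case 3
      have ab: "(a + 2 * b) mod 3 = 1"
      proof -
        have "a + 2 * b + 3 * a = 2 * (2 * a + b)" by simp
        then have "(a + 2 * b) mod 3 = (2 * ((2 * a + b) mod 3)) mod 3" by (metis mod_mult_right_eq mod_mult_self2)
        then show ?thesis using 3 by simp
      qed
      have xa: "x a = field_gauss 2 L / cr ^ 2 * x b"
        unfolding x_def f_def[symmetric] L_def f(3)[symmetric]
        by (rule moment_coeff_dual[OF f(1)]) (use di ab in \<open>simp_all add: add.commute\<close>)
      have "cnj (field_gauss 2 L) = field_gauss 1 L"
        unfolding cnj_field_gauss by (rule field_gauss_cong) simp
      moreover have "field_gauss (2 * a + b) L = field_gauss 2 L" using 3 by (intro field_gauss_cong) simp
      ultimately have "field_gauss (2 * a + b) L * (cnj (x a) * x b) = field_gauss 1 L * field_gauss 2 L / cr ^ 2 * (cnj (x b) * x b)"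
        unfolding xa by simp
      then show thesis unfolding g12 sq by (rule result) (simp add: xa)
    qed
  qed
qed

text \<open>
  The factor \<open>q ^ (8 n N)\<close> distributes over the two moments and the weight \<open>q ^ (4 (a + b) / 3)\<close>.
\<close>

lemma remainder_form_limit:
  fixes j P :: "'a poly"
  assumes P: "monic_irreducible P" "P \<in> monics n" and n: "n > 0" and j: "j \<noteq> 0" "degree j < n"
  defines "x \<equiv> \<lambda>c. moment_coeff (j * P ^ 2) (2 * c)"
  shows "(\<lambda>N. remainder_form P (3 * n * Suc N) j (6 * n * Suc N) / qc ^ (8 * n * Suc N))
    \<longlonglongrightarrow> (\<Sum>a\<in>{1..n}. \<Sum>b\<in>{0..n}. partial_gauss P (a + b) (2 * a + b) j / cr ^ (4 * (a + b)) * (cnj (x a) * x b))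
        * of_real ((norm (1 / (1 - 1 / qc ^ (2 * n))))\<^sup>2)"
proof -
  \<comment> \<open>The factor common to the limits of all normalised moments; it only scales the form.\<close>
  define \<kappa> where "\<kappa> = 1 / (1 - 1 / qc ^ (2 * n))"
  define y where "y = (\<lambda>c N. coprime_moment P j (3 * n * Suc N - c) / cr ^ (4 * (3 * n * Suc N - c)))"
  have y: "y c \<longlonglongrightarrow> x c * \<kappa>" if "c \<le> n" for c
    using coprime_moment_limit[OF P n j that] unfolding y_def x_def \<kappa>_def by simp
  let ?G = "\<lambda>a b. partial_gauss P (a + b) (2 * a + b) j / cr ^ (4 * (a + b))"
  have eq: "remainder_form P (3 * n * Suc N) j (6 * n * Suc N) / qc ^ (8 * n * Suc N)
      = (\<Sum>a\<in>{1..n}. \<Sum>b\<in>{0..n}. ?G a b * (cnj (y a N) * y b N))" for N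
  proof -
    define h where "h = 3 * n * Suc N"
    have h: "n \<le> h" "3 dvd h" "6 * n * Suc N = 2 * h" by (auto simp: h_def)
    have "(partial_gauss P (a + b) (2 * a + b) j * (cnj (coprime_moment P j (h - a)) * coprime_moment P j (h - b))) / qc ^ (8 * n * Suc N)
        = ?G a b * (cnj (y a N) * y b N)" if ab: "a \<le> n" "b \<le> n" for a b
    proof -
      have "qc ^ (8 * n * Suc N) = cr ^ (3 * (8 * n * Suc N))" by (rule cr_power[symmetric])
      also have "3 * (8 * n * Suc N) = 4 * (a + b) + 4 * (h - a) + 4 * (h - b)" using ab h(1) by (simp add: h_def algebra_simps)
      finally have "qc ^ (8 * n * Suc N) = cr ^ (4 * (a + b)) * cr ^ (4 * (h - a)) * cr ^ (4 * (h - b))" by (simp only: power_add)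
      then show ?thesis unfolding y_def h_def[symmetric] by simp
    qed
    then show ?thesis
      unfolding h(3) h_def[symmetric] remainder_form_short[OF P(2) j h(1,2)] sum_divide_distrib
      by (intro sum.cong refl) auto
  qed
  have "(\<lambda>N. \<Sum>a\<in>{1..n}. \<Sum>b\<in>{0..n}. ?G a b * (cnj (y a N) * y b N))
      \<longlonglongrightarrow> (\<Sum>a\<in>{1..n}. \<Sum>b\<in>{0..n}. ?G a b * (cnj (x a * \<kappa>) * (x b * \<kappa>)))"
    by (intro tendsto_sum tendsto_mult tendsto_const tendsto_cnj y) auto
  also have "(\<Sum>a\<in>{1..n}. \<Sum>b\<in>{0..n}. ?G a b * (cnj (x a * \<kappa>) * (x b * \<kappa>)))
      = (\<Sum>a\<in>{1..n}. \<Sum>b\<in>{0..n}. ?G a b * (cnj (x a) * x b)) * of_real ((norm \<kappa>)\<^sup>2)"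
    unfolding sum_distrib_right complex_norm_square by (intro sum.cong refl) simp
  finally show ?thesis unfolding eq \<kappa>_def .
qed

text \<open>
  By \<open>sum_remainder_form\<close> the normalised forms add up to a null sequence, while each of them tends to a sum of
  nonnegative terms; so every term of every limit is zero. The term \<open>a = 1\<close>, \<open>b = m - 1\<close> of the
  frequency \<open>f\<close> controls the coefficient in the class of \<open>2\<close>. The bound on \<open>deg f\<close> says that \<open>m \<ge> 1\<close>, so
  that this term is present.
\<close>

theorem moment_coeff_vanishes:
  fixes f P :: "'a poly"
  assumes P: "monic_irreducible P" "P \<in> monics n" and f: "f \<noteq> 0" "degree f + 1 < n"
  shows "moment_coeff (f * P ^ 2) 2 = 0"
proof -
  have n: "n > 0" using f by simp
  define A :: "'a poly set" where "A = below n - {0}"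
  have A: "j \<noteq> 0" "degree j < n" if "j \<in> A" for j using that by (auto simp: A_def below_iff)
  have finA: "finite A" by (simp add: A_def)
  define F where "F = (\<lambda>j a b. partial_gauss P (a + b) (2 * a + b) j / cr ^ (4 * (a + b)) *
      (cnj (moment_coeff (j * P ^ 2) (2 * a)) * moment_coeff (j * P ^ 2) (2 * b)))"
  define \<rho> where "\<rho> = (of_real ((norm (1 / (1 - 1 / qc ^ (2 * n))))\<^sup>2) :: complex)"
  have "norm (1 / qc ^ (2 * n)) < 1" using n by (intro norm_inverse_qc) simp
  then have \<rho>: "\<rho> \<noteq> 0" by (auto simp: \<rho>_def)
  let ?R = "\<lambda>N j. remainder_form P (3 * n * Suc N) j (6 * n * Suc N) / qc ^ (8 * n * Suc N)"
  have "(\<lambda>N. \<Sum>j\<in>A. ?R N j) \<longlonglongrightarrow> (\<Sum>j\<in>A. (\<Sum>a\<in>{1..n}. \<Sum>b\<in>{0..n}. F j a b) * \<rho>)"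
    unfolding F_def \<rho>_def by (intro tendsto_sum remainder_form_limit P n A)
  moreover have "(\<lambda>N. \<Sum>j\<in>A. ?R N j) \<longlonglongrightarrow> 0"
  proof -
    let ?K = "qc ^ n * (qc ^ n / qc - 1)"
    have "(\<Sum>j\<in>A. ?R N j) = ?K * (1 / qc ^ (4 * n)) ^ Suc N" for N
    proof -
      have "qc ^ (8 * n * Suc N) = qc ^ (4 * n * Suc N) * qc ^ (4 * n * Suc N)"
        unfolding power_add[symmetric] by (intro arg_cong[of _ _ "\<lambda>i. qc ^ i"]) simp
      then have "(\<Sum>j\<in>A. ?R N j) = ?K * (1 / qc ^ (4 * n * Suc N))"
        unfolding sum_divide_distrib[symmetric] A_def sum_remainder_form[OF P n zero_less_Suc[of N]] by simp
      then show ?thesis by (simp only: power_one_over power_mult)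
    qed
    moreover have "(\<lambda>N. ?K * (1 / qc ^ (4 * n)) ^ Suc N) \<longlonglongrightarrow> ?K * 0"
      using n by (intro tendsto_mult tendsto_const LIMSEQ_Suc LIMSEQ_power_zero norm_inverse_qc) simp
    ultimately show ?thesis by simp
  qed
  ultimately have "(\<Sum>j\<in>A. (\<Sum>a\<in>{1..n}. \<Sum>b\<in>{0..n}. F j a b) * \<rho>) = 0" by (rule LIMSEQ_unique)
  then have "(\<Sum>j\<in>A. \<Sum>a\<in>{1..n}. \<Sum>b\<in>{0..n}. F j a b) = 0"
    using \<rho> unfolding sum_distrib_right[symmetric] by simp
  then have sum0: "(\<Sum>j\<in>A. \<Sum>a\<in>{1..n}. \<Sum>b\<in>{0..n}. Re (F j a b)) = 0"
    unfolding Re_sum[symmetric] by simp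
  have nonneg: "Re (F j a b) \<ge> 0" if "j \<in> A" for j a b
  proof -
    have "degree j + (n - 1 - degree j) + 1 = n" using A[OF that] by simp
    from cut_term_nonneg[OF P(2) A(1)[OF that] this, of a b] show ?thesis
      unfolding F_def by (metis Re_complex_of_real)
  qed
  define m where "m = n - 1 - degree f"
  have m: "degree f + m + 1 = n" "1 \<le> m" "m \<le> n" using f by (auto simp: m_def)
  have fA: "f \<in> A" using f by (simp add: A_def below_iff)
  have "(\<Sum>a\<in>{1..n}. \<Sum>b\<in>{0..n}. Re (F f a b)) = 0"
    using sum0 nonneg fA by (subst (asm) sum_nonneg_eq_0_iff[OF finA]) (auto intro!: sum_nonneg)
  then have "(\<Sum>b\<in>{0..n}. Re (F f 1 b)) = 0"
    using nonneg[OF fA] m by (subst (asm) sum_nonneg_eq_0_iff) (auto intro!: sum_nonneg)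
  then have "Re (F f 1 (m - 1)) = 0"
    using nonneg[OF fA] m by (subst (asm) sum_nonneg_eq_0_iff) auto
  moreover obtain r where "F f 1 (m - 1) = of_real r" "1 + (m - 1) = m \<Longrightarrow> r = 0 \<Longrightarrow> moment_coeff (f * P ^ 2) (2 * 1) = 0"
    using cut_term_nonneg[OF P(2) f(1) m(1), of 1 "m - 1"] unfolding F_def by metis
  ultimately show ?thesis using m by simp
qed

section \<open>A long character sum\<close>

text \<open>
  The degree of \<open>f P\<^sup>2\<close> is at most \<open>3 n - 2\<close>. Below this value the moment is geometric with vanishing
  coefficient; at this value only the boundary term of \<open>gauss_moment_first\<close> survives.
\<close>

lemma coprime_moment_degree:
  fixes f P :: "'a poly"
  assumes P: "monic_irreducible P" "P \<in> monics n" and f: "f \<noteq> 0" "degree f + 1 < n"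
  shows "coprime_moment P f (3 * n - 1) = (if degree f + 2 = n then field_gauss 2 (lead_coeff f) * qc ^ (3 * n - 2) else 0)"
proof -
  have P0: "P \<noteq> 0" using monics_nonzero[OF P(2)] .
  have nd: "\<not> P dvd f" using f dvd_imp_degree_le[of P f] monicsD(1)[OF P(2)] by auto
  have g: "f * P ^ 2 \<noteq> 0" "degree (f * P ^ 2) = degree f + 2 * n" "lead_coeff (f * P ^ 2) = lead_coeff f"
  proof -
    show "f * P ^ 2 \<noteq> 0" "degree (f * P ^ 2) = degree f + 2 * n"
      using f P0 monicsD(1)[OF P(2)] by (simp_all add: degree_mult_eq degree_power_eq)
    show "lead_coeff (f * P ^ 2) = lead_coeff f"
      unfolding lead_coeff_mult lead_coeff_power monicsD(3)[OF P(2)] by simp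
  qed
  have mod: "(3 * n - 1) mod 3 = 2"
  proof -
    have "3 * n - 1 = 2 + 3 * (n - 1)" using f by simp
    then show ?thesis by (simp only: mod_mult_self2) simp
  qed
  have mc: "moment_coeff (f * P ^ 2) (3 * n - 1) = 0"
    unfolding moment_coeff_vanishes[OF P f, symmetric] by (rule moment_coeff_cong) (simp only: mod, simp)
  have "coprime_moment P f (3 * n - 1) = gauss_moment (f * P ^ 2) (3 * n - 1)"
  proof -
    have "\<not> 3 * n \<le> 3 * n - 1" using f by simp
    then show ?thesis unfolding gauss_moment_mult_square[OF P nd] by (simp only: if_False diff_zero)
  qed
  also have "\<dots> = (if degree f + 2 = n then field_gauss 2 (lead_coeff f) * qc ^ (3 * n - 2) else 0)"
  proof (cases "degree f + 2 = n")
    case True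
    have "gauss_moment (f * P ^ 2) (3 * n - 1) = field_gauss (3 * n - 1) (lead_coeff f) * qc ^ (3 * n - 1 - 1)"
    proof -
      have 1: "3 * n - 1 = degree (f * P ^ 2) + 1" unfolding g(2) using True by simp
      have 2: "\<not> 3 dvd 3 * n - 1" unfolding dvd_eq_mod_eq_0 mod by simp
      show ?thesis using gauss_moment_first[OF g(1) 1 2] unfolding mc g(3) by simp
    qed
    moreover have "3 * n - 1 - 1 = 3 * n - 2" by simp
    moreover have "field_gauss (3 * n - 1) (lead_coeff f) = field_gauss 2 (lead_coeff f)"
      by (rule field_gauss_cong) (simp only: mod, simp)
    ultimately show ?thesis using True by simp
  next
    case False
    then have 1: "degree (f * P ^ 2) + 2 \<le> 3 * n - 1" unfolding g(2) using f by simp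
    show ?thesis using gauss_moment_geometric[OF g(1) 1] False unfolding mc by simp
  qed
  finally show ?thesis .
qed

text \<open>
  Poisson summation: the condition that a residue modulo \<open>u\<close> is monic of degree \<open>2 n\<close> is detected by the
  \<open>q ^ (n - 1)\<close> frequencies \<open>v\<close> of degree below \<open>n - 1\<close>.
\<close>

lemma sum_chi_monics_poisson:
  fixes u :: "'a poly"
  assumes n: "n \<ge> 2" and u: "u \<in> monics (3 * n - 1)"
  shows "(\<Sum>c\<in>monics (2 * n). \<chi> u c) = (\<Sum>v\<in>below (n - 1). cnj (add_char (coeff v (n - 2))) * gauss v u) / qc ^ (n - 1)"
proof -
  let ?t = "monom 1 (2 * n) :: 'a poly"
  have du: "degree u = 3 * n - 1" using monicsD(1)[OF u] .
  have tb: "?t \<in> below (3 * n - 1)" using n by (auto simp: below_def)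
  have ind: "(\<Sum>v\<in>below (n - 1). echar (v * (d - ?t)) u) = (if d \<in> monics (2 * n) then qc ^ (n - 1) else 0)"
    if d: "d \<in> below (3 * n - 1)" for d
  proof -
    have "d - ?t \<in> below (2 * n) \<longleftrightarrow> d \<in> monics (2 * n)"
      using monics_add_below[of ?t "2 * n" "d - ?t"] monics_diff_below[of d "2 * n" ?t] by auto
    moreover have "degree u - (n - 1) = 2 * n" using du n by simp
    ultimately show ?thesis
      using sum_echar[OF monicsD(3)[OF u], of "d - ?t" "n - 1"] below_diff[OF d tb] du n by simp
  qed
  have top: "echar (v * ?t) u = add_char (coeff v (n - 2))" if v: "v \<in> below (n - 1)" for v
  proof -
    have "v * ?t \<in> below (n - 1 + 2 * n)" using below_mult[OF v, of ?t "2 * n"] by (simp add: degree_monom_le)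
    then have "echar (v * ?t) u = add_char (coeff (v * ?t) (3 * n - 1 - 1))"
      using du n by (subst echar_below) (auto simp: algebra_simps)
    also have "coeff (v * ?t) (3 * n - 1 - 1) = coeff (v * ?t) (n - 2 + 2 * n)" using n by (intro arg_cong[of _ _ "coeff _"]) simp
    also have "\<dots> = coeff v (n - 2)" by (simp add: coeff_monom_mult mult.commute[of v])
    finally show ?thesis .
  qed
  have "(\<Sum>v\<in>below (n - 1). cnj (add_char (coeff v (n - 2))) * gauss v u)
      = (\<Sum>v\<in>below (n - 1). \<Sum>d\<in>below (3 * n - 1). \<chi> u d * echar (v * (d - ?t)) u)"
    unfolding gauss_def du sum_distrib_left
    by (intro sum.cong refl) (simp add: right_diff_distrib echar_diff top)
  also have "\<dots> = (\<Sum>d\<in>below (3 * n - 1). \<Sum>v\<in>below (n - 1). \<chi> u d * echar (v * (d - ?t)) u)" by (rule sum.swap)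
  also have "\<dots> = (\<Sum>d\<in>below (3 * n - 1). if d \<in> monics (2 * n) then \<chi> u d * qc ^ (n - 1) else 0)"
    unfolding sum_distrib_left[symmetric] by (intro sum.cong refl) (simp only: ind if_distrib[of "(*) _"] mult_zero_right)
  also have "\<dots> = (\<Sum>d\<in>monics (2 * n). \<chi> u d * qc ^ (n - 1))"
  proof -
    have "below (3 * n - 1) \<inter> monics (2 * n) = (monics (2 * n) :: 'a poly set)"
      using n by (auto simp: below_iff monics_iff)
    then show ?thesis by (subst sum.inter_restrict[symmetric]) auto
  qed
  finally show ?thesis by (simp add: sum_distrib_right[symmetric])
qed

text \<open>
  Reciprocity, Poisson summation in \<open>c\<close>, and the evaluation of the moments of \<open>v P\<^sup>2\<close>. The frequency
  \<open>v = 0\<close> gives nothing because the degree \<open>3 n - 1\<close> is not divisible by \<open>3\<close>.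
\<close>

theorem sum_chi_mult_prime:
  fixes P :: "'a poly"
  assumes P: "monic_irreducible P" "P \<in> monics n" and n: "n \<ge> 2"
  shows "(\<Sum>c\<in>monics (2 * n). \<Sum>u\<in>monics (3 * n - 1). \<chi> (c * P) u) = qc ^ (3 * n - 2)"
proof -
  define G where "G = (\<lambda>v. cnj (add_char (coeff v (n - 2))) * coprime_moment P v (3 * n - 1))"
  have nd3: "\<not> 3 dvd 3 * n - 1"
  proof
    assume "3 dvd 3 * n - 1"
    then have "3 dvd 3 * n - (3 * n - 1)" by (rule dvd_diff_nat[rotated]) simp
    moreover have "3 * n - (3 * n - 1) = 1" using n by simp
    ultimately show False by simp
  qed
  have "(\<Sum>c\<in>monics (2 * n). \<Sum>u\<in>monics (3 * n - 1). \<chi> (c * P) u)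
      = (\<Sum>c\<in>monics (2 * n). \<Sum>u\<in>monics (3 * n - 1). \<chi> u P * \<chi> u c)"
  proof (intro sum.cong refl)
    fix c u :: "'a poly" assume c: "c \<in> monics (2 * n)" and u: "u \<in> monics (3 * n - 1)"
    show "\<chi> (c * P) u = \<chi> u P * \<chi> u c"
      unfolding chi_mult_modulus[OF monicsD(3)[OF c] monicsD(3)[OF P(2)]] chi_recip[OF c u] chi_recip[OF P(2) u]
      by (rule mult.commute)
  qed
  also have "\<dots> = (\<Sum>u\<in>monics (3 * n - 1). \<chi> u P * (\<Sum>c\<in>monics (2 * n). \<chi> u c))"
    unfolding sum_distrib_left by (rule sum.swap)
  also have "\<dots> = (\<Sum>u\<in>monics (3 * n - 1). \<chi> u P * ((\<Sum>v\<in>below (n - 1). cnj (add_char (coeff v (n - 2))) * gauss v u) / qc ^ (n - 1)))"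
    by (intro sum.cong refl) (simp add: sum_chi_monics_poisson[OF n])
  also have "\<dots> = (\<Sum>u\<in>monics (3 * n - 1). \<Sum>v\<in>below (n - 1). cnj (add_char (coeff v (n - 2))) * (\<chi> u P * gauss v u)) / qc ^ (n - 1)"
    unfolding sum_divide_distrib sum_distrib_left by (intro sum.cong refl) simp
  also have "(\<Sum>u\<in>monics (3 * n - 1). \<Sum>v\<in>below (n - 1). cnj (add_char (coeff v (n - 2))) * (\<chi> u P * gauss v u))
      = (\<Sum>v\<in>below (n - 1). G v)"
  proof -
    have "(\<Sum>u\<in>monics (3 * n - 1). \<chi> u P * gauss v u) = coprime_moment P v (3 * n - 1)" for v
      unfolding coprime_moment_def
    proof (intro sum.cong refl)
      fix u :: "'a poly" assume u: "u \<in> monics (3 * n - 1)"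
      have "\<chi> u P = 0" if "P dvd u" using chi_eq_0[OF monics_nonzero[OF u]] P(1) that by auto
      then show "\<chi> u P * gauss v u = (if P dvd u then 0 else \<chi> u P * gauss v u)" by auto
    qed
    then show ?thesis unfolding G_def by (subst sum.swap) (simp only: sum_distrib_left[symmetric])
  qed
  also have "(\<Sum>v\<in>below (n - 1). G v) = qc ^ (n - 1) * qc ^ (3 * n - 2)"
  proof -
    have G0: "G 0 = 0"
      using coprime_moment_0[OF P(1)] total_eq_0[OF nd3] multiple_total_eq_0[OF P _ nd3] n by (simp add: G_def)
    have Gs: "G (smult a f) = (if Suc l = n - 1 then cnj (add_char a) * field_gauss 2 a * qc ^ (3 * n - 2) else 0)"
      if "l < n - 1" "f \<in> monics l" "a \<noteq> 0" for l f a
    proof -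
      have "degree (smult a f) = l" "smult a f \<noteq> 0" "lead_coeff (smult a f) = a"
        using that monicsD[OF that(2)] monics_nonzero[OF that(2)] by auto
      moreover have "coeff (smult a f) (n - 2) = a" if "Suc l = n - 1"
      proof -
        have "n - 2 = l" using that n by simp
        then show ?thesis using monicsD(2)[OF \<open>f \<in> monics l\<close>] by simp
      qed
      moreover have "l + 2 = n \<longleftrightarrow> Suc l = n - 1" using n by auto
      ultimately show ?thesis using coprime_moment_degree[OF P, of "smult a f"] that(1) unfolding G_def by auto
    qed
    have "(\<Sum>v\<in>below (n - 1). G v) = (\<Sum>l<n - 1. \<Sum>f\<in>monics l. \<Sum>a\<in>UNIV - {0}. G (smult a f))"
      by (rule sum_below_leading) (fact G0)
    also have "\<dots> = (\<Sum>l<n - 1. if l = n - 2 then \<Sum>f\<in>(monics l :: 'a poly set). \<Sum>a\<in>UNIV - {0}. cnj (add_char a) * field_gauss 2 a * qc ^ (3 * n - 2) else 0)"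
    proof (rule sum.cong[OF refl])
      fix l assume l: "l \<in> {..<n - 1}"
      have "Suc l = n - 1 \<longleftrightarrow> l = n - 2" using n by auto
      then show "(\<Sum>f\<in>monics l. \<Sum>a\<in>UNIV - {0}. G (smult a f))
          = (if l = n - 2 then \<Sum>f\<in>(monics l :: 'a poly set). \<Sum>a\<in>UNIV - {0}. cnj (add_char a) * field_gauss 2 a * qc ^ (3 * n - 2) else 0)"
        using l by (auto simp: Gs)
    qed
    also have "\<dots> = qc ^ (n - 2) * (\<Sum>a\<in>UNIV - {0}. cnj (add_char a) * field_gauss 2 a) * qc ^ (3 * n - 2)"
      using n by (simp add: card_monics sum_distrib_right)
    also have "(\<Sum>a\<in>UNIV - {0}. cnj (add_char a) * field_gauss 2 a) = qc"
    proof -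
      have "(\<Sum>a\<in>UNIV - {0}. cnj (add_char a) * field_gauss 2 a) = (\<Sum>a\<in>UNIV - {0}. chi0 a ^ 1 * add_char (- 1 * a)) * field_gauss 2 1"
        unfolding sum_distrib_right
      proof (intro sum.cong refl)
        fix a :: 'a assume "a \<in> UNIV - {0}"
        then have a: "a \<noteq> 0" by simp
        have "chi0 (inverse a) * chi0 a = 1" using a by (simp add: chi0_mult[symmetric])
        then have "chi0 (inverse a) ^ 2 = chi0 (inverse a) ^ 2 * (chi0 (inverse a) * chi0 a)" by simp
        also have "\<dots> = chi0 (inverse a) ^ 3 * chi0 a" by (simp add: power2_eq_square power3_eq_cube)
        also have "\<dots> = chi0 a" using a by (simp add: chi0_cube)
        finally have "chi0 (inverse a) ^ 2 = chi0 a" .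
        then show "cnj (add_char a) * field_gauss 2 a = chi0 a ^ 1 * add_char (- 1 * a) * field_gauss 2 1"
          using field_gauss_scale[OF a, of 2] by (simp add: add_char_minus)
      qed
      also have "\<dots> = field_gauss 1 (- 1) * field_gauss 2 1" unfolding field_gauss_def ..
      also have "field_gauss 1 (- 1) = field_gauss 1 1" using field_gauss_scale[of "- 1" 1] by (simp add: chi0_minus)
      also have "field_gauss 1 1 * field_gauss 2 1 = qc" by (rule field_gauss_1_2) simp
      finally show ?thesis .
    qed
    also have "qc ^ (n - 2) * qc = qc ^ (n - 1)"
    proof -
      have "n - 1 = Suc (n - 2)" using n by simp
      then show ?thesis by simp
    qed
    finally show ?thesis .
  qed
  finally show ?thesis by simp
qed

section \<open>Gauss sums of products\<close>

lemma sum_below_product: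
  fixes c P :: "'a poly"
  assumes c: "c \<in> monics m" and P: "P \<in> monics n" and cop: "coprime c P"
  shows "(\<Sum>d\<in>below (m + n). F d) = (\<Sum>x\<in>below m. \<Sum>y\<in>below n. F (x * P + y * c))"
proof -
  define \<phi> where "\<phi> = (\<lambda>(x, y). x * P + y * c)"
  let ?A = "below m \<times> below n :: ('a poly \<times> 'a poly) set"
  have deg: "degree c = m" "degree P = n" using c P by (auto simp: monicsD)
  have inj: "inj_on \<phi> ?A"
  proof (rule inj_onI)
    fix z z' assume z: "z \<in> ?A" "z' \<in> ?A" and eq: "\<phi> z = \<phi> z'"
    obtain x y x' y' where xy: "z = (x, y)" "z' = (x', y')" by (cases z, cases z')
    have e: "(x - x') * P = (y' - y) * c" using eq by (simp add: xy \<phi>_def algebra_simps)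
    have "c dvd P * (x - x')" unfolding mult.commute[of P] e by simp
    then have 1: "c dvd x - x'" by (rule coprime_dvd_mult_poly[OF cop])
    have "P dvd c * (y' - y)" unfolding mult.commute[of c] e[symmetric] by simp
    then have 2: "P dvd y' - y" by (rule coprime_dvd_mult_poly[OF coprime_commute[THEN iffD1, OF cop]])
    have small: "f = 0" if "g dvd f" "f \<in> below (degree g)" for f g :: "'a poly"
      using that dvd_imp_degree_le[of g f] unfolding below_iff by linarith
    have "x - x' = 0"
      using z by (intro small[OF 1]) (auto simp: xy deg intro: below_diff)
    moreover have "y' - y = 0"
      using z by (intro small[OF 2]) (auto simp: xy deg intro: below_diff)
    ultimately show "z = z'" by (simp add: xy)
  qed
  have sub: "\<phi> ` ?A \<subseteq> below (m + n)"
  proof (clarsimp simp: \<phi>_def)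
    fix x y :: "'a poly" assume x: "x \<in> below m" and y: "y \<in> below n"
    have "y * c \<in> below (n + m)" by (rule below_mult[OF y]) (simp add: deg)
    moreover have "x * P \<in> below (m + n)" by (rule below_mult[OF x]) (simp add: deg)
    ultimately show "x * P + y * c \<in> below (m + n)" by (simp add: below_add add.commute)
  qed
  have "card (\<phi> ` ?A) = card (below (m + n) :: 'a poly set)"
    by (simp add: card_image[OF inj] card_cartesian_product card_below power_add)
  then have "\<phi> ` ?A = below (m + n)" using sub by (intro card_subset_eq) auto
  then have "(\<Sum>d\<in>below (m + n). F d) = (\<Sum>z\<in>?A. F (\<phi> z))"
    using sum.reindex[OF inj, of F] by simp
  then show ?thesis by (simp add: \<phi>_def sum.cartesian_product case_prod_unfold)
qed

lemma gauss_coprime_product: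
  fixes c P :: "'a poly"
  assumes c: "c \<in> monics m" and P: "P \<in> monics n" and cop: "coprime c P"
  shows "gauss 1 (c * P) = \<chi> c P * \<chi> P c * gauss 1 c * gauss 1 P"
proof -
  have cP: "c * P \<in> monics (m + n)" by (rule monics_mult[OF c P])
  have "gauss 1 (c * P) = (\<Sum>x\<in>below m. \<Sum>y\<in>below n. \<chi> (c * P) (x * P + y * c) * echar (1 * (x * P + y * c)) (c * P))"
    unfolding gauss_def monicsD(1)[OF cP] by (rule sum_below_product[OF c P cop])
  also have "\<dots> = (\<Sum>x\<in>below m. \<Sum>y\<in>below n. \<chi> c P * \<chi> P c * (\<chi> c x * echar (1 * x) c) * (\<chi> P y * echar (1 * y) P))"
  proof (intro sum.cong refl)
    fix x y :: "'a poly"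
    have 1: "\<chi> c (x * P + y * c) = \<chi> c x * \<chi> c P"
      unfolding chi_mult[symmetric] by (rule chi_cong) simp
    have 2: "\<chi> P (x * P + y * c) = \<chi> P y * \<chi> P c"
      unfolding chi_mult[symmetric] by (rule chi_cong) simp
    have 3: "echar (x * P + y * c) (c * P) = echar x c * echar y P"
      by (rule echar_common_denominator[OF monicsD(3)[OF c] monicsD(3)[OF P], symmetric])
    show "\<chi> (c * P) (x * P + y * c) * echar (1 * (x * P + y * c)) (c * P)
        = \<chi> c P * \<chi> P c * (\<chi> c x * echar (1 * x) c) * (\<chi> P y * echar (1 * y) P)"
      unfolding mult_1_left chi_mult_modulus[OF monicsD(3)[OF c] monicsD(3)[OF P]] 1 2 3 by (simp only: mult_ac)
  qed
  also have "\<dots> = \<chi> c P * \<chi> P c * gauss 1 c * gauss 1 P"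
    unfolding gauss_def monicsD(1)[OF c] monicsD(1)[OF P] sum_distrib_left[symmetric] sum_distrib_right[symmetric]
    by (simp only: mult_ac)
  finally show ?thesis .
qed

text \<open>
  Adding a multiple of \<open>Q c\<close> to the residue does not change \<open>\<chi>\<close>, as \<open>Q\<close> and \<open>c\<close> divide it, but it changes
  the additive character by an arbitrary value of \<open>e(w / Q)\<close>.
\<close>

lemma gauss_square_modulus_eq_0:
  fixes c Q :: "'a poly"
  assumes Q: "Q \<in> monics k" "k > 0" and c: "c \<in> monics m"
  shows "gauss 1 (Q ^ 2 * c) = 0"
proof -
  define M where "M = Q ^ 2 * c"
  have Qc: "Q * c \<in> monics (k + m)" by (rule monics_mult[OF Q(1) c])
  have M: "M = Q * (Q * c)" by (simp add: M_def power2_eq_square)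
  have MM: "M \<in> monics (k + (k + m))" unfolding M by (rule monics_mult[OF Q(1) Qc])
  obtain a :: 'a where a: "add_char a \<noteq> 1" using ex_add_char_neq_1 by blast
  define w where "w = monom a (k - 1)"
  have w: "w \<in> below k" using Q(2) by (auto simp: w_def below_def)
  have ew: "echar (w * (Q * c)) M = add_char a"
  proof -
    have "echar (w * (Q * c)) M = echar w Q"
      unfolding M by (rule echar_cancel[OF monics_nonzero[OF Q(1)] monicsD(3)[OF Qc]])
    also have "\<dots> = add_char (coeff w (k - 1))" using w monicsD(1)[OF Q(1)] by (simp add: echar_below)
    finally show ?thesis by (simp add: w_def)
  qed
  have z: "w * (Q * c) \<in> below (k + (k + m))" by (rule below_mult[OF w]) (simp add: monicsD(1)[OF Qc])
  have chi: "\<chi> M (d + w * (Q * c)) = \<chi> M d" for d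
  proof -
    have "\<chi> Q (d + w * (Q * c)) = \<chi> Q d" "\<chi> c (d + w * (Q * c)) = \<chi> c d" by (auto intro: chi_cong)
    then show ?thesis
      unfolding M chi_mult_modulus[OF monicsD(3)[OF Q(1)] monicsD(3)[OF Qc]] chi_mult_modulus[OF monicsD(3)[OF Q(1)] monicsD(3)[OF c]]
      by simp
  qed
  have "gauss 1 M = (\<Sum>d\<in>below (k + (k + m)). \<chi> M (d + w * (Q * c)) * echar (d + w * (Q * c)) M)"
    unfolding gauss_def monicsD(1)[OF MM] mult_1_left by (rule sum_below_translate[OF z, symmetric])
  also have "\<dots> = gauss 1 M * add_char a"
    unfolding gauss_def monicsD(1)[OF MM] mult_1_left sum_distrib_right chi echar_add ew mult.assoc ..
  finally have "gauss 1 M * (add_char a - 1) = 0" by (simp add: algebra_simps)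
  then show ?thesis using a by (simp add: M_def)
qed

lemma gauss_0_irreducible: "monic_irreducible P \<Longrightarrow> gauss 0 P = 0"
  using gauss_exact_power_eq_0[of P 1 1 0] by (auto simp: monic_irreducible_def irreducible_not_unit)

text \<open>
  The classical evaluation of the absolute value, by averaging \<open>|G(g, P)|\<^sup>2\<close> over \<open>g\<close>.
\<close>

lemma gauss_mult_cnj:
  fixes P :: "'a poly"
  assumes P: "monic_irreducible P" "P \<in> monics n" and n: "n > 0"
  shows "gauss 1 P * cnj (gauss 1 P) = qc ^ n"
proof -
  let ?B = "below n :: 'a poly set"
  have P0: "P \<noteq> 0" using monics_nonzero[OF P(2)] .
  have nd: "\<not> P dvd g" if "g \<in> ?B" "g \<noteq> 0" for g
    using that dvd_imp_degree_le[of P g] monicsD(1)[OF P(2)] by (auto simp: below_iff)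
  have chi1: "\<chi> P g * cnj (\<chi> P g) = (if g = 0 then 0 else 1)" if "g \<in> ?B" for g
  proof (cases "g = 0")
    case True
    then show ?thesis using chi_zero[of P] monicsD(1)[OF P(2)] n by simp
  next
    case False
    have "\<chi> P g \<noteq> 0"
      using nd[OF that False] coprime_monic_irreducible_iff[OF P(1)] chi_eq_0_iff_coprime[OF P0] by blast
    then show ?thesis using chi_mult_cnj[OF P0] False by simp
  qed
  have sum1: "(\<Sum>g\<in>?B. if g = 0 then 0 else z) = (qc ^ n - 1) * z" for z
  proof -
    have "(\<Sum>g\<in>?B. if g = 0 then 0 else z) = (\<Sum>g\<in>?B. z) - (\<Sum>g\<in>?B. if g = 0 then z else 0)"
      unfolding sum_subtractf[symmetric] by (intro sum.cong) auto
    then show ?thesis by (simp add: card_below algebra_simps)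
  qed
  have "(\<Sum>g\<in>?B. gauss g P * cnj (gauss g P)) = (\<Sum>g\<in>?B. if g = 0 then 0 else gauss 1 P * cnj (gauss 1 P))"
  proof (intro sum.cong refl)
    fix g assume g: "g \<in> ?B"
    show "gauss g P * cnj (gauss g P) = (if g = 0 then 0 else gauss 1 P * cnj (gauss 1 P))"
    proof (cases "g = 0")
      case True
      then show ?thesis using gauss_0_irreducible[OF P(1)] by simp
    next
      case False
      have "coprime P g" using nd[OF g False] coprime_monic_irreducible_iff[OF P(1)] by blast
      then have "gauss 1 P = gauss g P * \<chi> P g" using gauss_mult_coprime[OF P0, of g 1] by simp
      then have "gauss 1 P * cnj (gauss 1 P) = gauss g P * cnj (gauss g P) * (\<chi> P g * cnj (\<chi> P g))" by simp
      then show ?thesis using chi1[OF g] False by simp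
    qed
  qed
  also have "\<dots> = (qc ^ n - 1) * (gauss 1 P * cnj (gauss 1 P))" by (rule sum1)
  finally have 1: "(\<Sum>g\<in>?B. gauss g P * cnj (gauss g P)) = (qc ^ n - 1) * (gauss 1 P * cnj (gauss 1 P))" .
  have "(\<Sum>g\<in>?B. gauss g P * cnj (gauss g P))
      = (\<Sum>g\<in>?B. \<Sum>d\<in>?B. \<Sum>e\<in>?B. \<chi> P d * cnj (\<chi> P e) * echar (g * (d - e)) P)"
    unfolding gauss_def monicsD(1)[OF P(2)] cnj_sum sum_product
    by (intro sum.cong refl) (simp add: right_diff_distrib echar_diff)
  also have "\<dots> = (\<Sum>d\<in>?B. \<Sum>g\<in>?B. \<Sum>e\<in>?B. \<chi> P d * cnj (\<chi> P e) * echar (g * (d - e)) P)" by (rule sum.swap)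
  also have "\<dots> = (\<Sum>d\<in>?B. \<Sum>e\<in>?B. \<Sum>g\<in>?B. \<chi> P d * cnj (\<chi> P e) * echar (g * (d - e)) P)"
    by (rule sum.cong[OF refl], rule sum.swap)
  also have "\<dots> = (\<Sum>d\<in>?B. \<Sum>e\<in>?B. if e = d then \<chi> P d * cnj (\<chi> P e) * qc ^ n else 0)"
    unfolding sum_distrib_left[symmetric] sum_echar_dvd[OF P(2)]
  proof (intro sum.cong refl)
    fix d e assume de: "d \<in> ?B" "e \<in> ?B"
    have "P dvd d - e \<longleftrightarrow> e = d" using nd[of "d - e"] below_diff[OF de] by auto
    then show "\<chi> P d * cnj (\<chi> P e) * (if P dvd d - e then qc ^ n else 0) = (if e = d then \<chi> P d * cnj (\<chi> P e) * qc ^ n else 0)"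
      by simp
  qed
  also have "\<dots> = (\<Sum>d\<in>?B. if d = 0 then 0 else qc ^ n)"
    by (intro sum.cong refl) (auto simp: chi1)
  also have "\<dots> = (qc ^ n - 1) * qc ^ n" by (rule sum1)
  finally have "(qc ^ n - 1) * (gauss 1 P * cnj (gauss 1 P)) = (qc ^ n - 1) * qc ^ n" using 1 by simp
  moreover have "qc ^ n \<noteq> 1"
  proof
    assume "qc ^ n = 1"
    then have "real CARD('a) ^ n = 1" by (metis norm_one norm_power norm_qc)
    then show False using q_ge_2 n one_less_power[of "real CARD('a)" n] by simp
  qed
  ultimately show ?thesis by simp
qed

text \<open>
  For a modulus \<open>F\<close> of degree divisible by \<open>3\<close> the Gauss sum only sees the leading coefficient of
  the residues, and the symbol is trivial on constants.
\<close>

lemma gauss_even_modulus: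
  fixes F :: "'a poly"
  assumes F: "F \<in> monics m" and m: "3 dvd m" "m > 0"
  shows "gauss 1 F = gauss 0 F - qc * (\<Sum>u\<in>monics (m - 1). \<chi> F u)"
proof -
  let ?S = "\<Sum>u\<in>(monics (m - 1) :: 'a poly set). \<chi> F u"
  have part: "(\<Sum>d\<in>below m. \<chi> F d * G (coeff d (m - 1))) = (\<Sum>d\<in>below (m - 1). \<chi> F d) * G 0 + ?S * (\<Sum>a\<in>UNIV - {0}. G a)"
    for G :: "'a \<Rightarrow> complex"
  proof -
    have z: "\<chi> F 0 = 0" using chi_zero[of F] monicsD(1)[OF F] m(2) by simp
    have "(\<Sum>d\<in>below m. \<chi> F d * G (coeff d (m - 1))) = (\<Sum>l<m. \<Sum>u\<in>monics l. \<Sum>a\<in>UNIV - {0}. \<chi> F (smult a u) * G (coeff (smult a u) (m - 1)))"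
      by (rule sum_below_leading) (simp add: z)
    also have "{..<m} = insert (m - 1) {..<m - 1}" using m(2) by auto
    also have "(\<Sum>l\<in>insert (m - 1) {..<m - 1}. \<Sum>u\<in>monics l. \<Sum>a\<in>UNIV - {0}. \<chi> F (smult a u) * G (coeff (smult a u) (m - 1)))
        = (\<Sum>u\<in>monics (m - 1). \<Sum>a\<in>UNIV - {0}. \<chi> F (smult a u) * G (coeff (smult a u) (m - 1)))
          + (\<Sum>l<m - 1. \<Sum>u\<in>monics l. \<Sum>a\<in>UNIV - {0}. \<chi> F (smult a u) * G (coeff (smult a u) (m - 1)))"
      by (rule sum.insert) auto
    also have "(\<Sum>u\<in>monics (m - 1). \<Sum>a\<in>UNIV - {0}. \<chi> F (smult a u) * G (coeff (smult a u) (m - 1))) = ?S * (\<Sum>a\<in>UNIV - {0}. G a)"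
      unfolding sum_product
      by (intro sum.cong refl) (simp add: chi_smult[OF F] chi0_power_eq_1[OF m(1)] monicsD)
    also have "(\<Sum>l<m - 1. \<Sum>u\<in>monics l. \<Sum>a\<in>UNIV - {0}. \<chi> F (smult a u) * G (coeff (smult a u) (m - 1)))
        = (\<Sum>l<m - 1. \<Sum>u\<in>monics l. \<Sum>a\<in>UNIV - {0}. \<chi> F (smult a u) * G 0)"
      by (intro sum.cong refl) (simp add: monicsD coeff_eq_0)
    also have "\<dots> = (\<Sum>d\<in>below (m - 1). \<chi> F d * G 0)"
      by (rule sum_below_leading[symmetric]) (simp add: z)
    finally show ?thesis unfolding sum_distrib_right by simp
  qed
  have e: "echar d F = add_char (coeff d (m - 1))" if "d \<in> below m" for d
    using that monicsD(1)[OF F] by (simp add: echar_below)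
  have "gauss 1 F = (\<Sum>d\<in>below m. \<chi> F d * add_char (coeff d (m - 1)))"
    unfolding gauss_def monicsD(1)[OF F] by (intro sum.cong refl) (simp add: e)
  also have "\<dots> = (\<Sum>d\<in>below (m - 1). \<chi> F d) * add_char (0 :: 'a) + ?S * (\<Sum>a\<in>UNIV - {0 :: 'a}. add_char a)"
    by (rule part)
  also have "(\<Sum>a\<in>UNIV - {0 :: 'a}. add_char a) = - 1"
    using field_gauss_trivial[of 0 1] by (simp add: field_gauss_def)
  finally have 1: "gauss 1 F = (\<Sum>d\<in>below (m - 1). \<chi> F d) - ?S" by simp
  have "gauss 0 F = (\<Sum>d\<in>below m. \<chi> F d * 1)"
    unfolding gauss_def monicsD(1)[OF F] by simp
  also have "\<dots> = (\<Sum>d\<in>below (m - 1). \<chi> F d) * 1 + ?S * (\<Sum>a\<in>UNIV - {0 :: 'a}. 1)"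
    by (rule part)
  also have "(\<Sum>a\<in>UNIV - {0 :: 'a}. 1) = qc - 1" using of_nat_card_units by simp
  finally have 2: "gauss 0 F = (\<Sum>d\<in>below (m - 1). \<chi> F d) + ?S * (qc - 1)" by simp
  show ?thesis unfolding 1 2 by (simp add: algebra_simps)
qed

text \<open>
  The complete sums add up to \<open>multiple_total P (3 n)\<close>, and the sums over monic polynomials to the double sum
  evaluated above.
\<close>

theorem sum_gauss_mult_prime:
  fixes P :: "'a poly"
  assumes P: "monic_irreducible P" "P \<in> monics n" and n: "n \<ge> 2"
  shows "(\<Sum>c\<in>monics (2 * n). gauss 1 (c * P)) = qc ^ (3 * n) - qc ^ (3 * n - 1) - qc ^ (2 * n)"
proof -
  have cP: "c * P \<in> monics (3 * n)" if "c \<in> monics (2 * n)" for c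
    using monics_mult[OF that P(2)] by (simp add: algebra_simps)
  have "(\<Sum>c\<in>monics (2 * n). gauss 1 (c * P))
      = (\<Sum>c\<in>monics (2 * n). gauss 0 (c * P)) - qc * (\<Sum>c\<in>monics (2 * n). \<Sum>u\<in>monics (3 * n - 1). \<chi> (c * P) u)"
    unfolding sum_distrib_left[of qc] sum_subtractf[symmetric]
    using n by (intro sum.cong refl) (subst gauss_even_modulus[OF cP], auto simp: sum_distrib_left)
  also have "(\<Sum>c\<in>monics (2 * n). gauss 0 (c * P)) = multiple_total P (3 * n)"
  proof -
    have "multiple_total P (3 * n) = (\<Sum>F\<in>{F \<in> monics (3 * n). P dvd F}. gauss 0 F)"
      unfolding multiple_total_def by (rule sum.inter_filter[symmetric]) simp
    also have "\<dots> = (\<Sum>c\<in>monics (2 * n). gauss 0 (c * P))"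
    proof (rule sum.reindex_bij_witness[of _ "\<lambda>c. c * P" "\<lambda>F. F div P"])
      fix F assume "F \<in> {F \<in> monics (3 * n). P dvd F}"
      then have F: "F \<in> monics (3 * n)" "P dvd F" by auto
      then have e: "P * (F div P) = F" by simp
      then have "P * (F div P) \<in> monics (n + 2 * n)" using F by (simp add: algebra_simps)
      then show "F div P \<in> monics (2 * n)" by (rule monics_mult_cancel[OF P(2)])
      show "F div P * P = F" using F by simp
      then show "gauss 0 (F div P * P) = gauss 0 F" by simp
    next
      fix c :: "'a poly" assume c: "c \<in> monics (2 * n)"
      show "c * P div P = c" using monics_nonzero[OF P(2)] by simp
      show "c * P \<in> {F \<in> monics (3 * n). P dvd F}" using cP[OF c] by simp
    qed
    finally show ?thesis ..
  qed
  also have "multiple_total P (3 * n) = qc ^ (3 * n) - qc ^ (2 * n)"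
    using multiple_total_rec[OF P, of "3 * n"] multiple_total_rec[OF P, of 0] n by (simp add: total_0)
  also have "qc * (\<Sum>c\<in>monics (2 * n). \<Sum>u\<in>monics (3 * n - 1). \<chi> (c * P) u) = qc ^ (3 * n - 1)"
  proof -
    have "3 * n - 1 = Suc (3 * n - 2)" using n by simp
    then show ?thesis unfolding sum_chi_mult_prime[OF P n] by simp
  qed
  finally show ?thesis by simp
qed

end

section \<open>Counting square-free polynomials\<close>

text \<open>
  This gives uniqueness of the decomposition of a monic polynomial into a square-free one and a square.
\<close>

lemma square_dvd_squarefree_mult_square:
  fixes a b :: "'b::field poly"
  assumes b': "lead_coeff b' = 1" and a: "squarefree a" and "b \<noteq> 0" and "b' ^ 2 dvd a * b ^ 2"
  shows "b' dvd b"
  using assms(1,3,4)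
proof (induction b' arbitrary: b rule: monic_factor_induct)
  case (mult Q c)
  have Q: "prime_elem Q" using mult.hyps(1) by (rule monic_irreducible_prime_elem)
  have Q2: "Q ^ 2 dvd a * b ^ 2" using mult.prems(2) by (metis dvd_mult_left power_mult_distrib)
  have "Q dvd b"
  proof (rule ccontr)
    assume nd: "\<not> Q dvd b"
    have nd2: "\<not> Q dvd b ^ 2" using nd prime_elem_dvd_power[OF Q] by blast
    have Q0: "Q \<noteq> 0" using Q by auto
    obtain e where e: "a * b ^ 2 = Q ^ 2 * e" using Q2 by blast
    have "Q dvd Q ^ 2 * e" by (simp add: power2_eq_square)
    then have "Q dvd a * b ^ 2" unfolding e .
    then have "Q dvd a" using nd2 Q by (simp add: prime_elem_dvd_mult_iff)
    then obtain a1 where a1: "a = Q * a1" by blast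
    have "Q * (a1 * b ^ 2) = Q * (Q * e)" using e unfolding a1 power2_eq_square mult.assoc .
    then have "a1 * b ^ 2 = Q * e" using Q0 by simp
    then have "Q dvd a1 * b ^ 2" by simp
    then have "Q dvd a1" using nd2 Q by (simp add: prime_elem_dvd_mult_iff)
    then have "Q ^ 2 dvd a" unfolding a1 power2_eq_square by simp
    then have "Q dvd 1" using a by (rule squarefreeD[rotated])
    then show False using Q by (simp add: prime_elem_def)
  qed
  then obtain b1 where b1: "b = Q * b1" by blast
  have Q0: "Q \<noteq> 0" using Q by auto
  have "Q ^ 2 * c ^ 2 dvd Q ^ 2 * (a * b1 ^ 2)" using mult.prems(2) unfolding b1 power_mult_distrib by (simp only: mult_ac)
  then have "c ^ 2 dvd a * b1 ^ 2" using Q0 by simp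
  then have "c dvd b1" using mult.IH[of b1] mult.prems(1) b1 by auto
  then show ?case unfolding b1 by (rule mult_dvd_mono[OF dvd_refl])
qed simp

lemma ex_squarefree_mult_square:
  fixes c :: "'b::field poly"
  assumes "lead_coeff c = 1"
  shows "\<exists>a b. c = a * b ^ 2 \<and> squarefree a \<and> lead_coeff a = 1 \<and> lead_coeff b = 1"
  using assms
proof (induction "degree c" arbitrary: c rule: less_induct)
  case less
  show ?case
  proof (cases "squarefree c")
    case True
    then have "c = c * 1 ^ 2 \<and> squarefree c \<and> lead_coeff c = 1 \<and> lead_coeff (1 :: 'b poly) = 1" using less.prems by simp
    then show ?thesis by blast
  next
    case False
    have c0: "c \<noteq> 0" using less.prems by auto
    obtain x where x: "x ^ 2 dvd c" "\<not> x dvd 1" using False by (auto simp: squarefree_def)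
    have "x \<noteq> 0" using x c0 by auto
    then have "degree x > 0" using x by (simp add: is_unit_iff_degree)
    then obtain Q where Q: "monic_irreducible Q" "Q dvd x" using ex_irreducible_factor by blast
    have lQ: "lead_coeff Q = 1" and dQ: "degree Q > 0" using Q by (auto simp: monic_irreducible_def irreducible_degree_pos)
    have "Q ^ 2 dvd c" using Q(2) x(1) dvd_power_same dvd_trans by blast
    then obtain e where e: "c = Q ^ 2 * e" by blast
    have e0: "e \<noteq> 0" "Q \<noteq> 0" using e c0 dQ by auto
    have "lead_coeff e = 1" using less.prems lQ unfolding e lead_coeff_mult lead_coeff_power by simp
    moreover have "degree e < degree c" using e0 dQ by (simp add: e degree_mult_eq degree_power_eq)
    ultimately obtain a b where ab: "e = a * b ^ 2" "squarefree a" "lead_coeff a = 1" "lead_coeff b = 1"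
      using less.hyps by blast
    have "c = a * (Q * b) ^ 2" unfolding e ab(1) by (simp add: power_mult_distrib mult_ac)
    moreover have "lead_coeff (Q * b) = 1" unfolding lead_coeff_mult using lQ ab(4) by simp
    ultimately show ?thesis using ab by blast
  qed
qed

lemma H_set_eq: "H_set d = {c \<in> monics d. squarefree c}"
  unfolding H_set_def monic_squarefree_def by (auto simp: monics_iff)

lemma finite_H_set: "finite (H_set d)"
  unfolding H_set_eq by simp

text \<open>
  Every monic polynomial is \<open>a b\<^sup>2\<close> with \<open>a\<close> square-free in exactly one way.
\<close>

lemma card_monics_squarefree_parts:
  "CARD('b::finite_field) ^ k = (\<Sum>i\<le>k div 2. card (H_set (k - 2 * i) :: 'b poly set) * CARD('b) ^ i)"
proof -
  define A :: "(nat \<times> 'b poly \<times> 'b poly) set" where "A = (SIGMA i : {..k div 2}. H_set (k - 2 * i) \<times> monics i)"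
  define \<phi> :: "nat \<times> 'b poly \<times> 'b poly \<Rightarrow> 'b poly" where "\<phi> = (\<lambda>(i, a, b). a * b ^ 2)"
  have inj: "inj_on \<phi> A"
  proof (rule inj_onI)
    fix z z' assume "z \<in> A" "z' \<in> A" and eq: "\<phi> z = \<phi> z'"
    moreover obtain i a b i' a' b' where z: "z = (i, a, b)" "z' = (i', a', b')" by (cases z, cases z')
    ultimately have 1: "squarefree a" "squarefree a'" "b \<in> monics i" "b' \<in> monics i'" and e: "a * b ^ 2 = a' * b' ^ 2"
      by (auto simp: A_def H_set_eq \<phi>_def)
    have nz: "b \<noteq> 0" "b' \<noteq> 0" using 1 monics_nonzero by blast+
    have "b' dvd b" using e by (intro square_dvd_squarefree_mult_square[OF monicsD(3)[OF 1(4)] 1(1) nz(1)]) simp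
    moreover have "b dvd b'" using e[symmetric] by (intro square_dvd_squarefree_mult_square[OF monicsD(3)[OF 1(3)] 1(2) nz(2)]) simp
    ultimately have "degree b = degree b'" using nz by (meson dvd_imp_degree_le le_antisym)
    then have ii: "i = i'" using 1 by (simp add: monicsD)
    obtain w where w: "b = b' * w" using \<open>b' dvd b\<close> by blast
    have "w \<in> monics 0" using monics_mult_cancel[OF 1(4), of w 0] 1(3) w ii by simp
    then have bb: "b = b'" using w by simp
    moreover have "a = a'" using e nz unfolding bb by simp
    ultimately show "z = z'" using z ii by simp
  qed
  have "\<phi> ` A = monics k"
  proof (intro equalityI subsetI)
    fix c assume "c \<in> \<phi> ` A"
    then obtain i a b where "i \<le> k div 2" "a \<in> monics (k - 2 * i)" "b \<in> monics i" "c = a * (b * b)"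
      by (auto simp: A_def H_set_eq \<phi>_def power2_eq_square)
    moreover from this have "c \<in> monics (k - 2 * i + (i + i))" by (simp only: monics_mult)
    moreover have "k - 2 * i + (i + i) = k" using \<open>i \<le> k div 2\<close> by linarith
    ultimately show "c \<in> monics k" by simp
  next
    fix c :: "'b poly" assume c: "c \<in> monics k"
    then obtain a b where ab: "c = a * b ^ 2" "squarefree a" "lead_coeff a = 1" "lead_coeff b = 1"
      using ex_squarefree_mult_square[OF monicsD(3)[OF c]] by blast
    have nz: "a \<noteq> 0" "b \<noteq> 0" using ab by auto
    have "k = degree a + 2 * degree b" using monicsD(1)[OF c] nz by (simp add: ab(1) degree_mult_eq degree_power_eq)
    then have "(degree b, a, b) \<in> A" using ab by (auto simp: A_def H_set_eq monics_iff)
    moreover have "\<phi> (degree b, a, b) = c" by (simp add: \<phi>_def ab(1))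
    ultimately show "c \<in> \<phi> ` A" by (metis imageI)
  qed
  then have "CARD('b) ^ k = card A" using card_image[OF inj] by (simp add: card_monics)
  also have "card A = (\<Sum>i\<le>k div 2. card ((H_set (k - 2 * i) :: 'b poly set) \<times> (monics i :: 'b poly set)))"
    unfolding A_def by (simp add: card_SigmaI finite_H_set)
  also have "\<dots> = (\<Sum>i\<le>k div 2. card (H_set (k - 2 * i) :: 'b poly set) * CARD('b) ^ i)"
    by (simp add: card_cartesian_product card_monics)
  finally show ?thesis .
qed

text \<open>
  The decompositions with \<open>b \<noteq> 1\<close> of degree \<open>k + 2\<close> correspond, up to the factor \<open>q\<close>, to all
  decompositions in degree \<open>k\<close>.
\<close>

lemma card_H_set:
  "card (H_set (k + 2) :: 'b::finite_field poly set) + CARD('b) ^ (k + 1) = CARD('b) ^ (k + 2)"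
proof -
  let ?h = "\<lambda>k. card (H_set k :: 'b poly set)"
  have "CARD('b) ^ (k + 2) = (\<Sum>i\<le>Suc (k div 2). ?h (k + 2 - 2 * i) * CARD('b) ^ i)"
    using card_monics_squarefree_parts[of "k + 2", where ?'b = 'b] by simp
  also have "\<dots> = ?h (k + 2) + (\<Sum>i\<le>k div 2. ?h (k - 2 * i) * CARD('b) ^ i * CARD('b))"
    by (subst sum.atMost_Suc_shift) (simp add: mult_ac)
  also have "(\<Sum>i\<le>k div 2. ?h (k - 2 * i) * CARD('b) ^ i * CARD('b)) = CARD('b) ^ k * CARD('b)"
    unfolding sum_distrib_right[symmetric] card_monics_squarefree_parts[symmetric] ..
  finally show ?thesis by simp
qed

section \<open>Root numbers and the first moment\<close>

lemma poly_at_infinity_nth: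
  "fls_nth (poly_at_infinity f) k = (if k \<le> 0 then coeff f (nat (- k)) else 0)"
proof (induction f arbitrary: k)
  case 0
  show ?case by (simp add: poly_at_infinity_def)
next
  case (pCons a f)
  have "poly_at_infinity (pCons a f) = fls_const a + fls_X_inv * poly_at_infinity f"
    unfolding poly_at_infinity_def by (subst map_poly_pCons) simp_all
  then have e: "fls_nth (poly_at_infinity (pCons a f)) k = fls_nth (fls_const a) k + fls_nth (poly_at_infinity f) (k + 1)"
    by (simp add: fls_X_inv_times_conv_shift)
  consider "k > 0" | "k = 0" | "k < 0" by linarith
  then show ?case
  proof cases
    case 3
    then have "nat (- k) = Suc (nat (- (k + 1)))" by simp
    then show ?thesis using e pCons.IH[of "k + 1"] 3 by simp
  qed (use e pCons.IH[of "k + 1"] in simp_all)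
qed

text \<open>
  In \<open>\<F>\<^sub>q((1/T))\<close> the quotient \<open>u / c\<close> has no coefficient before \<open>1/T\<close>, and the coefficient of \<open>1/T\<close> is the
  quotient of the coefficients of \<open>T ^ (m - 1)\<close> and \<open>T ^ m\<close>.
\<close>

lemma poly_at_infinity_divide_nth:
  assumes c: "c \<in> monics m" "m > 0" and u: "u \<in> below m"
  shows "fls_nth (poly_at_infinity u / poly_at_infinity c) 1 = coeff u (m - 1)"
proof (cases "u = 0")
  case True
  then have "poly_at_infinity u = 0" by (simp add: poly_at_infinity_def)
  then show ?thesis using True by simp
next
  case False
  define U where "U = poly_at_infinity u"
  define C where "C = poly_at_infinity c"
  define h where "h = U / C"
  have Cm: "fls_nth C (- int m) = 1" using c by (simp add: C_def poly_at_infinity_nth monicsD)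
  have sC: "fls_subdegree C = - int m"
  proof (rule fls_subdegree_eqI)
    show "fls_nth C k = 0" if "k < - int m" for k
    proof -
      have "m < nat (- k)" using that by simp
      then show ?thesis using that monicsD(1)[OF c(1)] by (simp add: C_def poly_at_infinity_nth coeff_eq_0)
    qed
  qed (use Cm in simp)
  have C0: "C \<noteq> 0" using Cm by auto
  have U0: "U \<noteq> 0"
  proof
    assume "U = 0"
    then have "fls_nth U (- int i) = 0" for i by simp
    then have "coeff u i = 0" for i by (simp add: U_def poly_at_infinity_nth)
    then show False using False by (simp add: poly_eq_iff)
  qed
  have U: "U = h * C" using C0 by (simp add: h_def)
  then have h0: "h \<noteq> 0" using U0 by auto
  have sU: "fls_subdegree U = fls_subdegree h - int m" unfolding U using h0 C0 by (simp add: sC)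
  have "1 - int m \<le> fls_subdegree U"
  proof (rule fls_subdegree_geI[OF U0])
    fix k assume k: "k < 1 - int m"
    then have "nat (- k) \<ge> m" by simp
    then show "fls_nth U k = 0" using u c k by (simp add: U_def poly_at_infinity_nth below_def)
  qed
  then have sh: "1 \<le> fls_subdegree h" using sU by simp
  have top: "fls_nth U (1 - int m) = coeff u (m - 1)"
    using c(2) by (simp add: U_def poly_at_infinity_nth nat_diff_distrib)
  have "fls_nth h 1 = fls_nth U (1 - int m)"
  proof (cases "fls_subdegree h = 1")
    case True
    have "fls_nth U (fls_subdegree h + fls_subdegree C) = fls_nth h (fls_subdegree h) * fls_nth C (fls_subdegree C)"
      unfolding U by (rule fls_times_base)
    then show ?thesis unfolding True sC Cm by simp
  next
    case False
    then show ?thesis using sh sU by simp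
  qed
  then show ?thesis using top by (simp add: h_def U_def C_def)
qed

context cubic_symbols
begin

lemma gauss_sum_eq_gauss:
  assumes c: "c \<in> monics m" and m: "m > 0"
  shows "gauss_sum (\<chi> c) c = gauss 1 c"
proof -
  have c0: "c \<noteq> 0" "degree c = m" using monics_nonzero[OF c] monicsD(1)[OF c] by auto
  have "{u. u mod c = u} = below m"
  proof (intro equalityI subsetI)
    fix u :: "'a poly" assume "u \<in> {u. u mod c = u}"
    then show "u \<in> below m" using mod_in_below[OF c0(1), of u] c0(2) by simp
  next
    fix u :: "'a poly" assume "u \<in> below m"
    then show "u \<in> {u. u mod c = u}" using mod_below[of u c] c0(2) by simp
  qed
  moreover have "e_q (poly_at_infinity u / poly_at_infinity c) = echar (1 * u) c" if "u \<in> below m" for u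
    using that c0(2) by (simp add: e_q_def poly_at_infinity_divide_nth[OF c m] echar_below)
  ultimately show ?thesis unfolding gauss_sum_def gauss_def c0(2) by simp
qed

lemma even_char_iff:
  assumes c: "c \<in> monics m"
  shows "even_char (\<chi> c) \<longleftrightarrow> 3 dvd m"
proof -
  have "\<chi> c [:a:] = chi0 a ^ m" if "a \<noteq> 0" for a
    using chi_const[OF monicsD(3)[OF c] that] monicsD(1)[OF c] by simp
  then show ?thesis unfolding even_char_def using chi0_power_eq_1[of m] chi0_power_nontrivial[of m] by metis
qed

text \<open>
  The factor \<open>\<epsilon>(\<chi>)\<close> of the root number of a character of conductor degree \<open>m\<close>, taken to be \<open>1\<close> for even
  characters so that both parities share a formula.
\<close>

definition sign_factor :: "nat \<Rightarrow> complex" where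
  "sign_factor m = (if 3 dvd m then 1 else field_gauss m 1 / of_real (sqrt (real CARD('a))))"

lemma eps_eq:
  assumes c: "c \<in> monics m" and m: "\<not> 3 dvd m"
  shows "eps (\<chi> c) = sign_factor m"
proof -
  have "(\<Sum>a\<in>{a. a \<noteq> 0}. \<chi> c [:a:] * add_char a) = field_gauss m 1"
    unfolding field_gauss_def
  proof (rule sum.cong)
    fix a :: 'a assume "a \<in> UNIV - {0}"
    then show "\<chi> c [:a:] * add_char a = chi0 a ^ m * add_char (1 * a)"
      using chi_const[OF monicsD(3)[OF c]] monicsD(1)[OF c] by simp
  qed auto
  moreover have "real CARD('a) powr (- 1 / 2) = 1 / sqrt (real CARD('a))"
    using powr_minus_divide[of "real CARD('a)" "1 / 2"] by (simp add: powr_half_sqrt)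
  ultimately show ?thesis using m unfolding eps_def sign_factor_def by (simp only: if_False of_real_divide of_real_1) simp
qed

lemma norm_sign_factor: "norm (sign_factor m) = 1"
proof (cases "3 dvd m")
  case False
  have "of_real ((norm (field_gauss m 1))\<^sup>2) = qc"
    unfolding complex_norm_square using field_gauss_mult_cnj[OF False] by simp
  then have "(norm (field_gauss m 1))\<^sup>2 = real CARD('a)"
    unfolding qc_of_real of_real_eq_iff .
  then have "norm (field_gauss m 1) = sqrt (real CARD('a))" by (metis norm_ge_zero real_sqrt_unique)
  moreover have "sqrt (real CARD('a)) > 0" using q_ge_2 by simp
  ultimately show ?thesis using False by (simp add: sign_factor_def norm_divide)
qed (simp add: sign_factor_def)

text \<open>
  The moduli \<open>c\<close> have degree \<open>2 n\<close> and \<open>P\<close> has degree \<open>n\<close>: this is why the conjugate of \<open>\<omega>(\<chi>\<^sub>P)\<close>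
  appears.
\<close>

lemma sign_factor_double: "sign_factor (2 * m) = cnj (sign_factor m)"
proof -
  have "3 dvd 2 * m \<longleftrightarrow> 3 dvd m"
    by presburger
  then show ?thesis unfolding sign_factor_def by (simp add: cnj_field_gauss)
qed

lemma root_number_eq:
  assumes c: "c \<in> monics m" "squarefree c" and m: "m > 0"
  shows "root_number \<iota> (\<chi> c) = of_real (real CARD('a) powr (- real m / 2)) * gauss 1 c / sign_factor m"
proof -
  have "char_modulus \<iota> (\<chi> c) = c"
    using c by (intro char_modulus_chi q_mod_3 ident) (simp add: monic_squarefree_def monicsD)
  then have "root_number \<iota> (\<chi> c) = (let w = of_real (real CARD('a) powr (- real m / 2)) * gauss 1 c
      in if 3 dvd m then w else w / eps (\<chi> c))"
    unfolding root_number_def Let_def gauss_sum_eq_gauss[OF c(1) m, symmetric] even_char_iff[OF c(1), symmetric]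
    using monicsD(1)[OF c(1)] by simp
  then show ?thesis
    using eps_eq[OF c(1)] unfolding Let_def by (cases "3 dvd m") (simp_all add: sign_factor_def)
qed

lemma monic_irreducible_squarefree: "monic_irreducible P \<Longrightarrow> squarefree (P :: 'b::field poly)"
proof (unfold squarefree_def, intro allI impI)
  fix x assume P: "monic_irreducible P" and "x ^ 2 dvd P"
  from \<open>x ^ 2 dvd P\<close> obtain z where "P = x ^ 2 * z" by blast
  then obtain y where y: "P = x * (x * y)" using that[of z] by (simp add: power2_eq_square mult.assoc)
  then have "x dvd 1 \<or> x * y dvd 1" using P by (intro irreducibleD) (auto simp: monic_irreducible_def)
  then show "x dvd 1" using dvd_mult_left by blast
qed

text \<open>
  Twisting by \<open>P\<close> turns the Gauss sum of \<open>c\<close> into that of \<open>c P\<close>: the two symbols that the Chinese remainder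
  theorem produces agree by reciprocity, and their product \<open>\<chi>\<^sub>c(P)\<^sup>2\<close> is the conjugate of \<open>\<chi>\<^sub>c(P)\<close>. Moduli
  that are not square-free contribute nothing, so the sum over \<open>c\<close> may be extended to all monic
  polynomials.
\<close>

lemma sum_gauss_twist:
  fixes P :: "'a poly"
  assumes P: "monic_irreducible P" "P \<in> monics n" and n: "n \<ge> 2"
  shows "(\<Sum>c\<in>H_set (2 * n). gauss 1 c * cnj (\<chi> c P))
    = cnj (gauss 1 P) / qc ^ n * (qc ^ (3 * n) - qc ^ (3 * n - 1) - qc ^ (2 * n))"
proof -
  have n0: "n > 0" using n by simp
  have square: "gauss 1 F = 0" if "Q ^ 2 dvd F" "monic_irreducible Q" "F \<in> monics k" for Q F :: "'a poly" and k
  proof -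
    from that(1) obtain e where e: "F = Q ^ 2 * e" by blast
    have dQ: "Q \<in> monics (degree Q)" "degree Q > 0"
      using that(2) by (auto simp: monic_irreducible_def monics_iff irreducible_degree_pos)
    have Q2: "Q ^ 2 \<in> monics (degree Q + degree Q)" unfolding power2_eq_square by (rule monics_mult[OF dQ(1) dQ(1)])
    have "lead_coeff e = 1"
      using monicsD(3)[OF that(3)] monicsD(3)[OF Q2] unfolding e lead_coeff_mult by simp
    then have "e \<in> monics (degree e)" by (simp add: monics_iff)
    then show ?thesis unfolding e by (rule gauss_square_modulus_eq_0[OF dQ])
  qed
  have twist: "gauss 1 c * cnj (\<chi> c P) = cnj (gauss 1 P) / qc ^ n * gauss 1 (c * P)"
    if c: "c \<in> monics (2 * n)" for c
  proof (cases "P dvd c")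
    case True
    then have "\<chi> c P = 0" using chi_eq_0[OF monics_nonzero[OF c]] P(1) by auto
    moreover have "gauss 1 (c * P) = 0"
    proof (rule square[OF _ P(1) monics_mult[OF c P(2)]])
      show "P ^ 2 dvd c * P" using True unfolding power2_eq_square by (intro mult_dvd_mono) auto
    qed
    ultimately show ?thesis by simp
  next
    case False
    then have cop: "coprime c P"
      using coprime_monic_irreducible_iff[OF P(1), of c] coprime_commute[of c P] by blast
    have "gauss 1 (c * P) = (\<chi> c P) ^ 2 * gauss 1 c * gauss 1 P"
      unfolding gauss_coprime_product[OF c P(2) cop] chi_recip[OF P(2) c] power2_eq_square ..
    also have "(\<chi> c P) ^ 2 = cnj (\<chi> c P)" using cnj_chi[OF monics_nonzero[OF c]] by simp
    finally have "cnj (gauss 1 P) / qc ^ n * gauss 1 (c * P) = gauss 1 c * cnj (\<chi> c P) * (gauss 1 P * cnj (gauss 1 P)) / qc ^ n"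
      by simp
    then show ?thesis unfolding gauss_mult_cnj[OF P n0] by simp
  qed
  have "(\<Sum>c\<in>H_set (2 * n). gauss 1 c * cnj (\<chi> c P)) = (\<Sum>c\<in>monics (2 * n). gauss 1 c * cnj (\<chi> c P))"
  proof (rule sum.mono_neutral_left)
    show "\<forall>c\<in>monics (2 * n) - H_set (2 * n). gauss 1 c * cnj (\<chi> c P) = 0"
    proof
      fix c :: "'a poly" assume "c \<in> monics (2 * n) - H_set (2 * n)"
      then have c: "c \<in> monics (2 * n)" "\<not> squarefree c" by (auto simp: H_set_eq)
      obtain x where x: "x ^ 2 dvd c" "\<not> x dvd 1" using c(2) by (auto simp: squarefree_def)
      have "x \<noteq> 0" using x monics_nonzero[OF c(1)] by auto
      then have "degree x > 0" using x by (simp add: is_unit_iff_degree)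
      then obtain Q where Q: "monic_irreducible Q" "Q dvd x" using ex_irreducible_factor by blast
      have "Q ^ 2 dvd c" using Q(2) x(1) dvd_power_same dvd_trans by blast
      then show "gauss 1 c * cnj (\<chi> c P) = 0" using square[OF _ Q(1) c(1)] by simp
    qed
  qed (auto simp: H_set_eq)
  also have "\<dots> = (\<Sum>c\<in>monics (2 * n). cnj (gauss 1 P) / qc ^ n * gauss 1 (c * P))"
    by (intro sum.cong refl twist)
  also have "\<dots> = cnj (gauss 1 P) / qc ^ n * (\<Sum>c\<in>monics (2 * n). gauss 1 (c * P))"
    by (rule sum_distrib_left[symmetric])
  finally show ?thesis unfolding sum_gauss_mult_prime[OF P n] .
qed

lemma norm_root_number:
  assumes P: "monic_irreducible P" "P \<in> monics n" and n: "n > 0"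
  shows "norm (root_number \<iota> (\<chi> P)) = 1"
proof -
  have "of_real ((norm (gauss 1 P))\<^sup>2) = (of_real (real CARD('a) ^ n) :: complex)"
    unfolding complex_norm_square gauss_mult_cnj[OF P n] qc_of_real by (rule of_real_power[symmetric])
  then have g: "(norm (gauss 1 P))\<^sup>2 = real CARD('a) ^ n" unfolding of_real_eq_iff .
  have q: "real CARD('a) > 0" using q_ge_2 by simp
  have "(real CARD('a) powr (- real n / 2))\<^sup>2 = real CARD('a) powr (- real n)"
    using q by (simp add: power2_eq_square powr_add[symmetric])
  also have "\<dots> = 1 / real CARD('a) ^ n" using q by (simp add: powr_minus_divide powr_realpow)
  finally have "(norm (root_number \<iota> (\<chi> P)))\<^sup>2 = 1"
    unfolding root_number_eq[OF P(2) monic_irreducible_squarefree[OF P(1)] n]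
    using g q by (simp add: norm_mult norm_divide norm_sign_factor power_mult_distrib)
  then show ?thesis by (metis norm_ge_zero power2_eq_iff_nonneg zero_le_one one_power2)
qed

theorem M_tilde_eq:
  fixes P :: "'a poly"
  assumes P: "monic_irreducible P" "P \<in> monics n" and n: "n \<ge> 2"
  shows "M_tilde \<iota> (2 * n) P = cnj (root_number \<iota> (\<chi> P)) *
    of_real (1 - real CARD('a) ^ n / (real CARD('a) ^ (2 * n) - real CARD('a) ^ (2 * n - 1)))"
proof -
  define q where "q = real CARD('a)"
  define H :: "'a poly set" where "H = H_set (2 * n)"
  define s where "s = sqrt (q ^ n)"
  have n0: "n > 0" using n by simp
  have q: "q > 1" using q_ge_2 by (simp add: q_def)
  have s: "s > 0" "s ^ 2 = q ^ n" using q by (simp_all add: s_def)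
  have qcq: "qc = of_real q" unfolding q_def by (rule qc_of_real)
  have pw1: "q powr (- real n / 2) = 1 / s"
  proof -
    have "q powr (real n / 2) = sqrt (q powr real n)" using q by (simp add: powr_half_sqrt[symmetric] powr_powr)
    then have "q powr (real n / 2) = s" using q by (simp add: powr_realpow s_def)
    then show ?thesis using powr_minus_divide[of q "real n / 2"] by simp
  qed
  have pw2: "q powr (- real (2 * n) / 2) = 1 / q ^ n"
    using q by (simp add: powr_minus_divide powr_realpow)
  have inj: "inj_on (chi \<iota>) H"
    by (rule inj_on_subset[OF chi_inj_on[OF q_mod_3 ident]]) (auto simp: H_def H_set_def)
  have cardF: "card (F3 \<iota> (2 * n)) = card H" unfolding F3_def H_def[symmetric] by (rule card_image[OF inj])
  have cH: "real (card H) = q ^ (2 * n) - q ^ (2 * n - 1)"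
  proof -
    have "2 * n = 2 * (n - 1) + 2" "2 * n - 1 = 2 * (n - 1) + 1" using n by auto
    then have "card H + CARD('a) ^ (2 * n - 1) = CARD('a) ^ (2 * n)"
      using card_H_set[of "2 * (n - 1)", where ?'b = 'a] unfolding H_def by simp
    then have "real (card H + CARD('a) ^ (2 * n - 1)) = real (CARD('a) ^ (2 * n))" by simp
    then show ?thesis by (simp add: q_def)
  qed
  have abs: "sqrt (real (poly_abs P)) = s"
    using monics_nonzero[OF P(2)] monicsD(1)[OF P(2)] by (simp add: poly_abs_def s_def q_def)
  have root: "root_number \<iota> (\<chi> c) = of_real (1 / q ^ n) * gauss 1 c / cnj (sign_factor n)" if "c \<in> H" for c
    using root_number_eq[of c "2 * n"] that n0 unfolding H_def H_set_eq q_def[symmetric] pw2 sign_factor_double by simp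
  have rP: "root_number \<iota> (\<chi> P) = of_real (1 / s) * gauss 1 P / sign_factor n"
    using root_number_eq[OF P(2) monic_irreducible_squarefree[OF P(1)] n0] unfolding q_def[symmetric] pw1 .
  have shuffle: "1 / of_real D * (of_real (1 / z) / g * of_real t * (G / of_real z * of_real K)) = G / g * of_real (t * K / (z * z * D))"
    for D z t K :: real and g G :: complex by (simp add: mult_ac)
  have "M_tilde \<iota> (2 * n) P = 1 / of_nat (card H) * (\<Sum>c\<in>H. root_number \<iota> (\<chi> c) * cnj (\<chi> c P) * of_real s)"
    unfolding M_tilde_def cardF abs unfolding F3_def H_def[symmetric] sum.reindex[OF inj] comp_def ..
  also have "(\<Sum>c\<in>H. root_number \<iota> (\<chi> c) * cnj (\<chi> c P) * of_real s)
      = of_real (1 / q ^ n) / cnj (sign_factor n) * of_real s * (\<Sum>c\<in>H. gauss 1 c * cnj (\<chi> c P))"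
    unfolding sum_distrib_left by (intro sum.cong refl) (simp add: root)
  also have "(\<Sum>c\<in>H. gauss 1 c * cnj (\<chi> c P)) = cnj (gauss 1 P) / of_real (q ^ n) * of_real (q ^ (3 * n) - q ^ (3 * n - 1) - q ^ (2 * n))"
    unfolding H_def sum_gauss_twist[OF P n] qcq by simp
  also have "of_nat (card H) = (of_real (real (card H)) :: complex)" by simp
  finally have M: "M_tilde \<iota> (2 * n) P = cnj (gauss 1 P) / cnj (sign_factor n) *
      of_real (s * (q ^ (3 * n) - q ^ (3 * n - 1) - q ^ (2 * n)) / (q ^ n * q ^ n * (q ^ (2 * n) - q ^ (2 * n - 1))))"
    unfolding cH shuffle .
  have val: "s * (q ^ (3 * n) - q ^ (3 * n - 1) - q ^ (2 * n)) / (q ^ n * q ^ n * (q ^ (2 * n) - q ^ (2 * n - 1)))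
      = 1 / s * (1 - q ^ n / (q ^ (2 * n) - q ^ (2 * n - 1)))"
  proof -
    define z where "z = q ^ n"
    define D where "D = q ^ (2 * n) - q ^ (2 * n - 1)"
    have "q ^ (2 * n - 1) < q ^ (2 * n)" using q n by (intro power_strict_increasing) auto
    then have D: "D \<noteq> 0" by (simp add: D_def)
    have z: "z \<noteq> 0" using q by (simp add: z_def)
    have "3 * n - 1 = n + (2 * n - 1)" "3 * n = n + 2 * n" "2 * n = n + n" using n by auto
    then have "q ^ (3 * n) = z * q ^ (2 * n)" "q ^ (3 * n - 1) = z * q ^ (2 * n - 1)" "q ^ (2 * n) = z * z"
      unfolding z_def by (metis power_add)+
    then have num: "q ^ (3 * n) - q ^ (3 * n - 1) - q ^ (2 * n) = z * (D - z)" by (simp add: D_def algebra_simps)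
    have sz: "s * s = z" using s(2) by (simp add: z_def power2_eq_square)
    have "s * (z * (D - z)) / (z * z * D) = s * (1 - z / D) / z" using z D by (simp add: field_simps)
    also have "\<dots> = 1 / s * (1 - z / D)" using s(1) by (simp add: sz[symmetric])
    finally show ?thesis unfolding num by (simp only: z_def D_def)
  qed
  show ?thesis unfolding M val rP q_def[symmetric] by simp
qed

end

theorem theorem1p5:
  fixes \<iota> :: "'a::finite_field \<Rightarrow> complex" and \<epsilon> :: real
  assumes "odd CARD('a)"
    and "CARD('a) mod 3 = 1"
    and "cube_root_identification \<iota>"
    and "\<epsilon> > 0"
  shows "\<exists>C. \<forall>\<^sub>F n in sequentially. \<forall>P :: 'a poly.
           monic_irreducible P \<and> degree P = n \<longrightarrow>
             norm (M_tilde \<iota> (2 * n) P - cnj (root_number \<iota> (chi \<iota> P)))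
               \<le> C * real CARD('a) powr ((\<epsilon> - 1 / 6) * real (2 * n))"
proof (intro exI eventually_sequentiallyI allI impI)
  interpret cubic_symbols \<iota> using assms by unfold_locales
  define q where "q = real CARD('a)"
  fix n and P :: "'a poly"
  assume n: "2 \<le> n" and P: "monic_irreducible P \<and> degree P = n"
  have Pm: "monic_irreducible P" "P \<in> monics n" using P by (auto simp: monic_irreducible_def monics_iff)
  have q: "q \<ge> 2" using q_ge_2 by (simp add: q_def)
  have "M_tilde \<iota> (2 * n) P - cnj (root_number \<iota> (chi \<iota> P))
      = - (cnj (root_number \<iota> (chi \<iota> P)) * of_real (q ^ n / (q ^ (2 * n) - q ^ (2 * n - 1))))"
    unfolding M_tilde_eq[OF Pm n] q_def[symmetric] by (simp add: algebra_simps)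
  then have "norm (M_tilde \<iota> (2 * n) P - cnj (root_number \<iota> (chi \<iota> P)))
      = norm (cnj (root_number \<iota> (chi \<iota> P))) * \<bar>q ^ n / (q ^ (2 * n) - q ^ (2 * n - 1))\<bar>"
    by (simp only: norm_minus_cancel norm_mult norm_of_real)
  also have "norm (cnj (root_number \<iota> (chi \<iota> P))) = 1"
    using norm_root_number[OF Pm] n by simp
  finally have norm: "norm (M_tilde \<iota> (2 * n) P - cnj (root_number \<iota> (chi \<iota> P)))
      = \<bar>q ^ n / (q ^ (2 * n) - q ^ (2 * n - 1))\<bar>" by simp
  have "q ^ n / (q ^ (2 * n) - q ^ (2 * n - 1)) = q / ((q - 1) * q ^ n)"
  proof -
    have "2 * n = Suc (n + (n - 1))" "2 * n - 1 = n + (n - 1)" "n = Suc (n - 1)" using n by auto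
    then have "q ^ (2 * n) = q * (q ^ n * q ^ (n - 1))" "q ^ (2 * n - 1) = q ^ n * q ^ (n - 1)" "q ^ n = q * q ^ (n - 1)"
      by (metis power_Suc power_add)+
    then have "q ^ (2 * n) - q ^ (2 * n - 1) = (q - 1) * q ^ n * q ^ n / q" using q by (simp add: algebra_simps)
    then show ?thesis using q by simp
  qed
  also have "\<dots> \<le> q / (1 * q ^ n)" using q by (intro divide_left_mono mult_right_mono) auto
  also have "\<dots> = q * q powr (- real n)" using q by (simp add: powr_minus_divide powr_realpow)
  also have "\<dots> \<le> q * q powr ((\<epsilon> - 1 / 6) * real (2 * n))"
  proof -
    have "0 \<le> (\<epsilon> + 1 / 3) * real (2 * n)" using assms(4) by simp
    then have "- real n \<le> (\<epsilon> - 1 / 6) * real (2 * n)" by (simp add: algebra_simps)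
    then show ?thesis using q by (intro mult_left_mono powr_mono) auto
  qed
  finally have "q ^ n / (q ^ (2 * n) - q ^ (2 * n - 1)) \<le> q * q powr ((\<epsilon> - 1 / 6) * real (2 * n))" .
  moreover have "q ^ n / (q ^ (2 * n) - q ^ (2 * n - 1)) \<ge> 0"
  proof -
    have "q ^ (2 * n - 1) \<le> q ^ (2 * n)" using q by (intro power_increasing) auto
    then show ?thesis using q by simp
  qed
  ultimately show "norm (M_tilde \<iota> (2 * n) P - cnj (root_number \<iota> (chi \<iota> P)))
      \<le> real CARD('a) * real CARD('a) powr ((\<epsilon> - 1 / 6) * real (2 * n))"
    unfolding norm q_def by (simp only: abs_of_nonneg)
qed

end
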